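(* Let $n\ge 1$, let $\mathcal L$ be the sublaplacian on the unit sphere $S^{2n+1}\subset\mathbf C^{n+1}$, and let $Q=2n+2$. Let $p\ge 2$ and $q<+\infty$ satisfy $$\frac{2}{p}+\frac{Q}{q}=\frac{Q}{2}.$$ Define $s_n:=2\left[1-\frac{1}{n+1}\right]$ if $n>1$ and $s_1:=4/3$. Let $M>1$ be fixed, let $I$ be any finite time interval, and let $s\ge s_1$ if $n=1$, respectively $s>s_n$ if $n>1$. Then there exists a constant $C=C(s,I,M)>0$ such that any solution $v$ of $$i\partial_t v+\mathcal L v=0,\qquad v(0,\cdot)=v_0\in L^2(S^{2n+1}),$$ satisfies $$\|v\|_{L^p(I,L^q(S^{2n+1}))}\le C\,\|v_0\|_{\mathcal X^{(s/p,\,2/p)}_M(S^{2n+1})}.$$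
   Context: $S^{2n+1}$ is the unit sphere of $\mathbf C^{n+1}$ with its surface measure $d\sigma$. The sublaplacian is $$\mathcal L:=-\sum_{1\le j<k\le n+1}\left(M_{jk}\overline M_{jk}+\overline M_{jk}M_{jk}\right),\qquad M_{jk}:=\overline z_j\partial_{z_k}-\overline z_k\partial_{z_j}.$$ Let $\mathcal H^{\ell,\ell'}$ ($\ell,\ell'\in\mathbf N=\{0,1,2,\dots\}$) be the space of restrictions to $S^{2n+1}$ of harmonic polynomials in $(z,\bar z)$ homogeneous of degree $\ell$ in $z$ and $\ell'$ in $\bar z$. Then $L^2(S^{2n+1})=\bigoplus_{\ell,\ell'\ge0}\mathcal H^{\ell,\ell'}$ (orthogonal sum), with orthogonal projectors $\pi_{\ell,\ell'}$, and $\mathcal L$ acts on $\mathcal H^{\ell,\ell'}$ as multiplication by $\lambda_{\ell,\ell'}=2\ell\ell'+n(\ell+\ell')$. The solution of the Cauchy problem is $v(t)=e^{it\mathcal L}v_0=\sum_{\ell,\ell'}e^{it\lambda_{\ell,\ell'}}\pi_{\ell,\ell'}v_0$. For $M>1$ let $\mathcal V=\{(\ell,\ell')\in\mathbf N^2:\ \ell/M<\ell'<M\ell\}$ and $\mathcal E=\mathbf N^2\setminus\mathcal V$. For $r,s\ge0$, $\mathcal X^{(r,s)}_M(S^{2n+1})$ is the space of $u\in L^2(S^{2n+1})$ with finite norm $$\|u\|_{\mathcal X^{(r,s)}_M}=\Big(\sum_{(\ell,\ell')\in\mathcal V}(1+\lambda_{\ell,\ell'})^r\|\pi_{\ell,\ell'}u\|_{L^2}^2+\sum_{(\ell,\ell')\in\mathcal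 E}(1+\lambda_{\ell,\ell'})^s\|\pi_{\ell,\ell'}u\|_{L^2}^2\Big)^{1/2}.$$ *)

theory Defs
  imports "HOL-Analysis.Analysis" "HOL-Probability.Essential_Supremum"
begin

text \<open>
  The space \<open>C^(n+1)\<close> is \<open>complex ^ 'm\<close> with \<open>CARD('m) = n + 1\<close>. The order on \<open>'m\<close>
  only serves to sum over the pairs \<open>j < k\<close>.
\<close>

section \<open>Surface measure and Lebesgue norms\<close>

text \<open>
  Surface measure of the unit sphere of a Euclidean space of real dimension \<open>d\<close>, by polar
  coordinates: \<open>\<sigma>(A)\<close> is \<open>d\<close> times the volume of the cone \<open>{r x | 0 < r < 1, x \<in> A}\<close>;
  recall \<open>sgn x = x / norm x\<close>.
\<close>

definition sphere_measure :: "'a::euclidean_space measure" where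
  "sphere_measure = scale_measure (of_nat DIM('a))
     (distr (restrict_space lborel (ball 0 1 - {0})) (restrict_space borel (sphere 0 1)) sgn)"

lemma space_sphere_measure [simp]:
  "space (sphere_measure :: 'a::euclidean_space measure) = sphere 0 1"
  by (simp add: sphere_measure_def space_restrict_space space_scale_measure)

lemma sets_sphere_measure [simp, measurable_cong]:
  "sets (sphere_measure :: 'a::euclidean_space measure) = sets (restrict_space borel (sphere 0 1))"
  by (simp add: sphere_measure_def)

lemma emeasure_sphere_measure:
  fixes A :: "'a::euclidean_space set"
  assumes "A \<in> sets borel" "A \<subseteq> sphere 0 1"
  shows "emeasure sphere_measure A
    = of_nat DIM('a) * emeasure lborel {x \<in> ball 0 1 - {0}. sgn x \<in> A}"
proof -
  have m: "sgn \<in> restrict_space lborel (ball 0 1 - {0::'a})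
      \<rightarrow>\<^sub>M restrict_space borel (sphere 0 1)"
    unfolding sgn_div_norm
    by (intro measurable_restrict_space2 measurable_restrict_space1)
       (auto simp: space_restrict_space)
  have A: "A \<in> sets (restrict_space borel (sphere 0 1))"
    using assms by (simp add: sets_restrict_space_iff)
  have S: "sgn -` A \<inter> (ball 0 1 - {0}) = {x \<in> ball 0 1 - {0}. sgn x \<in> A}"
    by blast
  have "emeasure (distr (restrict_space lborel (ball 0 1 - {0::'a}))
      (restrict_space borel (sphere 0 1)) sgn) A
    = emeasure (restrict_space lborel (ball 0 1 - {0})) {x \<in> ball 0 1 - {0}. sgn x \<in> A}"
    by (subst emeasure_distr[OF m A]) (simp only: space_restrict_space2 S sets_lborel
        open_delete open_ball borel_open)
  also have "\<dots> = emeasure lborel {x \<in> ball 0 1 - {0}. sgn x \<in> A}"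
    by (rule emeasure_restrict_space) auto
  finally show ?thesis
    by (simp only: sphere_measure_def emeasure_scale_measure)
qed

definition ennreal_powr :: "ennreal \<Rightarrow> real \<Rightarrow> ennreal" where
  "ennreal_powr x a = (if x = \<infinity> then \<infinity> else ennreal (enn2real x powr a))"

text \<open>
  The \<open>L^p\<close> norm of an \<open>[0,\<infinity>]\<close>-valued function, for \<open>0 < p \<le> \<infinity>\<close>.
\<close>

definition Lp_norm :: "'a measure \<Rightarrow> ereal \<Rightarrow> ('a \<Rightarrow> ennreal) \<Rightarrow> ennreal" where
  "Lp_norm N p F =
     (if p = \<infinity> then esssup N F
      else ennreal_powr (\<integral>\<^sup>+ x. ennreal_powr (F x) (real_of_ereal p) \<partial>N) (1 / real_of_ereal p))"

definition sphere_norm :: "ereal \<Rightarrow> (complex ^ 'm \<Rightarrow> complex) \<Rightarrow> ennreal" where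
  "sphere_norm q f = Lp_norm sphere_measure q (\<lambda>z. ennreal (norm (f z)))"

definition mixed_norm ::
    "ereal \<Rightarrow> ereal \<Rightarrow> real set \<Rightarrow> (real \<Rightarrow> complex ^ 'm \<Rightarrow> complex) \<Rightarrow> ennreal" where
  "mixed_norm p q I v = Lp_norm (restrict_space lborel I) p (\<lambda>t. sphere_norm q (v t))"

text \<open>
  Elements of \<open>L^2\<close> are represented by functions on \<open>C^(n+1)\<close> of which only the values on the
  sphere matter.
\<close>

definition sphere_L2 :: "(complex ^ 'm \<Rightarrow> complex) set" where
  "sphere_L2 = {f. f \<in> borel_measurable sphere_measure \<and> sphere_norm 2 f < \<infinity>}"

definition sphere_inner :: "(complex ^ 'm \<Rightarrow> complex) \<Rightarrow> (complex ^ 'm \<Rightarrow> complex) \<Rightarrow> complex" where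
  "sphere_inner f g = (LINT z|sphere_measure. f z * cnj (g z))"

section \<open>The sublaplacian\<close>

definition d_z :: "'m \<Rightarrow> (complex ^ 'm::finite \<Rightarrow> complex) \<Rightarrow> complex ^ 'm \<Rightarrow> complex" where
  "d_z j f z = (frechet_derivative f (at z) (axis j 1)
                - \<i> * frechet_derivative f (at z) (axis j \<i>)) / 2"

definition d_zbar :: "'m \<Rightarrow> (complex ^ 'm::finite \<Rightarrow> complex) \<Rightarrow> complex ^ 'm \<Rightarrow> complex" where
  "d_zbar j f z = (frechet_derivative f (at z) (axis j 1)
                   + \<i> * frechet_derivative f (at z) (axis j \<i>)) / 2"

text \<open>
  The fields below are tangent to the spheres centred at the origin, so on the unit sphere they
  depend only on the restriction of \<open>f\<close> to it and may be evaluated on any extension.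
\<close>

definition M_field :: "'m \<Rightarrow> 'm \<Rightarrow> (complex ^ 'm::finite \<Rightarrow> complex) \<Rightarrow> complex ^ 'm \<Rightarrow> complex" where
  "M_field j k f = (\<lambda>z. cnj (z $ j) * d_z k f z - cnj (z $ k) * d_z j f z)"

definition Mbar_field :: "'m \<Rightarrow> 'm \<Rightarrow> (complex ^ 'm::finite \<Rightarrow> complex) \<Rightarrow> complex ^ 'm \<Rightarrow> complex" where
  "Mbar_field j k f = (\<lambda>z. z $ j * d_zbar k f z - z $ k * d_zbar j f z)"

definition sublaplacian ::
    "(complex ^ 'm::{finite,linorder} \<Rightarrow> complex) \<Rightarrow> complex ^ 'm::{finite,linorder} \<Rightarrow> complex" where
  "sublaplacian f = (\<lambda>z. - (\<Sum>(j, k) | j < k.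
      M_field j k (Mbar_field j k f) z + Mbar_field j k (M_field j k f) z))"

section \<open>Bigraded spherical harmonics\<close>

definition bihom_poly :: "nat \<Rightarrow> nat \<Rightarrow> (complex ^ 'm::finite \<Rightarrow> complex) \<Rightarrow> bool" where
  "bihom_poly l l' P \<longleftrightarrow> (\<exists>c :: ('m \<Rightarrow> nat) \<Rightarrow> ('m \<Rightarrow> nat) \<Rightarrow> complex.
     P = (\<lambda>z. \<Sum>(\<alpha>, \<beta>) \<in> {\<alpha>. (\<Sum>j\<in>UNIV. \<alpha> j) = l} \<times> {\<beta>. (\<Sum>j\<in>UNIV. \<beta> j) = l'}.
                c \<alpha> \<beta> * (\<Prod>j\<in>UNIV. (z $ j) ^ \<alpha> j * cnj (z $ j) ^ \<beta> j)))"

text \<open>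
  The Euclidean Laplacian of \<open>C^(n+1)\<close> is \<open>4\<close> times the sum of the operators
  \<open>d/dz_j d/dzbar_j\<close>.
\<close>

definition complex_laplacian :: "(complex ^ 'm::finite \<Rightarrow> complex) \<Rightarrow> complex ^ 'm \<Rightarrow> complex" where
  "complex_laplacian f = (\<lambda>z. 4 * (\<Sum>j\<in>UNIV. d_z j (d_zbar j f) z))"

definition harmonics :: "nat \<Rightarrow> nat \<Rightarrow> (complex ^ 'm::finite \<Rightarrow> complex) set" where
  "harmonics l l' =
     {restrict P (sphere 0 1) | P. bihom_poly l l' P \<and> (\<forall>z. complex_laplacian P z = 0)}"

text \<open>Orthogonal projection of \<open>L^2\<close> onto the space of harmonics of bidegree \<open>(l, l')\<close>.\<close>

definition harm_proj ::
    "nat \<Rightarrow> nat \<Rightarrow> (complex ^ 'm::finite \<Rightarrow> complex) \<Rightarrow> complex ^ 'm \<Rightarrow> complex" where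
  "harm_proj l l' u = (THE h. h \<in> harmonics l l' \<and>
     (\<forall>g \<in> harmonics l l'. sphere_inner (\<lambda>z. u z - h z) g = 0))"

section \<open>The spaces of the initial data\<close>

definition eigval :: "nat \<Rightarrow> nat \<Rightarrow> nat \<Rightarrow> real" where
  "eigval n l l' = real (2 * l * l' + n * (l + l'))"

definition cone_region :: "real \<Rightarrow> (nat \<times> nat) set" where
  "cone_region M = {(l, l'). real l / M < real l' \<and> real l' < M * real l}"

text \<open>
  The norm of the paper's space of order \<open>(r, s)\<close>, which is \<open>\<infinity>\<close> off that space; \<open>n\<close> is the
  complex dimension of the ambient space minus one.
\<close>

definition X_norm ::
    "nat \<Rightarrow> real \<Rightarrow> real \<Rightarrow> real \<Rightarrow> (complex ^ 'm::finite \<Rightarrow> complex) \<Rightarrow> ennreal" where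
  "X_norm n M r s u = ennreal_powr
     ((\<Sum>\<^sub>\<infinity>(l, l') \<in> cone_region M.
          ennreal ((1 + eigval n l l') powr r) * (sphere_norm 2 (harm_proj l l' u))\<^sup>2)
      + (\<Sum>\<^sub>\<infinity>(l, l') \<in> - cone_region M.
          ennreal ((1 + eigval n l l') powr s) * (sphere_norm 2 (harm_proj l l' u))\<^sup>2)) (1 / 2)"

section \<open>The Cauchy problem\<close>

primrec Ck :: "nat \<Rightarrow> ('a::euclidean_space \<Rightarrow> complex) \<Rightarrow> bool" where
  "Ck 0 f \<longleftrightarrow> continuous_on UNIV f"
| "Ck (Suc k) f \<longleftrightarrow> (\<forall>x. f differentiable at x) \<and> (\<forall>b. Ck k (\<lambda>x. frechet_derivative f (at x) b))"

definition smooth :: "('a::euclidean_space \<Rightarrow> complex) \<Rightarrow> bool" where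
  "smooth f \<longleftrightarrow> (\<forall>k. Ck k f)"

text \<open>
  For \<open>v0\<close> merely in \<open>L^2\<close> the equation \<open>i v' + L v = 0\<close> is understood as usual: \<open>v\<close> is a
  continuous curve in \<open>L^2\<close> and, \<open>L\<close> being symmetric, the operator is moved to smooth test
  functions (every smooth function on the sphere extends to a smooth one on the ambient space).
  The only such curve is \<open>v(t) = exp(itL) v0\<close>.
\<close>

definition cauchy_solution ::
    "(complex ^ 'm::{finite,linorder} \<Rightarrow> complex)
      \<Rightarrow> (real \<Rightarrow> complex ^ 'm::{finite,linorder} \<Rightarrow> complex) \<Rightarrow> bool" where
  "cauchy_solution v0 v \<longleftrightarrow>
     (\<forall>t. v t \<in> sphere_L2) \<and>
     (\<forall>t. ((\<lambda>t'. sphere_norm 2 (\<lambda>z. v t' z - v t z)) \<longlongrightarrow> 0) (at t)) \<and>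
     (AE z in sphere_measure. v 0 z = v0 z) \<and>
     (\<forall>\<phi> t. smooth \<phi> \<longrightarrow>
        (\<exists>D. ((\<lambda>t'. sphere_inner (v t') \<phi>) has_vector_derivative D) (at t) \<and>
             \<i> * D + sphere_inner (v t) (sublaplacian \<phi>) = 0))"

definition s_crit :: "nat \<Rightarrow> real" where
  "s_crit n = (if n = 1 then 4 / 3 else 2 * (1 - 1 / (real n + 1)))"

end

theory Submission
  imports Defs "HOL-Computational_Algebra.Primes"
begin

text \<open>
  On a finite sum of harmonics \<open>u = \<Sum>h\<^sub>k\<close>, \<open>k = (l, l')\<close>, the flow multiplies \<open>h\<^sub>k\<close> by a phase with
  integral frequency. Off the cone a Sobolev inequality at fixed time suffices, since it loses only
  \<open>2/p\<close> derivatives. Inside the cone, at frequencies \<open>\<mu> \<le> L\<close>, the fourth power of \<open>\<bar>u(t)\<bar>\<close> is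
  expanded and integrated over a period and over the Hopf fibres: only quadruples with equal
  differences of eigenvalues and of \<open>l - l'\<close> survive, the divisor bound counts them, and the dimension
  formula bounds the products. This gives an \<open>L\<^sup>4\<close> estimate, which is interpolated with the conservation
  of the \<open>L\<^sup>2\<close> norm and summed over blocks with loss \<open>s/p\<close>. All constants are uniform in the exponents,
  and general data follow by Fatou's lemma, because the harmonics are complete and the weak formulation
  determines the harmonic components of \<open>v(t)\<close>.
\<close>

text \<open>The constant is fixed before \<open>p\<close> and \<open>q\<close>, so every inequality
  is kept in a form that survives \<open>q\<close> tending to 2 and \<open>p\<close> to infinity,
  and constants at least 1 are moved inside the powers. Write \<open>x = sqrt (M * L)\<close>. On
  the cone both indices are at most \<open>x\<close> once \<mu> is at most \<open>L\<close>. So a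
  non-zero resonance has about \<open>x powr (1 + 2 * \<epsilon>)\<close> solutions, the dimension
  is about \<open>x ^ (2 * n - 1)\<close>, and the loss in the fourth power is their product, of
  order \<open>L powr (n + \<epsilon>)\<close>. Interpolation in space followed by Hoelder in time
  raises it to the power \<open>1 / (n + 1)\<close>, the same for every admissible pair; hence
  squared norms carry the power \<open>2 * (n + \<epsilon>) / ((n + 1) * p)\<close> of the
  eigenvalue. This is the origin of \<open>2 * n / (n + 1)\<close>, which is \<open>s_crit n\<close>
  for \<open>n > 1\<close> and below \<open>4 / 3\<close> for \<open>n = 1\<close>. The excess of
  \<open>s\<close> over it pays for the divisor bound and for the summation of the blocks. Off the
  cone one index may be of the order of \<open>L\<close> itself, and the box to be counted in is too
  large.\<close>

section \<open>Invariance of Lebesgue measure and surface measure under linear isometries\<close>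

text \<open>Both signs serve the next lemma: \<open>c = 1\<close> is a translation, and
  \<open>c = -1\<close> integrates the indicator of \<open>A\<close> at \<open>U x - y\<close> over
  \<open>y\<close>.\<close>

lemma nn_integral_lborel_reflect:
  fixes f :: "'a::euclidean_space \<Rightarrow> ennreal"
  assumes f: "f \<in> borel_measurable borel" and c: "\<bar>c\<bar> = 1"
  shows "(\<integral>\<^sup>+ x. f (t + c *\<^sub>R x) \<partial>lborel) = (\<integral>\<^sup>+ x. f x \<partial>lborel)"
proof -
  have "lborel = distr lborel borel (\<lambda>x::'a. t + c *\<^sub>R x)"
    using lborel_affine[of c t] c by (auto simp: density_1)
  then have "(\<integral>\<^sup>+ x. f x \<partial>lborel) = (\<integral>\<^sup>+ x. f x \<partial>distr lborel borel (\<lambda>x. t + c *\<^sub>R x))"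
    by simp
  also have "\<dots> = (\<integral>\<^sup>+ x. f (t + c *\<^sub>R x) \<partial>lborel)"
    using f by (subst nn_integral_distr) auto
  finally show ?thesis by simp
qed

text \<open>
  The usual uniqueness argument for Haar measure: for a translation-invariant \<open>\<mu>\<close>, Tonelli's theorem
  gives \<open>\<mu>(A) \<lambda>(B) = \<mu>(B) \<lambda>(A)\<close>, and the image of \<open>\<lambda>\<close> under an isometry agrees with \<open>\<lambda>\<close> on the ball.
\<close>

lemma distr_lborel_orthogonal:
  fixes U :: "'a::euclidean_space \<Rightarrow> 'a"
  assumes U: "orthogonal_transformation U"
  shows "distr lborel borel U = lborel"
proof (rule measure_eqI)
  show "sets (distr lborel borel U) = sets lborel" by simp
  have lin: "linear U" using U by (simp add: orthogonal_transformation_def)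
  have mU [measurable]: "U \<in> borel_measurable borel"
    using U by (intro borel_measurable_continuous_onI linear_continuous_on)
      (simp add: linear_conv_bounded_linear orthogonal_transformation_def)
  \<comment> \<open>Translating \<open>x\<close> by \<open>- V y\<close> takes \<open>y\<close> out
    of the factor of the ball and puts it into that of \<open>A\<close>.\<close>
  obtain V where V: "\<And>y. U (V y) = y"
    using orthogonal_transformation_surj[OF U] by (metis surj_def)
  fix A assume "A \<in> sets (distr lborel borel U)"
  then have A [measurable]: "A \<in> sets borel" by simp
  let ?B = "ball (0::'a) 1"
  have B [measurable]: "?B \<in> sets borel" by simp
  let ?a = "indicator A :: 'a \<Rightarrow> ennreal" and ?b = "indicator ?B :: 'a \<Rightarrow> ennreal"
  have bU: "?b (U x) = ?b x" for x
    using U by (simp add: indicator_def orthogonal_transformation_norm)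
  have "emeasure lborel (U -` A) * emeasure lborel ?B
    = (\<integral>\<^sup>+ x. ?a (U x) * (\<integral>\<^sup>+ y. ?b y \<partial>lborel) \<partial>lborel)"
  proof -
    have "emeasure lborel (U -` A) = (\<integral>\<^sup>+ x. indicator (U -` A) x \<partial>lborel)"
      using measurable_sets[OF mU A] by simp
    then have "emeasure lborel (U -` A) = (\<integral>\<^sup>+ x. ?a (U x) \<partial>lborel)"
      by (simp add: indicator_vimage o_def)
    then show ?thesis
      by (subst nn_integral_multc) simp_all
  qed
  also have "\<dots> = (\<integral>\<^sup>+ x. (\<integral>\<^sup>+ y. ?a (U x) * ?b (U x + y) \<partial>lborel) \<partial>lborel)"
    using nn_integral_lborel_reflect[of ?b 1] by (simp add: nn_integral_cmult)
  also have "\<dots> = (\<integral>\<^sup>+ y. (\<integral>\<^sup>+ x. ?a (U x) * ?b (U x + y) \<partial>lborel) \<partial>lborel)"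
    by (rule lborel_pair.Fubini') measurable
  also have "\<dots> = (\<integral>\<^sup>+ y. (\<integral>\<^sup>+ x. ?a (U x - y) * ?b (U x) \<partial>lborel) \<partial>lborel)"
  proof (rule nn_integral_cong)
    fix y
    have [measurable]: "(\<lambda>x. ?b (U x + y)) \<in> borel_measurable borel"
      by (rule measurable_compose[OF _ borel_measurable_indicator[OF B], where f="\<lambda>x. U x + y"])
         (intro borel_measurable_add mU borel_measurable_const)
    have "(\<lambda>x. ?a (U x) * ?b (U x + y)) \<in> borel_measurable borel"
      by measurable
    then have "(\<integral>\<^sup>+ x. ?a (U x) * ?b (U x + y) \<partial>lborel)
        = (\<integral>\<^sup>+ x. ?a (U (- V y + 1 *\<^sub>R x)) * ?b (U (- V y + 1 *\<^sub>R x) + y) \<partial>lborel)"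
      by (intro nn_integral_lborel_reflect[symmetric]) simp_all
    also have "\<dots> = (\<integral>\<^sup>+ x. ?a (U x - y) * ?b (U x) \<partial>lborel)"
      by (simp add: linear_diff[OF lin] V)
    finally show "(\<integral>\<^sup>+ x. ?a (U x) * ?b (U x + y) \<partial>lborel) = (\<integral>\<^sup>+ x. ?a (U x - y) * ?b (U x) \<partial>lborel)" .
  qed
  also have "\<dots> = (\<integral>\<^sup>+ x. (\<integral>\<^sup>+ y. ?a (U x - y) * ?b (U x) \<partial>lborel) \<partial>lborel)"
    by (rule lborel_pair.Fubini') measurable
  also have "\<dots> = (\<integral>\<^sup>+ x. emeasure lborel A * ?b x \<partial>lborel)"
    using nn_integral_lborel_reflect[of ?a "-1"] by (simp add: nn_integral_multc bU)
  also have "\<dots> = emeasure lborel A * emeasure lborel ?B"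
    by (simp add: nn_integral_cmult)
  finally have eq: "emeasure lborel (U -` A) * emeasure lborel ?B = emeasure lborel A * emeasure lborel ?B" .
  have "emeasure lborel ?B \<noteq> 0" "emeasure lborel ?B \<noteq> \<infinity>"
    using unit_ball_vol_pos[of "real DIM('a)"] by (simp_all add: emeasure_ball less_imp_neq[symmetric])
  then have "emeasure lborel (U -` A) = emeasure lborel A"
    using eq by (auto simp: mult.commute[of _ "emeasure lborel ?B"] ennreal_mult_cancel_left)
  then show "emeasure (distr lborel borel U) A = emeasure lborel A"
    by (simp add: emeasure_distr)
qed

lemma orthogonal_transformation_measurable_sphere:
  fixes U :: "complex^'m::finite \<Rightarrow> complex^'m"
  assumes U: "orthogonal_transformation U"
  shows "U \<in> sphere_measure \<rightarrow>\<^sub>M sphere_measure"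
proof -
  have "U \<in> borel_measurable borel"
    using U by (intro borel_measurable_continuous_onI linear_continuous_on)
      (simp add: linear_conv_bounded_linear orthogonal_transformation_def)
  then have "U \<in> restrict_space borel (sphere 0 1) \<rightarrow>\<^sub>M restrict_space borel (sphere 0 1)"
    using U by (intro measurable_restrict_space2 measurable_restrict_space1)
      (auto simp: space_restrict_space orthogonal_transformation_norm)
  then show ?thesis
    by (subst measurable_cong_sets[OF sets_sphere_measure sets_sphere_measure])
qed

text \<open>A linear isometry commutes with \<open>sgn\<close>, so the cone over a preimage is the
  preimage of the cone, and the invariance of Lebesgue measure carries over.\<close>

lemma sphere_measure_orthogonal:
  fixes U :: "complex^'m::finite \<Rightarrow> complex^'m"
  assumes U: "orthogonal_transformation U"
  shows "distr sphere_measure sphere_measure U = sphere_measure"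
proof (rule measure_eqI)
  show "sets (distr sphere_measure sphere_measure U) = sets sphere_measure" by simp
  fix A assume "A \<in> sets (distr sphere_measure sphere_measure U)"
  then have A: "A \<in> sets sphere_measure" by simp
  then have A': "A \<in> sets borel" "A \<subseteq> sphere 0 1"
    by (simp_all add: sets_restrict_space_iff)
  have mU: "U \<in> borel_measurable borel"
    using U by (intro borel_measurable_continuous_onI linear_continuous_on)
      (simp add: linear_conv_bounded_linear orthogonal_transformation_def)
  have linU: "linear U" using U by (simp add: orthogonal_transformation_def)
  have nU: "norm (U x) = norm x" for x using U by (simp add: orthogonal_transformation_norm)
  have zero: "U x = 0 \<longleftrightarrow> x = 0" for x using nU[of x] by (metis norm_eq_zero)
  have sgnU: "sgn (U x) = U (sgn x)" for x
    by (simp add: sgn_div_norm nU linear_scale[OF linU])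
  have Ub: "U -` A \<inter> sphere 0 1 \<in> sets borel" "U -` A \<inter> sphere 0 1 \<subseteq> sphere 0 1"
    using measurable_sets[OF mU A'(1)] by auto
  let ?W = "{x \<in> ball 0 1 - {0}. sgn x \<in> A}"
  have W: "?W \<in> sets borel"
  proof -
    have "sgn \<in> restrict_space borel (ball 0 1 - {0::complex^'m}) \<rightarrow>\<^sub>M borel"
      unfolding sgn_div_norm by (intro measurable_restrict_space1) auto
    from measurable_sets[OF this A'(1)]
    have "sgn -` A \<inter> (ball 0 1 - {0}) \<in> sets (restrict_space borel (ball 0 1 - {0}))"
      by (simp add: space_restrict_space)
    then have "sgn -` A \<inter> (ball 0 1 - {0}) \<in> sets borel"
      by (subst (asm) sets_restrict_space_iff) auto
    also have "sgn -` A \<inter> (ball 0 1 - {0}) = ?W" by auto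
    finally show ?thesis .
  qed
  have "emeasure (distr sphere_measure sphere_measure U) A
    = emeasure sphere_measure (U -` A \<inter> sphere 0 1)"
    using A by (subst emeasure_distr[OF orthogonal_transformation_measurable_sphere[OF U]]) auto
  also have "\<dots> = of_nat DIM(complex^'m) * emeasure lborel
      {x \<in> ball 0 1 - {0}. sgn x \<in> U -` A \<inter> sphere 0 1}"
    by (rule emeasure_sphere_measure[OF Ub])
  also have "{x \<in> ball 0 1 - {0}. sgn x \<in> U -` A \<inter> sphere 0 1} = U -` ?W"
    by (auto simp: sgnU nU zero norm_sgn)
  also have "emeasure lborel (U -` ?W) = emeasure (distr lborel borel U) ?W"
    by (subst emeasure_distr[OF _ W]) (simp_all only: measurable_lborel2 mU space_lborel space_borel Int_UNIV_right)
  also have "\<dots> = emeasure lborel ?W" by (simp add: distr_lborel_orthogonal[OF U])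
  finally show "emeasure (distr sphere_measure sphere_measure U) A = emeasure sphere_measure A"
    by (simp only: emeasure_sphere_measure[OF A'])
qed

lemma integral_sphere_orthogonal:
  fixes f :: "complex^'m::finite \<Rightarrow> 'b::{banach, second_countable_topology}"
    and U :: "complex^'m \<Rightarrow> complex^'m"
  assumes U: "orthogonal_transformation U" and f: "f \<in> borel_measurable sphere_measure"
  shows "(LINT z|sphere_measure. f (U z)) = (LINT z|sphere_measure. f z)"
  using integral_distr[OF orthogonal_transformation_measurable_sphere[OF U] f]
  by (simp add: sphere_measure_orthogonal[OF U])

lemma finite_measure_sphere: "finite_measure (sphere_measure :: (complex^'m::finite) measure)"
proof (rule finite_measureI)
  have "emeasure (sphere_measure :: (complex^'m) measure) (sphere 0 1)
      = of_nat DIM(complex^'m) * emeasure lborel {x \<in> ball 0 1 - {0}. sgn x \<in> sphere (0::complex^'m) 1}"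
    by (rule emeasure_sphere_measure) auto
  also have "\<dots> \<le> of_nat DIM(complex^'m) * emeasure lborel (ball (0::complex^'m) 1)"
    by (intro mult_left_mono emeasure_mono) auto
  also have "\<dots> < \<infinity>"
    using emeasure_lborel_ball_finite[of "0::complex^'m" 1]
    by (simp add: ennreal_mult_less_top of_nat_less_top)
  finally show "emeasure (sphere_measure :: (complex^'m) measure) (space sphere_measure) \<noteq> \<infinity>" by simp
qed

interpretation sphere: finite_measure "sphere_measure :: (complex^'m::finite) measure"
  by (rule finite_measure_sphere)

lemma emeasure_sphere_pos: "emeasure (sphere_measure :: (complex^'m::finite) measure) (sphere 0 1) > 0"
proof -
  have "0 < emeasure lborel (ball (0::complex^'m) 1)"
    using unit_ball_vol_pos[of "real DIM(complex^'m)"] by (simp add: emeasure_ball)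
  also have "emeasure lborel (ball (0::complex^'m) 1) = emeasure lborel (ball (0::complex^'m) 1 - {0})"
    by (rule emeasure_eq_AE) (auto intro: AE_lborel_singleton eventually_mono[OF AE_lborel_singleton[of 0]])
  also have "ball 0 1 - {0} = {x \<in> ball 0 1 - {0}. sgn x \<in> sphere (0::complex^'m) 1}"
    by (auto simp: norm_sgn)
  finally have "0 < emeasure lborel {x \<in> ball 0 1 - {0}. sgn x \<in> sphere (0::complex^'m) 1}" .
  moreover have "emeasure (sphere_measure :: (complex^'m) measure) (sphere 0 1)
      = of_nat DIM(complex^'m) * emeasure lborel {x \<in> ball 0 1 - {0}. sgn x \<in> sphere (0::complex^'m) 1}"
    by (rule emeasure_sphere_measure) auto
  ultimately show ?thesis by (simp add: ennreal_zero_less_mult_iff)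
qed

lemma measure_sphere_pos: "measure (sphere_measure :: (complex^'m::finite) measure) (sphere 0 1) > 0"
  using emeasure_sphere_pos[where 'm='m] by (simp add: sphere.emeasure_eq_measure)

lemma continuous_on_sphere_measurable:
  fixes f :: "complex^'m::finite \<Rightarrow> 'b::topological_space"
  assumes "continuous_on (sphere 0 1) f"
  shows "f \<in> borel_measurable sphere_measure"
  using borel_measurable_continuous_on_restrict[OF assms]
  by (subst measurable_cong_sets[OF sets_sphere_measure refl])

lemma continuous_on_sphere_bounded:
  fixes f :: "complex^'m::finite \<Rightarrow> 'b::real_normed_vector"
  assumes "continuous_on (sphere 0 1) f"
  obtains B where "B > 0" "\<And>z. z \<in> sphere 0 1 \<Longrightarrow> norm (f z) \<le> B"
proof -
  have "compact (f ` sphere 0 1)" using assms by (intro compact_continuous_image) auto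
  then have "bounded (f ` sphere 0 1)" by (rule compact_imp_bounded)
  then show ?thesis using that unfolding bounded_pos by auto
qed

lemma continuous_on_sphere_integrable:
  fixes f :: "complex^'m::finite \<Rightarrow> 'b::{banach, second_countable_topology}"
  assumes "continuous_on (sphere 0 1) f"
  shows "integrable sphere_measure f"
proof -
  obtain B where "\<And>z. z \<in> sphere 0 1 \<Longrightarrow> norm (f z) \<le> B"
    using continuous_on_sphere_bounded[OF assms] by metis
  then show ?thesis
    by (intro sphere.integrable_const_bound[where B=B] continuous_on_sphere_measurable assms AE_I2) auto
qed

section \<open>Polynomials in z and its conjugate\<close>

lemma d_z_has_derivative:
  "(f has_derivative f') (at z) \<Longrightarrow> d_z j f z = (f' (axis j 1) - \<i> * f' (axis j \<i>)) / 2"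
  unfolding d_z_def by (simp add: frechet_derivative_at[symmetric])

lemma d_zbar_has_derivative:
  "(f has_derivative f') (at z) \<Longrightarrow> d_zbar j f z = (f' (axis j 1) + \<i> * f' (axis j \<i>)) / 2"
  unfolding d_zbar_def by (simp add: frechet_derivative_at[symmetric])

lemma has_derivative_vec_nth': "((\<lambda>z. z $ j) has_derivative (\<lambda>h. h $ j)) (at (z :: complex^'m::finite))"
  by (rule bounded_linear_imp_has_derivative[OF bounded_linear_vec_nth])

lemma has_derivative_cnj_vec_nth:
  "((\<lambda>z. cnj (z $ j)) has_derivative (\<lambda>h. cnj (h $ j))) (at (z :: complex^'m::finite))"
  by (rule bounded_linear_imp_has_derivative[OF bounded_linear_compose[OF bounded_linear_cnj bounded_linear_vec_nth]])

lemma
  fixes f g :: "complex^'m::finite \<Rightarrow> complex"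
  assumes "f differentiable at z" "g differentiable at z"
  shows d_z_add: "d_z j (\<lambda>z. f z + g z) z = d_z j f z + d_z j g z"
    and d_zbar_add: "d_zbar j (\<lambda>z. f z + g z) z = d_zbar j f z + d_zbar j g z"
    and d_z_diff: "d_z j (\<lambda>z. f z - g z) z = d_z j f z - d_z j g z"
    and d_zbar_diff: "d_zbar j (\<lambda>z. f z - g z) z = d_zbar j f z - d_zbar j g z"
    and d_z_mult: "d_z j (\<lambda>z. f z * g z) z = f z * d_z j g z + d_z j f z * g z"
    and d_zbar_mult: "d_zbar j (\<lambda>z. f z * g z) z = f z * d_zbar j g z + d_zbar j f z * g z"
proof -
  note f = assms(1)[unfolded frechet_derivative_works] and g = assms(2)[unfolded frechet_derivative_works]
  note rules = d_z_has_derivative d_zbar_has_derivative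
  note s = rules[OF has_derivative_add[OF f g]] rules[OF has_derivative_diff[OF f g]]
    rules[OF has_derivative_mult[OF f g]] d_z_def[of j f z] d_zbar_def[of j f z]
    d_z_def[of j g z] d_zbar_def[of j g z]
  show "d_z j (\<lambda>z. f z + g z) z = d_z j f z + d_z j g z"
    "d_zbar j (\<lambda>z. f z + g z) z = d_zbar j f z + d_zbar j g z"
    "d_z j (\<lambda>z. f z - g z) z = d_z j f z - d_z j g z"
    "d_zbar j (\<lambda>z. f z - g z) z = d_zbar j f z - d_zbar j g z"
    "d_z j (\<lambda>z. f z * g z) z = f z * d_z j g z + d_z j f z * g z"
    "d_zbar j (\<lambda>z. f z * g z) z = f z * d_zbar j g z + d_zbar j f z * g z"
    unfolding s by (simp_all add: field_simps)
qed

lemma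
  fixes z :: "complex^'m::finite"
  shows d_z_const [simp]: "d_z j (\<lambda>z. c) z = 0"
    and d_zbar_const [simp]: "d_zbar j (\<lambda>z. c) z = 0"
    and d_z_nth [simp]: "d_z j (\<lambda>z. z $ k) z = (if j = k then 1 else 0)"
    and d_zbar_nth [simp]: "d_zbar j (\<lambda>z. z $ k) z = 0"
    and d_z_cnj_nth [simp]: "d_z j (\<lambda>z. cnj (z $ k)) z = 0"
    and d_zbar_cnj_nth [simp]: "d_zbar j (\<lambda>z. cnj (z $ k)) z = (if j = k then 1 else 0)"
  by (simp_all add: d_z_has_derivative[OF has_derivative_const] d_zbar_has_derivative[OF has_derivative_const]
      d_z_has_derivative[OF has_derivative_vec_nth'] d_zbar_has_derivative[OF has_derivative_vec_nth']
      d_z_has_derivative[OF has_derivative_cnj_vec_nth] d_zbar_has_derivative[OF has_derivative_cnj_vec_nth] axis_def)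

text \<open>The generators multiply by one coordinate at a time, so that inductions on polynomials
  meet the product rule only with a coordinate as one factor; closure under products comes
  later.\<close>

inductive cpoly :: "(complex^'m::finite \<Rightarrow> complex) \<Rightarrow> bool" where
  const: "cpoly (\<lambda>z. c)"
| z: "cpoly f \<Longrightarrow> cpoly (\<lambda>z. z $ j * f z)"
| zbar: "cpoly f \<Longrightarrow> cpoly (\<lambda>z. cnj (z $ j) * f z)"
| add: "cpoly f \<Longrightarrow> cpoly g \<Longrightarrow> cpoly (\<lambda>z. f z + g z)"

text \<open>Amounts to \<^const>\<open>bihom_poly\<close>, but lends itself to induction.\<close>

inductive bh :: "nat \<Rightarrow> nat \<Rightarrow> (complex^'m::finite \<Rightarrow> complex) \<Rightarrow> bool" where
  const: "bh 0 0 (\<lambda>z. c)"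
| z: "bh a b f \<Longrightarrow> bh (Suc a) b (\<lambda>z. z $ j * f z)"
| zbar: "bh a b f \<Longrightarrow> bh a (Suc b) (\<lambda>z. cnj (z $ j) * f z)"
| add: "bh a b f \<Longrightarrow> bh a b g \<Longrightarrow> bh a b (\<lambda>z. f z + g z)"

lemma bh_imp_cpoly: "bh a b f \<Longrightarrow> cpoly f"
  by (induction rule: bh.induct) (auto intro: cpoly.intros)

lemma bh_cmult: "bh a b f \<Longrightarrow> bh a b (\<lambda>z. c * f z)"
proof (induction rule: bh.induct)
  case (z a b f j) from bh.z[OF z.IH, of j] show ?case by (simp add: mult_ac)
next
  case (zbar a b f j) from bh.zbar[OF zbar.IH, of j] show ?case by (simp add: mult_ac)
next
  case (add a b f g) from bh.add[OF add.IH] show ?case by (simp add: distrib_left)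
qed (rule bh.const)

lemma bh_zero: "bh a b (\<lambda>z. 0)"
proof -
  have *: "bh a 0 (\<lambda>z. 0)"
  proof (induction a)
    case (Suc a)
    from bh.z[OF Suc.IH, of undefined] show ?case by simp
  qed (rule bh.const)
  show ?thesis
  proof (induction b)
    case (Suc b)
    from bh.zbar[OF Suc.IH, of undefined] show ?case by simp
  qed (rule *)
qed

lemma bh_diff: "bh a b f \<Longrightarrow> bh a b g \<Longrightarrow> bh a b (\<lambda>z. f z - g z)"
  using bh.add[of a b f "\<lambda>z. (-1) * g z"] bh_cmult[of a b g "-1"] by simp

lemma bh_sum: "(\<And>i. i \<in> I \<Longrightarrow> bh a b (f i)) \<Longrightarrow> bh a b (\<lambda>z. \<Sum>i\<in>I. f i z)"
  by (induction I rule: infinite_finite_induct) (auto intro: bh_zero bh.add)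

lemma bh_mult: "bh a b f \<Longrightarrow> bh c d g \<Longrightarrow> bh (a + c) (b + d) (\<lambda>z. f z * g z)"
proof (induction rule: bh.induct)
  case (const c) then show ?case by (simp add: bh_cmult)
next
  case (z a b f j) from bh.z[OF z.IH[OF z.prems], of j] show ?case by (simp add: mult_ac)
next
  case (zbar a b f j) from bh.zbar[OF zbar.IH[OF zbar.prems], of j] show ?case by (simp add: mult_ac)
next
  case (add a b f g) from bh.add[OF add.IH(1)[OF add.prems] add.IH(2)[OF add.prems]] show ?case by (simp add: distrib_right)
qed

lemma bh_cnj: "bh a b f \<Longrightarrow> bh b a (\<lambda>z. cnj (f z))"
  by (induction rule: bh.induct) (auto intro: bh.intros)

lemma cpoly_cmult: "cpoly f \<Longrightarrow> cpoly (\<lambda>z. c * f z)"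
proof (induction rule: cpoly.induct)
  case (z f j) from cpoly.z[OF z.IH, of j] show ?case by (simp add: mult_ac)
next
  case (zbar f j) from cpoly.zbar[OF zbar.IH, of j] show ?case by (simp add: mult_ac)
next
  case (add f g) from cpoly.add[OF add.IH] show ?case by (simp add: distrib_left)
qed (rule cpoly.const)

lemma cpoly_mult: "cpoly f \<Longrightarrow> cpoly g \<Longrightarrow> cpoly (\<lambda>z. f z * g z)"
proof (induction rule: cpoly.induct)
  case (const c) then show ?case by (simp add: cpoly_cmult)
next
  case (z f j) from cpoly.z[OF z.IH[OF z.prems], of j] show ?case by (simp add: mult_ac)
next
  case (zbar f j) from cpoly.zbar[OF zbar.IH[OF zbar.prems], of j] show ?case by (simp add: mult_ac)
next
  case (add f g) from cpoly.add[OF add.IH(1)[OF add.prems] add.IH(2)[OF add.prems]] show ?case by (simp add: distrib_right)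
qed

lemma cpoly_diff: "cpoly f \<Longrightarrow> cpoly g \<Longrightarrow> cpoly (\<lambda>z. f z - g z)"
  using cpoly.add[of f "\<lambda>z. (-1) * g z"] cpoly_cmult[of g "-1"] by simp

lemma cpoly_sum: "(\<And>i. i \<in> I \<Longrightarrow> cpoly (f i)) \<Longrightarrow> cpoly (\<lambda>z. \<Sum>i\<in>I. f i z)"
  by (induction I rule: infinite_finite_induct) (auto intro: cpoly.intros)

lemma cpoly_cnj: "cpoly f \<Longrightarrow> cpoly (\<lambda>z. cnj (f z))"
  by (induction rule: cpoly.induct) (auto intro: cpoly.intros)

lemma cpoly_nth: "cpoly (\<lambda>z. z $ j)"
  using cpoly.z[OF cpoly.const[of 1]] by simp

lemma cpoly_cnj_nth: "cpoly (\<lambda>z. cnj (z $ j))"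
  using cpoly.zbar[OF cpoly.const[of 1]] by simp

lemma cpoly_differentiable: "cpoly f \<Longrightarrow> f differentiable at z"
proof (induction rule: cpoly.induct)
  case (z f j)
  then show ?case
    using has_derivative_vec_nth'[of j z] by (intro differentiable_mult) (auto simp: differentiable_def)
next
  case (zbar f j)
  then show ?case
    using has_derivative_cnj_vec_nth[of j z] by (intro differentiable_mult) (auto simp: differentiable_def)
qed auto

lemma cpoly_continuous: "cpoly f \<Longrightarrow> continuous_on S f"
  by (meson continuous_at_imp_continuous_on cpoly_differentiable differentiable_imp_continuous_within)

lemma differentiable_nth [simp]:
  "(\<lambda>z. z $ j) differentiable at (z :: complex^'m::finite)"
  "(\<lambda>z. cnj (z $ j)) differentiable at (z :: complex^'m::finite)"
  using has_derivative_vec_nth'[of j z] has_derivative_cnj_vec_nth[of j z]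
  unfolding differentiable_def by blast+

lemma
  assumes f: "cpoly f"
  shows d_z_cpoly_z: "d_z j (\<lambda>z. z $ k * f z) = (\<lambda>z. z $ k * d_z j f z + (if j = k then f z else 0))"
    and d_zbar_cpoly_z: "d_zbar j (\<lambda>z. z $ k * f z) = (\<lambda>z. z $ k * d_zbar j f z)"
    and d_z_cpoly_zbar: "d_z j (\<lambda>z. cnj (z $ k) * f z) = (\<lambda>z. cnj (z $ k) * d_z j f z)"
    and d_zbar_cpoly_zbar:
      "d_zbar j (\<lambda>z. cnj (z $ k) * f z) = (\<lambda>z. cnj (z $ k) * d_zbar j f z + (if j = k then f z else 0))"
  using cpoly_differentiable[OF f] by (auto simp: fun_eq_iff d_z_mult d_zbar_mult)

lemma
  assumes f: "cpoly f" and g: "cpoly g"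
  shows d_z_cpoly_add: "d_z j (\<lambda>z. f z + g z) = (\<lambda>z. d_z j f z + d_z j g z)"
    and d_zbar_cpoly_add: "d_zbar j (\<lambda>z. f z + g z) = (\<lambda>z. d_zbar j f z + d_zbar j g z)"
    and d_z_cpoly_diff: "d_z j (\<lambda>z. f z - g z) = (\<lambda>z. d_z j f z - d_z j g z)"
    and d_zbar_cpoly_diff: "d_zbar j (\<lambda>z. f z - g z) = (\<lambda>z. d_zbar j f z - d_zbar j g z)"
    and d_z_cpoly_mult: "d_z j (\<lambda>z. f z * g z) = (\<lambda>z. f z * d_z j g z + d_z j f z * g z)"
    and d_zbar_cpoly_mult: "d_zbar j (\<lambda>z. f z * g z) = (\<lambda>z. f z * d_zbar j g z + d_zbar j f z * g z)"
  using cpoly_differentiable[OF f] cpoly_differentiable[OF g]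
  by (auto simp: fun_eq_iff d_z_add d_zbar_add d_z_diff d_zbar_diff d_z_mult d_zbar_mult)

lemma
  assumes f: "cpoly f"
  shows d_z_cpoly_cmult: "d_z j (\<lambda>z. c * f z) = (\<lambda>z. c * d_z j f z)"
    and d_zbar_cpoly_cmult: "d_zbar j (\<lambda>z. c * f z) = (\<lambda>z. c * d_zbar j f z)"
  using d_z_cpoly_mult[OF cpoly.const f, of j c] d_zbar_cpoly_mult[OF cpoly.const f, of j c]
  by auto

lemma
  assumes f: "\<And>i. i \<in> I \<Longrightarrow> cpoly (f i)"
  shows d_z_cpoly_sum: "d_z j (\<lambda>z. \<Sum>i\<in>I. f i z) = (\<lambda>z. \<Sum>i\<in>I. d_z j (f i) z)"
    and d_zbar_cpoly_sum: "d_zbar j (\<lambda>z. \<Sum>i\<in>I. f i z) = (\<lambda>z. \<Sum>i\<in>I. d_zbar j (f i) z)"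
  using f by (induction I rule: infinite_finite_induct)
    (auto simp: fun_eq_iff d_z_cpoly_add d_zbar_cpoly_add cpoly_sum)

lemma cpoly_d_z: "cpoly f \<Longrightarrow> cpoly (d_z j f)"
proof (induction rule: cpoly.induct)
  case (const c)
  have "d_z j (\<lambda>z. c) = (\<lambda>z. 0)" by (rule ext) simp
  then show ?case using cpoly.const by metis
next
  case (z f k)
  then show ?case by (cases "j = k") (auto simp: d_z_cpoly_z intro: cpoly.intros)
qed (auto simp: d_z_cpoly_zbar d_z_cpoly_add intro: cpoly.intros)

lemma cpoly_d_zbar: "cpoly f \<Longrightarrow> cpoly (d_zbar j f)"
proof (induction rule: cpoly.induct)
  case (const c)
  have "d_zbar j (\<lambda>z. c) = (\<lambda>z. 0)" by (rule ext) simp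
  then show ?case using cpoly.const by metis
next
  case (zbar f k)
  then show ?case by (cases "j = k") (auto simp: d_zbar_cpoly_zbar intro: cpoly.intros)
qed (auto simp: d_zbar_cpoly_z d_zbar_cpoly_add intro: cpoly.intros)

lemma d_z_d_zbar_commute: "cpoly f \<Longrightarrow> d_z j (d_zbar k f) = d_zbar k (d_z j f)"
proof (induction rule: cpoly.induct)
  case (const c)
  have "d_z j (\<lambda>z. c) = (\<lambda>z. 0)" "d_zbar k (\<lambda>z. c) = (\<lambda>z. 0)" for c by auto
  then show ?case by simp
next
  case (z f i)
  have "d_z j (d_zbar k (\<lambda>z. z $ i * f z)) = (\<lambda>z. z $ i * d_z j (d_zbar k f) z + (if j = i then d_zbar k f z else 0))"
    using z by (simp add: d_zbar_cpoly_z d_z_cpoly_z cpoly_d_zbar)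
  moreover have "d_zbar k (d_z j (\<lambda>z. z $ i * f z)) = \<dots>"
    using z by (cases "j = i") (simp_all add: d_z_cpoly_z d_zbar_cpoly_add d_zbar_cpoly_z cpoly_d_z cpoly.z)
  ultimately show ?case by simp
next
  case (zbar f i)
  have "d_zbar k (d_z j (\<lambda>z. cnj (z $ i) * f z)) = (\<lambda>z. cnj (z $ i) * d_z j (d_zbar k f) z + (if k = i then d_z j f z else 0))"
    using zbar by (simp add: d_z_cpoly_zbar d_zbar_cpoly_zbar cpoly_d_z)
  moreover have "d_z j (d_zbar k (\<lambda>z. cnj (z $ i) * f z)) = \<dots>"
    using zbar by (cases "k = i") (simp_all add: d_zbar_cpoly_zbar d_z_cpoly_add d_z_cpoly_zbar cpoly_d_zbar cpoly.zbar)
  ultimately show ?case by simp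
next
  case (add f g)
  then show ?case by (simp add: d_z_cpoly_add d_zbar_cpoly_add cpoly_d_z cpoly_d_zbar)
qed

lemma bh_d_z_zero: "bh a b f \<Longrightarrow> a = 0 \<Longrightarrow> d_z j f = (\<lambda>z. 0)"
  by (induction rule: bh.induct) (auto simp: d_z_cpoly_zbar d_z_cpoly_add bh_imp_cpoly fun_eq_iff)

lemma bh_d_zbar_zero: "bh a b f \<Longrightarrow> b = 0 \<Longrightarrow> d_zbar j f = (\<lambda>z. 0)"
  by (induction rule: bh.induct) (auto simp: d_zbar_cpoly_z d_zbar_cpoly_add bh_imp_cpoly fun_eq_iff)

text \<open>The truncated \<open>a - 1\<close> is harmless: for \<open>a = 0\<close> the derivative
  vanishes, and the zero function has every bidegree.\<close>

lemma bh_d_z: "bh a b f \<Longrightarrow> bh (a - 1) b (d_z j f)"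
proof (induction rule: bh.induct)
  case (const c)
  have "d_z j (\<lambda>z. c) = (\<lambda>z. 0)" by (rule ext) simp
  then show ?case using bh_zero by metis
next
  case (z a b f k)
  have "bh a b (\<lambda>z. z $ k * d_z j f z)"
  proof (cases a)
    case 0
    then show ?thesis using bh_d_z_zero[OF z.hyps] by (simp add: bh_zero)
  next
    case (Suc a')
    then show ?thesis using bh.z[OF z.IH, of k] by simp
  qed
  moreover have "bh a b (\<lambda>z. if j = k then f z else 0)"
    using z.hyps by (cases "j = k") (auto intro: bh_zero)
  ultimately have "bh a b (\<lambda>z. z $ k * d_z j f z + (if j = k then f z else 0))"
    by (rule bh.add)
  then show ?case by (simp add: d_z_cpoly_z[OF bh_imp_cpoly[OF z.hyps]])
next
  case (zbar a b f k)
  from bh.zbar[OF zbar.IH, of k] show ?case by (simp add: d_z_cpoly_zbar bh_imp_cpoly[OF zbar.hyps])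
next
  case (add a b f g)
  from bh.add[OF add.IH] show ?case
    by (simp add: d_z_cpoly_add bh_imp_cpoly[OF add.hyps(1)] bh_imp_cpoly[OF add.hyps(2)])
qed

lemma bh_d_zbar: "bh a b f \<Longrightarrow> bh a (b - 1) (d_zbar j f)"
proof (induction rule: bh.induct)
  case (const c)
  have "d_zbar j (\<lambda>z. c) = (\<lambda>z. 0)" by (rule ext) simp
  then show ?case using bh_zero by metis
next
  case (zbar a b f k)
  have "bh a b (\<lambda>z. cnj (z $ k) * d_zbar j f z)"
  proof (cases b)
    case 0
    then show ?thesis using bh_d_zbar_zero[OF zbar.hyps] by (simp add: bh_zero)
  next
    case (Suc b')
    then show ?thesis using bh.zbar[OF zbar.IH, of k] by simp
  qed
  moreover have "bh a b (\<lambda>z. if j = k then f z else 0)"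
    using zbar.hyps by (cases "j = k") (auto intro: bh_zero)
  ultimately have "bh a b (\<lambda>z. cnj (z $ k) * d_zbar j f z + (if j = k then f z else 0))"
    by (rule bh.add)
  then show ?case by (simp add: d_zbar_cpoly_zbar[OF bh_imp_cpoly[OF zbar.hyps]])
next
  case (z a b f k)
  from bh.z[OF z.IH, of k] show ?case by (simp add: d_zbar_cpoly_z bh_imp_cpoly[OF z.hyps])
next
  case (add a b f g)
  from bh.add[OF add.IH] show ?case
    by (simp add: d_zbar_cpoly_add bh_imp_cpoly[OF add.hyps(1)] bh_imp_cpoly[OF add.hyps(2)])
qed

lemma euler_d_z: "bh a b f \<Longrightarrow> (\<Sum>j\<in>UNIV. z $ j * d_z j f z) = of_nat a * f z"
proof (induction rule: bh.induct)
  case (z a b f k)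
  have "(\<Sum>j\<in>UNIV. z $ j * d_z j (\<lambda>z. z $ k * f z) z)
    = (\<Sum>j\<in>UNIV. z $ k * (z $ j * d_z j f z) + (if j = k then z $ k * f z else 0))"
    by (intro sum.cong) (auto simp: d_z_cpoly_z bh_imp_cpoly[OF z.hyps] distrib_left mult.left_commute)
  also have "\<dots> = z $ k * (of_nat a * f z) + z $ k * f z"
    by (simp add: sum.distrib z.IH sum_distrib_left[symmetric])
  finally show ?case by (simp add: algebra_simps)
next
  case (zbar a b f k)
  have "(\<Sum>j\<in>UNIV. z $ j * d_z j (\<lambda>z. cnj (z $ k) * f z) z)
    = (\<Sum>j\<in>UNIV. cnj (z $ k) * (z $ j * d_z j f z))"
    by (intro sum.cong) (auto simp: d_z_cpoly_zbar bh_imp_cpoly[OF zbar.hyps] mult.left_commute)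
  then show ?case by (simp add: zbar.IH sum_distrib_left[symmetric])
next
  case (add a b f g)
  then show ?case
    by (simp add: d_z_cpoly_add bh_imp_cpoly distrib_left sum.distrib)
qed simp

lemma euler_d_zbar: "bh a b f \<Longrightarrow> (\<Sum>j\<in>UNIV. cnj (z $ j) * d_zbar j f z) = of_nat b * f z"
proof (induction rule: bh.induct)
  case (zbar a b f k)
  have "(\<Sum>j\<in>UNIV. cnj (z $ j) * d_zbar j (\<lambda>z. cnj (z $ k) * f z) z)
    = (\<Sum>j\<in>UNIV. cnj (z $ k) * (cnj (z $ j) * d_zbar j f z) + (if j = k then cnj (z $ k) * f z else 0))"
    by (intro sum.cong) (auto simp: d_zbar_cpoly_zbar bh_imp_cpoly[OF zbar.hyps] distrib_left mult.left_commute)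
  also have "\<dots> = cnj (z $ k) * (of_nat b * f z) + cnj (z $ k) * f z"
    by (simp add: sum.distrib zbar.IH sum_distrib_left[symmetric])
  finally show ?case by (simp add: algebra_simps)
next
  case (z a b f k)
  have "(\<Sum>j\<in>UNIV. cnj (z $ j) * d_zbar j (\<lambda>z. z $ k * f z) z)
    = (\<Sum>j\<in>UNIV. z $ k * (cnj (z $ j) * d_zbar j f z))"
    by (intro sum.cong) (auto simp: d_zbar_cpoly_z bh_imp_cpoly[OF z.hyps] mult.left_commute)
  then show ?case by (simp add: z.IH sum_distrib_left[symmetric])
next
  case (add a b f g)
  then show ?case
    by (simp add: d_zbar_cpoly_add bh_imp_cpoly distrib_left sum.distrib)
qed simp

lemma bh_homogeneous:
  "bh a b f \<Longrightarrow> f (c *s z) = c ^ a * cnj c ^ b * f z"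
  by (induction rule: bh.induct) (auto simp: algebra_simps)

section \<open>The Laplacian and the Fischer decomposition\<close>

definition lap :: "(complex^'m::finite \<Rightarrow> complex) \<Rightarrow> complex^'m \<Rightarrow> complex" where
  "lap f = (\<lambda>z. \<Sum>j\<in>UNIV. d_z j (d_zbar j f) z)"

lemma complex_laplacian_lap: "complex_laplacian f z = 4 * lap f z"
  by (simp add: complex_laplacian_def lap_def)

definition nsq :: "complex^'m::finite \<Rightarrow> complex" where
  "nsq z = (\<Sum>j\<in>UNIV. z $ j * cnj (z $ j))"

lemma nsq_norm: "nsq z = of_real ((norm z)\<^sup>2)"
  by (simp add: nsq_def complex_norm_square[symmetric] norm_vec_def L2_set_def sum_nonneg flip: of_real_sum of_real_power)

lemma nsq_sphere: "z \<in> sphere 0 1 \<Longrightarrow> nsq z = 1"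
  by (simp add: nsq_norm)

lemma bh_nsq: "bh 1 1 nsq"
proof -
  have "bh 1 1 (\<lambda>z::complex^'m. \<Sum>j\<in>UNIV. z $ j * (cnj (z $ j) * 1))"
    using bh.z[OF bh.zbar[OF bh.const[of 1]]] by (intro bh_sum) simp
  then show ?thesis by (simp add: nsq_def[abs_def])
qed

lemma d_z_nsq: "d_z j nsq z = cnj (z $ j)"
  unfolding nsq_def[abs_def] by (simp add: d_z_cpoly_sum cpoly_mult cpoly_nth cpoly_cnj_nth d_z_cpoly_z)

lemma d_zbar_nsq: "d_zbar j nsq z = z $ j"
  unfolding nsq_def[abs_def] by (simp add: d_zbar_cpoly_sum cpoly_mult cpoly_nth cpoly_cnj_nth d_zbar_cpoly_z if_distrib[of "\<lambda>x. _ * x"] cong: if_cong)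

lemma cpoly_lap: "cpoly f \<Longrightarrow> cpoly (lap f)"
  unfolding lap_def by (intro cpoly_sum cpoly_d_z cpoly_d_zbar)

lemma bh_lap: "bh a b f \<Longrightarrow> bh (a - 1) (b - 1) (lap f)"
  unfolding lap_def by (intro bh_sum bh_d_z bh_d_zbar)

lemma lap_cmult: "cpoly f \<Longrightarrow> lap (\<lambda>z. c * f z) = (\<lambda>z. c * lap f z)"
  by (simp add: lap_def d_z_cpoly_cmult d_zbar_cpoly_cmult cpoly_d_zbar sum_distrib_left)

lemma lap_diff: "cpoly f \<Longrightarrow> cpoly g \<Longrightarrow> lap (\<lambda>z. f z - g z) = (\<lambda>z. lap f z - lap g z)"
  by (simp add: lap_def d_z_cpoly_diff d_zbar_cpoly_diff cpoly_d_zbar sum_subtractf)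

lemma lap_add: "cpoly f \<Longrightarrow> cpoly g \<Longrightarrow> lap (\<lambda>z. f z + g z) = (\<lambda>z. lap f z + lap g z)"
  by (simp add: lap_def d_z_cpoly_add d_zbar_cpoly_add cpoly_d_zbar sum.distrib)

text \<open>The cross terms of the product rule are the two Euler operators, which contribute
  \<open>a\<close> and \<open>b\<close>; differentiating the coordinate in front of \<open>f\<close>
  contributes the dimension.\<close>

lemma lap_nsq_mult:
  assumes f: "bh a b f"
  shows "lap (\<lambda>z. nsq z * f z) = (\<lambda>z. of_nat (CARD('m) + a + b) * f z + nsq z * lap f (z :: complex^'m::finite))"
proof
  fix z :: "complex^'m"
  have cf: "cpoly f" and cn: "cpoly (nsq :: complex^'m \<Rightarrow> _)" using f bh_nsq by (auto intro: bh_imp_cpoly)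
  have 1: "d_zbar j (\<lambda>z. nsq z * f z) = (\<lambda>z. nsq z * d_zbar j f z + z $ j * f z)" for j
    by (simp add: d_zbar_cpoly_mult cf cn d_zbar_nsq)
  have 2: "d_z j (\<lambda>z. nsq z * d_zbar j f z + z $ j * f z) z
      = nsq z * d_z j (d_zbar j f) z + cnj (z $ j) * d_zbar j f z + (z $ j * d_z j f z + f z)" for j
    by (simp add: d_z_cpoly_add d_z_cpoly_mult cpoly_mult cpoly_d_zbar cf cn d_z_nsq d_z_cpoly_z cpoly.z)
  have "lap (\<lambda>z. nsq z * f z) z = nsq z * lap f z + of_nat b * f z + (of_nat a * f z + of_nat CARD('m) * f z)"
    unfolding lap_def 1 2 by (simp add: sum.distrib sum_distrib_left[symmetric] euler_d_z[OF f] euler_d_zbar[OF f])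
  then show "lap (\<lambda>z. nsq z * f z) z = of_nat (CARD('m) + a + b) * f z + nsq z * lap f z"
    by (simp add: algebra_simps)
qed

text \<open>Harmonic representatives, before restriction to the sphere.\<close>

definition harm :: "nat \<Rightarrow> nat \<Rightarrow> (complex^'m::finite \<Rightarrow> complex) set" where
  "harm a b = {f. bh a b f \<and> (\<forall>z. lap f z = 0)}"

lemma harm_bh: "f \<in> harm a b \<Longrightarrow> bh a b f"
  by (simp add: harm_def)

lemma harm_lap: "f \<in> harm a b \<Longrightarrow> lap f = (\<lambda>z. 0)"
  by (auto simp: harm_def)

lemma harm_cpoly: "f \<in> harm a b \<Longrightarrow> cpoly f"
  by (auto dest: harm_bh bh_imp_cpoly)

lemma lap_zero: "lap (\<lambda>z. 0) = (\<lambda>z :: complex^'m::finite. 0)"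
proof -
  have "d_zbar j (\<lambda>z. 0) = (\<lambda>z :: complex^'m. 0)" for j by (rule ext) simp
  then show ?thesis by (simp add: lap_def)
qed

lemma lap_power_zero: "(lap ^^ i) (\<lambda>z. 0) = (\<lambda>z :: complex^'m::finite. 0)"
  by (induction i) (simp_all add: lap_zero)

lemma harm_zero: "(\<lambda>z. 0) \<in> harm a b"
  by (simp add: harm_def bh_zero lap_zero)

lemma harm_add: "f \<in> harm a b \<Longrightarrow> g \<in> harm a b \<Longrightarrow> (\<lambda>z. f z + g z) \<in> harm a b"
  by (auto simp: harm_def bh.add lap_add bh_imp_cpoly)

lemma harm_cmult: "f \<in> harm a b \<Longrightarrow> (\<lambda>z. c * f z) \<in> harm a b"
  by (auto simp: harm_def bh_cmult lap_cmult bh_imp_cpoly)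

lemma harm_diff: "f \<in> harm a b \<Longrightarrow> g \<in> harm a b \<Longrightarrow> (\<lambda>z. f z - g z) \<in> harm a b"
  using harm_add[of f a b "\<lambda>z. (-1) * g z"] harm_cmult[of g a b "-1"] by simp

lemma harm_sum: "(\<And>i. i \<in> I \<Longrightarrow> f i \<in> harm a b) \<Longrightarrow> (\<lambda>z. \<Sum>i\<in>I. f i z) \<in> harm a b"
  by (induction I rule: infinite_finite_induct) (auto intro: harm_zero harm_add)

text \<open>The bidegree is carried along in the same induction because \<open>lap_nsq_mult\<close>
  asks for it at each step.\<close>

lemma lap_nsq_power_harm:
  fixes h :: "complex^'m::finite \<Rightarrow> complex"
  assumes h: "h \<in> harm a b"
  shows "lap (\<lambda>z. nsq z ^ Suc k * h z) = (\<lambda>z. of_nat (Suc k * (CARD('m) + a + b + k)) * (nsq z ^ k * h z))"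
    and "bh (k + a) (k + b) (\<lambda>z. nsq z ^ k * h z)"
proof (induction k)
  case 0
  show "lap (\<lambda>z. nsq z ^ Suc 0 * h z) = (\<lambda>z. of_nat (Suc 0 * (CARD('m) + a + b + 0)) * (nsq z ^ 0 * h z))"
    using lap_nsq_mult[OF harm_bh[OF h]] by (simp add: harm_lap[OF h])
  show "bh (0 + a) (0 + b) (\<lambda>z. nsq z ^ 0 * h z)" using harm_bh[OF h] by simp
next
  case (Suc k)
  show bh: "bh (Suc k + a) (Suc k + b) (\<lambda>z. nsq z ^ Suc k * h z)"
    using bh_mult[OF bh_nsq Suc.IH(2)] by (simp add: mult_ac)
  show "lap (\<lambda>z. nsq z ^ Suc (Suc k) * h z)
      = (\<lambda>z. of_nat (Suc (Suc k) * (CARD('m) + a + b + Suc k)) * (nsq z ^ Suc k * h z))"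
  proof
    fix z
    have "lap (\<lambda>z. nsq z ^ Suc (Suc k) * h z) z = lap (\<lambda>z. nsq z * (nsq z ^ Suc k * h z)) z"
      by (simp add: mult.assoc)
    also have "\<dots> = of_nat (CARD('m) + (Suc k + a) + (Suc k + b)) * (nsq z ^ Suc k * h z)
        + nsq z * lap (\<lambda>z. nsq z ^ Suc k * h z) z"
      by (simp only: lap_nsq_mult[OF bh])
    also have "\<dots> = of_nat (CARD('m) + (Suc k + a) + (Suc k + b) + Suc k * (CARD('m) + a + b + k)) * (nsq z ^ Suc k * h z)"
      by (simp only: Suc.IH(1)) (simp add: algebra_simps)
    also have "CARD('m) + (Suc k + a) + (Suc k + b) + Suc k * (CARD('m) + a + b + k)
        = Suc (Suc k) * (CARD('m) + a + b + Suc k)"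
      by (simp add: algebra_simps)
    finally show "lap (\<lambda>z. nsq z ^ Suc (Suc k) * h z) z
      = of_nat (Suc (Suc k) * (CARD('m) + a + b + Suc k)) * (nsq z ^ Suc k * h z)" .
  qed
qed

lemma cpoly_lap_power: "cpoly f \<Longrightarrow> cpoly ((lap ^^ m) f)"
  by (induction m) (auto intro: cpoly_lap)

lemma bh_lap_power: "bh a b f \<Longrightarrow> bh (a - m) (b - m) ((lap ^^ m) f)"
proof (induction m)
  case (Suc m)
  from bh_lap[OF Suc.IH[OF Suc.prems]] show ?case by simp
qed simp

lemma lap_power_cmult: "cpoly f \<Longrightarrow> (lap ^^ m) (\<lambda>z. c * f z) = (\<lambda>z. c * (lap ^^ m) f z)"
  by (induction m) (auto simp: lap_cmult cpoly_lap_power)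

lemma lap_power_diff:
  "cpoly f \<Longrightarrow> cpoly g \<Longrightarrow> (lap ^^ m) (\<lambda>z. f z - g z) = (\<lambda>z. (lap ^^ m) f z - (lap ^^ m) g z)"
  by (induction m) (auto simp: lap_diff cpoly_lap_power)

text \<open>Only \<open>c > 0\<close> matters: up to a non-zero scalar, multiplication by
  \<open>nsq ^ m\<close> inverts the iterated Laplacian on harmonics, and \<open>fischer\<close>
  divides by that scalar.\<close>

lemma lap_power_nsq_power_harm:
  fixes h :: "complex^'m::finite \<Rightarrow> complex"
  assumes h: "h \<in> harm a b"
  obtains c where "c > 0" "(lap ^^ m) (\<lambda>z. nsq z ^ m * h z) = (\<lambda>z. of_nat c * h z)"
proof -
  have "\<exists>c>0. (lap ^^ m) (\<lambda>z. nsq z ^ m * h z) = (\<lambda>z. of_nat c * h z)"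
  proof (induction m)
    case 0
    show ?case by (intro exI[of _ 1]) auto
  next
    case (Suc m)
    then obtain c where c: "c > 0" "(lap ^^ m) (\<lambda>z. nsq z ^ m * h z) = (\<lambda>z. of_nat c * h z)" by blast
    have cp: "cpoly (\<lambda>z. nsq z ^ m * h z)"
      using lap_nsq_power_harm(2)[OF h] by (rule bh_imp_cpoly)
    let ?d = "Suc m * (CARD('m) + a + b + m)"
    have "(lap ^^ Suc m) (\<lambda>z. nsq z ^ Suc m * h z) = (lap ^^ m) (lap (\<lambda>z. nsq z ^ Suc m * h z))"
      by (simp add: funpow_swap1)
    also have "\<dots> = (lap ^^ m) (\<lambda>z. of_nat ?d * (nsq z ^ m * h z))"
      by (simp only: lap_nsq_power_harm(1)[OF h])
    also have "\<dots> = (\<lambda>z. of_nat (?d * c) * h z)"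
      by (simp only: lap_power_cmult[OF cp] c(2)) (simp add: mult.assoc)
    finally show ?case using c(1) by (intro exI[of _ "?d * c"]) simp
  qed
  then show ?thesis using that by blast
qed

text \<open>
  Fischer decomposition by induction on the order of vanishing under the Laplacian: the top
  component \<open>lap^m f\<close> is harmonic, and a multiple of \<open>nsq^m lap^m f\<close> has the same image under \<open>lap^m\<close>.
\<close>

lemma fischer:
  fixes f :: "complex^'m::finite \<Rightarrow> complex"
  shows "bh a b f \<Longrightarrow> (lap ^^ m) f = (\<lambda>z. 0) \<Longrightarrow>
    \<exists>h. (\<forall>k<m. h k \<in> harm (a - k) (b - k)) \<and> (\<forall>z\<in>sphere 0 1. f z = (\<Sum>k<m. h k z))"
proof (induction m arbitrary: f)
  case 0
  then show ?case by simp
next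
  case (Suc m)
  let ?h = "(lap ^^ m) f"
  show ?case
  proof (cases "?h = (\<lambda>z. 0)")
    case True
    from Suc.IH[OF Suc.prems(1) this] obtain h where
      h: "\<forall>k<m. h k \<in> harm (a - k) (b - k)" "\<forall>z\<in>sphere 0 1. f z = (\<Sum>k<m. h k z)" by blast
    show ?thesis
      by (intro exI[of _ "\<lambda>k. if k < m then h k else (\<lambda>z. 0)"]) (use h in \<open>auto simp: harm_zero\<close>)
  next
    case False
    \<comment> \<open>If some \<open>i < m\<close> used up one of the two degrees, the next
      Laplacian would already annihilate \<open>f\<close>, against \<open>?h\<close> being non-zero.
      Hence the subtractions \<open>a - m\<close> and \<open>b - m\<close> are not
      truncated.\<close>
    have lt: "m \<le> a" "m \<le> b"
    proof -
      have "i < m \<Longrightarrow> a - i = 0 \<or> b - i = 0 \<Longrightarrow> False" for i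
      proof -
        assume i: "i < m" "a - i = 0 \<or> b - i = 0"
        have b: "bh (a - i) (b - i) ((lap ^^ i) f)" by (rule bh_lap_power[OF Suc.prems(1)])
        have "lap ((lap ^^ i) f) = (\<lambda>z. 0)"
        proof
          fix z
          have "d_z j (d_zbar j ((lap ^^ i) f)) z = 0" for j
          proof (cases "a - i = 0")
            case True
            then show ?thesis
              using bh_d_z_zero[OF bh_d_zbar[OF b, of j] True, of j] by simp
          next
            case False
            then show ?thesis using i bh_d_zbar_zero[OF b, of j] by simp
          qed
          then show "lap ((lap ^^ i) f) z = 0" unfolding lap_def by simp
        qed
        then have *: "(lap ^^ Suc i) f = (\<lambda>z. 0)" by simp
        have "(lap ^^ m) f = (lap ^^ (m - Suc i)) ((lap ^^ Suc i) f)"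
          using i by (metis Suc_leI funpow_add le_add_diff_inverse2 o_apply)
        also have "\<dots> = (\<lambda>z. 0)"
          unfolding * by (rule lap_power_zero)
        finally show False using False by contradiction
      qed
      from this[of a] this[of b] show "m \<le> a" "m \<le> b" by (auto simp: not_less[symmetric])
    qed
    have h: "?h \<in> harm (a - m) (b - m)"
      using bh_lap_power[OF Suc.prems(1), of m] Suc.prems(2) by (auto simp: harm_def)
    obtain c where c: "c > 0" "(lap ^^ m) (\<lambda>z. nsq z ^ m * ?h z) = (\<lambda>z. of_nat c * ?h z)"
      using lap_power_nsq_power_harm[OF h] by blast
    have bn: "bh a b (\<lambda>z. nsq z ^ m * ?h z)"
      using lap_nsq_power_harm(2)[OF h, of m] lt by simp
    let ?g = "\<lambda>z. f z - (1 / of_nat c) * (nsq z ^ m * ?h z)"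
    have "bh a b ?g" by (intro bh_diff Suc.prems bh_cmult bn)
    moreover have "(lap ^^ m) ?g = (\<lambda>z. 0)"
      using c(1) by (simp only: lap_power_diff[OF bh_imp_cpoly[OF Suc.prems(1)] cpoly_cmult[OF bh_imp_cpoly[OF bn]]]
          lap_power_cmult[OF bh_imp_cpoly[OF bn]] c(2)) simp
    ultimately obtain h' where
      h': "\<forall>k<m. h' k \<in> harm (a - k) (b - k)" "\<forall>z\<in>sphere 0 1. ?g z = (\<Sum>k<m. h' k z)"
      using Suc.IH by blast
    have 1: "\<forall>z\<in>sphere 0 1. f z = (\<Sum>k<m. h' k z) + (1 / of_nat c) * ?h z"
    proof
      fix z :: "complex^'m" assume z: "z \<in> sphere 0 1"
      from h'(2) z have "f z - (1 / of_nat c) * (nsq z ^ m * ?h z) = (\<Sum>k<m. h' k z)" by blast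
      then show "f z = (\<Sum>k<m. h' k z) + (1 / of_nat c) * ?h z"
        by (simp add: nsq_sphere[OF z] diff_eq_eq)
    qed
    show ?thesis
      by (intro exI[of _ "\<lambda>k. if k < m then h' k else (\<lambda>z. (1 / of_nat c) * ?h z)"])
         (use h'(1) 1 harm_cmult[OF h, of "1 / of_nat c"] in \<open>auto simp: less_Suc_eq\<close>)
  qed
qed

lemma lap_power_eq_zero: "bh a b f \<Longrightarrow> (lap ^^ Suc a) f = (\<lambda>z. 0)"
proof -
  assume "bh a b f"
  from bh_lap_power[OF this, of a] have b: "bh 0 (b - a) ((lap ^^ a) f)" by simp
  have "d_z j (d_zbar j ((lap ^^ a) f)) z = 0" for j z
    using bh_d_z_zero[OF bh_d_zbar[OF b, of j] refl, of j] by simp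
  then show ?thesis by (auto simp: lap_def fun_eq_iff)
qed

section \<open>Monomials and the agreement of \<open>bh\<close> with
  \<open>bihom_poly\<close>\<close>

definition multi_idx :: "nat \<Rightarrow> ('m::finite \<Rightarrow> nat) set" where
  "multi_idx l = {\<alpha>. (\<Sum>j\<in>UNIV. \<alpha> j) = l}"

definition zmonom :: "('m::finite \<Rightarrow> nat) \<Rightarrow> ('m \<Rightarrow> nat) \<Rightarrow> complex^'m \<Rightarrow> complex" where
  "zmonom \<alpha> \<beta> z = (\<Prod>j\<in>UNIV. (z $ j) ^ \<alpha> j * cnj (z $ j) ^ \<beta> j)"

lemma finite_multi_idx [simp]: "finite (multi_idx l :: ('m::finite \<Rightarrow> nat) set)"
proof (rule finite_subset)
  show "multi_idx l \<subseteq> (PiE UNIV (\<lambda>_. {..l}) :: ('m \<Rightarrow> nat) set)"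
    by (auto simp: multi_idx_def intro: member_le_sum[where f="_ :: 'm \<Rightarrow> nat"])
qed (intro finite_PiE; simp)

lemma bihom_poly_iff:
  "bihom_poly l l' P \<longleftrightarrow> (\<exists>c. P = (\<lambda>z. \<Sum>(\<alpha>, \<beta>) \<in> multi_idx l \<times> multi_idx l'. c \<alpha> \<beta> * zmonom \<alpha> \<beta> z))"
  by (simp add: bihom_poly_def multi_idx_def zmonom_def)

lemma bh_power: "bh p q (\<lambda>z. (z $ j) ^ p * cnj (z $ j) ^ q)"
proof -
  have *: "bh 0 q (\<lambda>z. cnj (z $ j) ^ q)"
  proof (induction q)
    case (Suc q) from bh.zbar[OF Suc.IH, of j] show ?case by simp
  qed (use bh.const in simp)
  show ?thesis
  proof (induction p)
    case (Suc p) from bh.z[OF Suc.IH, of j] show ?case by (simp add: mult_ac)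
  qed (use * in simp)
qed

lemma bh_zmonom: "\<alpha> \<in> multi_idx l \<Longrightarrow> \<beta> \<in> multi_idx l' \<Longrightarrow> bh l l' (zmonom \<alpha> \<beta>)"
proof -
  have "bh (\<Sum>j\<in>A. \<alpha> j) (\<Sum>j\<in>A. \<beta> j) (\<lambda>z. \<Prod>j\<in>A. (z $ j) ^ \<alpha> j * cnj (z $ j) ^ \<beta> j)" for A
    by (induction A rule: infinite_finite_induct) (auto intro: bh.const bh_mult bh_power)
  from this[of UNIV] show "\<alpha> \<in> multi_idx l \<Longrightarrow> \<beta> \<in> multi_idx l' \<Longrightarrow> bh l l' (zmonom \<alpha> \<beta>)"
    by (simp add: multi_idx_def zmonom_def[abs_def])
qed

lemma bihom_poly_zmonom:
  assumes "\<alpha> \<in> multi_idx l" "\<beta> \<in> multi_idx l'"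
  shows "bihom_poly l l' (zmonom \<alpha> \<beta>)"
proof -
  have "zmonom \<alpha> \<beta> z = (\<Sum>(\<alpha>', \<beta>') \<in> multi_idx l \<times> multi_idx l'.
      (if (\<alpha>', \<beta>') = (\<alpha>, \<beta>) then 1 else 0) * zmonom \<alpha>' \<beta>' z)" for z
  proof -
    have "(\<Sum>(\<alpha>', \<beta>') \<in> multi_idx l \<times> multi_idx l'.
      (if (\<alpha>', \<beta>') = (\<alpha>, \<beta>) then 1 else 0) * zmonom \<alpha>' \<beta>' z)
      = (\<Sum>k \<in> multi_idx l \<times> multi_idx l'. if k = (\<alpha>, \<beta>) then zmonom \<alpha> \<beta> z else 0)"
      by (intro sum.cong) (auto split: if_splits)
    then show ?thesis using assms by simp
  qed
  then show ?thesis unfolding bihom_poly_iff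
    by (intro exI[of _ "\<lambda>\<alpha>' \<beta>'. if (\<alpha>', \<beta>') = (\<alpha>, \<beta>) then 1 else 0"]) auto
qed

lemma bihom_poly_add:
  assumes "bihom_poly l l' P" "bihom_poly l l' R"
  shows "bihom_poly l l' (\<lambda>z. P z + R z)"
proof -
  from assms obtain c d where "P = (\<lambda>z. \<Sum>(\<alpha>, \<beta>) \<in> multi_idx l \<times> multi_idx l'. c \<alpha> \<beta> * zmonom \<alpha> \<beta> z)"
    "R = (\<lambda>z. \<Sum>(\<alpha>, \<beta>) \<in> multi_idx l \<times> multi_idx l'. d \<alpha> \<beta> * zmonom \<alpha> \<beta> z)"
    unfolding bihom_poly_iff by blast
  then show ?thesis unfolding bihom_poly_iff
    by (intro exI[of _ "\<lambda>\<alpha> \<beta>. c \<alpha> \<beta> + d \<alpha> \<beta>"])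
       (auto simp: sum.distrib[symmetric] algebra_simps intro!: sum.cong)
qed

lemma bihom_poly_cmult:
  assumes "bihom_poly l l' P"
  shows "bihom_poly l l' (\<lambda>z. x * P z)"
proof -
  from assms obtain c where "P = (\<lambda>z. \<Sum>(\<alpha>, \<beta>) \<in> multi_idx l \<times> multi_idx l'. c \<alpha> \<beta> * zmonom \<alpha> \<beta> z)"
    unfolding bihom_poly_iff by blast
  then show ?thesis unfolding bihom_poly_iff
    by (intro exI[of _ "\<lambda>\<alpha> \<beta>. x * c \<alpha> \<beta>"])
       (auto simp: sum_distrib_left algebra_simps intro!: sum.cong)
qed

lemma bihom_poly_zero: "bihom_poly l l' (\<lambda>z. 0)"
  unfolding bihom_poly_iff by (intro exI[of _ "\<lambda>\<alpha> \<beta>. 0"]) auto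

lemma bihom_poly_sum: "(\<And>i. i \<in> I \<Longrightarrow> bihom_poly l l' (f i)) \<Longrightarrow> bihom_poly l l' (\<lambda>z. \<Sum>i\<in>I. f i z)"
  by (induction I rule: infinite_finite_induct) (auto intro: bihom_poly_zero bihom_poly_add)

lemma zmonom_z: "z $ j * zmonom \<alpha> \<beta> z = zmonom (\<alpha>(j := Suc (\<alpha> j))) \<beta> z"
proof -
  have "zmonom (\<alpha>(j := Suc (\<alpha> j))) \<beta> z
    = (\<Prod>i\<in>UNIV. (if i = j then z $ j else 1) * ((z $ i) ^ \<alpha> i * cnj (z $ i) ^ \<beta> i))"
    unfolding zmonom_def by (intro prod.cong) auto
  then show ?thesis
    by (subst (asm) prod.distrib) (simp only: prod.delta finite UNIV_I if_True zmonom_def)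
qed

lemma zmonom_zbar: "cnj (z $ j) * zmonom \<alpha> \<beta> z = zmonom \<alpha> (\<beta>(j := Suc (\<beta> j))) z"
proof -
  have "zmonom \<alpha> (\<beta>(j := Suc (\<beta> j))) z
    = (\<Prod>i\<in>UNIV. (if i = j then cnj (z $ j) else 1) * ((z $ i) ^ \<alpha> i * cnj (z $ i) ^ \<beta> i))"
    unfolding zmonom_def by (intro prod.cong) auto
  then show ?thesis
    by (subst (asm) prod.distrib) (simp only: prod.delta finite UNIV_I if_True zmonom_def)
qed

lemma multi_idx_upd: "\<alpha> \<in> multi_idx l \<Longrightarrow> \<alpha>(j := Suc (\<alpha> j)) \<in> multi_idx (Suc l)"
proof -
  have "(\<Sum>i\<in>UNIV. (\<alpha>(j := Suc (\<alpha> j))) i) = (\<Sum>i\<in>UNIV. \<alpha> i + (if i = j then 1 else 0))"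
    by (intro sum.cong) auto
  then show "\<alpha> \<in> multi_idx l \<Longrightarrow> \<alpha>(j := Suc (\<alpha> j)) \<in> multi_idx (Suc l)"
    by (simp add: multi_idx_def sum.distrib)
qed

lemma bihom_poly_bh: "bihom_poly l l' P \<longleftrightarrow> bh l l' P"
proof
  assume "bihom_poly l l' P"
  then obtain c where "P = (\<lambda>z. \<Sum>(\<alpha>, \<beta>) \<in> multi_idx l \<times> multi_idx l'. c \<alpha> \<beta> * zmonom \<alpha> \<beta> z)"
    unfolding bihom_poly_iff by blast
  then show "bh l l' P"
    by (auto intro!: bh_sum bh_cmult bh_zmonom simp: case_prod_beta)
next
  assume "bh l l' P"
  then show "bihom_poly l l' P"
  proof (induction rule: bh.induct)
    case (const c)
    have "bihom_poly 0 0 (\<lambda>z. c * zmonom (\<lambda>_. 0) (\<lambda>_. 0) z)"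
      by (intro bihom_poly_cmult bihom_poly_zmonom) (auto simp: multi_idx_def)
    then show ?case by (simp add: zmonom_def)
  next
    case (z a b f j)
    then obtain c where c: "f = (\<lambda>z. \<Sum>(\<alpha>, \<beta>) \<in> multi_idx a \<times> multi_idx b. c \<alpha> \<beta> * zmonom \<alpha> \<beta> z)"
      unfolding bihom_poly_iff by blast
    have "(\<lambda>z. z $ j * f z) = (\<lambda>z. \<Sum>k \<in> multi_idx a \<times> multi_idx b. c (fst k) (snd k) * zmonom ((fst k)(j := Suc (fst k j))) (snd k) z)"
      unfolding c by (auto simp: sum_distrib_left zmonom_z[symmetric] case_prod_beta mult_ac)
    then show ?case
      by (auto intro!: bihom_poly_sum bihom_poly_cmult bihom_poly_zmonom multi_idx_upd)
  next
    case (zbar a b f j)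
    then obtain c where c: "f = (\<lambda>z. \<Sum>(\<alpha>, \<beta>) \<in> multi_idx a \<times> multi_idx b. c \<alpha> \<beta> * zmonom \<alpha> \<beta> z)"
      unfolding bihom_poly_iff by blast
    have "(\<lambda>z. cnj (z $ j) * f z) = (\<lambda>z. \<Sum>k \<in> multi_idx a \<times> multi_idx b. c (fst k) (snd k) * zmonom (fst k) ((snd k)(j := Suc (snd k j))) z)"
      unfolding c by (auto simp: sum_distrib_left zmonom_zbar[symmetric] case_prod_beta mult_ac)
    then show ?case
      by (auto intro!: bihom_poly_sum bihom_poly_cmult bihom_poly_zmonom multi_idx_upd)
  qed (rule bihom_poly_add)
qed

lemma harmonics_eq: "harmonics l l' = (\<lambda>P. restrict P (sphere 0 1)) ` harm l l'"
  by (auto simp: harmonics_def harm_def bihom_poly_bh complex_laplacian_lap)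

section \<open>Smoothness and the sublaplacian\<close>

lemma cpoly_frechet_derivative:
  "cpoly f \<Longrightarrow> frechet_derivative f (at z) w = (\<Sum>j\<in>UNIV. w $ j * d_z j f z + cnj (w $ j) * d_zbar j f z)"
proof (induction rule: cpoly.induct)
  case (const c)
  show ?case by (simp add: frechet_derivative_const)
next
  case (z f i)
  have "frechet_derivative (\<lambda>z. z $ i * f z) (at z) w = z $ i * frechet_derivative f (at z) w + w $ i * f z"
    using cpoly_differentiable[OF z.hyps, of z, unfolded frechet_derivative_works]
    by (subst frechet_derivative_at[OF has_derivative_mult[OF has_derivative_vec_nth'], symmetric]) auto
  moreover have "(\<Sum>j\<in>UNIV. w $ j * d_z j (\<lambda>z. z $ i * f z) z + cnj (w $ j) * d_zbar j (\<lambda>z. z $ i * f z) z)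
      = (\<Sum>j\<in>UNIV. z $ i * (w $ j * d_z j f z + cnj (w $ j) * d_zbar j f z) + (if j = i then w $ i * f z else 0))"
    by (intro sum.cong refl) (simp add: d_z_cpoly_z[OF z.hyps] d_zbar_cpoly_z[OF z.hyps] distrib_left mult.left_commute)
  moreover have "\<dots> = z $ i * (\<Sum>j\<in>UNIV. w $ j * d_z j f z + cnj (w $ j) * d_zbar j f z) + w $ i * f z"
    unfolding sum.distrib[where h="\<lambda>j. if j = i then _ else 0"] sum_distrib_left by simp
  ultimately show ?case by (simp only: z.IH)
next
  case (zbar f i)
  have "frechet_derivative (\<lambda>z. cnj (z $ i) * f z) (at z) w
      = cnj (z $ i) * frechet_derivative f (at z) w + cnj (w $ i) * f z"
    using cpoly_differentiable[OF zbar.hyps, of z, unfolded frechet_derivative_works]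
    by (subst frechet_derivative_at[OF has_derivative_mult[OF has_derivative_cnj_vec_nth], symmetric]) auto
  moreover have "(\<Sum>j\<in>UNIV. w $ j * d_z j (\<lambda>z. cnj (z $ i) * f z) z + cnj (w $ j) * d_zbar j (\<lambda>z. cnj (z $ i) * f z) z)
      = (\<Sum>j\<in>UNIV. cnj (z $ i) * (w $ j * d_z j f z + cnj (w $ j) * d_zbar j f z) + (if j = i then cnj (w $ i) * f z else 0))"
    by (intro sum.cong refl) (simp add: d_z_cpoly_zbar[OF zbar.hyps] d_zbar_cpoly_zbar[OF zbar.hyps] distrib_left mult.left_commute)
  moreover have "\<dots> = cnj (z $ i) * (\<Sum>j\<in>UNIV. w $ j * d_z j f z + cnj (w $ j) * d_zbar j f z) + cnj (w $ i) * f z"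
    unfolding sum.distrib[where h="\<lambda>j. if j = i then _ else 0"] sum_distrib_left by simp
  ultimately show ?case by (simp only: zbar.IH)
next
  case (add f g)
  have "frechet_derivative (\<lambda>z. f z + g z) (at z) w = frechet_derivative f (at z) w + frechet_derivative g (at z) w"
    using cpoly_differentiable[OF add.hyps(1), of z, unfolded frechet_derivative_works]
      cpoly_differentiable[OF add.hyps(2), of z, unfolded frechet_derivative_works]
    by (subst frechet_derivative_at[OF has_derivative_add, symmetric]) auto
  then show ?case
    by (simp add: add.IH d_z_cpoly_add[OF add.hyps] d_zbar_cpoly_add[OF add.hyps] sum.distrib algebra_simps)
qed

text \<open>Directional derivatives of polynomials are polynomials, so induction on the order goes
  through. It makes harmonics admissible as test functions in
  \<open>cauchy_solution\<close>.\<close>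

lemma cpoly_smooth:
  fixes f :: "complex^'m::finite \<Rightarrow> complex"
  shows "cpoly f \<Longrightarrow> smooth f"
proof -
  have "cpoly f \<Longrightarrow> Ck k f" for k and f :: "complex^'m \<Rightarrow> complex"
  proof (induction k arbitrary: f)
    case 0
    then show ?case by (simp add: cpoly_continuous)
  next
    case (Suc k)
    have "cpoly (\<lambda>x. frechet_derivative f (at x) b)" for b
      unfolding cpoly_frechet_derivative[OF Suc.prems]
      by (intro cpoly_sum cpoly.add cpoly_cmult cpoly_d_z cpoly_d_zbar Suc.prems)
    then show ?case using cpoly_differentiable[OF Suc.prems] Suc.IH by simp
  qed
  then show "cpoly f \<Longrightarrow> smooth f" by (simp add: smooth_def)
qed

text \<open>Replaces the sum over \<open>j < k\<close> in \<open>sublaplacian\<close> by a full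
  double sum, in which the Euler identities apply.\<close>

lemma sum_less_symmetric:
  fixes F :: "'m::{finite,linorder} \<Rightarrow> 'm \<Rightarrow> complex"
  assumes "\<And>j k. F j k = F k j" "\<And>j. F j j = 0"
  shows "2 * (\<Sum>(j, k) | j < k. F j k) = (\<Sum>j\<in>UNIV. \<Sum>k\<in>UNIV. F j k)"
proof -
  let ?L = "{(j, k). j < k} :: ('m \<times> 'm) set" and ?G = "{(j, k). k < j} :: ('m \<times> 'm) set"
    and ?D = "{(j, k). j = k} :: ('m \<times> 'm) set"
  have "(\<Sum>j\<in>UNIV. \<Sum>k\<in>UNIV. F j k) = (\<Sum>(j, k)\<in>UNIV. F j k)"
    by (simp add: sum.cartesian_product)
  also have "(UNIV :: ('m \<times> 'm) set) = ?L \<union> ?G \<union> ?D" by auto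
  also have "(\<Sum>(j, k)\<in>?L \<union> ?G \<union> ?D. F j k) = (\<Sum>(j, k)\<in>?L. F j k) + (\<Sum>(j, k)\<in>?G. F j k) + (\<Sum>(j, k)\<in>?D. F j k)"
    by (subst sum.union_disjoint, auto)+
  also have "(\<Sum>(j, k)\<in>?D. F j k) = 0"
    by (rule sum.neutral) (auto simp: assms)
  also have "(\<Sum>(j, k)\<in>?G. F j k) = (\<Sum>(j, k)\<in>?L. F j k)"
    by (rule sum.reindex_bij_witness[of _ prod.swap prod.swap]) (auto simp: assms)
  finally show ?thesis by simp
qed

lemma cpoly_M_field: "cpoly f \<Longrightarrow> cpoly (M_field j k f)"
  unfolding M_field_def by (intro cpoly_diff cpoly.zbar cpoly_d_z)

lemma cpoly_Mbar_field: "cpoly f \<Longrightarrow> cpoly (Mbar_field j k f)"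
  unfolding Mbar_field_def by (intro cpoly_diff cpoly.z cpoly_d_zbar)

lemma M_field_Mbar_field:
  assumes f: "cpoly f"
  shows "M_field j k (Mbar_field j k f) z =
      cnj (z $ j) * ((if j = k then d_zbar k f z else 0) + z $ j * d_z k (d_zbar k f) z - d_zbar j f z - z $ k * d_z k (d_zbar j f) z)
    - cnj (z $ k) * (d_zbar k f z + z $ j * d_z j (d_zbar k f) z - (if j = k then d_zbar j f z else 0) - z $ k * d_z j (d_zbar j f) z)"
  unfolding M_field_def Mbar_field_def
  by (simp add: d_z_cpoly_diff d_z_cpoly_z cpoly.z cpoly_d_zbar f algebra_simps)

lemma Mbar_field_M_field:
  assumes f: "cpoly f"
  shows "Mbar_field j k (M_field j k f) z =
      z $ j * ((if j = k then d_z k f z else 0) + cnj (z $ j) * d_z k (d_zbar k f) z - d_z j f z - cnj (z $ k) * d_z j (d_zbar k f) z)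
    - z $ k * (d_z k f z + cnj (z $ j) * d_z k (d_zbar j f) z - (if j = k then d_z j f z else 0) - cnj (z $ k) * d_z j (d_zbar j f) z)"
  unfolding M_field_def Mbar_field_def
  by (simp add: d_zbar_cpoly_diff d_zbar_cpoly_zbar cpoly.zbar cpoly_d_z f algebra_simps d_z_d_zbar_commute)

text \<open>After expansion each double sum is an Euler operator applied once or twice, or contains
  the Laplacian of \<open>f\<close> and vanishes; a free index contributes the factor
  \<open>CARD('m)\<close>.\<close>

lemma sum_M_Mbar:
  fixes f :: "complex^'m::finite \<Rightarrow> complex"
  assumes f: "f \<in> harm a b"
  shows "(\<Sum>j\<in>UNIV. \<Sum>k\<in>UNIV. M_field j k (Mbar_field j k f) z + Mbar_field j k (M_field j k f) z)
    = - 2 * (of_nat (2 * a * b) + (of_nat CARD('m) - 1) * of_nat (a + b)) * f z"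
proof -
  note bf = harm_bh[OF f] and cf = harm_cpoly[OF f]
  have lap0: "(\<Sum>j\<in>UNIV. d_z j (d_zbar j f) z) = 0"
    using harm_lap[OF f] by (simp add: lap_def fun_eq_iff)
  have E: "(\<Sum>k\<in>UNIV. z $ k * d_z k (d_zbar j f) z) = of_nat a * d_zbar j f z" for j
    by (rule euler_d_z[OF bh_d_zbar[OF bf]])
  have E1: "(\<Sum>j\<in>UNIV. \<Sum>k\<in>UNIV. cnj (z $ j) * (z $ k * d_z k (d_zbar j f) z)) = of_nat (a * b) * f z"
  proof -
    have "(\<Sum>j\<in>UNIV. \<Sum>k\<in>UNIV. cnj (z $ j) * (z $ k * d_z k (d_zbar j f) z))
        = (\<Sum>j\<in>UNIV. of_nat a * (cnj (z $ j) * d_zbar j f z))"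
      by (simp only: sum_distrib_left[symmetric] E mult.left_commute[of "cnj _" "of_nat a"])
    then show ?thesis by (simp add: sum_distrib_left[symmetric] euler_d_zbar[OF bf])
  qed
  have E2: "(\<Sum>j\<in>UNIV. \<Sum>k\<in>UNIV. cnj (z $ k) * (z $ j * d_z j (d_zbar k f) z)) = of_nat (a * b) * f z"
    by (subst sum.swap) (rule E1)
  have N1: "(\<Sum>j\<in>UNIV. \<Sum>k\<in>UNIV. cnj (z $ j) * (z $ j * d_z k (d_zbar k f) z)) = 0"
    by (simp add: sum_distrib_left[symmetric] lap0)
  have N2: "(\<Sum>j\<in>UNIV. \<Sum>k\<in>UNIV. cnj (z $ k) * (z $ k * d_z j (d_zbar j f) z)) = 0"
    by (subst sum.swap) (rule N1)
  have D: "(\<Sum>j\<in>UNIV. \<Sum>k\<in>UNIV. (if j = k then g j else 0)) = (\<Sum>j\<in>UNIV. g j)" for g :: "'m \<Rightarrow> complex"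
    by simp
  have C1: "(\<Sum>j\<in>UNIV. \<Sum>k\<in>(UNIV :: 'm set). g j) = of_nat CARD('m) * (\<Sum>j\<in>UNIV. g j)" for g :: "'m \<Rightarrow> complex"
    by (simp add: sum_distrib_left)
  have C2: "(\<Sum>j\<in>(UNIV :: 'm set). \<Sum>k\<in>UNIV. g k) = of_nat CARD('m) * (\<Sum>j\<in>UNIV. g j)" for g :: "'m \<Rightarrow> complex"
    by simp
  have "(\<Sum>j\<in>UNIV. \<Sum>k\<in>UNIV. M_field j k (Mbar_field j k f) z + Mbar_field j k (M_field j k f) z)
    = (\<Sum>j\<in>UNIV. \<Sum>k\<in>UNIV.
        2 * (if j = k then cnj (z $ j) * d_zbar j f z else 0) + 2 * (if j = k then z $ j * d_z j f z else 0)
        + 2 * (cnj (z $ j) * (z $ j * d_z k (d_zbar k f) z)) + 2 * (cnj (z $ k) * (z $ k * d_z j (d_zbar j f) z))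
        - cnj (z $ j) * d_zbar j f z - cnj (z $ k) * d_zbar k f z
        - z $ j * d_z j f z - z $ k * d_z k f z
        - 2 * (cnj (z $ j) * (z $ k * d_z k (d_zbar j f) z)) - 2 * (cnj (z $ k) * (z $ j * d_z j (d_zbar k f) z)))"
    unfolding M_field_Mbar_field[OF cf] Mbar_field_M_field[OF cf]
    by (intro sum.cong refl) (simp add: algebra_simps)
  also have "\<dots> = 2 * (of_nat b * f z) + 2 * (of_nat a * f z)
      - 2 * (of_nat CARD('m) * (of_nat b * f z)) - 2 * (of_nat CARD('m) * (of_nat a * f z)) - 4 * (of_nat (a * b) * f z)"
    by (simp only: sum.distrib sum_subtractf sum_distrib_left[where r="2::complex", symmetric] N1 N2 E1 E2 D C1 C2
      euler_d_z[OF bf] euler_d_zbar[OF bf]) simp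
  finally show ?thesis by (simp add: algebra_simps)
qed

lemma sublaplacian_harm:
  fixes f :: "complex^'m::{finite,linorder} \<Rightarrow> complex"
  assumes f: "f \<in> harm a b" and n: "CARD('m) = n + 1"
  shows "sublaplacian f z = of_real (eigval n a b) * f z"
proof -
  note cf = harm_cpoly[OF f]
  have sym: "M_field j k (Mbar_field j k f) z + Mbar_field j k (M_field j k f) z
      = M_field k j (Mbar_field k j f) z + Mbar_field k j (M_field k j f) z" for j k
    unfolding M_field_Mbar_field[OF cf] Mbar_field_M_field[OF cf] by (simp add: algebra_simps)
  have diag: "M_field j j (Mbar_field j j f) z + Mbar_field j j (M_field j j f) z = 0" for j
    by (simp add: M_field_def Mbar_field_def)
  have "2 * sublaplacian f z = - (\<Sum>j\<in>UNIV. \<Sum>k\<in>UNIV. M_field j k (Mbar_field j k f) z + Mbar_field j k (M_field j k f) z)"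
    unfolding sublaplacian_def by (subst sum_less_symmetric[OF sym diag, symmetric]) simp
  also have "\<dots> = 2 * (of_real (eigval n a b) * f z)"
    unfolding sum_M_Mbar[OF f] by (simp add: n eigval_def algebra_simps)
  finally show ?thesis by simp
qed

section \<open>Integration by parts and orthogonality\<close>

lemma d_z_cnj: "cpoly f \<Longrightarrow> d_z j (\<lambda>z. cnj (f z)) = (\<lambda>z. cnj (d_zbar j f z))"
proof (induction rule: cpoly.induct)
  case (z f i) then show ?case by (simp add: d_z_cpoly_zbar d_zbar_cpoly_z cpoly_cnj)
next
  case (zbar f i) then show ?case by (auto simp: d_z_cpoly_z d_zbar_cpoly_zbar cpoly_cnj)
next
  case (add f g) then show ?case by (simp add: d_z_cpoly_add d_zbar_cpoly_add cpoly_cnj)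
qed (auto simp: fun_eq_iff)

lemma d_zbar_cnj: "cpoly f \<Longrightarrow> d_zbar j (\<lambda>z. cnj (f z)) = (\<lambda>z. cnj (d_z j f z))"
proof (induction rule: cpoly.induct)
  case (z f i) then show ?case by (auto simp: d_zbar_cpoly_zbar d_z_cpoly_z cpoly_cnj)
next
  case (zbar f i) then show ?case by (auto simp: d_zbar_cpoly_z d_z_cpoly_zbar cpoly_cnj)
next
  case (add f g) then show ?case by (simp add: d_z_cpoly_add d_zbar_cpoly_add cpoly_cnj)
qed (auto simp: fun_eq_iff)

lemma harm_cnj: "f \<in> harm a b \<Longrightarrow> (\<lambda>z. cnj (f z)) \<in> harm b a"
proof -
  assume f: "f \<in> harm a b"
  note cf = harm_cpoly[OF f]
  have "lap (\<lambda>z. cnj (f z)) z = cnj (lap f z)" for z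
    by (simp add: lap_def d_zbar_cnj d_z_cnj cf cpoly_d_z d_z_d_zbar_commute)
  then show ?thesis using f by (simp add: harm_def bh_cnj)
qed

lemma orthogonal_transformation_cmult:
  assumes "norm c = 1"
  shows "orthogonal_transformation (\<lambda>z :: complex^'m::finite. c *s z)"
  unfolding orthogonal_transformation
proof
  show "linear (\<lambda>z :: complex^'m. c *s z)"
    by (rule linearI) (auto simp: vec_eq_iff algebra_simps)
  show "\<forall>v :: complex^'m. norm (c *s v) = norm v"
    using assms by (simp add: norm_vec_def L2_set_def norm_mult)
qed

text \<open>Turning all coordinates by a common phase multiplies \<open>f\<close> by a unimodular
  constant and preserves the integral. The angle is chosen so that the constant is -1.\<close>

lemma integral_bh_zero:
  fixes f :: "complex^'m::finite \<Rightarrow> complex"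
  assumes f: "bh p q f" and pq: "p \<noteq> q"
  shows "(LINT z|sphere_measure. f z) = 0"
proof -
  define \<theta> where "\<theta> = pi / (real p - real q)"
  let ?c = "cis \<theta>"
  have mf: "f \<in> borel_measurable sphere_measure"
    by (intro continuous_on_sphere_measurable cpoly_continuous bh_imp_cpoly[OF f])
  have "?c ^ p * cnj ?c ^ q = cis (real p * \<theta> - real q * \<theta>)"
    unfolding cis_cnj Complex.DeMoivre cis_mult by simp
  also have "real p * \<theta> - real q * \<theta> = (real p - real q) * \<theta>"
    by (simp add: left_diff_distrib)
  also have "\<dots> = pi"
    using pq by (simp add: \<theta>_def)
  finally have c: "?c ^ p * cnj ?c ^ q = -1" by simp
  have "(LINT z|sphere_measure. f z) = (LINT z|sphere_measure. f (?c *s z))"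
    by (rule integral_sphere_orthogonal[OF orthogonal_transformation_cmult mf, symmetric]) simp
  also have "\<dots> = - (LINT z|sphere_measure. f z)"
    by (simp add: bh_homogeneous[OF f] c)
  finally show ?thesis by simp
qed


section \<open>Rotations of coordinate planes and integration by parts\<close>

text \<open>The real vector field along which polynomials are differentiated by
  \<open>c * M_field j k + cnj c * Mbar_field j k\<close>.\<close>

definition rot_vel :: "complex \<Rightarrow> 'm \<Rightarrow> 'm \<Rightarrow> complex^'m::finite \<Rightarrow> complex^'m" where
  "rot_vel c j k z = (\<chi> i. if i = j then - c * cnj (z $ k) else if i = k then c * cnj (z $ j) else 0)"

text \<open>The flow of \<^const>\<open>rot_vel\<close>.\<close>

definition rot :: "complex \<Rightarrow> 'm \<Rightarrow> 'm \<Rightarrow> real \<Rightarrow> complex^'m::finite \<Rightarrow> complex^'m" where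
  "rot c j k t z = z + (cos t - 1) *\<^sub>R (\<chi> i. if i = j \<or> i = k then z $ i else 0) + sin t *\<^sub>R rot_vel c j k z"

context
  fixes c :: complex and j k :: "'m::finite"
  assumes c: "norm c = 1" and jk: "j \<noteq> k"
begin

lemma rot_nth:
  "rot c j k t z $ i = (if i = j then cos t *\<^sub>R z $ j - sin t *\<^sub>R (c * cnj (z $ k))
    else if i = k then cos t *\<^sub>R z $ k + sin t *\<^sub>R (c * cnj (z $ j)) else z $ i)"
  using jk by (simp add: rot_def rot_vel_def algebra_simps)

lemma c_cnj: "c * cnj c = 1" "c * (cnj c * x) = x"
  using c complex_norm_square[of c] by (simp_all flip: mult.assoc)

lemma orthogonal_transformation_rot: "orthogonal_transformation (rot c j k t)"
  unfolding orthogonal_transformation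
proof
  show "linear (rot c j k t)"
    by (rule linearI) (simp_all add: vec_eq_iff rot_nth algebra_simps)
  have *: "(norm (cos t *\<^sub>R a - sin t *\<^sub>R (c * cnj b)))\<^sup>2 + (norm (cos t *\<^sub>R b + sin t *\<^sub>R (c * cnj a)))\<^sup>2
      = (norm a)\<^sup>2 + (norm b)\<^sup>2" (is "?l = ?r") for a b :: complex
  proof -
    have "complex_of_real ?l = (complex_of_real ((cos t)\<^sup>2) + complex_of_real ((sin t)\<^sup>2) * (c * cnj c)) * (a * cnj a + b * cnj b)"
      unfolding of_real_add complex_norm_square scaleR_conv_of_real
      by (simp add: algebra_simps power2_eq_square)
    also have "\<dots> = complex_of_real ((cos t)\<^sup>2 + (sin t)\<^sup>2) * (a * cnj a + b * cnj b)"
      by (simp only: c_cnj of_real_add mult_1_right)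
    also have "\<dots> = complex_of_real ?r"
      unfolding sin_cos_squared_add2 of_real_add complex_norm_square by simp
    finally show ?thesis by (simp only: of_real_eq_iff)
  qed
  have split: "(\<Sum>i\<in>UNIV. g i) = g j + (g k + (\<Sum>i\<in>UNIV - {j} - {k}. g i))" for g :: "'m \<Rightarrow> real"
    using jk by (subst sum.remove[of _ j], simp, simp, subst sum.remove[of _ k]) auto
  show "\<forall>v. norm (rot c j k t v) = norm v"
  proof
    fix v
    have "(\<Sum>i\<in>UNIV. (norm (rot c j k t v $ i))\<^sup>2) = (\<Sum>i\<in>UNIV. (norm (v $ i))\<^sup>2)"
      unfolding split using *[of "v $ j" "v $ k"] jk by (simp add: rot_nth)
    then show "norm (rot c j k t v) = norm v"
      by (simp add: norm_vec_def L2_set_def)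
  qed
qed

lemma rot_has_vector_derivative:
  "((\<lambda>t. rot c j k t z) has_vector_derivative rot_vel c j k (rot c j k t z)) (at t)"
proof -
  let ?P = "\<chi> i. if i = j \<or> i = k then z $ i else 0"
  have "((\<lambda>t. rot c j k t z) has_vector_derivative (0 + (- sin t) *\<^sub>R ?P + cos t *\<^sub>R rot_vel c j k z)) (at t)"
    unfolding rot_def by (auto intro!: derivative_eq_intros)
  also have "0 + (- sin t) *\<^sub>R ?P + cos t *\<^sub>R rot_vel c j k z = rot_vel c j k (rot c j k t z)"
    using jk c_cnj by (auto simp: vec_eq_iff rot_vel_def rot_nth algebra_simps)
  finally show ?thesis .
qed

text \<open>The flow consists of isometries, so the integral of \<open>f\<close> along it is
  constant and its derivative at time 0 vanishes. Difference quotients converge to the integrand and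
  are dominated by \<open>B\<close>, the bound of the derivative on the compact sphere, through the
  mean value inequality.\<close>

lemma integral_rot_vel:
  assumes f: "cpoly f"
  shows "(LINT z|sphere_measure. c * M_field j k f z + cnj c * Mbar_field j k f z) = 0"
proof -
  define g where "g = (\<lambda>z. c * M_field j k f z + cnj c * Mbar_field j k f z)"
  have cg: "continuous_on (sphere 0 1) g"
    unfolding g_def by (intro cpoly_continuous cpoly.add cpoly_cmult cpoly_M_field cpoly_Mbar_field f)
  have cf: "continuous_on (sphere 0 1) f" by (intro cpoly_continuous f)
  have fg: "frechet_derivative f (at z) (rot_vel c j k z) = g z" for z
  proof -
    have "(\<Sum>i\<in>UNIV. rot_vel c j k z $ i * d_z i f z + cnj (rot_vel c j k z $ i) * d_zbar i f z)
      = (\<Sum>i\<in>{j, k}. rot_vel c j k z $ i * d_z i f z + cnj (rot_vel c j k z $ i) * d_zbar i f z)"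
      by (intro sum.mono_neutral_right) (auto simp: rot_vel_def)
    then show ?thesis
      using jk unfolding cpoly_frechet_derivative[OF f]
      by (simp add: rot_vel_def g_def M_field_def Mbar_field_def algebra_simps)
  qed
  have D: "((\<lambda>t. f (rot c j k t z)) has_vector_derivative g (rot c j k t z)) (at t)" for t z
  proof -
    have "(f has_derivative frechet_derivative f (at (rot c j k t z))) (at (rot c j k t z))"
      using cpoly_differentiable[OF f] by (simp add: frechet_derivative_works)
    from vector_derivative_diff_chain_within[OF rot_has_vector_derivative has_derivative_at_withinI[OF this]]
    show ?thesis by (simp add: fg o_def)
  qed
  obtain B where B: "\<And>z. z \<in> sphere 0 1 \<Longrightarrow> norm (g z) \<le> B"
    using continuous_on_sphere_bounded[OF cg] by metis
  have rot_sphere: "rot c j k t z \<in> sphere 0 1" if "z \<in> sphere 0 1" for t z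
    using that orthogonal_transformation_norm[OF orthogonal_transformation_rot] by simp
  have rot0: "rot c j k 0 z = z" for z by (simp add: rot_def)
  have bound: "norm (f (rot c j k t z) - f z) \<le> B * t" if t: "t > 0" and z: "z \<in> sphere 0 1" for t z
  proof -
    have "continuous_on {0..t} (\<lambda>t. f (rot c j k t z))"
      by (intro continuous_at_imp_continuous_on ballI has_vector_derivative_continuous[OF D])
    from mvt_general[OF t this D[unfolded has_vector_derivative_def]]
    obtain x where "norm (f (rot c j k t z) - f (rot c j k 0 z)) \<le> norm ((t - 0) *\<^sub>R g (rot c j k x z))"
      by auto
    also have "\<dots> \<le> B * t"
      using B[OF rot_sphere[OF z, of x]] t by (simp add: mult.commute mult_left_mono)
    finally show ?thesis by (simp add: rot0)
  qed
  define s where "s i z = (f (rot c j k (inverse (Suc i)) z) - f z) /\<^sub>R inverse (Suc i)"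
    for i :: nat and z
  have mf: "f \<in> borel_measurable sphere_measure" by (intro continuous_on_sphere_measurable cf)
  have mfr: "(\<lambda>z. f (rot c j k t z)) \<in> borel_measurable sphere_measure" for t
    using measurable_compose[OF orthogonal_transformation_measurable_sphere[OF orthogonal_transformation_rot] mf] .
  have ifr: "integrable sphere_measure (\<lambda>z. f (rot c j k t z))" for t
    using integrable_distr[OF orthogonal_transformation_measurable_sphere[OF orthogonal_transformation_rot], where f=f]
      continuous_on_sphere_integrable[OF cf]
    by (simp add: sphere_measure_orthogonal[OF orthogonal_transformation_rot])
  have "(\<lambda>i. LINT z|sphere_measure. s i z) \<longlonglongrightarrow> (LINT z|sphere_measure. g z)"
  proof (rule integral_dominated_convergence)
    show "g \<in> borel_measurable sphere_measure" by (intro continuous_on_sphere_measurable cg)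
    show "s i \<in> borel_measurable sphere_measure" for i
      unfolding s_def by (intro borel_measurable_scaleR borel_measurable_diff borel_measurable_const mf mfr)
    show "integrable sphere_measure (\<lambda>z :: complex^'m. B)" by (rule sphere.integrable_const)
    show "AE z in sphere_measure. (\<lambda>i. s i z) \<longlonglongrightarrow> g z"
    proof (rule AE_I2)
      fix z :: "complex^'m"
      have "(\<lambda>h. norm (f (rot c j k (0 + h) z) - f (rot c j k 0 z) - h *\<^sub>R g (rot c j k 0 z)) / norm h) \<midarrow>0\<rightarrow> 0"
        using D[of z 0] unfolding has_vector_derivative_def has_derivative_at by blast
      moreover have "norm (f (rot c j k (0 + h) z) - f (rot c j k 0 z) - h *\<^sub>R g (rot c j k 0 z)) / norm h
          = norm ((f (rot c j k h z) - f z) /\<^sub>R h - g z)" if "h \<noteq> 0" for h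
      proof -
        have "(f (rot c j k h z) - f z) /\<^sub>R h - g z = (f (rot c j k h z) - f z - h *\<^sub>R g z) /\<^sub>R h"
          using that by (simp add: scaleR_diff_right)
        then show ?thesis by (simp add: rot0 divide_inverse mult.commute)
      qed
      ultimately have "(\<lambda>h. norm ((f (rot c j k h z) - f z) /\<^sub>R h - g z)) \<midarrow>0\<rightarrow> 0"
        by (subst (asm) LIM_cong[OF refl _ refl]) auto
      then have "((\<lambda>h. (f (rot c j k h z) - f z) /\<^sub>R h) \<longlongrightarrow> g z) (at 0)"
        by (simp add: tendsto_norm_zero_iff LIM_zero_iff)
      moreover have "filterlim (\<lambda>i. inverse (real (Suc i))) (at 0) sequentially"
        using LIMSEQ_inverse_real_of_nat by (simp add: filterlim_at)
      ultimately show "(\<lambda>i. s i z) \<longlonglongrightarrow> g z"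
        unfolding s_def by (rule filterlim_compose)
    qed
    show "AE z in sphere_measure. norm (s i z) \<le> B" for i
    proof (rule AE_I2)
      fix z :: "complex^'m" assume "z \<in> space sphere_measure"
      then have "norm (f (rot c j k (inverse (Suc i)) z) - f z) \<le> B * inverse (Suc i)"
        by (intro bound) auto
      then show "norm (s i z) \<le> B"
        by (simp add: s_def divide_simps mult.commute)
    qed
  qed
  moreover have "(LINT z|sphere_measure. s i z) = 0" for i
  proof -
    have "(LINT z|sphere_measure. s i z)
        = (1 / inverse (Suc i)) *\<^sub>R ((LINT z|sphere_measure. f (rot c j k (inverse (Suc i)) z)) - (LINT z|sphere_measure. f z))"
      unfolding s_def using ifr[of "inverse (Suc i)"] continuous_on_sphere_integrable[OF cf]
      by (simp add: divide_inverse)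
    also have "\<dots> = 0"
      using integral_sphere_orthogonal[OF orthogonal_transformation_rot mf] by simp
    finally show ?thesis .
  qed
  ultimately have "(\<lambda>i::nat. 0) \<longlonglongrightarrow> (LINT z|sphere_measure. g z)" by simp
  then show ?thesis using LIMSEQ_unique tendsto_const unfolding g_def by metis
qed

end

lemma
  fixes f :: "complex^'m::finite \<Rightarrow> complex"
  assumes f: "cpoly f"
  shows integral_M_field: "(LINT z|sphere_measure. M_field j k f z) = 0"
    and integral_Mbar_field: "(LINT z|sphere_measure. Mbar_field j k f z) = 0"
proof -
  have "(LINT z|sphere_measure. M_field j k f z) = 0 \<and> (LINT z|sphere_measure. Mbar_field j k f z) = 0"
  proof (cases "j = k")
    case True
    then show ?thesis by (simp add: M_field_def Mbar_field_def)
  next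
    case False
    have i: "integrable sphere_measure (M_field j k f)" "integrable sphere_measure (Mbar_field j k f)"
      by (intro continuous_on_sphere_integrable cpoly_continuous cpoly_M_field cpoly_Mbar_field f)+
    have "c * (LINT z|sphere_measure. M_field j k f z) + cnj c * (LINT z|sphere_measure. Mbar_field j k f z) = 0"
      if "norm c = 1" for c
      using integral_rot_vel[OF that False f] i by simp
    \<comment> \<open>\<open>c = 1\<close> gives the sum of the two integrals and
      \<open>c = \<i>\<close> a multiple of their difference.\<close>
    from this[of 1] this[of \<i>] show ?thesis by (auto simp: add_eq_0_iff)
  qed
  then show "(LINT z|sphere_measure. M_field j k f z) = 0" "(LINT z|sphere_measure. Mbar_field j k f z) = 0"
    by auto
qed

lemma
  fixes f g :: "complex^'m::finite \<Rightarrow> complex"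
  assumes f: "cpoly f" and g: "cpoly g"
  shows integral_M_field_parts:
      "(LINT z|sphere_measure. M_field j k f z * g z) = - (LINT z|sphere_measure. f z * M_field j k g z)"
    and integral_Mbar_field_parts:
      "(LINT z|sphere_measure. Mbar_field j k f z * g z) = - (LINT z|sphere_measure. f z * Mbar_field j k g z)"
proof -
  have e: "M_field j k (\<lambda>z. f z * g z) = (\<lambda>z. M_field j k f z * g z + f z * M_field j k g z)"
    "Mbar_field j k (\<lambda>z. f z * g z) = (\<lambda>z. Mbar_field j k f z * g z + f z * Mbar_field j k g z)"
    by (auto simp: M_field_def Mbar_field_def d_z_cpoly_mult d_zbar_cpoly_mult f g algebra_simps)
  have "integrable sphere_measure (\<lambda>z. M_field j k f z * g z)" "integrable sphere_measure (\<lambda>z. f z * M_field j k g z)"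
    "integrable sphere_measure (\<lambda>z. Mbar_field j k f z * g z)" "integrable sphere_measure (\<lambda>z. f z * Mbar_field j k g z)"
    by (intro continuous_on_sphere_integrable cpoly_continuous cpoly_mult cpoly_M_field cpoly_Mbar_field f g)+
  then show "(LINT z|sphere_measure. M_field j k f z * g z) = - (LINT z|sphere_measure. f z * M_field j k g z)"
    "(LINT z|sphere_measure. Mbar_field j k f z * g z) = - (LINT z|sphere_measure. f z * Mbar_field j k g z)"
    using integral_M_field[OF cpoly_mult[OF f g], of j k] integral_Mbar_field[OF cpoly_mult[OF f g], of j k]
    by (simp_all add: e eq_neg_iff_add_eq_0)
qed

lemma integral_double_sum:
  fixes u v :: "'i \<Rightarrow> 'j \<Rightarrow> 'a \<Rightarrow> complex"
  assumes "\<And>j k. integrable M (u j k)" "\<And>j k. integrable M (v j k)"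
  shows "(LINT z|M. (\<Sum>j\<in>A. \<Sum>k\<in>B. u j k z + v j k z))
    = (\<Sum>j\<in>A. \<Sum>k\<in>B. (LINT z|M. u j k z) + (LINT z|M. v j k z))"
  using assms by simp

text \<open>Each integration by parts costs a sign; two of them turn \<open>M_field\<close> after
  \<open>Mbar_field\<close> on \<open>f\<close> into the opposite composition on \<open>g\<close>,
  so the two summands change places.\<close>

lemma integral_sum_M_Mbar:
  fixes f :: "complex^'m::finite \<Rightarrow> complex"
  assumes f: "cpoly f" and g: "cpoly g"
  shows "(LINT z|sphere_measure. (\<Sum>j\<in>UNIV. \<Sum>k\<in>UNIV. M_field j k (Mbar_field j k f) z + Mbar_field j k (M_field j k f) z) * g z)
    = (LINT z|sphere_measure. f z * (\<Sum>j\<in>UNIV. \<Sum>k\<in>UNIV. M_field j k (Mbar_field j k g) z + Mbar_field j k (M_field j k g) z))"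
proof -
  note c = f g cpoly_M_field cpoly_Mbar_field
  have i: "integrable sphere_measure (\<lambda>z. F z * G z)" if "cpoly F" "cpoly G" for F G :: "complex^'m \<Rightarrow> complex"
    using that by (intro continuous_on_sphere_integrable cpoly_continuous cpoly_mult)
  have *: "(LINT z|sphere_measure. M_field j k (Mbar_field j k f) z * g z) + (LINT z|sphere_measure. Mbar_field j k (M_field j k f) z * g z)
     = (LINT z|sphere_measure. f z * M_field j k (Mbar_field j k g) z) + (LINT z|sphere_measure. f z * Mbar_field j k (M_field j k g) z)" for j k
    using integral_M_field_parts[OF cpoly_Mbar_field[OF f] g, of j k j k]
      integral_Mbar_field_parts[OF cpoly_M_field[OF f] g, of j k j k]
      integral_Mbar_field_parts[OF f cpoly_M_field[OF g], of j k j k]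
      integral_M_field_parts[OF f cpoly_Mbar_field[OF g], of j k j k]
    by simp
  show ?thesis
    unfolding sum_distrib_left sum_distrib_right distrib_left distrib_right
    by (subst (1 2) integral_double_sum) (intro i c | simp only: *)+
qed

text \<open>If \<open>a - b\<close> and \<open>a' - b'\<close> differ as integers, the circle action
  separates the two spaces. Otherwise both entries of the bidegree move in the same direction, the
  eigenvalue is strictly monotone, and the symmetry of the operator separates them.\<close>

lemma harm_orthogonal:
  fixes f g :: "complex^'m::finite \<Rightarrow> complex"
  assumes f: "f \<in> harm a b" and g: "g \<in> harm a' b'" and ne: "(a, b) \<noteq> (a', b')" and n: "CARD('m) \<ge> 2"
  shows "(LINT z|sphere_measure. f z * cnj (g z)) = 0"
proof (cases "a + b' = b + a'")
  case False
  have "bh (a + b') (b + a') (\<lambda>z. f z * cnj (g z))"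
    by (intro bh_mult bh_cnj harm_bh f g)
  from integral_bh_zero[OF this False] show ?thesis .
next
  case True
  let ?g = "\<lambda>z. cnj (g z)"
  let ?I = "LINT z|sphere_measure. f z * ?g z"
  let ?e = "\<lambda>a b. 2 * real a * real b + (real CARD('m) - 1) * (real a + real b)"
  have e: "- 2 * (of_nat (2 * a * b) + (of_nat CARD('m) - 1) * of_nat (a + b)) = complex_of_real (- 2 * ?e a b)" for a b
    by simp
  have "complex_of_real (- 2 * ?e a b) * ?I = complex_of_real (- 2 * ?e b' a') * ?I"
    using integral_sum_M_Mbar[OF harm_cpoly[OF f] harm_cpoly[OF harm_cnj[OF g]]]
    unfolding sum_M_Mbar[OF f] sum_M_Mbar[OF harm_cnj[OF g]] e
    by (simp add: mult.assoc mult.left_commute[of "f _"])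
  moreover have "?e a b \<noteq> ?e b' a'"
  proof -
    have lt: "?e a b < ?e a' b'" if "a < a'" "b < b'" for a b a' b' :: nat
    proof -
      have "real a * real b \<le> real a' * real b'" using that by (intro mult_mono) auto
      moreover have "(real CARD('m) - 1) * (real a + real b) < (real CARD('m) - 1) * (real a' + real b')"
        using that n by (intro mult_strict_left_mono) auto
      ultimately show ?thesis by simp
    qed
    have s: "?e b' a' = ?e a' b'" by simp
    from True ne have "a < a' \<and> b < b' \<or> a' < a \<and> b' < b" by auto
    then show ?thesis using lt[of a a' b b'] lt[of a' a b' b] unfolding s by auto
  qed
  ultimately show ?thesis by (simp only: mult_cancel_right of_real_eq_iff) simp
qed

section \<open>Square integrable functions on the sphere\<close>

text \<open>The real square of \<open>sphere_norm 2\<close>, used to compute outside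
  \<open>ennreal\<close>; \<open>sphere_norm_2_L2s\<close> is the way back.\<close>

definition sq_norm :: "(complex^'m::finite \<Rightarrow> complex) \<Rightarrow> real" where
  "sq_norm f = (LINT z|sphere_measure. (norm (f z))\<^sup>2)"

definition L2s :: "(complex^'m::finite \<Rightarrow> complex) \<Rightarrow> bool" where
  "L2s f \<longleftrightarrow> f \<in> borel_measurable sphere_measure \<and> integrable sphere_measure (\<lambda>z. (norm (f z))\<^sup>2)"

lemma ennreal_powr_ennreal: "0 \<le> x \<Longrightarrow> ennreal_powr (ennreal x) a = ennreal (x powr a)"
  by (simp add: ennreal_powr_def)

lemma ennreal_powr_less_top_iff [simp]: "ennreal_powr x a < top \<longleftrightarrow> x < top"
  by (auto simp: ennreal_powr_def less_top)

lemma nn_integral_norm_powr_2: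
  "(\<integral>\<^sup>+ z. ennreal_powr (ennreal (norm (f z))) 2 \<partial>M) = (\<integral>\<^sup>+ z. ennreal ((norm (f z))\<^sup>2) \<partial>M)"
  by (intro nn_integral_cong) (simp add: ennreal_powr_ennreal powr_numeral)

lemma sphere_norm_2:
  "sphere_norm 2 f = ennreal_powr (\<integral>\<^sup>+ z. ennreal ((norm (f z))\<^sup>2) \<partial>sphere_measure) (1 / 2)"
  by (simp add: sphere_norm_def Lp_norm_def nn_integral_norm_powr_2)

lemma sphere_L2_iff: "f \<in> sphere_L2 \<longleftrightarrow> L2s f"
proof (cases "f \<in> borel_measurable sphere_measure")
  case True
  have "sphere_norm 2 f < \<infinity> \<longleftrightarrow> (\<integral>\<^sup>+ z. ennreal ((norm (f z))\<^sup>2) \<partial>sphere_measure) < \<infinity>"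
    unfolding sphere_norm_2 by simp
  also have "\<dots> \<longleftrightarrow> integrable sphere_measure (\<lambda>z. (norm (f z))\<^sup>2)"
    using True by (simp add: integrable_iff_bounded)
  finally show ?thesis using True by (simp add: sphere_L2_def L2s_def)
qed (simp add: sphere_L2_def L2s_def)

lemma sphere_norm_2_L2s: "L2s f \<Longrightarrow> sphere_norm 2 f = ennreal (sqrt (sq_norm f))"
  unfolding sphere_norm_2 L2s_def sq_norm_def
  by (subst nn_integral_eq_integral) (auto simp: ennreal_powr_ennreal powr_half_sqrt)

lemma sq_norm_nonneg [simp]: "sq_norm f \<ge> 0"
  by (simp add: sq_norm_def)

lemma L2s_continuous: "continuous_on (sphere 0 1) f \<Longrightarrow> L2s f"
  unfolding L2s_def
  by (intro conjI continuous_on_sphere_measurable continuous_on_sphere_integrable continuous_intros)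

lemma L2s_measurable: "L2s f \<Longrightarrow> f \<in> borel_measurable sphere_measure"
  by (simp add: L2s_def)

lemma L2s_mult_integrable:
  assumes "L2s f" "L2s g"
  shows "integrable sphere_measure (\<lambda>z. f z * cnj (g z))"
proof (rule Bochner_Integration.integrable_bound)
  show "integrable sphere_measure (\<lambda>z. (norm (f z))\<^sup>2 + (norm (g z))\<^sup>2)"
    using assms by (simp add: L2s_def)
  show "(\<lambda>z. f z * cnj (g z)) \<in> borel_measurable sphere_measure"
    using assms unfolding L2s_def
    by (intro borel_measurable_times measurable_compose[OF _ borel_measurable_continuous_onI[of cnj]])
       (auto intro: continuous_intros)
  have "norm a * norm b \<le> (norm a)\<^sup>2 + (norm b)\<^sup>2" for a b :: complex
  proof -
    have "0 \<le> norm a * norm b" by simp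
    moreover have "2 * (norm a * norm b) \<le> (norm a)\<^sup>2 + (norm b)\<^sup>2"
      using sum_squares_bound[of "norm a" "norm b"] by (simp add: mult.assoc)
    ultimately show ?thesis by linarith
  qed
  then show "AE z in sphere_measure. norm (f z * cnj (g z)) \<le> norm ((norm (f z))\<^sup>2 + (norm (g z))\<^sup>2)"
    by (simp add: norm_mult)
qed

lemma L2s_add: "L2s f \<Longrightarrow> L2s g \<Longrightarrow> L2s (\<lambda>z. f z + g z)"
proof -
  assume fg: "L2s f" "L2s g"
  have "(norm (a + b))\<^sup>2 \<le> 2 * (norm a)\<^sup>2 + 2 * (norm b)\<^sup>2" for a b :: complex
  proof -
    have "(norm (a + b))\<^sup>2 \<le> (norm a + norm b)\<^sup>2" by (intro power_mono norm_triangle_ineq) auto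
    also have "\<dots> \<le> 2 * (norm a)\<^sup>2 + 2 * (norm b)\<^sup>2"
      using sum_squares_bound[of "norm a" "norm b"] by (simp add: power2_sum)
    finally show ?thesis .
  qed
  then have AE: "AE z in sphere_measure. norm ((norm (f z + g z))\<^sup>2) \<le> norm (2 * (norm (f z))\<^sup>2 + 2 * (norm (g z))\<^sup>2)"
    by (intro AE_I2) simp
  have i: "integrable sphere_measure (\<lambda>z. 2 * (norm (f z))\<^sup>2 + 2 * (norm (g z))\<^sup>2)"
    using fg by (intro Bochner_Integration.integrable_add integrable_mult_right) (simp_all add: L2s_def)
  have m: "(\<lambda>z. f z + g z) \<in> borel_measurable sphere_measure"
    using fg by (intro borel_measurable_add) (simp_all add: L2s_def)
  then have "integrable sphere_measure (\<lambda>z. (norm (f z + g z))\<^sup>2)"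
    by (intro Bochner_Integration.integrable_bound[OF i _ AE] borel_measurable_power measurable_compose[OF m borel_measurable_norm])
  then show ?thesis using m by (simp add: L2s_def)
qed

lemma L2s_cmult: "L2s f \<Longrightarrow> L2s (\<lambda>z. c * f z)"
  unfolding L2s_def norm_mult power_mult_distrib
  by (intro conjI borel_measurable_times borel_measurable_const integrable_mult_right) auto

lemma L2s_diff: "L2s f \<Longrightarrow> L2s g \<Longrightarrow> L2s (\<lambda>z. f z - g z)"
  using L2s_add[of f "\<lambda>z. (-1) * g z"] L2s_cmult[of g "-1"] by simp

lemma L2s_zero: "L2s (\<lambda>z. 0)"
  by (simp add: L2s_def)

lemma L2s_sum: "(\<And>i. i \<in> I \<Longrightarrow> L2s (f i)) \<Longrightarrow> L2s (\<lambda>z. \<Sum>i\<in>I. f i z)"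
  by (induction I rule: infinite_finite_induct) (auto intro: L2s_zero L2s_add)

lemma L2s_cpoly: "cpoly f \<Longrightarrow> L2s f"
  by (intro L2s_continuous cpoly_continuous)

lemma sphere_inner_self: "L2s f \<Longrightarrow> sphere_inner f f = of_real (sq_norm f)"
  unfolding sphere_inner_def sq_norm_def complex_norm_square[symmetric] by (rule integral_complex_of_real)

lemma sphere_inner_add_left:
  "L2s f \<Longrightarrow> L2s g \<Longrightarrow> L2s h \<Longrightarrow> sphere_inner (\<lambda>z. f z + g z) h = sphere_inner f h + sphere_inner g h"
  unfolding sphere_inner_def by (simp add: distrib_right L2s_mult_integrable)

lemma sphere_inner_diff_left:
  "L2s f \<Longrightarrow> L2s g \<Longrightarrow> L2s h \<Longrightarrow> sphere_inner (\<lambda>z. f z - g z) h = sphere_inner f h - sphere_inner g h"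
  unfolding sphere_inner_def by (simp add: left_diff_distrib L2s_mult_integrable)

lemma sphere_inner_cmult_left: "sphere_inner (\<lambda>z. c * f z) h = c * sphere_inner f h"
  unfolding sphere_inner_def by (simp add: mult.assoc)

lemma sphere_inner_cmult_right: "sphere_inner f (\<lambda>z. c * h z) = cnj c * sphere_inner f h"
  unfolding sphere_inner_def by (simp add: mult.left_commute[of _ "cnj c"])

lemma sphere_inner_cnj: "sphere_inner g f = cnj (sphere_inner f g)"
  unfolding sphere_inner_def by (subst Bochner_Integration.integral_cnj[symmetric]) (simp add: mult.commute)

lemma sphere_inner_add_right:
  "L2s f \<Longrightarrow> L2s g \<Longrightarrow> L2s h \<Longrightarrow> sphere_inner h (\<lambda>z. f z + g z) = sphere_inner h f + sphere_inner h g"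
  unfolding sphere_inner_def by (simp add: distrib_left L2s_mult_integrable)

lemma sphere_inner_sum_left:
  assumes "\<And>i. i \<in> I \<Longrightarrow> L2s (f i)" "L2s h"
  shows "sphere_inner (\<lambda>z. \<Sum>i\<in>I. f i z) h = (\<Sum>i\<in>I. sphere_inner (f i) h)"
  using assms unfolding sphere_inner_def by (simp add: sum_distrib_right L2s_mult_integrable)

lemma sphere_inner_sum_right:
  assumes "\<And>i. i \<in> I \<Longrightarrow> L2s (f i)" "L2s h"
  shows "sphere_inner h (\<lambda>z. \<Sum>i\<in>I. f i z) = (\<Sum>i\<in>I. sphere_inner h (f i))"
  using assms unfolding sphere_inner_def by (simp add: sum_distrib_left L2s_mult_integrable)

lemma sphere_inner_lincomb_left:
  assumes "\<And>i. i \<in> I \<Longrightarrow> L2s (f i)" "L2s h"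
  shows "sphere_inner (\<lambda>z. \<Sum>i\<in>I. c i * f i z) h = (\<Sum>i\<in>I. c i * sphere_inner (f i) h)"
  by (subst sphere_inner_sum_left) (auto simp: sphere_inner_cmult_left assms L2s_cmult)

lemma sphere_inner_lincomb_right:
  assumes "\<And>i. i \<in> I \<Longrightarrow> L2s (f i)" "L2s h"
  shows "sphere_inner h (\<lambda>z. \<Sum>i\<in>I. c i * f i z) = (\<Sum>i\<in>I. cnj (c i) * sphere_inner h (f i))"
  by (subst sphere_inner_sum_right) (auto simp: sphere_inner_cmult_right assms L2s_cmult)

lemma sphere_inner_cong:
  assumes "\<And>z. z \<in> sphere 0 1 \<Longrightarrow> f z = f' z" "\<And>z. z \<in> sphere 0 1 \<Longrightarrow> g z = g' z"
  shows "sphere_inner f g = sphere_inner f' g'"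
  unfolding sphere_inner_def using assms by (intro Bochner_Integration.integral_cong) auto

lemma sq_norm_cong: "(\<And>z. z \<in> sphere 0 1 \<Longrightarrow> norm (f z) = norm (g z)) \<Longrightarrow> sq_norm f = sq_norm g"
  unfolding sq_norm_def by (intro Bochner_Integration.integral_cong) auto

lemma L2s_cong: "(\<And>z. z \<in> sphere 0 1 \<Longrightarrow> f z = g z) \<Longrightarrow> L2s f = L2s g"
  unfolding L2s_def
  by (intro conj_cong measurable_cong Bochner_Integration.integrable_cong) auto

lemma sq_norm_cmult: "sq_norm (\<lambda>z. c * f z) = (norm c)\<^sup>2 * sq_norm f"
  by (simp add: sq_norm_def norm_mult power_mult_distrib)

lemma sq_norm_add:
  assumes "L2s f" "L2s g"
  shows "sq_norm (\<lambda>z. f z + g z) = sq_norm f + sq_norm g + 2 * Re (sphere_inner f g)"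
proof -
  have "complex_of_real (sq_norm (\<lambda>z. f z + g z)) = sphere_inner (\<lambda>z. f z + g z) (\<lambda>z. f z + g z)"
    by (simp add: sphere_inner_self L2s_add assms)
  also have "\<dots> = sphere_inner f f + sphere_inner g g + (sphere_inner f g + cnj (sphere_inner f g))"
    by (simp add: sphere_inner_add_left[OF assms L2s_add[OF assms]] sphere_inner_add_right[OF assms] assms
        sphere_inner_cnj[of g f])
  also have "\<dots> = complex_of_real (sq_norm f + sq_norm g + 2 * Re (sphere_inner f g))"
    by (simp add: sphere_inner_self assms complex_add_cnj)
  finally show ?thesis by (simp only: of_real_eq_iff)
qed

text \<open>The surface measure has full support: the cone over the set where \<open>f\<close> does
  not vanish is open in the ambient space and a Lebesgue null set, hence empty.\<close>

lemma continuous_sq_norm_zero: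
  fixes f :: "complex^'m::finite \<Rightarrow> complex"
  assumes f: "continuous_on (sphere 0 1) f" and 0: "sq_norm f = 0" and z0: "z0 \<in> sphere 0 1"
  shows "f z0 = 0"
proof (rule ccontr)
  assume nz: "f z0 \<noteq> 0"
  let ?A = "{z \<in> sphere 0 1. f z \<noteq> 0}"
  have "integrable sphere_measure (\<lambda>z. (norm (f z))\<^sup>2)" using L2s_continuous[OF f] by (simp add: L2s_def)
  then have "AE z in sphere_measure. (norm (f z))\<^sup>2 = 0"
    using 0 unfolding sq_norm_def by (subst (asm) integral_nonneg_eq_0_iff_AE) auto
  then have AE: "AE z in sphere_measure. f z = 0" by simp
  have mf: "f \<in> borel_measurable sphere_measure" using f by (rule continuous_on_sphere_measurable)
  have mA: "?A \<in> sets sphere_measure"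
    using measurable_sets[OF mf, of "- {0}"] by (simp add: vimage_def Int_def conj_commute)
  then have A: "emeasure sphere_measure ?A = 0"
    using AE by (subst (asm) AE_iff_null[OF _]) (auto simp: null_sets_def)
  have bA: "?A \<in> sets borel" using mA by (simp add: sets_restrict_space_iff)
  let ?W = "{x \<in> ball 0 1 - {0}. sgn x \<in> ?A}"
  have "continuous_on (ball 0 1 - {0}) (\<lambda>x. f (sgn x))"
    by (rule continuous_on_compose2[OF f]) (auto simp: norm_sgn split: if_splits intro!: continuous_intros)
  then have "open ((\<lambda>x. f (sgn x)) -` (- {0}) \<inter> (ball 0 1 - {0}))"
    by (subst (asm) continuous_on_open_vimage) auto
  also have "(\<lambda>x. f (sgn x)) -` (- {0}) \<inter> (ball 0 1 - {0}) = ?W" by (auto simp: norm_sgn split: if_splits)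
  finally have oW: "open ?W" .
  have z0W: "(1/2) *\<^sub>R z0 \<in> ?W"
  proof -
    have "sgn ((1/2) *\<^sub>R z0) = z0" using z0 by (simp add: sgn_div_norm)
    then show ?thesis using z0 nz by (auto simp: dist_norm)
  qed
  have "of_nat DIM(complex^'m) * emeasure lborel ?W = 0"
    using A emeasure_sphere_measure[OF bA Collect_restrict] by (simp only:)
  then have "emeasure lborel ?W = 0"
    by (subst (asm) mult_eq_0_iff) (metis DIM_positive of_nat_eq_0_iff less_irrefl)
  then have "?W \<in> null_sets lborel"
    using oW by (intro null_setsI) (simp_all only: sets_lborel borel_open)
  then have "negligible ?W"
    unfolding negligible_iff_null_sets by (rule null_sets_completionI)
  then show False using open_not_negligible[OF oW] z0W by blast
qed

section \<open>The dimension of the spaces of harmonics\<close>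

text \<open>Gaussian elimination: a pivot \<open>a k i0\<close> removes the unknown
  \<open>i0\<close> together with the equation \<open>k\<close>.\<close>

lemma linear_system_nontrivial:
  fixes a :: "'k \<Rightarrow> 'i \<Rightarrow> complex"
  assumes "finite K" "finite I" "card K < card I"
  shows "\<exists>c. (\<exists>i\<in>I. c i \<noteq> 0) \<and> (\<forall>k\<in>K. (\<Sum>i\<in>I. c i * a k i) = 0)"
  using assms
proof (induction K arbitrary: I a rule: finite_induct)
  case empty
  then have "I \<noteq> {}" by auto
  then show ?case by (intro exI[of _ "\<lambda>_. 1"]) auto
next
  case (insert k K)
  show ?case
  proof (cases "\<forall>i\<in>I. a k i = 0")
    case True
    from insert.IH[of I a] insert.prems insert.hyps obtain c where
      "\<exists>i\<in>I. c i \<noteq> 0" "\<forall>k\<in>K. (\<Sum>i\<in>I. c i * a k i) = 0" by auto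
    then show ?thesis using True by (intro exI[of _ c]) auto
  next
    case False
    then obtain i0 where i0: "i0 \<in> I" "a k i0 \<noteq> 0" by blast
    let ?I = "I - {i0}"
    have "finite ?I" "card K < card ?I" using insert.prems insert.hyps i0 by simp_all
    from insert.IH[OF this, of "\<lambda>k' i. a k' i - a k' i0 * (a k i / a k i0)"]
    obtain c where c: "\<exists>i\<in>?I. c i \<noteq> 0"
      "\<And>k'. k' \<in> K \<Longrightarrow> (\<Sum>i\<in>?I. c i * (a k' i - a k' i0 * (a k i / a k i0))) = 0"
      by blast
    define d where "d = (\<lambda>i. if i = i0 then - (\<Sum>i\<in>?I. c i * (a k i / a k i0)) else c i)"
    have sum: "(\<Sum>i\<in>I. d i * a k' i) = (\<Sum>i\<in>?I. c i * (a k' i - a k' i0 * (a k i / a k i0)))" for k'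
    proof -
      have "(\<Sum>i\<in>I. d i * a k' i) = d i0 * a k' i0 + (\<Sum>i\<in>?I. d i * a k' i)"
        using i0 insert.prems by (intro sum.remove) auto
      also have "(\<Sum>i\<in>?I. d i * a k' i) = (\<Sum>i\<in>?I. c i * a k' i)"
        by (intro sum.cong) (auto simp: d_def)
      finally show ?thesis
        by (simp add: d_def right_diff_distrib sum_subtractf sum_distrib_right sum_distrib_left mult_ac)
    qed
    have "(\<Sum>i\<in>I. d i * a k i) = 0"
      unfolding sum using i0 by simp
    then show ?thesis
      using c by (intro exI[of _ d]) (auto simp: sum, metis Diff_iff d_def singletonI)
  qed
qed

text \<open>On the sphere \<open>g\<close> is a sum of harmonics of bidegrees
  \<open>(a' - k, b' - k)\<close>; their first entries lie below \<open>a\<close>, so each of them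
  is orthogonal to \<open>h\<close>.\<close>

lemma harm_inner_lower:
  fixes h :: "complex^'m::finite \<Rightarrow> complex"
  assumes n: "CARD('m) \<ge> 2" and h: "h \<in> harm a b" and g: "bh a' b' g" and a': "a' < a"
  shows "sphere_inner h g = 0"
proof -
  from fischer[OF g lap_power_eq_zero[OF g]] obtain r where
    r: "\<forall>k<Suc a'. r k \<in> harm (a' - k) (b' - k)" "\<forall>z\<in>sphere 0 1. g z = (\<Sum>k<Suc a'. r k z)"
    by blast
  have "sphere_inner h g = sphere_inner h (\<lambda>z. \<Sum>k<Suc a'. r k z)"
    using r(2) by (intro sphere_inner_cong) auto
  also have "\<dots> = (\<Sum>k<Suc a'. sphere_inner h (r k))"
    using r(1) h by (intro sphere_inner_sum_right L2s_cpoly) (auto intro: harm_cpoly)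
  also have "\<dots> = 0"
  proof (intro sum.neutral ballI)
    fix k assume "k \<in> {..<Suc a'}"
    then show "sphere_inner h (r k) = 0"
      using harm_orthogonal[OF h, of "r k" "a' - k" "b' - k"] r(1) a' n by (auto simp: sphere_inner_def)
  qed
  finally show ?thesis .
qed

definition reduced :: "'m::finite \<Rightarrow> nat \<Rightarrow> nat \<Rightarrow> (('m \<Rightarrow> nat) \<times> ('m \<Rightarrow> nat)) set" where
  "reduced j a b = {(\<alpha>, \<beta>). \<alpha> \<in> multi_idx a \<and> \<beta> \<in> multi_idx b \<and> (\<alpha> j = 0 \<or> \<beta> j = 0)}"

lemma finite_reduced: "finite (reduced j a b)"
  by (rule finite_subset[of _ "multi_idx a \<times> multi_idx b"]) (auto simp: reduced_def)

text \<open>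
  Modulo \<open>nsq\<close> times polynomials of lower degree, to which a harmonic polynomial is orthogonal on
  the sphere, \<open>z\<^sub>j cnj z\<^sub>j\<close> is minus the sum of the other \<open>z\<^sub>k cnj z\<^sub>k\<close>. So a harmonic polynomial that is
  orthogonal to the reduced monomials is orthogonal to all monomials of its bidegree.
\<close>

lemma harm_reduced_zero:
  fixes h :: "complex^'m::finite \<Rightarrow> complex"
  assumes n: "CARD('m) \<ge> 2" and h: "h \<in> harm a b"
    and red: "\<And>\<alpha> \<beta>. (\<alpha>, \<beta>) \<in> reduced j a b \<Longrightarrow> sphere_inner h (zmonom \<alpha> \<beta>) = 0"
  shows "sq_norm h = 0"
proof -
  have Lh: "L2s h" by (intro L2s_cpoly harm_cpoly[OF h])
  have Lm: "L2s (zmonom \<alpha> \<beta>)" for \<alpha> \<beta> :: "'m \<Rightarrow> nat"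
    by (rule L2s_cpoly, rule bh_imp_cpoly, rule bh_zmonom) (auto simp: multi_idx_def)
  have all: "\<alpha> \<in> multi_idx a \<Longrightarrow> \<beta> \<in> multi_idx b \<Longrightarrow> sphere_inner h (zmonom \<alpha> \<beta>) = 0" for \<alpha> \<beta>
  proof (induction "\<alpha> j" arbitrary: \<alpha> \<beta>)
    case 0
    then show ?case by (intro red) (auto simp: reduced_def)
  next
    case (Suc i)
    show ?case
    proof (cases "\<beta> j")
      case 0
      then show ?thesis using Suc.prems by (intro red) (auto simp: reduced_def)
    next
      case (Suc i')
      define \<alpha>' \<beta>' where "\<alpha>' = \<alpha>(j := i)" and "\<beta>' = \<beta>(j := i')"
      have \<alpha>: "\<alpha> = \<alpha>'(j := Suc (\<alpha>' j))" and \<beta>: "\<beta> = \<beta>'(j := Suc (\<beta>' j))"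
        using Suc.hyps(2) Suc by (auto simp: \<alpha>'_def \<beta>'_def)
      have dec: "\<gamma>'(j := Suc (\<gamma>' j)) \<in> multi_idx l \<Longrightarrow> \<gamma>' \<in> multi_idx (l - 1) \<and> l \<ge> 1" for \<gamma>' l
      proof -
        assume g: "\<gamma>'(j := Suc (\<gamma>' j)) \<in> multi_idx l"
        have "\<gamma>'(j := Suc (\<gamma>' j)) \<in> multi_idx (Suc (\<Sum>i\<in>UNIV. \<gamma>' i))"
          by (rule multi_idx_upd) (simp add: multi_idx_def)
        then show ?thesis using g by (auto simp: multi_idx_def)
      qed
      have a: "\<alpha>' \<in> multi_idx (a - 1)" "a \<ge> 1" and b: "\<beta>' \<in> multi_idx (b - 1)" "b \<ge> 1"
        using dec Suc.prems \<alpha> \<beta> by metis+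
      let ?m = "\<lambda>k. zmonom (\<alpha>'(k := Suc (\<alpha>' k))) (\<beta>'(k := Suc (\<beta>' k)))"
      have m: "z $ k * cnj (z $ k) * zmonom \<alpha>' \<beta>' z = ?m k z" for k z
        by (simp add: mult.assoc zmonom_z zmonom_zbar)
      have "(\<Sum>k\<in>UNIV. sphere_inner h (?m k)) = sphere_inner h (\<lambda>z. \<Sum>k\<in>UNIV. ?m k z)"
        by (intro sphere_inner_sum_right[symmetric] Lm Lh)
      also have "\<dots> = sphere_inner h (zmonom \<alpha>' \<beta>')"
      proof (rule sphere_inner_cong[OF refl])
        fix z :: "complex^'m" assume z: "z \<in> sphere 0 1"
        have "(\<Sum>k\<in>UNIV. ?m k z) = nsq z * zmonom \<alpha>' \<beta>' z"
          unfolding m[symmetric] nsq_def sum_distrib_right ..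
        then show "(\<Sum>k\<in>UNIV. ?m k z) = zmonom \<alpha>' \<beta>' z" by (simp add: nsq_sphere[OF z])
      qed
      also have "\<dots> = 0"
        using harm_inner_lower[OF n h bh_zmonom[OF a(1) b(1)]] a(2) by simp
      finally have "sphere_inner h (?m j) + (\<Sum>k\<in>UNIV - {j}. sphere_inner h (?m k)) = 0"
        by (subst (asm) sum.remove[of _ j]) auto
      \<comment> \<open>For \<open>k \<noteq> j\<close> the exponent at \<open>j\<close> has dropped
        to \<open>i\<close>, and the induction hypothesis applies.\<close>
      moreover have "(\<Sum>k\<in>UNIV - {j}. sphere_inner h (?m k)) = 0"
      proof (intro sum.neutral ballI)
        fix k assume k: "k \<in> UNIV - {j}"
        have "\<alpha>'(k := Suc (\<alpha>' k)) \<in> multi_idx a" "\<beta>'(k := Suc (\<beta>' k)) \<in> multi_idx b"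
          using multi_idx_upd[OF a(1), of k] multi_idx_upd[OF b(1), of k] a b by simp_all
        then show "sphere_inner h (?m k) = 0"
          using k by (intro Suc.hyps(1)) (auto simp: \<alpha>'_def)
      qed
      ultimately show ?thesis using \<alpha> \<beta> by simp
    qed
  qed
  obtain c where c: "h = (\<lambda>z. \<Sum>(\<alpha>, \<beta>) \<in> multi_idx a \<times> multi_idx b. c \<alpha> \<beta> * zmonom \<alpha> \<beta> z)"
    using harm_bh[OF h] unfolding bihom_poly_bh[symmetric] bihom_poly_iff by blast
  have "sphere_inner h h = sphere_inner h (\<lambda>z. \<Sum>k \<in> multi_idx a \<times> multi_idx b. c (fst k) (snd k) * zmonom (fst k) (snd k) z)"
    by (subst (2) c) (simp add: case_prod_beta)
  also have "\<dots> = (\<Sum>k \<in> multi_idx a \<times> multi_idx b. sphere_inner h (\<lambda>z. c (fst k) (snd k) * zmonom (fst k) (snd k) z))"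
    by (intro sphere_inner_sum_right L2s_cmult Lm Lh)
  also have "\<dots> = 0"
    by (intro sum.neutral) (auto simp: sphere_inner_cmult_right all)
  finally show ?thesis by (simp add: sphere_inner_self[OF Lh])
qed

text \<open>The total degree determines the exponent at \<open>k\<close>, and those in
  \<open>Z\<close> vanish; every other index leaves at most \<open>l + 1\<close> choices.\<close>

lemma card_multi_idx_le:
  assumes "A \<subseteq> multi_idx l" "\<And>\<alpha> i. \<alpha> \<in> A \<Longrightarrow> i \<in> Z \<Longrightarrow> \<alpha> i = 0" "(k :: 'm::finite) \<notin> Z"
  shows "card A \<le> (l + 1) ^ (CARD('m) - 1 - card Z)"
proof -
  let ?J = "UNIV - insert k Z :: 'm set"
  have inj: "inj_on (\<lambda>\<alpha>. restrict \<alpha> ?J) A"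
  proof (rule inj_onI)
    fix \<alpha> \<beta> assume A: "\<alpha> \<in> A" "\<beta> \<in> A" and eq: "restrict \<alpha> ?J = restrict \<beta> ?J"
    have J: "\<alpha> i = \<beta> i" if "i \<in> ?J" for i using eq that by (metis restrict_apply')
    have Z: "\<alpha> i = \<beta> i" if "i \<in> Z" for i using assms(2)[OF A(1) that] assms(2)[OF A(2) that] by simp
    have "(\<Sum>i\<in>UNIV. \<alpha> i) = (\<Sum>i\<in>UNIV. \<beta> i)" using A assms(1) by (auto simp: multi_idx_def)
    then have "\<alpha> k + (\<Sum>i\<in>UNIV - {k}. \<alpha> i) = \<beta> k + (\<Sum>i\<in>UNIV - {k}. \<beta> i)"
      by (simp add: sum.remove[of UNIV k])
    moreover have "(\<Sum>i\<in>UNIV - {k}. \<alpha> i) = (\<Sum>i\<in>UNIV - {k}. \<beta> i)"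
      using J Z by (intro sum.cong) auto
    ultimately have "\<alpha> k = \<beta> k" by simp
    then show "\<alpha> = \<beta>" using J Z by fastforce
  qed
  have sub: "(\<lambda>\<alpha>. restrict \<alpha> ?J) ` A \<subseteq> PiE ?J (\<lambda>_. {..l})"
  proof -
    have "\<alpha> i \<le> l" if "\<alpha> \<in> A" for \<alpha> i
      using assms(1) that member_le_sum[of i UNIV \<alpha>] by (auto simp: multi_idx_def)
    then show ?thesis by (intro image_subsetI restrict_PiE_iff[THEN iffD2]) simp
  qed
  have "card A = card ((\<lambda>\<alpha>. restrict \<alpha> ?J) ` A)" by (rule card_image[OF inj, symmetric])
  also have "\<dots> \<le> card (PiE ?J (\<lambda>_. {..l}))"
    by (intro card_mono sub finite_PiE) auto
  also have "\<dots> = (l + 1) ^ card ?J" by (simp add: card_PiE)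
  also have "card ?J = CARD('m) - 1 - card Z"
    using assms(3) by (subst card_Diff_subset) auto
  finally show ?thesis .
qed

text \<open>A bound for the dimension of \<open>harm a b\<close>, of the right order in
  \<open>a\<close> and \<open>b\<close> for fixed \<open>n\<close>. The two parts
  \<open>a + 1\<close> and \<open>b + 1\<close> of the last factor come from the alternatives
  \<open>\<alpha> j = 0\<close> and \<open>\<beta> j = 0\<close> for reduced monomials.\<close>

definition hdim :: "nat \<Rightarrow> nat \<Rightarrow> nat \<Rightarrow> nat" where
  "hdim n a b = (a + 1) ^ (n - 1) * (b + 1) ^ (n - 1) * (a + b + 2)"

lemma card_reduced:
  assumes n: "CARD('m::finite) = n + 1" "n \<ge> 1"
  shows "card (reduced (j :: 'm) a b) \<le> hdim n a b"
proof -
  have "\<not> UNIV \<subseteq> {j}"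
  proof
    assume "UNIV \<subseteq> {j}"
    then have "CARD('m) \<le> card {j}" by (intro card_mono) auto
    then show False using n by simp
  qed
  then obtain k where k: "k \<noteq> j" by blast
  let ?A = "\<lambda>l. {\<alpha> \<in> multi_idx l. \<alpha> j = 0}"
  have 0: "card (?A l) \<le> (l + 1) ^ (n - 1)" for l
  proof -
    have "card (?A l) \<le> (l + 1) ^ (CARD('m) - 1 - card {j})"
      by (rule card_multi_idx_le[where k=k]) (use k in auto)
    then show ?thesis using n by simp
  qed
  have 1: "card (multi_idx l :: ('m \<Rightarrow> nat) set) \<le> (l + 1) ^ n" for l
  proof -
    have "card (multi_idx l :: ('m \<Rightarrow> nat) set) \<le> (l + 1) ^ (CARD('m) - 1 - card ({} :: 'm set))"
      by (rule card_multi_idx_le[where k=k]) auto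
    then show ?thesis using n by simp
  qed
  have "reduced j a b \<subseteq> ?A a \<times> multi_idx b \<union> multi_idx a \<times> ?A b"
    by (auto simp: reduced_def)
  then have "card (reduced j a b) \<le> card (?A a \<times> multi_idx b \<union> multi_idx a \<times> ?A b)"
    by (rule card_mono[rotated]) (intro finite_UnI finite_cartesian_product finite_multi_idx finite_subset[OF Collect_restrict])
  also have "\<dots> \<le> card (?A a) * card (multi_idx b :: ('m \<Rightarrow> nat) set) + card (multi_idx a :: ('m \<Rightarrow> nat) set) * card (?A b)"
    by (rule order_trans[OF card_Un_le]) (simp add: card_cartesian_product)
  also have "\<dots> \<le> (a + 1) ^ (n - 1) * (b + 1) ^ n + (a + 1) ^ n * (b + 1) ^ (n - 1)"
    by (intro add_mono mult_mono 0 1) auto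
  also have "\<dots> = hdim n a b"
  proof -
    obtain k where "n = Suc k" using n by (cases n) auto
    then show ?thesis by (simp add: hdim_def algebra_simps)
  qed
  finally show ?thesis .
qed

definition orthonormal :: "nat \<Rightarrow> (nat \<Rightarrow> complex^'m::finite \<Rightarrow> complex) \<Rightarrow> nat \<Rightarrow> nat \<Rightarrow> bool" where
  "orthonormal d \<phi> a b \<longleftrightarrow> (\<forall>i<d. \<phi> i \<in> harm a b) \<and>
     (\<forall>i<d. \<forall>j<d. sphere_inner (\<phi> i) (\<phi> j) = (if i = j then 1 else 0))"

lemma orthonormal_sq_norm:
  assumes "orthonormal d \<phi> a b"
  shows "sq_norm (\<lambda>z. \<Sum>i<d. c i * \<phi> i z) = (\<Sum>i<d. (norm (c i))\<^sup>2)"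
proof -
  have L: "i < d \<Longrightarrow> L2s (\<phi> i)" for i
    using assms by (auto simp: orthonormal_def intro: L2s_cpoly harm_cpoly)
  have L': "L2s (\<lambda>z. \<Sum>i<d. c i * \<phi> i z)" by (intro L2s_sum L2s_cmult L) auto
  have "complex_of_real (sq_norm (\<lambda>z. \<Sum>i<d. c i * \<phi> i z))
      = (\<Sum>i<d. c i * (\<Sum>j<d. cnj (c j) * sphere_inner (\<phi> i) (\<phi> j)))"
    unfolding sphere_inner_self[OF L', symmetric]
    using L L' by (subst sphere_inner_lincomb_left, simp, simp)
      (intro sum.cong refl arg_cong2[where f="(*)"] sphere_inner_lincomb_right, auto)
  also have "\<dots> = (\<Sum>i<d. c i * cnj (c i))"
  proof (intro sum.cong refl)
    fix i assume i: "i \<in> {..<d}"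
    have "(\<Sum>j<d. cnj (c j) * sphere_inner (\<phi> i) (\<phi> j)) = (\<Sum>j<d. if j = i then cnj (c i) else 0)"
      using assms i by (intro sum.cong) (auto simp: orthonormal_def)
    then show "c i * (\<Sum>j<d. cnj (c j) * sphere_inner (\<phi> i) (\<phi> j)) = c i * cnj (c i)" using i by simp
  qed
  also have "\<dots> = complex_of_real (\<Sum>i<d. (norm (c i))\<^sup>2)"
    by (simp add: complex_norm_square[symmetric] del: of_real_power)
  finally show ?thesis by (simp only: of_real_eq_iff)
qed

text \<open>A longer family would have a non-trivial combination orthogonal to all reduced
  monomials, which \<open>harm_reduced_zero\<close> forces to have norm 0.\<close>

lemma orthonormal_card:
  fixes \<phi> :: "nat \<Rightarrow> complex^'m::finite \<Rightarrow> complex"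
  assumes n: "CARD('m) = n + 1" "n \<ge> 1" and on: "orthonormal d \<phi> a b"
  shows "d \<le> hdim n a b"
proof (rule ccontr)
  assume d: "\<not> d \<le> hdim n a b"
  obtain j :: 'm where True by simp
  have "card (reduced j a b) < card {..<d}" using card_reduced[OF n, of j a b] d by simp
  from linear_system_nontrivial[OF finite_reduced _ this, of "\<lambda>k i. sphere_inner (\<phi> i) (zmonom (fst k) (snd k))"]
  obtain c where c: "\<exists>i\<in>{..<d}. c i \<noteq> 0"
    "\<And>k. k \<in> reduced j a b \<Longrightarrow> (\<Sum>i<d. c i * sphere_inner (\<phi> i) (zmonom (fst k) (snd k))) = 0"
    by auto
  have h: "(\<lambda>z. \<Sum>i<d. c i * \<phi> i z) \<in> harm a b"
    using on by (intro harm_sum harm_cmult) (auto simp: orthonormal_def)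
  have L: "i < d \<Longrightarrow> L2s (\<phi> i)" for i
    using on by (auto simp: orthonormal_def intro: L2s_cpoly harm_cpoly)
  have "sq_norm (\<lambda>z. \<Sum>i<d. c i * \<phi> i z) = 0"
  proof (rule harm_reduced_zero[OF _ h])
    show "CARD('m) \<ge> 2" using n by simp
    fix \<alpha> \<beta> assume k: "(\<alpha>, \<beta>) \<in> reduced j a b"
    have "L2s (zmonom \<alpha> \<beta>)"
      using k by (intro L2s_cpoly bh_imp_cpoly[OF bh_zmonom]) (auto simp: reduced_def)
    then show "sphere_inner (\<lambda>z. \<Sum>i<d. c i * \<phi> i z) (zmonom \<alpha> \<beta>) = 0"
      using c(2)[OF k] L by (subst sphere_inner_lincomb_left) auto
  qed
  then have "(\<Sum>i<d. (norm (c i))\<^sup>2) = 0" by (simp add: orthonormal_sq_norm[OF on])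
  then show False using c(1) by (subst (asm) sum_nonneg_eq_0_iff) auto
qed

text \<open>An orthonormal family of greatest length exists because of
  \<open>orthonormal_card\<close>. A non-zero remainder of the expansion of some \<open>h\<close>
  could be normalised and appended to it.\<close>

lemma orthonormal_basis_exists:
  assumes n: "CARD('m::finite) = n + 1" "n \<ge> 1"
  obtains d and \<phi> :: "nat \<Rightarrow> complex^'m \<Rightarrow> complex" where "orthonormal d \<phi> a b" "d \<le> hdim n a b"
    "\<And>h z. h \<in> harm a b \<Longrightarrow> z \<in> sphere 0 1 \<Longrightarrow> h z = (\<Sum>i<d. sphere_inner h (\<phi> i) * \<phi> i z)"
proof -
  define P where "P d \<longleftrightarrow> (\<exists>\<phi> :: nat \<Rightarrow> complex^'m \<Rightarrow> complex. orthonormal d \<phi> a b)" for d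
  have P0: "P 0" by (simp add: P_def orthonormal_def)
  have bd: "P d \<Longrightarrow> d \<le> hdim n a b" for d using orthonormal_card[OF n] unfolding P_def by blast
  define d where "d = Greatest P"
  have d: "P d" "\<And>d'. P d' \<Longrightarrow> d' \<le> d"
    unfolding d_def using GreatestI_nat[where P=P, OF P0] Greatest_le_nat[where P=P] bd by metis+
  from d(1) obtain \<phi> :: "nat \<Rightarrow> complex^'m \<Rightarrow> complex" where \<phi>: "orthonormal d \<phi> a b"
    unfolding P_def by blast
  have H: "i < d \<Longrightarrow> \<phi> i \<in> harm a b" for i using \<phi> by (simp add: orthonormal_def)
  have O: "i < d \<Longrightarrow> j < d \<Longrightarrow> sphere_inner (\<phi> i) (\<phi> j) = (if i = j then 1 else 0)" for i j
    using \<phi> by (simp add: orthonormal_def)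
  have L: "i < d \<Longrightarrow> L2s (\<phi> i)" for i using H by (auto intro: L2s_cpoly harm_cpoly)
  have "h z0 = (\<Sum>i<d. sphere_inner h (\<phi> i) * \<phi> i z0)" if h: "h \<in> harm a b" and z0: "z0 \<in> sphere 0 1" for h z0
  proof -
    define r where "r = (\<lambda>z. h z - (\<Sum>i<d. sphere_inner h (\<phi> i) * \<phi> i z))"
    have r: "r \<in> harm a b" unfolding r_def using H by (intro harm_diff harm_sum harm_cmult h) auto
    have Lh: "L2s h" "L2s r" using h r by (auto intro: L2s_cpoly harm_cpoly)
    have orth: "sphere_inner r (\<phi> j) = 0" if j: "j < d" for j
    proof -
      have "sphere_inner r (\<phi> j) = sphere_inner h (\<phi> j) - (\<Sum>i<d. sphere_inner h (\<phi> i) * sphere_inner (\<phi> i) (\<phi> j))"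
        unfolding r_def using j L Lh(1)
        by (subst sphere_inner_diff_left, simp, intro L2s_sum L2s_cmult, simp, simp, subst sphere_inner_lincomb_left) auto
      also have "(\<Sum>i<d. sphere_inner h (\<phi> i) * sphere_inner (\<phi> i) (\<phi> j)) = (\<Sum>i<d. if i = j then sphere_inner h (\<phi> j) else 0)"
        using O j by (intro sum.cong) auto
      also have "\<dots> = sphere_inner h (\<phi> j)" using j by simp
      finally show ?thesis by simp
    qed
    have "sq_norm r = 0"
    proof (rule ccontr)
      assume nz: "sq_norm r \<noteq> 0"
      then have pos: "sq_norm r > 0" using sq_norm_nonneg[of r] by linarith
      define \<kappa> where "\<kappa> = complex_of_real (1 / sqrt (sq_norm r))"
      define \<psi> where "\<psi> = (\<lambda>i. if i < d then \<phi> i else (\<lambda>z. \<kappa> * r z))"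
      have s: "sphere_inner r r = of_real (sq_norm r)" by (rule sphere_inner_self[OF Lh(2)])
      have one: "sphere_inner (\<lambda>z. \<kappa> * r z) (\<lambda>z. \<kappa> * r z) = 1"
        unfolding sphere_inner_cmult_left sphere_inner_cmult_right s \<kappa>_def
        using pos by (simp flip: of_real_mult of_real_divide)
      have orth': "sphere_inner (\<phi> j) r = 0" if "j < d" for j
        using orth[OF that] sphere_inner_cnj[of "\<phi> j" r] by simp
      have "orthonormal (Suc d) \<psi> a b"
        unfolding orthonormal_def
      proof (intro conjI allI impI)
        fix i assume "i < Suc d"
        then show "\<psi> i \<in> harm a b" using H r by (auto simp: \<psi>_def less_Suc_eq intro: harm_cmult)
        fix j assume "j < Suc d"
        then show "sphere_inner (\<psi> i) (\<psi> j) = (if i = j then 1 else 0)"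
          using \<open>i < Suc d\<close> O orth orth' one
          by (auto simp: \<psi>_def less_Suc_eq sphere_inner_cmult_left sphere_inner_cmult_right)
      qed
      then have "Suc d \<le> d" by (intro d(2)) (auto simp: P_def)
      then show False by simp
    qed
    then have "r z0 = 0"
      using z0 by (intro continuous_sq_norm_zero cpoly_continuous harm_cpoly[OF r])
    then show ?thesis by (simp add: r_def)
  qed
  with that \<phi> orthonormal_card[OF n \<phi>] show ?thesis by blast
qed

section \<open>Pointwise bounds for harmonics\<close>

definition refl_mat :: "complex^'m::finite \<Rightarrow> 'm \<Rightarrow> 'm \<Rightarrow> complex" where
  "refl_mat w l j = (if l = j then 1 else 0) - 2 * w $ l * cnj (w $ j)"

text \<open>The unitary reflection in the hyperplane orthogonal to a unit vector.\<close>

definition hrefl :: "complex^'m::finite \<Rightarrow> complex^'m \<Rightarrow> complex^'m" where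
  "hrefl w z = (\<chi> l. \<Sum>j\<in>UNIV. refl_mat w l j * z $ j)"

lemma hrefl_nth: "hrefl w z $ l = z $ l - 2 * (\<Sum>j\<in>UNIV. z $ j * cnj (w $ j)) * w $ l"
proof -
  have "hrefl w z $ l = (\<Sum>j\<in>UNIV. (if j = l then z $ l else 0) - 2 * w $ l * (z $ j * cnj (w $ j)))"
    unfolding hrefl_def by (simp, intro sum.cong) (auto simp: refl_mat_def algebra_simps)
  then show ?thesis
    unfolding sum_subtractf sum_distrib_left[symmetric] by (simp add: mult.assoc mult.commute[of "w $ l"])
qed

context
  fixes w :: "complex^'m::finite"
  assumes w: "nsq w = 1"
begin

lemma hrefl_invol: "hrefl w (hrefl w z) = z"
proof -
  let ?s = "\<Sum>j\<in>UNIV. z $ j * cnj (w $ j)"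
  have "(\<Sum>j\<in>UNIV. hrefl w z $ j * cnj (w $ j)) = ?s - 2 * ?s * nsq w"
    by (simp add: hrefl_nth left_diff_distrib sum_subtractf nsq_def sum_distrib_left mult.assoc)
  then show ?thesis by (simp add: vec_eq_iff hrefl_nth[of w "hrefl w z"] w) (simp add: hrefl_nth)
qed

lemma refl_mat_unitary:
  "(\<Sum>j\<in>UNIV. refl_mat w l j * cnj (refl_mat w k j)) = (if l = k then 1 else 0)"
proof -
  have "(\<Sum>j\<in>UNIV. refl_mat w l j * cnj (refl_mat w k j))
    = (\<Sum>j\<in>UNIV. (if j = l then (if l = k then 1 else 0) else 0) - (if j = l then 2 * cnj (w $ k) * w $ j else 0)
       - (if j = k then 2 * w $ l * cnj (w $ j) else 0) + 4 * w $ l * cnj (w $ k) * (w $ j * cnj (w $ j)))"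
    by (intro sum.cong) (auto simp: refl_mat_def algebra_simps)
  also have "\<dots> = (if l = k then 1 else 0) - 2 * cnj (w $ k) * w $ l - 2 * w $ l * cnj (w $ k) + 4 * w $ l * cnj (w $ k) * nsq w"
    unfolding sum.distrib sum_subtractf sum_distrib_left[symmetric] nsq_def by simp
  finally show ?thesis by (simp add: w)
qed

lemma orthogonal_transformation_hrefl: "orthogonal_transformation (hrefl w)"
  unfolding orthogonal_transformation
proof
  show "linear (hrefl w)"
    by (rule linearI)
       (simp_all add: vec_eq_iff hrefl_def sum.distrib distrib_left scaleR_sum_right)
  show "\<forall>z. norm (hrefl w z) = norm z"
  proof
    fix z
    let ?s = "\<Sum>j\<in>UNIV. z $ j * cnj (w $ j)"
    have s': "cnj ?s = (\<Sum>j\<in>UNIV. w $ j * cnj (z $ j))" by (simp add: mult.commute)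
    have "nsq (hrefl w z) = (\<Sum>l\<in>UNIV. z $ l * cnj (z $ l) - 2 * cnj ?s * (z $ l * cnj (w $ l))
        - 2 * ?s * (w $ l * cnj (z $ l)) + 4 * ?s * cnj ?s * (w $ l * cnj (w $ l)))"
      unfolding nsq_def by (intro sum.cong) (auto simp: hrefl_nth algebra_simps)
    also have "\<dots> = nsq z - 2 * cnj ?s * ?s - 2 * ?s * cnj ?s + 4 * ?s * cnj ?s * nsq w"
      unfolding sum.distrib sum_subtractf sum_distrib_left[symmetric] nsq_def s' ..
    finally have "nsq (hrefl w z) = nsq z" by (simp add: w)
    then have "(norm (hrefl w z))\<^sup>2 = (norm z)\<^sup>2" by (simp only: nsq_norm of_real_eq_iff)
    then show "norm (hrefl w z) = norm z" by simp
  qed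
qed

lemma bh_hrefl: "bh a b f \<Longrightarrow> bh a b (\<lambda>z. f (hrefl w z))"
proof (induction rule: bh.induct)
  case (const c) show ?case by (rule bh.const)
next
  case (z a b f l)
  have "bh 1 0 (\<lambda>z. \<Sum>j\<in>UNIV. refl_mat w l j * (z $ j * 1))"
    using bh.z[OF bh.const[of 1]] by (intro bh_sum bh_cmult) simp
  then have "bh 1 0 (\<lambda>z. hrefl w z $ l)" by (simp add: hrefl_def)
  from bh_mult[OF this z.IH] show ?case by simp
next
  case (zbar a b f l)
  have "bh 0 1 (\<lambda>z. \<Sum>j\<in>UNIV. cnj (refl_mat w l j) * (cnj (z $ j) * 1))"
    using bh.zbar[OF bh.const[of 1]] by (intro bh_sum bh_cmult) simp
  then have "bh 0 1 (\<lambda>z. cnj (hrefl w z $ l))" by (simp add: hrefl_def)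
  from bh_mult[OF this zbar.IH] show ?case by simp
next
  case (add a b f g) then show ?case by (intro bh.add)
qed

lemma
  assumes f: "cpoly f"
  shows d_z_hrefl: "d_z j (\<lambda>z. f (hrefl w z)) = (\<lambda>z. \<Sum>k\<in>UNIV. refl_mat w k j * d_z k f (hrefl w z))"
    and d_zbar_hrefl: "d_zbar j (\<lambda>z. f (hrefl w z)) = (\<lambda>z. \<Sum>k\<in>UNIV. cnj (refl_mat w k j) * d_zbar k f (hrefl w z))"
proof -
  have lin: "bounded_linear (hrefl w)"
    using orthogonal_transformation_hrefl by (simp add: orthogonal_transformation_def linear_conv_bounded_linear)
  have D: "((\<lambda>z. f (hrefl w z)) has_derivative (\<lambda>h. frechet_derivative f (at (hrefl w z)) (hrefl w h))) (at z)" for z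
    using has_derivative_compose[OF bounded_linear_imp_has_derivative[OF lin]
        cpoly_differentiable[OF f, of "hrefl w z", unfolded frechet_derivative_works]] by simp
  have A: "hrefl w (axis j c) $ k = refl_mat w k j * c" for k j c
  proof -
    have "hrefl w (axis j c) $ k = (\<Sum>i\<in>UNIV. if i = j then refl_mat w k j * c else 0)"
      unfolding hrefl_def vec_lambda_beta by (intro sum.cong refl) (auto simp: axis_def)
    then show ?thesis by simp
  qed
  show "d_z j (\<lambda>z. f (hrefl w z)) = (\<lambda>z. \<Sum>k\<in>UNIV. refl_mat w k j * d_z k f (hrefl w z))"
    "d_zbar j (\<lambda>z. f (hrefl w z)) = (\<lambda>z. \<Sum>k\<in>UNIV. cnj (refl_mat w k j) * d_zbar k f (hrefl w z))"
    by (auto simp: fun_eq_iff d_z_has_derivative[OF D] d_zbar_has_derivative[OF D]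
        cpoly_frechet_derivative[OF f] A sum_distrib_left sum_subtractf[symmetric] sum.distrib[symmetric]
        sum_divide_distrib algebra_simps intro!: sum.cong)
qed

text \<open>The two chain rules produce the matrix of the reflection times its adjoint, which
  \<open>refl_mat_unitary\<close> evaluates.\<close>

lemma harm_hrefl:
  assumes f: "f \<in> harm a b"
  shows "(\<lambda>z. f (hrefl w z)) \<in> harm a b"
proof -
  note cf = harm_cpoly[OF f]
  have cp: "cpoly (\<lambda>z. d_zbar k f (hrefl w z))" for k
    using bh_hrefl[OF bh_d_zbar[OF harm_bh[OF f]]] by (rule bh_imp_cpoly)
  have "lap (\<lambda>z. f (hrefl w z)) z = 0" for z
  proof -
    let ?D = "\<lambda>l k. d_z l (d_zbar k f) (hrefl w z)"
    have "lap (\<lambda>z. f (hrefl w z)) z = (\<Sum>j\<in>UNIV. \<Sum>k\<in>UNIV. cnj (refl_mat w k j) * (\<Sum>l\<in>UNIV. refl_mat w l j * ?D l k))"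
      by (simp add: lap_def d_zbar_hrefl[OF cf] d_z_cpoly_sum cpoly_cmult cp d_z_cpoly_cmult d_z_hrefl cpoly_d_zbar cf)
    also have "\<dots> = (\<Sum>j\<in>UNIV. \<Sum>k\<in>UNIV. \<Sum>l\<in>UNIV. refl_mat w l j * cnj (refl_mat w k j) * ?D l k)"
      by (simp add: sum_distrib_left mult_ac)
    also have "\<dots> = (\<Sum>k\<in>UNIV. \<Sum>j\<in>UNIV. \<Sum>l\<in>UNIV. refl_mat w l j * cnj (refl_mat w k j) * ?D l k)"
      by (rule sum.swap)
    also have "\<dots> = (\<Sum>k\<in>UNIV. \<Sum>l\<in>UNIV. \<Sum>j\<in>UNIV. refl_mat w l j * cnj (refl_mat w k j) * ?D l k)"
      by (intro sum.cong refl sum.swap)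
    also have "\<dots> = (\<Sum>k\<in>UNIV. \<Sum>l\<in>UNIV. if l = k then ?D k k else 0)"
      by (simp only: sum_distrib_right[symmetric] refl_mat_unitary) (intro sum.cong, auto)
    also have "\<dots> = lap f (hrefl w z)" by (simp add: lap_def)
    finally show ?thesis using harm_lap[OF f] by simp
  qed
  then show ?thesis using bh_hrefl[OF harm_bh[OF f]] by (simp add: harm_def)
qed

end

lemma sq_norm_orthogonal:
  fixes f :: "complex^'m::finite \<Rightarrow> complex" and U :: "complex^'m \<Rightarrow> complex^'m"
  assumes "orthogonal_transformation U" "f \<in> borel_measurable sphere_measure"
  shows "sq_norm (\<lambda>z. f (U z)) = sq_norm f"
  unfolding sq_norm_def
  using integral_sphere_orthogonal[OF assms(1), of "\<lambda>z. (norm (f z))\<^sup>2"] assms(2) by simp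

lemma norm_square_lincomb_le:
  "(norm (\<Sum>i\<in>I. c i * f i :: complex))\<^sup>2 \<le> (\<Sum>i\<in>I. (norm (c i))\<^sup>2) * (\<Sum>i\<in>I. (norm (f i))\<^sup>2)"
proof -
  have "(norm (\<Sum>i\<in>I. c i * f i))\<^sup>2 \<le> (\<Sum>i\<in>I. norm (c i) * norm (f i))\<^sup>2"
    by (intro power_mono order_trans[OF norm_sum]) (auto simp: norm_mult)
  also have "\<dots> \<le> (\<Sum>i\<in>I. (norm (c i))\<^sup>2) * (\<Sum>i\<in>I. (norm (f i))\<^sup>2)"
    by (rule Cauchy_Schwarz_ineq_sum)
  finally show ?thesis .
qed

abbreviation sphere_vol :: "'m::finite itself \<Rightarrow> real" where
  "sphere_vol _ \<equiv> measure (sphere_measure :: (complex^'m) measure) (sphere 0 1)"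

text \<open>
  The sum of squares of an orthonormal basis is invariant under unitary maps, hence constant on the
  sphere, and its integral is the dimension.
\<close>

lemma harm_pointwise:
  fixes h :: "complex^'m::finite \<Rightarrow> complex"
  assumes n: "CARD('m) = n + 1" "n \<ge> 1" and h: "h \<in> harm a b" and z: "z \<in> sphere 0 1"
  shows "(norm (h z))\<^sup>2 \<le> real (hdim n a b) / sphere_vol TYPE('m) * sq_norm h"
proof -
  from orthonormal_basis_exists[OF n, of a b] obtain d and \<phi> :: "nat \<Rightarrow> complex^'m \<Rightarrow> complex" where
    \<phi>: "orthonormal d \<phi> a b" and d: "d \<le> hdim n a b"
    and exp: "\<And>h z. h \<in> harm a b \<Longrightarrow> z \<in> sphere 0 1 \<Longrightarrow> h z = (\<Sum>i<d. sphere_inner h (\<phi> i) * \<phi> i z)" by blast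
  have H: "i < d \<Longrightarrow> \<phi> i \<in> harm a b" for i using \<phi> by (simp add: orthonormal_def)
  define K where "K z = (\<Sum>i<d. (norm (\<phi> i z))\<^sup>2)" for z
  have K: "(norm (g z))\<^sup>2 \<le> sq_norm g * K z" if g: "g \<in> harm a b" and z: "z \<in> sphere 0 1" for g z
  proof -
    have "sq_norm g = (\<Sum>i<d. (norm (sphere_inner g (\<phi> i)))\<^sup>2)"
      unfolding orthonormal_sq_norm[OF \<phi>, symmetric] by (rule sq_norm_cong) (simp add: exp[OF g])
    then show ?thesis
      using norm_square_lincomb_le[of "\<lambda>i. sphere_inner g (\<phi> i)" "\<lambda>i. \<phi> i z" "{..<d}"]
      unfolding K_def exp[OF g z] by simp
  qed
  have K0: "K z \<ge> 0" for z unfolding K_def by (intro sum_nonneg) auto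
  have K_hrefl: "K x \<le> K (hrefl w x)" if w: "nsq w = 1" and x: "x \<in> sphere 0 1" for x w
  proof -
    \<comment> \<open>\<open>g\<close> is the reproducing kernel at \<open>x\<close>: its value at
      \<open>x\<close> and its squared norm are both \<open>K x\<close>. The bound \<open>K\<close>,
      applied to \<open>g\<close> after the reflection at the reflected point, compares the two
      values of \<open>K\<close>.\<close>
    define g where "g = (\<lambda>z. \<Sum>i<d. cnj (\<phi> i x) * \<phi> i z)"
    have g: "g \<in> harm a b" unfolding g_def using H by (intro harm_sum harm_cmult) auto
    have gx: "g x = of_real (K x)"
      by (simp add: g_def K_def complex_norm_square mult.commute del: of_real_power)
    have sg: "sq_norm g = K x" unfolding g_def orthonormal_sq_norm[OF \<phi>] K_def by simp
    have Ux: "hrefl w x \<in> sphere 0 1"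
      using x orthogonal_transformation_norm[OF orthogonal_transformation_hrefl[OF w]] by simp
    have "(norm (g (hrefl w (hrefl w x))))\<^sup>2 \<le> sq_norm (\<lambda>z. g (hrefl w z)) * K (hrefl w x)"
      by (rule K[OF harm_hrefl[OF w g] Ux])
    also have "sq_norm (\<lambda>z. g (hrefl w z)) = sq_norm g"
      by (intro sq_norm_orthogonal orthogonal_transformation_hrefl[OF w] continuous_on_sphere_measurable
          cpoly_continuous harm_cpoly[OF g])
    finally have "(K x)\<^sup>2 \<le> K x * K (hrefl w x)"
      using K0 by (simp add: hrefl_invol[OF w] gx sg)
    then show ?thesis using K0[of x] K0[of "hrefl w x"]
      by (cases "K x = 0") (auto simp: power2_eq_square)
  qed
  have phase: "K (c *s x) = K x" if c: "norm c = 1" for c x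
    unfolding K_def
    using bh_homogeneous[OF harm_bh[OF H]] c by (intro sum.cong) (auto simp: norm_mult norm_power)
  have le: "K x \<le> K y" if x: "x \<in> sphere 0 1" and y: "y \<in> sphere 0 1" for x y
  proof -
    \<comment> \<open>A unitary reflection exchanges two unit vectors only if their inner product is
      real. The phase \<open>c\<close> arranges this for \<open>x\<close> and \<open>c *s y\<close>,
      and the mirror is then orthogonal to their difference.\<close>
    define \<mu> where "\<mu> = (\<Sum>j\<in>UNIV. x $ j * cnj (y $ j))"
    define c where "c = (if \<mu> = 0 then 1 else sgn \<mu>)"
    have c: "norm c = 1" by (simp add: c_def norm_sgn)
    have c\<mu>: "cnj c * \<mu> = of_real (norm \<mu>)"
    proof (cases "\<mu> = 0")
      case False
      then have "cnj c * \<mu> = of_real ((norm \<mu>)\<^sup>2 / norm \<mu>)"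
        unfolding of_real_divide complex_norm_square by (simp add: c_def sgn_eq mult.commute)
      then show ?thesis by (simp add: power2_eq_square)
    qed simp
    define y' where "y' = c *s y"
    have y': "(norm y')\<^sup>2 = 1" using y orthogonal_transformation_norm[OF orthogonal_transformation_cmult[OF c], of y]
      by (simp add: y'_def)
    have xy: "(\<Sum>j\<in>UNIV. x $ j * cnj (y' $ j)) = of_real (norm \<mu>)"
      using c\<mu> by (simp add: y'_def \<mu>_def sum_distrib_left mult_ac)
    show ?thesis
    proof (cases "x = y'")
      case True
      then show ?thesis using phase[OF c, of y] by (simp add: y'_def)
    next
      case False
      define r where "r = norm (x - y')"
      have r: "r > 0" using False by (simp add: r_def)
      define w where "w = (1 / r) *\<^sub>R (x - y')"
      have wn: "w $ j = of_real (1 / r) * (x $ j - y' $ j)" for j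
        by (simp add: w_def scaleR_conv_of_real[where 'a=complex])
      have nw: "nsq w = 1" using r by (simp add: nsq_norm w_def r_def)
      have nx: "nsq x = 1" "nsq y' = 1" using x y' by (simp_all add: nsq_norm)
      have s: "(\<Sum>j\<in>UNIV. x $ j * cnj (w $ j)) = of_real ((1 - norm \<mu>) / r)"
      proof -
        have "(\<Sum>j\<in>UNIV. x $ j * cnj (w $ j)) = (\<Sum>j\<in>UNIV. of_real (1 / r) * (x $ j * cnj (x $ j) - x $ j * cnj (y' $ j)))"
          by (intro sum.cong) (auto simp: wn algebra_simps)
        also have "\<dots> = of_real (1 / r) * (nsq x - of_real (norm \<mu>))"
          by (simp only: sum_distrib_left[symmetric] sum_subtractf xy nsq_def)
        finally show ?thesis by (simp add: nx)
      qed
      have r2: "r\<^sup>2 = 2 * (1 - norm \<mu>)"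
      proof -
        have yx: "(\<Sum>j\<in>UNIV. y' $ j * cnj (x $ j)) = of_real (norm \<mu>)"
          using arg_cong[OF xy, of cnj] by (simp add: mult.commute)
        have "complex_of_real (r\<^sup>2) = nsq (x - y')" by (simp add: nsq_norm r_def)
        also have "\<dots> = (\<Sum>j\<in>UNIV. x $ j * cnj (x $ j) - x $ j * cnj (y' $ j) - y' $ j * cnj (x $ j) + y' $ j * cnj (y' $ j))"
          unfolding nsq_def by (intro sum.cong) (auto simp: algebra_simps)
        also have "\<dots> = nsq x - of_real (norm \<mu>) - of_real (norm \<mu>) + nsq y'"
          by (simp only: sum.distrib sum_subtractf xy yx nsq_def)
        also have "\<dots> = complex_of_real (2 * (1 - norm \<mu>))" by (simp add: nx)
        finally show ?thesis by (simp only: of_real_eq_iff)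
      qed
      have "hrefl w x = y'"
      proof (subst vec_eq_iff, intro allI)
        fix l
        have "hrefl w x $ l = x $ l - of_real (2 * (1 - norm \<mu>) / r * (1 / r)) * (x $ l - y' $ l)"
          unfolding hrefl_nth s by (simp add: wn)
        also have "2 * (1 - norm \<mu>) / r * (1 / r) = 1"
          using r r2 by (simp add: field_simps power2_eq_square)
        finally show "hrefl w x $ l = y' $ l" by simp
      qed
      then show ?thesis using K_hrefl[OF nw x] phase[OF c, of y] by (simp add: y'_def)
    qed
  qed
  have "K z * sphere_vol TYPE('m) = (LINT x|(sphere_measure :: (complex^'m) measure). K z)"
    by simp
  also have "\<dots> = (LINT x|sphere_measure. K x)"
    using le z by (intro Bochner_Integration.integral_cong antisym) auto
  also have "\<dots> = (\<Sum>i<d. sq_norm (\<phi> i))"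
    unfolding K_def sq_norm_def
    using H by (intro Bochner_Integration.integral_sum) (auto simp: L2s_def[symmetric] dest!: H harm_cpoly L2s_cpoly[unfolded L2s_def])
  also have "\<dots> = (\<Sum>i<d. 1)"
  proof (rule sum.cong[OF refl])
    fix i assume i: "i \<in> {..<d}"
    have "complex_of_real (sq_norm (\<phi> i)) = 1"
      using i \<phi> by (subst sphere_inner_self[symmetric]) (auto simp: orthonormal_def intro!: L2s_cpoly harm_cpoly[OF H])
    then show "sq_norm (\<phi> i) = 1" by simp
  qed
  finally have "K z = real d / sphere_vol TYPE('m)"
    using measure_sphere_pos[where 'm='m] by (simp add: field_simps)
  then have "K z \<le> real (hdim n a b) / sphere_vol TYPE('m)"
    using d measure_sphere_pos[where 'm='m] by (simp add: divide_right_mono)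
  then show ?thesis
    using K[OF h z] mult_left_mono[of "K z" _ "sq_norm h"] by (fastforce simp: mult.commute)
qed

section \<open>Orthogonal projections\<close>

lemma harm_eqI:
  assumes "g \<in> harm a b" "h \<in> harm a b" "\<And>f. f \<in> harm a b \<Longrightarrow> sphere_inner g f = sphere_inner h f"
    and "z \<in> sphere 0 1"
  shows "g z = h z"
proof -
  have d: "(\<lambda>z. g z - h z) \<in> harm a b" by (intro harm_diff assms)
  have L: "L2s g" "L2s h" "L2s (\<lambda>z. g z - h z)" using assms d by (auto intro: L2s_cpoly harm_cpoly)
  have "sphere_inner (\<lambda>z. g z - h z) (\<lambda>z. g z - h z) = 0"
    by (subst sphere_inner_diff_left[OF L]) (simp add: assms(3)[OF d])
  then have "sq_norm (\<lambda>z. g z - h z) = 0" by (simp add: sphere_inner_self[OF L(3)])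
  from continuous_sq_norm_zero[OF cpoly_continuous[OF harm_cpoly[OF d]] this assms(4)]
  show ?thesis by simp
qed

text \<open>The Fourier sum in an orthonormal basis satisfies the description in
  \<open>harm_proj\<close>, and \<open>harm_eqI\<close> makes it unique as a function, since both
  candidates are restricted to the sphere. The representative \<open>h\<close> is a polynomial on
  the whole space.\<close>

lemma harm_proj_exists:
  fixes u :: "complex^'m::finite \<Rightarrow> complex"
  assumes n: "CARD('m) = n + 1" "n \<ge> 1" and u: "L2s u"
  obtains h where "h \<in> harm a b" "harm_proj a b u = restrict h (sphere 0 1)"
    "\<And>g. g \<in> harm a b \<Longrightarrow> sphere_inner u g = sphere_inner h g"
proof -
  from orthonormal_basis_exists[OF n, of a b] obtain d and \<phi> :: "nat \<Rightarrow> complex^'m \<Rightarrow> complex" where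
    \<phi>: "orthonormal d \<phi> a b" and "d \<le> hdim n a b"
    and exp: "\<And>h z. h \<in> harm a b \<Longrightarrow> z \<in> sphere 0 1 \<Longrightarrow> h z = (\<Sum>i<d. sphere_inner h (\<phi> i) * \<phi> i z)" by blast
  have H: "i < d \<Longrightarrow> \<phi> i \<in> harm a b" for i using \<phi> by (simp add: orthonormal_def)
  have L: "i < d \<Longrightarrow> L2s (\<phi> i)" for i using H by (auto intro: L2s_cpoly harm_cpoly)
  define h where "h = (\<lambda>z. \<Sum>i<d. sphere_inner u (\<phi> i) * \<phi> i z)"
  have h: "h \<in> harm a b" unfolding h_def using H by (intro harm_sum harm_cmult) auto
  have ip: "sphere_inner u g = sphere_inner h g" if g: "g \<in> harm a b" for g
  proof -
    have Lg: "L2s g" using g by (auto intro: L2s_cpoly harm_cpoly)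
    have "sphere_inner u g = sphere_inner u (\<lambda>z. \<Sum>i<d. sphere_inner g (\<phi> i) * \<phi> i z)"
      by (rule sphere_inner_cong) (auto simp: exp[OF g])
    also have "\<dots> = (\<Sum>i<d. cnj (sphere_inner g (\<phi> i)) * sphere_inner u (\<phi> i))"
      using L u by (intro sphere_inner_lincomb_right) auto
    also have "\<dots> = (\<Sum>i<d. sphere_inner u (\<phi> i) * sphere_inner (\<phi> i) g)"
      by (intro sum.cong) (auto simp: sphere_inner_cnj[of _ g] mult.commute)
    also have "\<dots> = sphere_inner h g"
      unfolding h_def using L Lg by (intro sphere_inner_lincomb_left[symmetric]) auto
    finally show ?thesis .
  qed
  have res: "sphere_inner (\<lambda>z. u z - restrict h' (sphere 0 1) z) (restrict g (sphere 0 1)) = sphere_inner u g - sphere_inner h' g"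
    if "h' \<in> harm a b" "g \<in> harm a b" for h' g
  proof -
    have "sphere_inner (\<lambda>z. u z - restrict h' (sphere 0 1) z) (restrict g (sphere 0 1)) = sphere_inner (\<lambda>z. u z - h' z) g"
      by (rule sphere_inner_cong) auto
    then show ?thesis using that u by (simp add: sphere_inner_diff_left L2s_cpoly harm_cpoly)
  qed
  have "harm_proj a b u = restrict h (sphere 0 1)"
    unfolding harm_proj_def
  proof (rule the_equality)
    show "restrict h (sphere 0 1) \<in> harmonics a b \<and>
      (\<forall>g\<in>harmonics a b. sphere_inner (\<lambda>z. u z - restrict h (sphere 0 1) z) g = 0)"
      using h ip res by (auto simp: harmonics_eq)
    fix k assume k: "k \<in> harmonics a b \<and> (\<forall>g\<in>harmonics a b. sphere_inner (\<lambda>z. u z - k z) g = 0)"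
    then obtain h' where h': "h' \<in> harm a b" "k = restrict h' (sphere 0 1)" by (auto simp: harmonics_eq)
    have "h' z = h z" if "z \<in> sphere 0 1" for z
      using k res[OF h'(1)] ip by (intro harm_eqI[OF h'(1) h _ that]) (auto simp: harmonics_eq h'(2))
    then show "k = restrict h (sphere 0 1)" by (auto simp: h'(2) fun_eq_iff)
  qed
  then show ?thesis using that h ip by blast
qed

section \<open>Completeness of the harmonics\<close>

lemma norm_add_square_le: "(norm (a + b :: complex))\<^sup>2 \<le> 2 * (norm a)\<^sup>2 + 2 * (norm b)\<^sup>2"
proof -
  have "(norm (a + b))\<^sup>2 \<le> (norm a + norm b)\<^sup>2" by (intro power_mono norm_triangle_ineq) auto
  also have "\<dots> \<le> 2 * (norm a)\<^sup>2 + 2 * (norm b)\<^sup>2"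
    using sum_squares_bound[of "norm a" "norm b"] by (simp add: power2_sum)
  finally show ?thesis .
qed

lemma sq_norm_add_le:
  assumes "L2s f" "L2s g"
  shows "sq_norm (\<lambda>z. f z + g z) \<le> 2 * sq_norm f + 2 * sq_norm g"
proof -
  have i: "integrable sphere_measure (\<lambda>z. 2 * (norm (f z))\<^sup>2)" "integrable sphere_measure (\<lambda>z. 2 * (norm (g z))\<^sup>2)"
    using assms by (auto simp: L2s_def)
  have "sq_norm (\<lambda>z. f z + g z) \<le> (LINT z|sphere_measure. 2 * (norm (f z))\<^sup>2 + 2 * (norm (g z))\<^sup>2)"
    unfolding sq_norm_def
    using L2s_add[OF assms] i norm_add_square_le by (intro integral_mono) (auto simp: L2s_def)
  also have "\<dots> = 2 * sq_norm f + 2 * sq_norm g"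
    using i by (simp add: sq_norm_def)
  finally show ?thesis .
qed

text \<open>Density of polynomials in \<open>L2s\<close> is proved by enlarging this class: it
  contains continuous functions by Stone-Weierstrass and is closed under dominated limits.\<close>

definition approx_poly :: "(complex^'m::finite \<Rightarrow> complex) \<Rightarrow> bool" where
  "approx_poly f \<longleftrightarrow> L2s f \<and> (\<forall>e>0. \<exists>P. cpoly P \<and> sq_norm (\<lambda>z. f z - P z) < e)"

lemma approx_poly_L2s: "approx_poly f \<Longrightarrow> L2s f"
  by (simp add: approx_poly_def)

lemma approx_poly_add:
  assumes "approx_poly f" "approx_poly g"
  shows "approx_poly (\<lambda>z. f z + g z)"
  unfolding approx_poly_def
proof (intro conjI allI impI L2s_add approx_poly_L2s assms)
  fix e :: real assume "e > 0"
  then have "e / 4 > 0" by simp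
  then obtain P R where P: "cpoly P" "sq_norm (\<lambda>z. f z - P z) < e / 4" and R: "cpoly R" "sq_norm (\<lambda>z. g z - R z) < e / 4"
    using assms unfolding approx_poly_def by meson
  have "sq_norm (\<lambda>z. (f z - P z) + (g z - R z)) \<le> 2 * sq_norm (\<lambda>z. f z - P z) + 2 * sq_norm (\<lambda>z. g z - R z)"
    by (intro sq_norm_add_le L2s_diff approx_poly_L2s assms L2s_cpoly P R)
  also have "\<dots> < e" using P R by simp
  finally have "sq_norm (\<lambda>z. f z + g z - (P z + R z)) < e" by (simp add: algebra_simps)
  then show "\<exists>P. cpoly P \<and> sq_norm (\<lambda>z. f z + g z - P z) < e"
    using cpoly.add[OF P(1) R(1)] by blast
qed

lemma approx_poly_limit:
  assumes "L2s f" "\<And>e. e > 0 \<Longrightarrow> \<exists>g. approx_poly g \<and> sq_norm (\<lambda>z. f z - g z) < e"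
  shows "approx_poly f"
  unfolding approx_poly_def
proof (intro conjI allI impI assms)
  fix e :: real assume "e > 0"
  then have e: "e / 4 > 0" by simp
  obtain g where g: "approx_poly g" "sq_norm (\<lambda>z. f z - g z) < e / 4" using assms(2)[OF e] by blast
  obtain P where P: "cpoly P" "sq_norm (\<lambda>z. g z - P z) < e / 4"
    using g(1) e unfolding approx_poly_def by meson
  have "sq_norm (\<lambda>z. (f z - g z) + (g z - P z)) \<le> 2 * sq_norm (\<lambda>z. f z - g z) + 2 * sq_norm (\<lambda>z. g z - P z)"
    by (intro sq_norm_add_le L2s_diff assms approx_poly_L2s g L2s_cpoly P)
  also have "\<dots> < e" using P g by simp
  finally show "\<exists>P. cpoly P \<and> sq_norm (\<lambda>z. f z - P z) < e" using P(1) by (auto simp: algebra_simps)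
qed

lemma approx_poly_dominated:
  assumes f: "L2s f" and g: "\<And>k::nat. approx_poly (g k)"
    and lim: "\<And>z. z \<in> sphere 0 1 \<Longrightarrow> (\<lambda>k. g k z) \<longlonglongrightarrow> f z"
    and w: "integrable sphere_measure w" "\<And>k z. z \<in> sphere 0 1 \<Longrightarrow> (norm (f z - g k z))\<^sup>2 \<le> w z"
  shows "approx_poly f"
proof (rule approx_poly_limit[OF f])
  fix e :: real assume e: "e > 0"
  have "(\<lambda>k. sq_norm (\<lambda>z. f z - g k z)) \<longlonglongrightarrow> (LINT z|(sphere_measure :: (complex^'a) measure). 0)"
    unfolding sq_norm_def
  proof (rule integral_dominated_convergence[where w=w])
    show "(\<lambda>z. (norm (f z - g k z))\<^sup>2) \<in> borel_measurable sphere_measure" for k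
      using L2s_diff[OF f approx_poly_L2s[OF g]] unfolding L2s_def by (blast dest: borel_measurable_integrable)
    show "AE z in sphere_measure. (\<lambda>k. (norm (f z - g k z))\<^sup>2) \<longlonglongrightarrow> 0"
    proof (rule AE_I2)
      fix z :: "complex^'a" assume "z \<in> space sphere_measure"
      then have "(\<lambda>k. (norm (f z - g k z))\<^sup>2) \<longlonglongrightarrow> (norm (f z - f z))\<^sup>2"
        by (intro tendsto_intros lim) simp
      then show "(\<lambda>k. (norm (f z - g k z))\<^sup>2) \<longlonglongrightarrow> 0" by simp
    qed
    show "AE z in sphere_measure. norm ((norm (f z - g k z))\<^sup>2) \<le> w z" for k
      using w(2) by (intro AE_I2) simp
  qed (use w(1) in simp_all)
  then have "(\<lambda>k. sq_norm (\<lambda>z. f z - g k z)) \<longlonglongrightarrow> 0" by simp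
  then have "eventually (\<lambda>k. sq_norm (\<lambda>z. f z - g k z) < e) sequentially"
    using e by (rule order_tendstoD)
  then obtain k where "sq_norm (\<lambda>z. f z - g k z) < e" by (auto simp: eventually_sequentially)
  then show "\<exists>g. approx_poly g \<and> sq_norm (\<lambda>z. f z - g z) < e" using g by blast
qed

lemma approx_poly_cmult:
  assumes "approx_poly f"
  shows "approx_poly (\<lambda>z. c * f z)"
  unfolding approx_poly_def
proof (intro conjI allI impI L2s_cmult approx_poly_L2s assms)
  fix e :: real assume e: "e > 0"
  have "e / ((norm c)\<^sup>2 + 1) > 0" using e by (simp add: add_nonneg_pos)
  then obtain P where P: "cpoly P" "sq_norm (\<lambda>z. f z - P z) < e / ((norm c)\<^sup>2 + 1)"
    using assms unfolding approx_poly_def by meson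
  have "sq_norm (\<lambda>z. c * f z - c * P z) = (norm c)\<^sup>2 * sq_norm (\<lambda>z. f z - P z)"
    by (simp add: sq_norm_cmult[symmetric] algebra_simps)
  also have "\<dots> \<le> ((norm c)\<^sup>2 + 1) * sq_norm (\<lambda>z. f z - P z)" by (intro mult_right_mono) auto
  also have "\<dots> < e" using P(2) by (simp add: pos_less_divide_eq add_nonneg_pos mult.commute)
  finally show "\<exists>P. cpoly P \<and> sq_norm (\<lambda>z. c * f z - P z) < e"
    using cpoly_cmult[OF P(1), of c] by blast
qed

text \<open>Real and imaginary parts of a coordinate are combinations of the coordinate and its
  conjugate, so Stone-Weierstrass provides approximation by \<open>cpoly\<close>.\<close>

lemma real_polynomial_function_cpoly:
  "real_polynomial_function p \<Longrightarrow> cpoly (\<lambda>z :: complex^'m::finite. complex_of_real (p z))"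
proof (induction rule: real_polynomial_function.induct)
  case (linear f)
  have l: "linear f" using linear by (rule bounded_linear.linear)
  have exp: "f z = (\<Sum>j\<in>UNIV. Re (z $ j) * f (axis j 1) + Im (z $ j) * f (axis j \<i>))" for z
  proof -
    have "z = (\<Sum>j\<in>UNIV. Re (z $ j) *\<^sub>R axis j 1 + Im (z $ j) *\<^sub>R axis j \<i>)"
    proof (subst vec_eq_iff, intro allI)
      fix i
      have "(\<Sum>j\<in>UNIV. Re (z $ j) *\<^sub>R axis j 1 + Im (z $ j) *\<^sub>R axis j \<i>) $ i = (\<Sum>j\<in>UNIV. if j = i then z $ i else 0)"
        unfolding sum_component by (intro sum.cong refl) (auto simp: axis_def complex_eq_iff)
      then show "z $ i = (\<Sum>j\<in>UNIV. Re (z $ j) *\<^sub>R axis j 1 + Im (z $ j) *\<^sub>R axis j \<i>) $ i" by simp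
    qed
    then have "f z = f (\<Sum>j\<in>UNIV. Re (z $ j) *\<^sub>R axis j 1 + Im (z $ j) *\<^sub>R axis j \<i>)" by (rule arg_cong)
    then show ?thesis by (simp add: linear_sum[OF l] linear_add[OF l] linear_scale[OF l])
  qed
  have re: "complex_of_real (Re w) = (1/2) * (w + cnj w)" and im: "complex_of_real (Im w) = (1/(2*\<i>)) * (w - cnj w)" for w
    by (simp_all add: complex_eq_iff)
  have "cpoly (\<lambda>z :: complex^'m. \<Sum>j\<in>UNIV. complex_of_real (f (axis j 1)) * complex_of_real (Re (z $ j))
      + complex_of_real (f (axis j \<i>)) * complex_of_real (Im (z $ j)))"
    unfolding re im by (intro cpoly_sum cpoly.add cpoly_cmult cpoly_diff cpoly_nth cpoly_cnj_nth)
  then show ?case by (subst exp) (simp add: mult.commute)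
next
  case (const c) then show ?case by (rule cpoly.const)
next
  case (add f g) then show ?case by (simp add: cpoly.add)
next
  case (mult f g) then show ?case by (simp add: cpoly_mult)
qed

lemma L2s_bounded:
  assumes "f \<in> borel_measurable sphere_measure" "\<And>z. z \<in> sphere 0 1 \<Longrightarrow> norm (f z) \<le> B"
  shows "L2s f"
  unfolding L2s_def
proof
  have "(norm (f z))\<^sup>2 \<le> B\<^sup>2" if "z \<in> sphere 0 1" for z
    using assms(2)[OF that] by (intro power_mono) auto
  moreover have "(\<lambda>z. (norm (f z))\<^sup>2) \<in> borel_measurable sphere_measure" using assms(1) by measurable
  ultimately show "integrable sphere_measure (\<lambda>z. (norm (f z))\<^sup>2)"
    by (intro sphere.integrable_const_bound[where B="B\<^sup>2"] AE_I2) auto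
qed (rule assms)

lemma sq_norm_le_bound:
  fixes f :: "complex^'m::finite \<Rightarrow> complex"
  assumes "f \<in> borel_measurable sphere_measure" "\<And>z. z \<in> sphere 0 1 \<Longrightarrow> norm (f z) \<le> B"
  shows "sq_norm f \<le> B\<^sup>2 * sphere_vol TYPE('m)"
proof -
  have "sq_norm f \<le> (LINT z|(sphere_measure :: (complex^'m) measure). B\<^sup>2)"
    unfolding sq_norm_def
    using L2s_bounded[OF assms] assms(2) by (intro integral_mono) (auto simp: L2s_def intro: power_mono)
  then show ?thesis by (simp add: mult.commute)
qed

lemma approx_poly_continuous:
  fixes f :: "complex^'m::finite \<Rightarrow> real"
  assumes f: "continuous_on (sphere 0 1) f"
  shows "approx_poly (\<lambda>z. complex_of_real (f z))"
  unfolding approx_poly_def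
proof (intro conjI allI impI)
  have cf: "continuous_on (sphere 0 1) (\<lambda>z. complex_of_real (f z))" by (intro continuous_intros f)
  then show "L2s (\<lambda>z. complex_of_real (f z))" by (rule L2s_continuous)
  fix e :: real assume e: "e > 0"
  let ?V = "sphere_vol TYPE('m)"
  define d where "d = sqrt (e / (2 * ?V))"
  have V: "?V > 0" by (rule measure_sphere_pos)
  have d: "d > 0" using e V by (simp add: d_def)
  obtain p where p: "real_polynomial_function p" "\<And>x. x \<in> sphere 0 1 \<Longrightarrow> \<bar>f x - p x\<bar> < d"
    using Stone_Weierstrass_real_polynomial_function[OF compact_sphere f d] by blast
  note cp = real_polynomial_function_cpoly[OF p(1)]
  have "sq_norm (\<lambda>z. complex_of_real (f z) - complex_of_real (p z)) \<le> d\<^sup>2 * ?V"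
  proof (rule sq_norm_le_bound)
    show "(\<lambda>z. complex_of_real (f z) - complex_of_real (p z)) \<in> borel_measurable sphere_measure"
      by (intro continuous_on_sphere_measurable continuous_on_diff cf cpoly_continuous cp)
    show "cmod (complex_of_real (f z) - complex_of_real (p z)) \<le> d" if "z \<in> sphere 0 1" for z
      using p(2)[OF that] by (simp flip: of_real_diff)
  qed
  also have "d\<^sup>2 * ?V = e / 2" using e V by (simp add: d_def)
  also have "\<dots> < e" using e by simp
  finally show "\<exists>P. cpoly P \<and> sq_norm (\<lambda>z. complex_of_real (f z) - P z) < e" using cp by blast
qed

lemma approx_poly_indicator_closed:
  fixes F :: "(complex^'m::finite) set"
  assumes F: "closed F"
  shows "approx_poly (\<lambda>z. complex_of_real (indicator F z))"
proof (cases "F = {}")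
  case True
  then show ?thesis using approx_poly_continuous[of "\<lambda>z. 0"] by simp
next
  case False
  \<comment> \<open>Continuous, equal to 1 on \<open>F\<close>, and tending to 0 off it. The empty
    set was treated apart because \<open>infdist\<close> to it is 0 by convention.\<close>
  let ?g = "\<lambda>k z. 1 / (1 + real k * infdist z F)"
  have pos: "1 + real k * infdist z F > 0" for k z by (simp add: add_pos_nonneg infdist_nonneg)
  show ?thesis
  proof (rule approx_poly_dominated[where g="\<lambda>k z. complex_of_real (?g k z)" and w="\<lambda>_. 1"])
    have [measurable]: "F \<in> sets borel" using F by simp
    have m: "(\<lambda>z. complex_of_real (indicator F z)) \<in> borel_measurable sphere_measure"
      by (subst measurable_cong_sets[OF sets_sphere_measure refl]) (intro measurable_restrict_space1, measurable)
    then show "L2s (\<lambda>z. complex_of_real (indicator F z))"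
      by (rule L2s_bounded[where B=1]) (simp add: indicator_def)
    show "approx_poly (\<lambda>z. complex_of_real (?g k z))" for k
      using pos by (intro approx_poly_continuous continuous_intros) (auto simp: less_imp_neq[symmetric])
    show "(\<lambda>k. complex_of_real (?g k z)) \<longlonglongrightarrow> complex_of_real (indicator F z)" for z
    proof (intro tendsto_of_real)
      show "(\<lambda>k. ?g k z) \<longlonglongrightarrow> indicator F z"
      proof (cases "z \<in> F")
        case True then show ?thesis using False F by (simp add: in_closed_iff_infdist_zero)
      next
        case nz: False
        then have i: "infdist z F > 0" using False F by (simp add: infdist_pos_not_in_closed)
        have "(\<lambda>k. ?g k z) \<longlonglongrightarrow> 0" using i by real_asymp
        then show ?thesis using nz by simp
      qed
    qed
    have "\<bar>x - y\<bar> \<le> 1" if "0 \<le> x" "x \<le> 1" "0 \<le> y" "y \<le> 1" for x y :: real using that by linarith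
    then have "\<bar>indicator F z - ?g k z\<bar> \<le> 1" for z k
      using pos[of k z] by (simp add: indicator_def infdist_nonneg)
    then show "(norm (complex_of_real (indicator F z) - complex_of_real (?g k z)))\<^sup>2 \<le> 1" for k z
      unfolding of_real_diff[symmetric] norm_of_real by (simp add: abs_square_le_1)
  qed auto
qed

lemma borel_measurable_sphere:
  assumes "f \<in> borel_measurable borel"
  shows "f \<in> borel_measurable (sphere_measure :: (complex^'m::finite) measure)"
  by (subst measurable_cong_sets[OF sets_sphere_measure refl]) (intro measurable_restrict_space1 assms)

text \<open>Dynkin's argument: the closed sets are stable under intersection, and the sets with this
  property are closed under complements and disjoint countable unions.\<close>

lemma approx_poly_indicator:
  fixes A :: "(complex^'m::finite) set"
  assumes A: "A \<in> sets borel"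
  shows "approx_poly (\<lambda>z. complex_of_real (indicator A z))"
proof -
  have L: "L2s (\<lambda>z. complex_of_real (indicator A z))" if "A \<in> sets borel" for A :: "(complex^'m) set"
    using that by (intro L2s_bounded[where B=1] borel_measurable_sphere) (auto simp: indicator_def)
  have st: "Int_stable (Collect (closed :: (complex^'m) set \<Rightarrow> bool))" by (auto simp: Int_stable_def)
  have "A \<in> sigma_sets UNIV (Collect closed)"
    using A by (simp add: borel_eq_closed)
  note a = this
  have sub: "Collect (closed :: (complex^'m) set \<Rightarrow> bool) \<subseteq> Pow UNIV" by simp
  from st sub a show ?thesis
  proof (induction A rule: sigma_sets_induct_disjoint)
    case basic then show ?case by (simp add: approx_poly_indicator_closed)
  next
    case empty then show ?case using approx_poly_indicator_closed[of "{}"] by simp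
  next
    case (compl A)
    have "approx_poly (\<lambda>z. complex_of_real (indicator UNIV z) + (-1) * complex_of_real (indicator A z))"
      by (intro approx_poly_add approx_poly_cmult compl approx_poly_indicator_closed) simp
    then show ?case by (simp add: indicator_compl Compl_eq_Diff_UNIV[symmetric])
  next
    case (union A)
    have sets: "A i \<in> sets borel" for i using union by (auto simp: borel_eq_closed)
    have fin: "approx_poly (\<lambda>z. complex_of_real (indicator (\<Union>i<k. A i) z))" for k
    proof (induction k)
      case 0 then show ?case using approx_poly_indicator_closed[of "{}"] by simp
    next
      case (Suc k)
      have "indicator (\<Union>i<Suc k. A i) z = (indicator (\<Union>i<k. A i) z + indicator (A k) z :: real)" for z
      proof -
        have "z \<notin> A i" if "z \<in> A k" "i < k" for i
          using union(1) that less_imp_neq[of i k] unfolding disjoint_family_on_def by blast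
        then show ?thesis by (auto simp: indicator_def less_Suc_eq)
      qed
      then show ?case using approx_poly_add[OF Suc union(3)[of k]] by simp
    qed
    show ?case
    proof (rule approx_poly_dominated[OF _ fin, where w="\<lambda>_. 1"])
      show "L2s (\<lambda>z. complex_of_real (indicator (\<Union> (range A)) z))" using sets by (intro L) auto
      show "(\<lambda>k. complex_of_real (indicator (\<Union>i<k. A i) z)) \<longlonglongrightarrow> complex_of_real (indicator (\<Union> (range A)) z)" for z
        by (intro tendsto_of_real LIMSEQ_indicator_UN)
      show "(norm (complex_of_real (indicator (\<Union> (range A)) z) - complex_of_real (indicator (\<Union>i<k. A i) z)))\<^sup>2 \<le> 1" for z k
        by (auto simp: indicator_def)
    qed auto
  qed
qed

lemma approx_poly_nonneg:
  fixes u :: "complex^'m::finite \<Rightarrow> real"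
  assumes "u \<in> borel_measurable sphere_measure" "\<And>z. 0 \<le> u z" "integrable sphere_measure (\<lambda>z. (u z)\<^sup>2)"
  shows "approx_poly (\<lambda>z. complex_of_real (u z))"
  using assms
proof (induction u rule: borel_measurable_induct_real)
  case (set A)
  then obtain B where "B \<in> sets borel" "A = B \<inter> sphere 0 1" by (auto simp: sets_restrict_space)
  then show ?case by (intro approx_poly_indicator) auto
next
  case (mult u c)
  show ?case
  \<comment> \<open>For \<open>c = 0\<close> square integrability of \<open>c * u\<close> says
    nothing about \<open>u\<close>, so the induction hypothesis is out of reach; but the product is
    zero.\<close>
  proof (cases "c = 0")
    case True
    then show ?thesis using approx_poly_continuous[of "\<lambda>z. 0"] by simp
  next
    case False
    have "integrable sphere_measure (\<lambda>z. (1 / c\<^sup>2) * (c * u z)\<^sup>2)" using mult by (intro integrable_mult_right) auto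
    then have "integrable sphere_measure (\<lambda>z. (u z)\<^sup>2)" using False by (simp add: power_mult_distrib)
    then show ?thesis using approx_poly_cmult[OF mult.IH, of "of_real c"] by simp
  qed
next
  case (add u v)
  have b: "x\<^sup>2 \<le> (y + x)\<^sup>2" "y\<^sup>2 \<le> (y + x)\<^sup>2" if "0 \<le> x" "0 \<le> y" for x y :: real
    using that by (auto intro: power_mono)
  have "integrable sphere_measure (\<lambda>z. (u z)\<^sup>2)" "integrable sphere_measure (\<lambda>z. (v z)\<^sup>2)"
    using add b by (auto intro!: Bochner_Integration.integrable_bound[OF add.prems])
  then show ?case using approx_poly_add[OF add.IH(2) add.IH(1)] by simp
next
  case (seq U)
  have le: "U i z \<le> u z" if "z \<in> sphere 0 1" for i z
    using seq that by (auto intro!: incseq_le simp: incseq_def le_fun_def)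
  have sq: "(U i z)\<^sup>2 \<le> (u z)\<^sup>2" "(u z - U i z)\<^sup>2 \<le> (u z)\<^sup>2" if "z \<in> sphere 0 1" for i z
    using le[OF that] seq(2)[of i z] by (auto intro!: power_mono)
  have iU: "integrable sphere_measure (\<lambda>z. (U i z)\<^sup>2)" for i
    using sq seq(1) by (intro Bochner_Integration.integrable_bound[OF seq.prems]) (auto intro!: AE_I2)
  show ?case
  proof (rule approx_poly_dominated[where g="\<lambda>i z. complex_of_real (U i z)" and w="\<lambda>z. (u z)\<^sup>2"])
    have "u \<in> borel_measurable sphere_measure"
      by (rule borel_measurable_LIMSEQ_real[OF seq.hyps(4) seq.hyps(1)])
    then show "L2s (\<lambda>z. complex_of_real (u z))" using seq by (simp add: L2s_def)
    show "approx_poly (\<lambda>z. complex_of_real (U i z))" for i using seq iU by auto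
    show "(\<lambda>k. complex_of_real (U k z)) \<longlonglongrightarrow> complex_of_real (u z)" if "z \<in> sphere 0 1" for z
      using seq that by (intro tendsto_of_real) auto
    show "(norm (complex_of_real (u z) - complex_of_real (U k z)))\<^sup>2 \<le> (u z)\<^sup>2" if "z \<in> sphere 0 1" for k z
      unfolding of_real_diff[symmetric] norm_of_real using sq(2)[OF that] by simp
  qed (rule seq.prems)
qed

lemma approx_poly_real:
  fixes u :: "complex^'m::finite \<Rightarrow> real"
  assumes m: "u \<in> borel_measurable sphere_measure" and i: "integrable sphere_measure (\<lambda>z. (u z)\<^sup>2)"
  shows "approx_poly (\<lambda>z. complex_of_real (u z))"
proof -
  have "approx_poly (\<lambda>z. complex_of_real (max 0 (s * u z)))" if "\<bar>s\<bar> = 1" for s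
  proof (rule approx_poly_nonneg)
    show "(\<lambda>z. max 0 (s * u z)) \<in> borel_measurable sphere_measure" using m by measurable
    have s2: "(s * x)\<^sup>2 = x\<^sup>2" for x using that by (metis abs_mult mult_1 power2_abs)
    have "(max 0 (s * u z))\<^sup>2 \<le> (u z)\<^sup>2" for z
      by (simp add: max_def s2)
    then show "integrable sphere_measure (\<lambda>z. (max 0 (s * u z))\<^sup>2)"
      using m by (intro Bochner_Integration.integrable_bound[OF i]) (auto intro!: AE_I2)
  qed auto
  from approx_poly_add[OF this[of 1] approx_poly_cmult[OF this[of "-1"], of "-1"]]
  have "approx_poly (\<lambda>z. complex_of_real (max 0 (u z)) + - complex_of_real (max 0 (- u z)))" by simp
  moreover have "max 0 x - max 0 (- x) = x" for x :: real by (simp add: max_def)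
  ultimately show ?thesis by (simp flip: of_real_minus of_real_add)
qed

lemma L2s_approx_poly: "L2s f \<Longrightarrow> approx_poly f"
proof -
  assume f: "L2s f"
  have m: "f \<in> borel_measurable sphere_measure" and i: "integrable sphere_measure (\<lambda>z. (norm (f z))\<^sup>2)"
    using f by (auto simp: L2s_def)
  have "(Re w)\<^sup>2 \<le> (norm w)\<^sup>2" "(Im w)\<^sup>2 \<le> (norm w)\<^sup>2" for w by (simp_all add: cmod_power2)
  then have "integrable sphere_measure (\<lambda>z. (Re (f z))\<^sup>2)" "integrable sphere_measure (\<lambda>z. (Im (f z))\<^sup>2)"
    using m by (auto intro!: Bochner_Integration.integrable_bound[OF i] AE_I2)
  then have "approx_poly (\<lambda>z. complex_of_real (Re (f z)) + \<i> * complex_of_real (Im (f z)))"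
    using m by (intro approx_poly_add approx_poly_cmult approx_poly_real) auto
  then show ?thesis by (simp add: complex_eq[symmetric])
qed


section \<open>Expansion of square integrable functions in harmonics\<close>

text \<open>Splits a polynomial into pieces of a single bidegree, the form in which
  \<open>fischer\<close> takes its argument.\<close>

inductive bhsum :: "(complex^'m::finite \<Rightarrow> complex) \<Rightarrow> bool" where
  base: "bh a b f \<Longrightarrow> bhsum f"
| add: "bhsum f \<Longrightarrow> bhsum g \<Longrightarrow> bhsum (\<lambda>z. f z + g z)"

lemma bhsum_z: "bhsum f \<Longrightarrow> bhsum (\<lambda>z. z $ j * f z) \<and> bhsum (\<lambda>z. cnj (z $ j) * f z)"
  by (induction rule: bhsum.induct) (auto simp: distrib_left intro: bhsum.intros bh.z bh.zbar)

lemma cpoly_bhsum: "cpoly f \<Longrightarrow> bhsum f"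
  by (induction rule: cpoly.induct) (auto simp: bhsum_z intro: bhsum.intros bh.const)

abbreviation harmk :: "nat \<times> nat \<Rightarrow> (complex^'m::finite \<Rightarrow> complex) set" where
  "harmk k \<equiv> harm (fst k) (snd k)"

text \<open>The components are indexed by all bidegrees and vanish off \<open>F\<close>, so that
  representations over different finite sets can be compared and added index by index.\<close>

definition harm_sum_rep :: "(complex^'m::finite \<Rightarrow> complex) \<Rightarrow> bool" where
  "harm_sum_rep f \<longleftrightarrow> (\<exists>F p. finite F \<and> (\<forall>k. p k \<in> harmk k) \<and> (\<forall>k. k \<notin> F \<longrightarrow> p k = (\<lambda>z. 0)) \<and>
     (\<forall>z\<in>sphere 0 1. f z = (\<Sum>k\<in>F. p k z)))"

lemma harm_sum_rep_harm: "h \<in> harm a b \<Longrightarrow> harm_sum_rep h"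
  unfolding harm_sum_rep_def
  by (intro exI[of _ "{(a, b)}"] exI[of _ "\<lambda>k. if k = (a, b) then h else (\<lambda>z. 0)"]) (auto simp: harm_zero)

lemma harm_sum_rep_add: "harm_sum_rep f \<Longrightarrow> harm_sum_rep g \<Longrightarrow> harm_sum_rep (\<lambda>z. f z + g z)"
proof -
  assume "harm_sum_rep f" "harm_sum_rep g"
  from \<open>harm_sum_rep f\<close> obtain F p where F: "finite F" "\<forall>k. p k \<in> harmk k" "\<forall>k. k \<notin> F \<longrightarrow> p k = (\<lambda>z. 0)"
      "\<forall>z\<in>sphere 0 1. f z = (\<Sum>k\<in>F. p k z)"
    unfolding harm_sum_rep_def by blast
  from \<open>harm_sum_rep g\<close> obtain G r where G: "finite G" "\<forall>k. r k \<in> harmk k" "\<forall>k. k \<notin> G \<longrightarrow> r k = (\<lambda>z. 0)"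
      "\<forall>z\<in>sphere 0 1. g z = (\<Sum>k\<in>G. r k z)"
    unfolding harm_sum_rep_def by blast
  have "(\<Sum>k\<in>F. p k z) = (\<Sum>k\<in>F \<union> G. p k z)" "(\<Sum>k\<in>G. r k z) = (\<Sum>k\<in>F \<union> G. r k z)" for z
    using F G by (auto intro!: sum.mono_neutral_left)
  then show ?thesis
    unfolding harm_sum_rep_def using F G
    by (intro exI[of _ "F \<union> G"] exI[of _ "\<lambda>k z. p k z + r k z"]) (auto simp: sum.distrib intro: harm_add)
qed

lemma harm_sum_rep_sum: "(\<And>i. i \<in> I \<Longrightarrow> harm_sum_rep (f i)) \<Longrightarrow> harm_sum_rep (\<lambda>z. \<Sum>i\<in>I. f i z)"
  by (induction I rule: infinite_finite_induct)
     (auto intro: harm_sum_rep_add harm_sum_rep_harm[OF harm_zero])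

lemma harm_sum_rep_cong:
  "harm_sum_rep f \<Longrightarrow> (\<And>z. z \<in> sphere 0 1 \<Longrightarrow> g z = f z) \<Longrightarrow> harm_sum_rep g"
  unfolding harm_sum_rep_def by simp

lemma cpoly_harm_sum_rep: "cpoly f \<Longrightarrow> harm_sum_rep f"
proof -
  have "bhsum f \<Longrightarrow> harm_sum_rep f"
  proof (induction rule: bhsum.induct)
    case (base a b f)
    from fischer[OF base lap_power_eq_zero[OF base]] obtain h where
      h: "\<And>k. k < Suc a \<Longrightarrow> h k \<in> harm (a - k) (b - k)" "\<And>z. z \<in> sphere 0 1 \<Longrightarrow> f z = (\<Sum>k<Suc a. h k z)"
      by blast
    have "harm_sum_rep (\<lambda>z. \<Sum>k\<in>{..<Suc a}. h k z)"
      using h(1) by (intro harm_sum_rep_sum) (blast intro: harm_sum_rep_harm)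
    then show ?case by (rule harm_sum_rep_cong) (simp add: h(2))
  qed (rule harm_sum_rep_add)
  then show "cpoly f \<Longrightarrow> harm_sum_rep f" using cpoly_bhsum by blast
qed

lemma sphere_inner_harm_distinct:
  fixes f g :: "complex^'m::finite \<Rightarrow> complex"
  assumes "CARD('m) \<ge> 2" "f \<in> harmk k" "g \<in> harmk k'" "k \<noteq> k'"
  shows "sphere_inner f g = 0"
  using harm_orthogonal[OF assms(2,3) _ assms(1)] assms(4) by (auto simp: sphere_inner_def prod_eq_iff)

lemma sq_norm_harm_sum:
  fixes h :: "nat \<times> nat \<Rightarrow> complex^'m::finite \<Rightarrow> complex"
  assumes n: "CARD('m) \<ge> 2" and F: "finite F" and h: "\<And>k. k \<in> F \<Longrightarrow> h k \<in> harmk k"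
  shows "sq_norm (\<lambda>z. \<Sum>k\<in>F. h k z) = (\<Sum>k\<in>F. sq_norm (h k))"
  using F h
proof (induction F rule: finite_induct)
  case empty
  then show ?case by (simp add: sq_norm_def)
next
  case (insert k F)
  have L: "L2s (h k')" if "k' \<in> insert k F" for k' using insert.prems[OF that] by (auto intro: L2s_cpoly harm_cpoly)
  have "sphere_inner (h k) (\<lambda>z. \<Sum>k\<in>F. h k z) = (\<Sum>k'\<in>F. sphere_inner (h k) (h k'))"
    using L by (intro sphere_inner_sum_right) auto
  also have "\<dots> = 0"
  proof (intro sum.neutral ballI)
    fix k' assume "k' \<in> F"
    then show "sphere_inner (h k) (h k') = 0"
      using insert by (intro sphere_inner_harm_distinct[OF n, of _ k _ k']) auto
  qed
  finally show ?case
    using insert L by (simp add: sq_norm_add L2s_sum)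
qed

text \<open>Both claims rest on the Pythagorean identity \<open>best\<close> with arbitrary
  components \<open>p\<close>: \<open>p = 0\<close> is the Bessel identity, and \<open>p\<close>
  taken from an approximating polynomial shows that the partial sums of \<open>h\<close> come at
  least as close.\<close>

lemma
  fixes f :: "complex^'m::finite \<Rightarrow> complex"
  assumes n: "CARD('m) \<ge> 2" and f: "L2s f" and h: "\<And>k. h k \<in> harmk k"
    and ip: "\<And>k g. g \<in> harmk k \<Longrightarrow> sphere_inner f g = sphere_inner (h k) g"
  shows bessel_identity: "finite F \<Longrightarrow> sq_norm (\<lambda>z. f z - (\<Sum>k\<in>F. h k z)) = sq_norm f - (\<Sum>k\<in>F. sq_norm (h k))"
    and harmonic_expansion: "e > 0 \<Longrightarrow> \<exists>F0. finite F0 \<and> (\<forall>F. finite F \<longrightarrow> F0 \<subseteq> F \<longrightarrow> sq_norm (\<lambda>z. f z - (\<Sum>k\<in>F. h k z)) < e)"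
proof -
  have L: "L2s (h k)" for k using h[of k] by (auto intro: L2s_cpoly harm_cpoly)
  have best: "sq_norm (\<lambda>z. f z - (\<Sum>k\<in>F. p k z)) = sq_norm (\<lambda>z. f z - (\<Sum>k\<in>F. h k z)) + (\<Sum>k\<in>F. sq_norm (\<lambda>z. h k z - p k z))"
    if F: "finite F" and p: "\<And>k. p k \<in> harmk k" for F p
  proof -
    let ?r = "\<lambda>z. f z - (\<Sum>k\<in>F. h k z)" and ?s = "\<lambda>z. \<Sum>k\<in>F. h k z - p k z"
    have d: "(\<lambda>z. h k z - p k z) \<in> harmk k" for k by (intro harm_diff h p)
    have Ld: "L2s (\<lambda>z. h k z - p k z)" for k using d[of k] by (auto intro: L2s_cpoly harm_cpoly)
    have Lr: "L2s ?r" by (intro L2s_diff f L2s_sum L)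
    have Ls: "L2s ?s" by (intro L2s_sum Ld)
    have "sphere_inner ?r (\<lambda>z. h k z - p k z) = 0" if k: "k \<in> F" for k
    proof -
      have "sphere_inner ?r (\<lambda>z. h k z - p k z) = sphere_inner f (\<lambda>z. h k z - p k z) - (\<Sum>k'\<in>F. sphere_inner (h k') (\<lambda>z. h k z - p k z))"
        by (subst sphere_inner_diff_left[OF f L2s_sum[OF L] Ld], subst sphere_inner_sum_left[OF L Ld]) simp
      also have "(\<Sum>k'\<in>F. sphere_inner (h k') (\<lambda>z. h k z - p k z)) = (\<Sum>k'\<in>F. if k' = k then sphere_inner (h k) (\<lambda>z. h k z - p k z) else 0)"
        using sphere_inner_harm_distinct[OF n h d] by (intro sum.cong) auto
      finally show ?thesis using k F ip[OF d] by simp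
    qed
    then have "sphere_inner ?r ?s = 0"
      by (subst sphere_inner_sum_right[OF Ld Lr]) simp
    moreover have "sq_norm (\<lambda>z. f z - (\<Sum>k\<in>F. p k z)) = sq_norm (\<lambda>z. ?r z + ?s z)"
      by (rule sq_norm_cong) (simp add: sum_subtractf)
    ultimately show ?thesis
      using sq_norm_add[OF Lr Ls] sq_norm_harm_sum[OF n F d] by simp
  qed
  show "sq_norm (\<lambda>z. f z - (\<Sum>k\<in>F. h k z)) = sq_norm f - (\<Sum>k\<in>F. sq_norm (h k))" if "finite F"
    using best[OF that harm_zero] by simp
  show "\<exists>F0. finite F0 \<and> (\<forall>F. finite F \<longrightarrow> F0 \<subseteq> F \<longrightarrow> sq_norm (\<lambda>z. f z - (\<Sum>k\<in>F. h k z)) < e)" if e: "e > 0"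
  proof -
    obtain P where P: "cpoly P" "sq_norm (\<lambda>z. f z - P z) < e"
      using L2s_approx_poly[OF f] e unfolding approx_poly_def by meson
    obtain F0 p where F0': "finite F0" "\<forall>k. p k \<in> harmk k" "\<forall>k. k \<notin> F0 \<longrightarrow> p k = (\<lambda>z. 0)"
      "\<forall>z\<in>sphere 0 1. P z = (\<Sum>k\<in>F0. p k z)"
      using cpoly_harm_sum_rep[OF P(1)] unfolding harm_sum_rep_def by blast
    note F0 = F0'(1) F0'(2)[rule_format] F0'(3)[rule_format] F0'(4)[rule_format]
    have "sq_norm (\<lambda>z. f z - (\<Sum>k\<in>F. h k z)) < e" if F: "finite F" "F0 \<subseteq> F" for F
    proof -
      have "(\<Sum>k\<in>F. p k z) = P z" if "z \<in> sphere 0 1" for z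
        unfolding F0(4)[OF that] using F F0(3) by (intro sum.mono_neutral_right) auto
      then have "sq_norm (\<lambda>z. f z - (\<Sum>k\<in>F. p k z)) = sq_norm (\<lambda>z. f z - P z)"
        by (intro sq_norm_cong) simp
      then have "sq_norm (\<lambda>z. f z - (\<Sum>k\<in>F. h k z)) + (\<Sum>k\<in>F. sq_norm (\<lambda>z. h k z - p k z)) < e"
        using best[OF F(1) F0(2)] P(2) by simp
      moreover have "(\<Sum>k\<in>F. sq_norm (\<lambda>z. h k z - p k z)) \<ge> 0" by (intro sum_nonneg) simp
      ultimately show ?thesis by linarith
    qed
    then show ?thesis using F0(1) by blast
  qed
qed

section \<open>The solution of the Cauchy problem\<close>

text \<open>Tested against an eigenfunction the weak equation is a scalar linear differential
  equation for the coefficient, and an integrating factor solves it.\<close>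

lemma cauchy_solution_inner:
  fixes v0 :: "complex^'m::{finite,linorder} \<Rightarrow> complex"
  assumes v: "cauchy_solution v0 v" and g: "g \<in> harm a b" and n: "CARD('m) = n + 1" and v0: "L2s v0"
  shows "sphere_inner (v t) g = cis (eigval n a b * t) * sphere_inner v0 g"
proof -
  define c where "c t = sphere_inner (v t) g" for t
  let ?l = "eigval n a b"
  have D: "(c has_vector_derivative \<i> * of_real ?l * c t) (at t)" for t
  proof -
    obtain D where D: "((\<lambda>t'. sphere_inner (v t') g) has_vector_derivative D) (at t)"
      "\<i> * D + sphere_inner (v t) (sublaplacian g) = 0"
      using v cpoly_smooth[OF harm_cpoly[OF g]] unfolding cauchy_solution_def by blast
    have "sublaplacian g = (\<lambda>z. of_real ?l * g z)" using sublaplacian_harm[OF g n] by auto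
    then have "\<i> * D + of_real ?l * c t = 0" using D(2) by (simp add: sphere_inner_cmult_right c_def)
    then have "\<i> * (\<i> * D + of_real ?l * c t) = 0" by simp
    then have "D = \<i> * of_real ?l * c t" by (simp add: algebra_simps)
    then show ?thesis using D(1) unfolding c_def[abs_def] by simp
  qed
  have E: "((\<lambda>t. exp (- (\<i> * of_real ?l) * of_real t)) has_vector_derivative
      - (\<i> * of_real ?l) * exp (- (\<i> * of_real ?l) * of_real t)) (at t)" for t :: real
    by (rule has_vector_derivative_real_field) (auto intro!: derivative_eq_intros)
  let ?w = "\<lambda>t. exp (- (\<i> * of_real ?l) * of_real t) * c t"
  have "(?w has_vector_derivative 0) (at t)" for t
    using has_vector_derivative_mult[OF E D, of t] by (simp add: algebra_simps)
  then obtain k where k: "\<And>t. ?w t = k"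
    using has_vector_derivative_zero_constant[of UNIV ?w] by auto
  have c0: "c 0 = sphere_inner v0 g"
    unfolding c_def sphere_inner_def
  proof (rule integral_cong_AE)
    have Lg: "L2s g" by (intro L2s_cpoly harm_cpoly[OF g])
    have "L2s (v 0)" using v by (simp add: cauchy_solution_def sphere_L2_iff)
    then show "(\<lambda>z. v 0 z * cnj (g z)) \<in> borel_measurable sphere_measure"
      by (intro borel_measurable_integrable L2s_mult_integrable Lg)
    show "(\<lambda>z. v0 z * cnj (g z)) \<in> borel_measurable sphere_measure"
      by (intro borel_measurable_integrable L2s_mult_integrable Lg v0)
    have "AE z in sphere_measure. v 0 z = v0 z" using v by (simp add: cauchy_solution_def)
    then show "AE z in sphere_measure. v 0 z * cnj (g z) = v0 z * cnj (g z)" by (rule eventually_mono) simp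
  qed
  have "c t = exp (\<i> * of_real ?l * of_real t) * ?w t"
    by (simp add: exp_minus mult.assoc[symmetric])
  also have "?w t = ?w 0" by (simp only: k)
  finally show ?thesis by (simp add: c_def[symmetric] c0 cis_conv_exp mult.assoc)
qed

section \<open>Inequalities for Lebesgue norms\<close>

text \<open>Scaling by \<open>y\<close> reduces the tangent of the convex power to the point 1,
  where it is Young's inequality with the constant 1.\<close>

lemma powr_tangent:
  fixes x y q :: real
  assumes "q \<ge> 1" "x \<ge> 0" "y > 0"
  shows "y powr q + q * y powr (q - 1) * (x - y) \<le> x powr q"
proof -
  define u where "u = x / y"
  have u: "u \<ge> 0" "x = u * y" using assms by (auto simp: u_def)
  have "q * u \<le> u powr q + q - 1"
  proof (cases "u = 0")
    case False
    then have "(u powr q) powr (1 / q) * 1 powr (1 - 1 / q) \<le> (1 / q) * u powr q + (1 - 1 / q) * 1"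
      using assms u by (intro Youngs_inequality_0) auto
    also have "(u powr q) powr (1 / q) * 1 powr (1 - 1 / q) = u" using assms u by (simp add: powr_powr)
    finally have "q * u \<le> q * ((1 / q) * u powr q + (1 - 1 / q) * 1)" using assms by (intro mult_left_mono) auto
    also have "\<dots> = u powr q + q - 1" using assms by (simp add: field_simps)
    finally show ?thesis .
  qed (use assms in auto)
  then have "y powr q * (1 + q * (u - 1)) \<le> y powr q * u powr q"
    by (intro mult_left_mono) (auto simp: algebra_simps)
  moreover have "y powr q = y * y powr (q - 1)" using assms by (simp add: powr_diff)
  ultimately show ?thesis using assms u by (simp add: powr_mult algebra_simps)
qed

text \<open>Jensen's inequality: in the average of the tangent bounds at the weighted mean the
  linear terms cancel.\<close>

lemma powr_weighted_sum_le:
  fixes w x :: "'i \<Rightarrow> real"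
  assumes q: "q \<ge> 1" and w: "\<And>i. i \<in> I \<Longrightarrow> w i \<ge> 0" "(\<Sum>i\<in>I. w i) = 1" and x: "\<And>i. i \<in> I \<Longrightarrow> x i \<ge> 0"
  shows "(\<Sum>i\<in>I. w i * x i) powr q \<le> (\<Sum>i\<in>I. w i * x i powr q)"
proof (cases "(\<Sum>i\<in>I. w i * x i) = 0")
  case True
  then show ?thesis using w by (simp add: sum_nonneg)
next
  case False
  define y where "y = (\<Sum>i\<in>I. w i * x i)"
  have "y \<ge> 0" unfolding y_def using w x by (intro sum_nonneg mult_nonneg_nonneg) auto
  then have y: "y > 0" using False by (simp add: y_def)
  have "(\<Sum>i\<in>I. w i * (y powr q + q * y powr (q - 1) * (x i - y))) \<le> (\<Sum>i\<in>I. w i * x i powr q)"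
    using w x y q by (intro sum_mono mult_left_mono powr_tangent) auto
  also have "(\<Sum>i\<in>I. w i * (Y + c * (x i - u))) = (\<Sum>i\<in>I. w i) * Y + c * (y - (\<Sum>i\<in>I. w i) * u)" for Y c u
    unfolding y_def by (simp add: algebra_simps sum.distrib sum_subtractf sum_distrib_left sum_distrib_right)
  finally show ?thesis using w by (simp add: y_def)
qed

text \<open>The triangle inequality of \<open>L\<^sup>q\<close>, from the convexity of the \<open>q\<close>-th power with weights \<open>a i / \<Sum>a\<close>.\<close>

lemma nn_integral_powr_sum_le:
  fixes f :: "'i \<Rightarrow> 'a \<Rightarrow> real"
  assumes q: "q \<ge> 1" and I: "finite I"
    and f: "\<And>i x. i \<in> I \<Longrightarrow> f i x \<ge> 0" "\<And>i. i \<in> I \<Longrightarrow> f i \<in> borel_measurable M"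
    and a: "\<And>i. i \<in> I \<Longrightarrow> a i \<ge> 0"
    and le: "\<And>i. i \<in> I \<Longrightarrow> (\<integral>\<^sup>+ x. ennreal (f i x powr q) \<partial>M) \<le> ennreal (a i powr q)"
  shows "(\<integral>\<^sup>+ x. ennreal ((\<Sum>i\<in>I. f i x) powr q) \<partial>M) \<le> ennreal ((\<Sum>i\<in>I. a i) powr q)"
proof (cases "I = {}")
  case True
  then show ?thesis by simp
next
  case ne: False
  \<comment> \<open>The bounds \<open>a i\<close> act as weights and are divided by, but may be 0.
    They are enlarged by \<open>e\<close>, which tends to 0 at the end.\<close>
  have pos: "(\<integral>\<^sup>+ x. ennreal ((\<Sum>i\<in>I. f i x) powr q) \<partial>M) \<le> ennreal ((\<Sum>i\<in>I. a i + e) powr q)" if e: "e > 0" for e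
  proof -
    define b where "b i = a i + e" for i
    define S where "S = (\<Sum>i\<in>I. b i)"
    have b: "i \<in> I \<Longrightarrow> b i > 0" for i using a e by (auto simp: b_def add_nonneg_pos)
    have S: "S > 0" unfolding S_def using b ne I by (intro sum_pos) auto
    have pt: "(\<Sum>i\<in>I. f i x) powr q \<le> (\<Sum>i\<in>I. (b i / S) * (S / b i) powr q * f i x powr q)" for x
    proof -
      have "(\<Sum>i\<in>I. f i x) = (\<Sum>i\<in>I. b i / S * (S / b i * f i x))"
        using b S by (intro sum.cong) (auto simp: less_imp_neq[symmetric])
      also have "\<dots> powr q \<le> (\<Sum>i\<in>I. b i / S * (S / b i * f i x) powr q)"
        using b S f q I by (intro powr_weighted_sum_le)
          (auto simp: less_imp_le S_def[symmetric] sum_divide_distrib[symmetric])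
      also have "\<dots> = (\<Sum>i\<in>I. (b i / S) * (S / b i) powr q * f i x powr q)"
      proof (intro sum.cong refl)
        fix i assume i: "i \<in> I"
        have "(S / b i * f i x) powr q = (S / b i) powr q * f i x powr q"
          by (rule powr_mult)
        then show "b i / S * (S / b i * f i x) powr q = (b i / S) * (S / b i) powr q * f i x powr q"
          by (simp only: mult.assoc)
      qed
      finally show ?thesis .
    qed
    have "(\<integral>\<^sup>+ x. ennreal ((\<Sum>i\<in>I. f i x) powr q) \<partial>M)
        \<le> (\<integral>\<^sup>+ x. (\<Sum>i\<in>I. ennreal ((b i / S) * (S / b i) powr q) * ennreal (f i x powr q)) \<partial>M)"
    proof (rule nn_integral_mono)
      fix x
      have "ennreal ((\<Sum>i\<in>I. f i x) powr q) \<le> ennreal (\<Sum>i\<in>I. (b i / S) * (S / b i) powr q * f i x powr q)"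
        by (intro ennreal_leI pt)
      also have "\<dots> = (\<Sum>i\<in>I. ennreal ((b i / S) * (S / b i) powr q * f i x powr q))"
        using b S by (intro sum_ennreal[symmetric]) (auto intro!: mult_nonneg_nonneg simp: less_imp_le)
      also have "\<dots> = (\<Sum>i\<in>I. ennreal ((b i / S) * (S / b i) powr q) * ennreal (f i x powr q))"
        using b S by (intro sum.cong ennreal_mult) (auto simp: less_imp_le)
      finally show "ennreal ((\<Sum>i\<in>I. f i x) powr q) \<le> \<dots>" .
    qed
    also have "\<dots> = (\<Sum>i\<in>I. ennreal ((b i / S) * (S / b i) powr q) * (\<integral>\<^sup>+ x. ennreal (f i x powr q) \<partial>M))"
    proof -
      have m: "(\<lambda>x. ennreal (f i x powr q)) \<in> borel_measurable M" if "i \<in> I" for i using f(2)[OF that] by measurable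
      then show ?thesis by (subst nn_integral_sum) (auto simp: nn_integral_cmult)
    qed
    also have "\<dots> \<le> (\<Sum>i\<in>I. ennreal ((b i / S) * (S / b i) powr q) * ennreal (b i powr q))"
    proof (intro sum_mono mult_left_mono)
      fix i assume i: "i \<in> I"
      have "ennreal (a i powr q) \<le> ennreal (b i powr q)"
        using a[OF i] e q by (intro ennreal_leI powr_mono2) (auto simp: b_def)
      with le[OF i] show "(\<integral>\<^sup>+ x. ennreal (f i x powr q) \<partial>M) \<le> ennreal (b i powr q)" by (rule order_trans)
    qed auto
    also have "\<dots> = (\<Sum>i\<in>I. ennreal ((b i / S) * S powr q))"
    proof (intro sum.cong refl)
      fix i assume i: "i \<in> I"
      have "ennreal ((b i / S) * (S / b i) powr q) * ennreal (b i powr q) = ennreal ((b i / S) * (S / b i) powr q * b i powr q)"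
        using b[OF i] S by (intro ennreal_mult[symmetric]) auto
      also have "(b i / S) * (S / b i) powr q * b i powr q = (b i / S) * S powr q"
        using b[OF i] S by (simp add: powr_divide)
      finally show "ennreal ((b i / S) * (S / b i) powr q) * ennreal (b i powr q) = ennreal ((b i / S) * S powr q)" .
    qed
    also have "\<dots> = ennreal (\<Sum>i\<in>I. (b i / S) * S powr q)"
      using b S by (intro sum_ennreal) (auto simp: less_imp_le)
    also have "(\<Sum>i\<in>I. (b i / S) * S powr q) = S powr q"
      using S by (simp add: S_def[symmetric] sum_distrib_right[symmetric] sum_divide_distrib[symmetric])
    finally show ?thesis by (simp add: S_def b_def)
  qed
  have ev: "\<forall>\<^sub>F e in at_right 0. 0 \<le> (\<Sum>i\<in>I. a i + e)"
    using eventually_at_right_less[of "0::real"]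
    by (rule eventually_mono) (auto intro!: sum_nonneg add_nonneg_nonneg a)
  have "((\<lambda>e. ennreal ((\<Sum>i\<in>I. a i + e) powr q)) \<longlongrightarrow> ennreal ((\<Sum>i\<in>I. a i + 0) powr q)) (at_right 0)"
    using q ev by (intro tendsto_ennrealI tendsto_powr' tendsto_intros) auto
  then have "(\<integral>\<^sup>+ x. ennreal ((\<Sum>i\<in>I. f i x) powr q) \<partial>M) \<le> ennreal ((\<Sum>i\<in>I. a i + 0) powr q)"
    by (rule tendsto_lowerbound) (auto simp: eventually_at_right_less intro!: eventually_mono[OF eventually_at_right_less] pos)
  then show ?thesis by simp
qed

text \<open>When \<open>a\<close> or \<open>b\<close> is 0 the left side is 0, even at the ends of
  the range of \<kappa>, because \<open>0 powr 0 = 0\<close>.\<close>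

lemma powr_mult_le_add:
  fixes a b \<kappa> :: real
  assumes "0 \<le> \<kappa>" "\<kappa> \<le> 1" "a \<ge> 0" "b \<ge> 0"
  shows "a powr (1 - \<kappa>) * b powr \<kappa> \<le> (1 - \<kappa>) * a + \<kappa> * b"
  using assms Youngs_inequality_0[of "1 - \<kappa>" \<kappa> a b] by (cases "a = 0 \<or> b = 0") auto

text \<open>After division by the two integrals this is the integrated form of
  \<open>powr_mult_le_add\<close>. Written with \<kappa> it covers the endpoints without infinite
  exponents; \<open>\<kappa> = 1\<close> occurs for \<open>q = 4\<close>.\<close>

lemma integral_holder:
  fixes f g :: "'a \<Rightarrow> real"
  assumes \<kappa>: "0 \<le> \<kappa>" "\<kappa> \<le> 1"
    and f: "integrable M f" "\<And>x. f x \<ge> 0" and g: "integrable M g" "\<And>x. g x \<ge> 0"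
  shows "(LINT x|M. f x powr (1 - \<kappa>) * g x powr \<kappa>) \<le> (LINT x|M. f x) powr (1 - \<kappa>) * (LINT x|M. g x) powr \<kappa>"
    and "integrable M (\<lambda>x. f x powr (1 - \<kappa>) * g x powr \<kappa>)"
proof -
  have m: "(\<lambda>x. f x powr (1 - \<kappa>) * g x powr \<kappa>) \<in> borel_measurable M"
    using borel_measurable_integrable[OF f(1)] borel_measurable_integrable[OF g(1)] by measurable
  show i: "integrable M (\<lambda>x. f x powr (1 - \<kappa>) * g x powr \<kappa>)"
  proof (rule Bochner_Integration.integrable_bound[OF _ m])
    show "integrable M (\<lambda>x. (1 - \<kappa>) * f x + \<kappa> * g x)" using f g by auto
    show "AE x in M. norm (f x powr (1 - \<kappa>) * g x powr \<kappa>) \<le> norm ((1 - \<kappa>) * f x + \<kappa> * g x)"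
      using powr_mult_le_add[OF \<kappa> f(2) g(2)] \<kappa> f(2) g(2) by (intro AE_I2) (simp add: abs_of_nonneg)
  qed
  let ?F = "LINT x|M. f x" and ?G = "LINT x|M. g x"
  show "(LINT x|M. f x powr (1 - \<kappa>) * g x powr \<kappa>) \<le> ?F powr (1 - \<kappa>) * ?G powr \<kappa>"
  proof (cases "?F = 0 \<or> ?G = 0")
    case True
    then have "AE x in M. f x = 0 \<or> g x = 0"
    proof
      assume "?F = 0"
      then have "AE x in M. f x = 0" using f by (subst (asm) integral_nonneg_eq_0_iff_AE) auto
      then show ?thesis by (rule eventually_mono) simp
    next
      assume "?G = 0"
      then have "AE x in M. g x = 0" using g by (subst (asm) integral_nonneg_eq_0_iff_AE) auto
      then show ?thesis by (rule eventually_mono) simp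
    qed
    then have "AE x in M. f x powr (1 - \<kappa>) * g x powr \<kappa> = 0" by (rule eventually_mono) auto
    then have "(LINT x|M. f x powr (1 - \<kappa>) * g x powr \<kappa>) = (LINT x|M. 0)" using m by (intro integral_cong_AE) auto
    then show ?thesis by simp
  next
    case False
    then have F: "?F > 0" and G: "?G > 0" using f g by (auto simp: less_le intro: integral_nonneg)
    have "(LINT x|M. f x powr (1 - \<kappa>) * g x powr \<kappa>)
        \<le> (LINT x|M. ?F powr (1 - \<kappa>) * ?G powr \<kappa> * ((1 - \<kappa>) / ?F * f x + \<kappa> / ?G * g x))"
    proof (rule integral_mono[OF i])
      show "integrable M (\<lambda>x. ?F powr (1 - \<kappa>) * ?G powr \<kappa> * ((1 - \<kappa>) / ?F * f x + \<kappa> / ?G * g x))"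
        using f g by (intro integrable_mult_right Bochner_Integration.integrable_add) auto
      fix x
      have "f x powr (1 - \<kappa>) * g x powr \<kappa> = ?F powr (1 - \<kappa>) * ?G powr \<kappa> * ((f x / ?F) powr (1 - \<kappa>) * (g x / ?G) powr \<kappa>)"
        using F G f(2)[of x] g(2)[of x] by (simp add: powr_divide)
      also have "\<dots> \<le> ?F powr (1 - \<kappa>) * ?G powr \<kappa> * ((1 - \<kappa>) * (f x / ?F) + \<kappa> * (g x / ?G))"
        using F G f(2)[of x] g(2)[of x] \<kappa> by (intro mult_left_mono powr_mult_le_add) auto
      finally show "f x powr (1 - \<kappa>) * g x powr \<kappa> \<le> ?F powr (1 - \<kappa>) * ?G powr \<kappa> * ((1 - \<kappa>) / ?F * f x + \<kappa> / ?G * g x)"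
        by simp
    qed
    also have "\<dots> = ?F powr (1 - \<kappa>) * ?G powr \<kappa> * ((1 - \<kappa>) / ?F * ?F + \<kappa> / ?G * ?G)"
      using f g by simp
    also have "\<dots> = ?F powr (1 - \<kappa>) * ?G powr \<kappa>" using F G by simp
    finally show ?thesis .
  qed
qed

section \<open>The Sobolev inequality\<close>

definition mu :: "nat \<Rightarrow> nat \<times> nat \<Rightarrow> real" where
  "mu n k = 1 + eigval n (fst k) (snd k)"

lemma mu_ge_1: "mu n k \<ge> 1"
  by (simp add: mu_def eigval_def)

lemma mu_pos [simp]: "mu n k > 0"
  using mu_ge_1[of n k] by linarith

text \<open>Bounded eigenvalues place the pairs of indices under a hyperbola, where
  \<open>sum_hyperbola_le\<close> counts them.\<close>

lemma mu_ge_prod: "n \<ge> 1 \<Longrightarrow> real (fst k + 1) * real (snd k + 1) \<le> mu n k"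
proof -
  assume n: "n \<ge> 1"
  have "fst k + snd k \<le> n * fst k + n * snd k"
    using mult_le_mono1[OF n, of "fst k + snd k"] by (simp add: algebra_simps)
  then have "(fst k + 1) * (snd k + 1) \<le> 1 + (2 * fst k * snd k + n * (fst k + snd k))" by (simp add: algebra_simps)
  then have "real ((fst k + 1) * (snd k + 1)) \<le> real (1 + (2 * fst k * snd k + n * (fst k + snd k)))"
    by (simp only: of_nat_le_iff)
  then show ?thesis unfolding mu_def eigval_def by (simp add: algebra_simps)
qed

lemma sum_inverse_squares_le: "(\<Sum>b<N. 1 / (real b + 1)\<^sup>2) \<le> 2"
proof -
  have "(\<Sum>b<Suc N. 1 / (real b + 1)\<^sup>2) \<le> 2 - 1 / (real N + 1)" for N
  proof (induction N)
    case (Suc N)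
    have "1 / (real N + 2)\<^sup>2 \<le> 1 / ((real N + 1) * (real N + 2))"
      unfolding power2_eq_square by (intro divide_left_mono mult_right_mono) auto
    also have "\<dots> = 1 / (real N + 1) - 1 / (real N + 2)" by (simp add: field_simps)
    finally show ?case using Suc.IH by (simp add: add.commute)
  qed simp
  from this[of N] have "(\<Sum>b<Suc N. 1 / (real b + 1)\<^sup>2) \<le> 2" by (rule order_trans) simp
  moreover have "(\<Sum>b<N. 1 / (real b + 1)\<^sup>2) \<le> (\<Sum>b<Suc N. 1 / (real b + 1)\<^sup>2)" by simp
  ultimately show ?thesis by (rule order_trans[rotated])
qed

text \<open>A given second index \<open>b\<close> allows at most \<open>R / (b + 1)\<close> first
  indices. The summand supplies another factor \<open>1 / (b + 1)\<close>, so the sum over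
  \<open>b\<close> converges and no logarithm appears.\<close>

lemma sum_hyperbola_le:
  fixes R :: real
  assumes R: "R \<ge> 0" and F: "finite F" "\<And>k. k \<in> F \<Longrightarrow> real (fst k + 1) * real (snd k + 1) \<le> R"
  shows "(\<Sum>k\<in>F. 1 / (real (snd k) + 1)) \<le> 2 * R"
proof -
  define N where "N = Suc (Max (snd ` F))"
  have snd: "snd k < N" if "k \<in> F" for k
    using that F by (auto simp: N_def less_Suc_eq_le intro!: Max_ge)
  have "(\<Sum>k\<in>F. 1 / (real (snd k) + 1)) = (\<Sum>b<N. \<Sum>k\<in>{k \<in> F. snd k = b}. 1 / (real (snd k) + 1))"
    using F snd by (intro sum.group[symmetric]) auto
  also have "\<dots> \<le> (\<Sum>b<N. R * (1 / (real b + 1)\<^sup>2))"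
  proof (rule sum_mono)
    fix b
    have "inj_on fst {k \<in> F. snd k = b}" by (auto simp: inj_on_def)
    then have "card {k \<in> F. snd k = b} = card (fst ` {k \<in> F. snd k = b})" by (simp add: card_image)
    also have "\<dots> \<le> card {..<nat \<lfloor>R / (real b + 1)\<rfloor>}"
    proof (rule card_mono)
      show "fst ` {k \<in> F. snd k = b} \<subseteq> {..<nat \<lfloor>R / (real b + 1)\<rfloor>}"
      proof
        fix a assume "a \<in> fst ` {k \<in> F. snd k = b}"
        then have "(a, b) \<in> F" by auto
        from F(2)[OF this] have "real a + 1 \<le> R / (real b + 1)" by (simp add: field_simps)
        then have "int a + 1 \<le> \<lfloor>R / (real b + 1)\<rfloor>" by (simp add: le_floor_iff)
        then show "a \<in> {..<nat \<lfloor>R / (real b + 1)\<rfloor>}" by simp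
      qed
    qed simp
    also have "\<dots> = nat \<lfloor>R / (real b + 1)\<rfloor>" by simp
    finally have "real (card {k \<in> F. snd k = b}) \<le> real (nat \<lfloor>R / (real b + 1)\<rfloor>)" by simp
    also have "\<dots> \<le> R / (real b + 1)" using R by (simp add: of_nat_floor)
    finally have c: "real (card {k \<in> F. snd k = b}) \<le> R / (real b + 1)" .
    have "(\<Sum>k\<in>{k \<in> F. snd k = b}. 1 / (real (snd k) + 1)) = real (card {k \<in> F. snd k = b}) * (1 / (real b + 1))"
      by simp
    also have "\<dots> \<le> R / (real b + 1) * (1 / (real b + 1))" by (intro mult_right_mono c) auto
    finally show "(\<Sum>k\<in>{k \<in> F. snd k = b}. 1 / (real (snd k) + 1)) \<le> R * (1 / (real b + 1)\<^sup>2)"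
      by (simp add: power2_eq_square)
  qed
  also have "\<dots> = R * (\<Sum>b<N. 1 / (real b + 1)\<^sup>2)" by (simp only: sum_distrib_left)
  also have "\<dots> \<le> R * 2" using R by (intro mult_left_mono sum_inverse_squares_le) auto
  finally show ?thesis by (simp add: mult.commute)
qed

text \<open>Division by \<open>mu\<close> cancels a product \<open>(a + 1) * (b + 1)\<close> and
  turns the last factor of \<open>hdim\<close> into two reciprocals, each summed under the
  hyperbola. The power is one less than \<open>n + 1\<close>, half of the homogeneous
  dimension.\<close>

lemma sum_hdim_over_mu_le:
  fixes R :: real
  assumes n: "n \<ge> 1" and F: "finite F" "\<And>k. k \<in> F \<Longrightarrow> mu n k \<le> R" and R: "R \<ge> 1"
  shows "(\<Sum>k\<in>F. real (hdim n (fst k) (snd k)) / mu n k) \<le> 4 * R ^ n"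
proof -
  have FR: "real (fst k + 1) * real (snd k + 1) \<le> R" if "k \<in> F" for k
    using mu_ge_prod[OF n, of k] F(2)[OF that] by linarith
  have "(\<Sum>k\<in>F. real (hdim n (fst k) (snd k)) / mu n k)
      \<le> (\<Sum>k\<in>F. R ^ (n - 1) * (1 / (real (snd k) + 1) + 1 / (real (fst k) + 1)))"
  proof (rule sum_mono)
    fix k assume k: "k \<in> F"
    let ?A = "real (fst k) + 1" and ?B = "real (snd k) + 1"
    have AB: "?A * ?B \<le> R" "?A * ?B \<le> mu n k" "?A * ?B > 0" using FR[OF k] mu_ge_prod[OF n, of k] by (simp_all add: add_pos_nonneg add.commute)
    have "real (hdim n (fst k) (snd k)) / mu n k = (?A * ?B) ^ (n - 1) * (?A + ?B) / mu n k"
      unfolding hdim_def of_nat_mult of_nat_power of_nat_add power_mult_distrib by simp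
    also have "\<dots> \<le> (?A * ?B) ^ (n - 1) * (?A + ?B) / (?A * ?B)"
      using AB by (intro divide_left_mono mult_pos_pos) (auto intro!: mult_nonneg_nonneg)
    also have "\<dots> = (?A * ?B) ^ (n - 1) * (1 / ?B + 1 / ?A)" by (simp add: field_simps)
    also have "\<dots> \<le> R ^ (n - 1) * (1 / ?B + 1 / ?A)"
      using AB by (intro mult_right_mono power_mono) auto
    finally show "real (hdim n (fst k) (snd k)) / mu n k \<le> R ^ (n - 1) * (1 / ?B + 1 / ?A)" .
  qed
  also have "\<dots> = R ^ (n - 1) * ((\<Sum>k\<in>F. 1 / (real (snd k) + 1)) + (\<Sum>k\<in>F. 1 / (real (fst k) + 1)))"
    by (simp only: sum_distrib_left[symmetric] sum.distrib)
  also have "\<dots> \<le> R ^ (n - 1) * (2 * R + 2 * R)"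
  proof (intro mult_left_mono add_mono)
    show "(\<Sum>k\<in>F. 1 / (real (snd k) + 1)) \<le> 2 * R"
      using R by (intro sum_hyperbola_le F FR) auto
    have "(\<Sum>k\<in>F. 1 / (real (fst k) + 1)) = (\<Sum>k\<in>prod.swap ` F. 1 / (real (snd k) + 1))"
      by (subst sum.reindex) auto
    also have "\<dots> \<le> 2 * R"
      using R F FR by (intro sum_hyperbola_le) (auto simp: mult.commute)
    finally show "(\<Sum>k\<in>F. 1 / (real (fst k) + 1)) \<le> 2 * R" .
  qed (use R in auto)
  also have "\<dots> = 4 * R ^ n" using n by (cases n) auto
  finally show ?thesis .
qed

text \<open>
  Levels \<open>S i\<close> at which the \<open>q\<close>-th power is integrated; weighting \<open>\<bar>f\<bar>\<^sup>2\<close> (and not the measure of the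
  superlevel sets) by \<open>\<bar>f\<bar>\<^sup>q\<^sup>-\<^sup>2\<close> keeps the constants bounded as \<open>q\<close> decreases to 2.
\<close>

lemma powr_levels:
  fixes S :: "nat \<Rightarrow> real"
  assumes S: "mono S" "\<And>i. S i > 0" and r: "r \<ge> 0" and y: "y \<ge> 0" "y \<le> S m"
  shows "y powr r \<le> S 0 powr r + (\<Sum>i<m. if S i \<le> y then S (Suc i) powr r - S i powr r else 0)"
  using y
proof (induction m)
  case 0
  then show ?case using r by (simp add: powr_mono2)
next
  case (Suc m)
  have inc: "S i powr r \<le> S j powr r" if "i \<le> j" for i j
    using S that r by (intro powr_mono2) (auto simp: less_imp_le monoD)
  show ?case
  proof (cases "y \<le> S m")
    case True
    then show ?thesis using Suc inc[of m "Suc m"] by auto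
  next
    case False
    then have "S i \<le> y" if "i < Suc m" for i
      using monoD[OF S(1), of i m] that by auto
    then have "(\<Sum>i<Suc m. if S i \<le> y then S (Suc i) powr r - S i powr r else 0) = (\<Sum>i<Suc m. S (Suc i) powr r - S i powr r)"
      by (intro sum.cong) auto
    also have "\<dots> = S (Suc m) powr r - S 0 powr r" by (rule sum_lessThan_telescope)
    finally show ?thesis using Suc.prems r by (simp add: powr_mono2)
  qed
qed

lemma norm_square_powr: "q \<ge> 2 \<Longrightarrow> norm (x :: complex) powr q = (norm x)\<^sup>2 * norm x powr (q - 2)"
  by (cases "x = 0") (auto simp: powr_diff powr_numeral)

text \<open>With levels proportional to \<open>R powr \<tau>\<close>, where
  \<open>\<tau> = (n + 1 - \<sigma>) / 2\<close>, the level to the power \<open>q - 2\<close> is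
  then proportional to \<open>R powr \<sigma>\<close>, the Sobolev weight.\<close>

lemma sobolev_exponents:
  fixes n q \<sigma> :: real
  assumes "q \<ge> 2" "\<sigma> = (n + 1) * (1 - 2 / q)"
  shows "(n + 1 - \<sigma>) / 2 * (q - 2) = \<sigma>"
proof -
  have "n + 1 - \<sigma> = 2 * (n + 1) / q" using assms by (simp add: field_simps)
  moreover have "\<sigma> * q = (n + 1) * (q - 2)" using assms by (simp add: field_simps)
  ultimately show ?thesis using assms by (simp add: field_simps)
qed

text \<open>
  Low frequencies are bounded uniformly by half the level, so where \<open>\<bar>f\<bar>\<close> exceeds the level it is at
  most twice its high-frequency part.
\<close>

lemma sobolev:
  fixes h :: "nat \<times> nat \<Rightarrow> complex^'m::finite \<Rightarrow> complex"
  assumes n: "CARD('m) = n + 1" "n \<ge> 1" and F: "finite F" and h: "\<And>k. k \<in> F \<Longrightarrow> h k \<in> harmk k"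
    and q: "q \<ge> 2" and \<sigma>: "\<sigma> = (n + 1) * (1 - 2 / q)" "\<sigma> \<le> 1"
  defines "A \<equiv> sqrt (\<Sum>k\<in>F. mu n k powr \<sigma> * sq_norm (h k))"
    and "\<kappa> \<equiv> 4 / sqrt (sphere_vol TYPE('m))"
  shows "(LINT z|sphere_measure. norm (\<Sum>k\<in>F. h k z) powr q) \<le> (8 * max 1 \<kappa> * A) powr q"
proof -
  let ?V = "sphere_vol TYPE('m)"
  have V: "?V > 0" by (rule measure_sphere_pos)
  have n2: "CARD('m) \<ge> 2" using n by simp
  have \<sigma>0: "\<sigma> \<ge> 0" using q by (simp add: \<sigma>)
  have \<kappa>: "\<kappa> > 0" using V by (simp add: \<kappa>_def)
  have A2: "A\<^sup>2 = (\<Sum>k\<in>F. mu n k powr \<sigma> * sq_norm (h k))"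
    unfolding A_def by (intro real_sqrt_pow2 sum_nonneg) simp
  have A0: "A \<ge> 0" by (simp add: A_def sum_nonneg)
  have cont: "continuous_on (sphere 0 1) (\<lambda>z. \<Sum>k\<in>G. h k z)" if "G \<subseteq> F" for G
    using that by (intro continuous_on_sum cpoly_continuous harm_cpoly[OF h]) auto
  have sub: "finite G" "sq_norm (\<lambda>z. \<Sum>k\<in>G. h k z) = (\<Sum>k\<in>G. sq_norm (h k))" if "G \<subseteq> F" for G
  proof -
    show "finite G" using that F by (rule finite_subset)
    then show "sq_norm (\<lambda>z. \<Sum>k\<in>G. h k z) = (\<Sum>k\<in>G. sq_norm (h k))"
      using that h by (intro sq_norm_harm_sum[OF n2]) auto
  qed
  define \<tau> where "\<tau> = (real n + 1 - \<sigma>) / 2"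
  have \<tau>: "\<tau> > 0" using \<sigma>(2) n by (simp add: \<tau>_def)
  \<comment> \<open>Cauchy-Schwarz with the weights \<open>mu powr \<sigma>\<close> and
    \<open>mu powr (- \<sigma>)\<close>. For \<open>\<sigma> \<le> 1\<close> the second sum is at
    most \<open>4 * R powr (n + 1 - \<sigma>)\<close> over the volume. The root of it gives
    \<open>\<kappa> / 2\<close>, so low frequencies take up half of the level
    \<open>S i\<close>.\<close>
  have low: "norm (\<Sum>k\<in>G. h k z) \<le> \<kappa> / 2 * A * R powr \<tau>"
    if G: "G \<subseteq> F" "\<And>k. k \<in> G \<Longrightarrow> mu n k \<le> R" and R: "R \<ge> 1" and z: "z \<in> sphere 0 1" for G R z
  proof -
    let ?d = "\<lambda>k. real (hdim n (fst k) (snd k)) / ?V"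
    have "norm (\<Sum>k\<in>G. h k z) \<le> (\<Sum>k\<in>G. sqrt (?d k * mu n k powr (- \<sigma>)) * sqrt (mu n k powr \<sigma> * sq_norm (h k)))"
    proof (intro order_trans[OF norm_sum] sum_mono)
      fix k assume "k \<in> G"
      then have k: "h k \<in> harm (fst k) (snd k)" using G(1) h by blast
      have "norm (h k z) = sqrt ((norm (h k z))\<^sup>2)" by simp
      also have "\<dots> \<le> sqrt (?d k * sq_norm (h k))"
        using harm_pointwise[OF n k z] by (intro real_sqrt_le_mono)
      also have "?d k * sq_norm (h k) = ?d k * mu n k powr (- \<sigma>) * (mu n k powr \<sigma> * sq_norm (h k))"
        by (simp add: powr_minus less_imp_neq[OF mu_pos, symmetric])
      finally show "norm (h k z) \<le> sqrt (?d k * mu n k powr (- \<sigma>)) * sqrt (mu n k powr \<sigma> * sq_norm (h k))"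
        by (simp only: real_sqrt_mult)
    qed
    also have "\<dots> \<le> sqrt (\<Sum>k\<in>G. (sqrt (?d k * mu n k powr (- \<sigma>)))\<^sup>2) * sqrt (\<Sum>k\<in>G. (sqrt (mu n k powr \<sigma> * sq_norm (h k)))\<^sup>2)"
      by (intro real_le_rsqrt[OF Cauchy_Schwarz_ineq_sum, unfolded real_sqrt_mult])
    also have "(\<Sum>k\<in>G. (sqrt (?d k * mu n k powr (- \<sigma>)))\<^sup>2) = (\<Sum>k\<in>G. ?d k * mu n k powr (- \<sigma>))"
      using V by (intro sum.cong refl real_sqrt_pow2) auto
    also have "(\<Sum>k\<in>G. (sqrt (mu n k powr \<sigma> * sq_norm (h k)))\<^sup>2) = (\<Sum>k\<in>G. mu n k powr \<sigma> * sq_norm (h k))"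
      by (intro sum.cong refl real_sqrt_pow2) auto
    also have "sqrt (\<Sum>k\<in>G. ?d k * mu n k powr (- \<sigma>)) * sqrt (\<Sum>k\<in>G. mu n k powr \<sigma> * sq_norm (h k))
        \<le> (\<kappa> / 2 * R powr \<tau>) * A"
    proof (intro mult_mono)
      have "(\<Sum>k\<in>G. ?d k * mu n k powr (- \<sigma>)) \<le> (\<Sum>k\<in>G. R powr (1 - \<sigma>) / ?V * (real (hdim n (fst k) (snd k)) / mu n k))"
      proof (rule sum_mono)
        fix k assume k: "k \<in> G"
        have "mu n k powr (- \<sigma>) = mu n k powr (1 - \<sigma>) / mu n k"
          by (simp add: powr_diff powr_minus field_simps less_imp_neq[OF mu_pos, symmetric] abs_of_pos[OF mu_pos])
        also have "\<dots> \<le> R powr (1 - \<sigma>) / mu n k"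
          using G(2)[OF k] \<sigma>(2) less_imp_le[OF mu_pos] by (intro divide_right_mono powr_mono2) auto
        finally have "?d k * mu n k powr (- \<sigma>) \<le> ?d k * (R powr (1 - \<sigma>) / mu n k)"
          using V by (intro mult_left_mono) auto
        then show "?d k * mu n k powr (- \<sigma>) \<le> R powr (1 - \<sigma>) / ?V * (real (hdim n (fst k) (snd k)) / mu n k)"
          by (simp add: field_simps)
      qed
      also have "\<dots> \<le> R powr (1 - \<sigma>) / ?V * (4 * R ^ n)"
        unfolding sum_distrib_left[symmetric]
        using V by (intro mult_left_mono sum_hdim_over_mu_le n(2) sub(1)[OF G(1)] G(2) R) auto
      also have "\<dots> = (\<kappa> / 2 * R powr \<tau>)\<^sup>2"
      proof -
        have "(R powr \<tau>)\<^sup>2 = R powr (1 - \<sigma>) * R powr real n"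
          using R by (simp add: power2_eq_square powr_add[symmetric] \<tau>_def algebra_simps)
        then show ?thesis using R V by (simp add: \<kappa>_def power_mult_distrib power_divide powr_realpow)
      qed
      finally show "sqrt (\<Sum>k\<in>G. ?d k * mu n k powr (- \<sigma>)) \<le> \<kappa> / 2 * R powr \<tau>"
        using \<kappa> by (intro real_le_lsqrt) auto
      show "sqrt (\<Sum>k\<in>G. mu n k powr \<sigma> * sq_norm (h k)) \<le> A"
        unfolding A_def by (intro real_sqrt_le_mono sum_mono2 F G) auto
    qed (use \<kappa> in \<open>auto intro!: sum_nonneg\<close>)
    finally show ?thesis by (simp add: mult_ac)
  qed
  let ?f = "\<lambda>z. \<Sum>k\<in>F. h k z"
  show ?thesis
  proof (cases "A = 0")
    case True
    have "sq_norm (h k) = 0" if "k \<in> F" for k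
    proof -
      have "(\<Sum>k\<in>F. mu n k powr \<sigma> * sq_norm (h k)) = 0" using True A2 by simp
      then have "mu n k powr \<sigma> * sq_norm (h k) = 0"
        using that F by (subst (asm) sum_nonneg_eq_0_iff) auto
      then show ?thesis by (simp add: less_imp_neq[OF mu_pos, symmetric])
    qed
    then have "h k z = 0" if "k \<in> F" "z \<in> sphere 0 1" for k z
      using that by (intro continuous_sq_norm_zero cpoly_continuous harm_cpoly[OF h]) auto
    then have "(LINT z|sphere_measure. norm (?f z) powr q) = (LINT z|(sphere_measure :: (complex^'m) measure). 0)"
      by (intro Bochner_Integration.integral_cong) auto
    then show ?thesis by simp
  next
    case False
    then have A: "A > 0" using A0 by simp
    define S where "S i = \<kappa> * A * (2 ^ i) powr \<tau>" for i :: nat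
    have S: "mono S" "S i > 0" for i
      using \<kappa> A \<tau> by (auto simp: S_def mono_def intro!: mult_left_mono powr_mono2 power_increasing)
    \<comment> \<open>The dyadic scale of \<open>mu n k\<close>; being the least one, it overshoots
      by a factor of at most 2.\<close>
    define ix where "ix k = (LEAST i. mu n k \<le> 2 ^ i)" for k
    have "\<exists>i. mu n k \<le> 2 ^ i" for k using real_arch_pow[of 2 "mu n k"] by (auto intro: less_imp_le)
    then have ix: "mu n k \<le> 2 ^ ix k" for k unfolding ix_def by (rule LeastI_ex)
    have ix2: "2 ^ ix k \<le> 2 * mu n k" for k
    proof (cases "ix k")
      case 0
      then show ?thesis using mu_ge_1[of n k] by simp
    next
      case (Suc i)
      then have "\<not> mu n k \<le> 2 ^ i" unfolding ix_def by (metis not_less_Least lessI)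
      then show ?thesis using Suc by simp
    qed
    define m where "m = Max (insert 0 (ix ` F))"
    have m: "ix k \<le> m" if "k \<in> F" for k using that F by (auto simp: m_def)
    define r where "r = q - 2"
    define H where "H i = (\<lambda>z. \<Sum>k\<in>{k \<in> F. i < ix k}. h k z)" for i
    define T where "T i = S i powr r" for i
    have Tinc: "T i \<le> T (Suc i)" for i
      unfolding T_def using S q by (intro powr_mono2) (auto simp: r_def less_imp_le monoD)
    have T0: "T i \<ge> 0" for i by (simp add: T_def)
    have lowi: "norm (\<Sum>k\<in>{k \<in> F. ix k \<le> i}. h k z) \<le> S i / 2" if z: "z \<in> sphere 0 1" for i z
    proof -
      have "mu n k \<le> 2 ^ i" if "ix k \<le> i" for k
        using ix[of k] power_increasing[OF that, of "2::real"] by linarith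
      then have "norm (\<Sum>k\<in>{k \<in> F. ix k \<le> i}. h k z) \<le> \<kappa> / 2 * A * (2 ^ i) powr \<tau>"
        by (intro low z) auto
      then show ?thesis by (simp add: S_def)
    qed
    have split: "?f z = (\<Sum>k\<in>{k \<in> F. ix k \<le> i}. h k z) + H i z" for i z
      unfolding H_def using F by (subst sum.union_disjoint[symmetric]) (auto intro!: sum.cong)
    have pt: "norm (?f z) powr q \<le> T 0 * (norm (?f z))\<^sup>2 + (\<Sum>i<m. (T (Suc i) - T i) * (4 * (norm (H i z))\<^sup>2))"
      if z: "z \<in> sphere 0 1" for z
    proof -
      have "{k \<in> F. ix k \<le> m} = F" using m by auto
      then have y: "norm (?f z) \<le> S m" using lowi[OF z, of m] S(2)[of m] by simp
      have "norm (?f z) powr q = (norm (?f z))\<^sup>2 * norm (?f z) powr r"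
        unfolding r_def by (rule norm_square_powr[OF q])
      also have "\<dots> \<le> (norm (?f z))\<^sup>2 * (T 0 + (\<Sum>i<m. if S i \<le> norm (?f z) then T (Suc i) - T i else 0))"
        unfolding T_def using S q y by (intro mult_left_mono powr_levels) (auto simp: r_def)
      also have "\<dots> = T 0 * (norm (?f z))\<^sup>2 + (\<Sum>i<m. if S i \<le> norm (?f z) then (T (Suc i) - T i) * (norm (?f z))\<^sup>2 else 0)"
        by (simp add: distrib_left sum_distrib_left mult.commute if_distrib cong: if_cong)
      also have "\<dots> \<le> T 0 * (norm (?f z))\<^sup>2 + (\<Sum>i<m. (T (Suc i) - T i) * (4 * (norm (H i z))\<^sup>2))"
      proof (intro add_left_mono sum_mono)
        fix i
        show "(if S i \<le> norm (?f z) then (T (Suc i) - T i) * (norm (?f z))\<^sup>2 else 0) \<le> (T (Suc i) - T i) * (4 * (norm (H i z))\<^sup>2)"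
        proof (cases "S i \<le> norm (?f z)")
          case True
          have "norm (?f z) \<le> norm (\<Sum>k\<in>{k \<in> F. ix k \<le> i}. h k z) + norm (H i z)"
            unfolding split[of z i] by (rule norm_triangle_ineq)
          then have "norm (?f z) \<le> 2 * norm (H i z)" using lowi[OF z, of i] True by linarith
          then have "(norm (?f z))\<^sup>2 \<le> (2 * norm (H i z))\<^sup>2" by (intro power_mono) auto
          then show ?thesis using True Tinc[of i] by (auto simp: power_mult_distrib intro!: mult_left_mono)
        qed (use Tinc[of i] in auto)
      qed
      finally show ?thesis .
    qed
    have Hc: "continuous_on (sphere 0 1) (H i)" for i unfolding H_def by (rule cont) auto
    have fc: "continuous_on (sphere 0 1) ?f" by (rule cont) auto
    have isq: "integrable sphere_measure (\<lambda>z. (norm (H i z))\<^sup>2)" "integrable sphere_measure (\<lambda>z. (norm (?f z))\<^sup>2)" for i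
      using L2s_continuous[OF Hc] L2s_continuous[OF fc] by (auto simp: L2s_def)
    have "(LINT z|sphere_measure. norm (?f z) powr q)
        \<le> (LINT z|sphere_measure. T 0 * (norm (?f z))\<^sup>2 + (\<Sum>i<m. (T (Suc i) - T i) * (4 * (norm (H i z))\<^sup>2)))"
    proof (rule integral_mono)
      show "integrable sphere_measure (\<lambda>z. norm (?f z) powr q)"
        using q by (intro continuous_on_sphere_integrable continuous_on_powr' continuous_on_norm fc continuous_on_const) auto
      show "integrable sphere_measure (\<lambda>z. T 0 * (norm (?f z))\<^sup>2 + (\<Sum>i<m. (T (Suc i) - T i) * (4 * (norm (H i z))\<^sup>2)))"
        using isq by (intro Bochner_Integration.integrable_add integrable_mult_right integrable_sum) auto
    qed (use pt in simp)
    also have "\<dots> = T 0 * sq_norm ?f + (\<Sum>i<m. (T (Suc i) - T i) * (4 * sq_norm (H i)))"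
      using isq by (simp add: sq_norm_def)
    also have "\<dots> \<le> 4 * (T 0 * (\<Sum>k\<in>F. sq_norm (h k)) + (\<Sum>i<m. (T (Suc i) - T i) * (\<Sum>k\<in>F. if i < ix k then sq_norm (h k) else 0)))"
    proof -
      have "sq_norm (H i) = (\<Sum>k\<in>F. if i < ix k then sq_norm (h k) else 0)" for i
        unfolding H_def using F by (subst sub(2)) (auto simp: sum.inter_filter)
      then have "(\<Sum>i<m. (T (Suc i) - T i) * (4 * sq_norm (H i)))
          = 4 * (\<Sum>i<m. (T (Suc i) - T i) * (\<Sum>k\<in>F. if i < ix k then sq_norm (h k) else 0))"
        by (subst sum_distrib_left) (simp only: mult.left_commute)
      moreover have f: "sq_norm ?f = (\<Sum>k\<in>F. sq_norm (h k))" by (rule sub(2)) simp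
      moreover have "T 0 * (\<Sum>k\<in>F. sq_norm (h k)) \<ge> 0" using T0 by (intro mult_nonneg_nonneg sum_nonneg) auto
      ultimately show ?thesis unfolding distrib_left[of 4] f by linarith
    qed
    \<comment> \<open>After exchanging the sums, the increments of \<open>T\<close> telescope up to
      the scale of \<open>k\<close>: each component is weighted by \<open>T (ix k)\<close>, which is
      of order \<open>mu n k powr \<sigma>\<close>.\<close>
    also have "T 0 * (\<Sum>k\<in>F. sq_norm (h k)) + (\<Sum>i<m. (T (Suc i) - T i) * (\<Sum>k\<in>F. if i < ix k then sq_norm (h k) else 0))
        = (\<Sum>k\<in>F. sq_norm (h k) * T (ix k))"
    proof -
      have "(\<Sum>i<m. (T (Suc i) - T i) * (\<Sum>k\<in>F. if i < ix k then sq_norm (h k) else 0))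
          = (\<Sum>k\<in>F. \<Sum>i<m. (T (Suc i) - T i) * (if i < ix k then sq_norm (h k) else 0))"
        unfolding sum_distrib_left by (rule sum.swap)
      also have "\<dots> = (\<Sum>k\<in>F. sq_norm (h k) * (T (ix k) - T 0))"
      proof (intro sum.cong refl)
        fix k assume k: "k \<in> F"
        have "(\<Sum>i<m. (T (Suc i) - T i) * (if i < ix k then sq_norm (h k) else 0))
            = (\<Sum>i\<in>{i \<in> {..<m}. i < ix k}. (T (Suc i) - T i) * sq_norm (h k))"
          by (subst sum.inter_filter) (auto intro!: sum.cong)
        also have "{i \<in> {..<m}. i < ix k} = {..<ix k}" using m[OF k] by auto
        also have "(\<Sum>i<ix k. (T (Suc i) - T i) * sq_norm (h k)) = (T (ix k) - T 0) * sq_norm (h k)"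
          unfolding sum_distrib_right[symmetric] sum_lessThan_telescope ..
        finally show "(\<Sum>i<m. (T (Suc i) - T i) * (if i < ix k then sq_norm (h k) else 0)) = sq_norm (h k) * (T (ix k) - T 0)"
          by (simp add: mult.commute)
      qed
      finally show ?thesis by (simp add: right_diff_distrib sum_subtractf sum_distrib_left mult.commute)
    qed
    also have "4 * (\<Sum>k\<in>F. sq_norm (h k) * T (ix k)) \<le> 4 * (\<Sum>k\<in>F. sq_norm (h k) * ((\<kappa> * A) powr r * (2 * mu n k powr \<sigma>)))"
    proof (intro mult_left_mono sum_mono)
      fix k
      have "T (ix k) = (\<kappa> * A) powr r * ((2 ^ ix k) powr (\<tau> * r))"
        using \<kappa> A by (simp add: T_def S_def powr_mult powr_powr)
      also have "\<tau> * r = \<sigma>" unfolding \<tau>_def r_def using sobolev_exponents[OF q, of \<sigma> "real n"] \<sigma>(1) by simp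
      also have "(2 ^ ix k) powr \<sigma> \<le> (2 * mu n k) powr \<sigma>" using ix2[of k] \<sigma>0 by (intro powr_mono2) auto
      also have "\<dots> = 2 powr \<sigma> * mu n k powr \<sigma>" using less_imp_le[OF mu_pos] by (simp add: powr_mult)
      also have "\<dots> \<le> 2 powr 1 * mu n k powr \<sigma>" using \<sigma>(2) by (intro mult_right_mono powr_mono) auto
      finally show "T (ix k) \<le> (\<kappa> * A) powr r * (2 * mu n k powr \<sigma>)" by (simp add: mult_left_mono)
    qed auto
    also have "\<dots> = 8 * (\<kappa> * A) powr r * A\<^sup>2"
      unfolding A2 by (simp add: sum_distrib_left mult_ac)
    \<comment> \<open>The constants go inside the power \<open>q\<close>, at the cost of
      \<open>max 1 \<kappa>\<close>, so that after taking the root they no longer depend on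
      \<open>q\<close>.\<close>
    also have "\<dots> \<le> 8 powr q * (max 1 \<kappa>) powr q * A powr q"
    proof -
      have "(\<kappa> * A) powr r * A\<^sup>2 = \<kappa> powr r * (A powr r * A powr 2)"
        using A by (simp add: powr_mult powr_numeral)
      also have "A powr r * A powr 2 = A powr q" unfolding powr_add[symmetric] r_def by simp
      finally have e: "(\<kappa> * A) powr r * A\<^sup>2 = \<kappa> powr r * A powr q" .
      have "\<kappa> powr r \<le> (max 1 \<kappa>) powr r" using \<kappa> q by (intro powr_mono2) (auto simp: r_def)
      also have "\<dots> \<le> (max 1 \<kappa>) powr q" by (intro powr_mono) (auto simp: r_def)
      finally have "8 powr 1 * \<kappa> powr r \<le> 8 powr q * (max 1 \<kappa>) powr q"
        using q by (intro mult_mono powr_mono) auto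
      then have "8 * \<kappa> powr r * A powr q \<le> 8 powr q * (max 1 \<kappa>) powr q * A powr q"
        by (intro mult_right_mono) auto
      then show ?thesis using e by (simp add: mult.assoc)
    qed
    also have "\<dots> = (8 * max 1 \<kappa> * A) powr q" using A \<kappa> by (simp add: powr_mult)
    finally show ?thesis .
  qed
qed

section \<open>The divisor bound and counting pairs of frequencies\<close>

lemma card_divisors_mult_le:
  fixes a b :: nat
  assumes "a > 0" "b > 0"
  shows "card {d. d dvd a * b} \<le> card {d. d dvd a} * card {d. d dvd b}"
proof -
  have "{d. d dvd a * b} \<subseteq> (\<lambda>(x, y). x * y) ` ({d. d dvd a} \<times> {d. d dvd b})"
  proof
    fix d assume "d \<in> {d. d dvd a * b}"
    then obtain x y where "d = x * y" "x dvd a" "y dvd b" using division_decomp[of d a b] by auto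
    then show "d \<in> (\<lambda>(x, y). x * y) ` ({d. d dvd a} \<times> {d. d dvd b})" by auto
  qed
  moreover have fin: "finite ({d. d dvd a} \<times> {d. d dvd b})" using assms by (simp add: finite_divisors_nat)
  ultimately have "card {d. d dvd a * b} \<le> card ((\<lambda>(x, y). x * y) ` ({d. d dvd a} \<times> {d. d dvd b}))"
    by (intro card_mono) auto
  also have "\<dots> \<le> card ({d. d dvd a} \<times> {d. d dvd b})" by (rule card_image_le[OF fin])
  finally show ?thesis by (simp add: card_cartesian_product)
qed

lemma card_divisors_prime_power_le:
  fixes p :: nat
  assumes "prime p"
  shows "card {d. d dvd p ^ e} \<le> e + 1"
proof -
  have "{d. d dvd p ^ e} \<subseteq> (\<lambda>i. p ^ i) ` {..e}"
    using divides_primepow_nat[OF assms] by auto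
  then have "card {d. d dvd p ^ e} \<le> card ((\<lambda>i. p ^ i) ` {..e})" by (intro card_mono) auto
  also have "\<dots> \<le> card {..e}" by (rule card_image_le) simp
  finally show ?thesis by simp
qed

text \<open>The number of divisors is bounded by the product of \<open>i + 1\<close> over the prime
  powers \<open>p ^ i\<close>. For \<open>p \<ge> N\<close> the inequality
  \<open>i + 1 \<le> 2 ^ i \<le> (p powr \<epsilon>) ^ i\<close> costs nothing; each of the at most
  \<open>N\<close> smaller primes costs a factor \<open>K\<close>.\<close>

lemma divisor_bound:
  fixes \<epsilon> :: real
  assumes e: "\<epsilon> > 0"
  obtains C where "C > 0" "\<And>m :: nat. m > 0 \<Longrightarrow> real (card {d. d dvd m}) \<le> C * real m powr \<epsilon>"
proof -
  define N where "N = nat \<lceil>2 powr (1 / \<epsilon>)\<rceil>"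
  \<comment> \<open>\<open>1 + i * (\<epsilon> * ln 2)\<close> is at most
    \<open>2 powr (\<epsilon> * i)\<close>, and multiplied by \<open>K\<close> it is at least
    \<open>i + 1\<close>.\<close>
  define K where "K = max 1 (1 / (\<epsilon> * ln 2))"
  have K1: "K \<ge> 1" by (simp add: K_def)
  have large: "2 \<le> real p powr \<epsilon>" if "N \<le> p" for p
  proof -
    have "2 powr (1 / \<epsilon>) \<le> real p" using that unfolding N_def by linarith
    then have "(2 powr (1 / \<epsilon>)) powr \<epsilon> \<le> real p powr \<epsilon>" using e by (intro powr_mono2) auto
    then show ?thesis using e by (simp add: powr_powr)
  qed
  have small: "real i + 1 \<le> K * (real p powr \<epsilon>) ^ i" if p: "p \<ge> 2" for p i :: nat
  proof -
    have l: "\<epsilon> * ln 2 > 0" using e by simp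
    have "1 / (\<epsilon> * ln 2) \<le> K" by (simp add: K_def)
    then have "1 \<le> K * (\<epsilon> * ln 2)" using l by (simp only: pos_divide_le_eq)
    then have "real i * 1 \<le> real i * (K * (\<epsilon> * ln 2))" by (rule mult_left_mono) simp
    then have "real i + 1 \<le> K * (1 + real i * (\<epsilon> * ln 2))" using K1 by (simp add: distrib_left mult_ac)
    also have "1 + real i * (\<epsilon> * ln 2) \<le> exp (real i * (\<epsilon> * ln 2))" by (rule exp_ge_add_one_self)
    also have "\<dots> = (2 powr \<epsilon>) ^ i" by (simp add: powr_def exp_of_nat_mult)
    also have "\<dots> \<le> (real p powr \<epsilon>) ^ i" using p e by (intro power_mono powr_mono2) auto
    finally show ?thesis using K1 by (simp add: mult_left_mono)
  qed
  let ?S = "\<lambda>m. {p. p < N \<and> prime p \<and> p dvd m}"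
  have fin: "finite (?S m)" for m by (rule finite_subset[of _ "{..<N}"]) auto
  \<comment> \<open>\<open>K\<close> is charged once for each small prime divisor. The induction
    splits off the full power of one prime, so this prime no longer divides the rest.\<close>
  have main: "m > 0 \<Longrightarrow> real (card {d. d dvd m}) \<le> K ^ card (?S m) * real m powr \<epsilon>" for m :: nat
  proof (induction m rule: less_induct)
    case (less m)
    show ?case
    proof (cases "m = 1")
      case True
      then show ?thesis using K1 by simp
    next
      case False
      obtain p where p: "prime p" "p dvd m" using prime_factor_nat[OF False] by blast
      define i where "i = multiplicity p m"
      have "\<not> is_unit p" using p(1) by auto
      then obtain y where y: "m = p ^ i * y" "\<not> p dvd y"
        unfolding i_def using less.prems by (metis multiplicity_decompose' neq0_conv)
      have i: "i \<ge> 1" using y p by (cases i) auto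
      have y0: "y > 0" using y less.prems by (auto intro: Nat.gr0I)
      have pi: "p ^ i > 1" using p(1) i prime_gt_1_nat[of p] by (intro one_less_power) auto
      have ym: "y < m" using y(1) pi y0 by simp
      have p2: "p \<ge> 2" using p(1) by (rule prime_ge_2_nat)
      have m': "real m powr \<epsilon> = (real p powr \<epsilon>) ^ i * real y powr \<epsilon>"
        using p2 by (simp add: y(1) powr_mult powr_power mult.commute powr_realpow[symmetric] powr_powr)
      have Sy: "?S y \<subseteq> ?S m" using y(1) by auto
      have "real (card {d. d dvd m}) \<le> real (card {d. d dvd p ^ i} * card {d. d dvd y})"
        unfolding y(1) by (intro of_nat_mono card_divisors_mult_le y0 less_trans[OF zero_less_one pi])
      also have "\<dots> \<le> (real i + 1) * (K ^ card (?S y) * real y powr \<epsilon>)"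
        unfolding of_nat_mult
      proof (intro mult_mono)
        show "real (card {d. d dvd p ^ i}) \<le> real i + 1"
          using card_divisors_prime_power_le[OF p(1), of i] by linarith
      qed (use less.IH[OF ym y0] in auto)
      also have "\<dots> \<le> K ^ card (?S m) * ((real p powr \<epsilon>) ^ i * real y powr \<epsilon>)"
      proof (cases "p < N")
        case True
        have "p \<in> ?S m" "p \<notin> ?S y" using True p y(2) by auto
        then have "?S y \<subset> ?S m" using Sy by blast
        then have "card (?S y) < card (?S m)" using fin by (intro psubset_card_mono)
        then have "K * K ^ card (?S y) \<le> K ^ card (?S m)"
          using K1 power_increasing[of "Suc (card (?S y))" "card (?S m)" K] by simp
        then have "(K * K ^ card (?S y)) * ((real p powr \<epsilon>) ^ i * real y powr \<epsilon>) \<le> K ^ card (?S m) * ((real p powr \<epsilon>) ^ i * real y powr \<epsilon>)"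
          by (intro mult_right_mono) auto
        moreover have "(real i + 1) * (K ^ card (?S y) * real y powr \<epsilon>) \<le> (K * (real p powr \<epsilon>) ^ i) * (K ^ card (?S y) * real y powr \<epsilon>)"
          using small[OF p2, of i] K1 by (intro mult_right_mono) auto
        ultimately show ?thesis by (simp add: mult_ac)
      next
        case False
        have "real i + 1 \<le> 2 ^ i" using less_exp[of i] by (metis Suc_eq_plus1 Suc_leI of_nat_1 of_nat_add of_nat_le_iff of_nat_numeral of_nat_power)
        also have "\<dots> \<le> (real p powr \<epsilon>) ^ i" using large[of p] False by (intro power_mono) auto
        finally have 1: "real i + 1 \<le> (real p powr \<epsilon>) ^ i" .
        have "K ^ card (?S y) \<le> K ^ card (?S m)"
          using K1 card_mono[OF fin Sy] by (intro power_increasing) auto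
        then have "(real i + 1) * (K ^ card (?S y) * real y powr \<epsilon>) \<le> (real p powr \<epsilon>) ^ i * (K ^ card (?S m) * real y powr \<epsilon>)"
          using 1 K1 by (intro mult_mono mult_right_mono) auto
        then show ?thesis by (simp add: mult_ac)
      qed
      finally show ?thesis by (simp only: m')
    qed
  qed
  have "real (card {d. d dvd m}) \<le> K ^ N * real m powr \<epsilon>" if "m > 0" for m :: nat
  proof -
    have "card (?S m) \<le> card {..<N}" by (intro card_mono) auto
    then have "K ^ card (?S m) \<le> K ^ N" using K1 by (intro power_increasing) auto
    then show ?thesis using main[OF that] by (meson mult_right_mono order_trans powr_ge_zero)
  qed
  then show ?thesis using that[of "K ^ N"] K1 by auto
qed

section \<open>Resonances between pairs of frequencies\<close>

definition lam :: "nat \<Rightarrow> nat \<times> nat \<Rightarrow> int" where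
  "lam n k = int (2 * fst k * snd k + n * (fst k + snd k))"

text \<open>The weight of \<open>harmk k\<close> under the circle action whose orbits are the Hopf
  fibres.\<close>

definition hopf :: "nat \<times> nat \<Rightarrow> int" where
  "hopf k = int (fst k) - int (snd k)"

text \<open>The shift by \<open>n\<close> completes the square in \<open>deg_hopf\<close>.\<close>

definition deg :: "nat \<Rightarrow> nat \<times> nat \<Rightarrow> int" where
  "deg n k = int (fst k + snd k + n)"

lemma eigval_lam: "eigval n (fst k) (snd k) = of_int (lam n k)"
  by (simp add: eigval_def lam_def)

text \<open>Up to constants the eigenvalue is a difference of squares; so, once the values of
  \<open>hopf\<close> are fixed, a difference of eigenvalues factors into integers.\<close>

lemma deg_hopf: "(deg n k)\<^sup>2 - (hopf k)\<^sup>2 = 2 * lam n k + (int n)\<^sup>2"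
  by (simp add: deg_def hopf_def lam_def power2_eq_square algebra_simps)

lemma deg_hopf_inj: "deg n k = deg n k' \<Longrightarrow> hopf k = hopf k' \<Longrightarrow> k = k'"
  by (simp add: deg_def hopf_def prod_eq_iff)

text \<open>Time and the Hopf fibres together separate all bidegrees, so only pairs
  \<open>(k, k)\<close> have both differences equal to 0.\<close>

lemma lam_hopf_inj:
  assumes "lam n k = lam n k'" "hopf k = hopf k'"
  shows "k = k'"
proof -
  have "(deg n k)\<^sup>2 = (deg n k')\<^sup>2" using deg_hopf[of n k] deg_hopf[of n k'] assms by simp
  then have "deg n k = deg n k'" by (simp add: power2_eq_iff_nonneg deg_def)
  then show ?thesis using assms by (auto intro: deg_hopf_inj)
qed

text \<open>
  With \<open>hopf k' = \<beta>\<close> prescribed, \<open>(deg k - deg k') (deg k + deg k') = 2 \<tau> + B (2 \<beta> + B)\<close>, so the pair is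
  given by a divisor of the right-hand side unless that vanishes, which happens for one \<open>\<beta>\<close> at most.
\<close>

lemma card_pairs_le:
  fixes \<tau> B :: int
  assumes n: "n \<ge> 1" and F: "F \<subseteq> {..N} \<times> {..N}"
    and D: "\<And>m. 0 < m \<Longrightarrow> m \<le> (4 * N + 2 * n)\<^sup>2 \<Longrightarrow> card {d. d dvd m} \<le> D"
    and nz: "(\<tau>, B) \<noteq> (0, 0)"
  shows "card {(k, k') \<in> F \<times> F. lam n k - lam n k' = \<tau> \<and> hopf k - hopf k' = B} \<le> (2 * N + 1) * D + (2 * N + n + 1)"
proof -
  define P where "P \<beta> = {(k, k') \<in> F \<times> F. lam n k - lam n k' = \<tau> \<and> hopf k - hopf k' = B \<and> hopf k' = \<beta>}" for \<beta>
  define m where "m \<beta> = 2 * \<tau> + B * (2 * \<beta> + B)" for \<beta>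
  have finF: "finite F" using F by (rule finite_subset) simp
  have hopf: "hopf k \<in> {- int N..int N}" if "k \<in> F" for k
    using F that by (auto simp: hopf_def)
  have deg: "0 < deg n k" "deg n k \<le> 2 * int N + int n" if "k \<in> F" for k
    using F that n by (auto simp: deg_def)
  have fac: "(deg n k - deg n k') * (deg n k + deg n k') = m \<beta>" if "(k, k') \<in> P \<beta>" for k k' \<beta>
  proof -
    have "hopf k = \<beta> + B" "hopf k' = \<beta>" "lam n k - lam n k' = \<tau>" using that by (auto simp: P_def)
    moreover have "(deg n k)\<^sup>2 - (deg n k')\<^sup>2 = 2 * (lam n k - lam n k') + ((hopf k)\<^sup>2 - (hopf k')\<^sup>2)"
      using deg_hopf[of n k] deg_hopf[of n k'] by simp
    ultimately show ?thesis by (simp add: m_def power2_eq_square algebra_simps)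
  qed
  have bound: "card (P \<beta>) \<le> D + (if m \<beta> = 0 then 2 * N + n + 1 else 0)" for \<beta>
  proof (cases "m \<beta> = 0")
    case True
    \<comment> \<open>The sum of the degrees is positive, so the other factor vanishes. The pair is
      then fixed by its common degree, which ranges up to \<open>2 * N + n\<close>.\<close>
    have eq: "deg n k = deg n k'" if "(k, k') \<in> P \<beta>" for k k'
    proof -
      have "deg n k + deg n k' > 0" using deg that by (auto simp: P_def add_pos_pos)
      then show ?thesis using fac[OF that] True by auto
    qed
    have "inj_on (\<lambda>(k, k'). nat (deg n k)) (P \<beta>)"
    proof (rule inj_onI, clarify)
      fix k k' l l' assume kl: "(k, k') \<in> P \<beta>" "(l, l') \<in> P \<beta>" and "nat (deg n k) = nat (deg n l)"
      moreover have "k \<in> F" "l \<in> F" using kl by (simp_all add: P_def)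
      ultimately have kl': "deg n k = deg n l" using deg(1) by (simp add: eq_nat_nat_iff less_imp_le)
      then have "deg n k' = deg n l'" using eq[OF kl(1)] eq[OF kl(2)] by simp
      moreover have "hopf k' = hopf l'" "hopf k = hopf l" using kl by (auto simp: P_def)
      ultimately show "k = l \<and> k' = l'" using kl' by (simp add: deg_hopf_inj)
    qed
    moreover have "(\<lambda>(k, k'). nat (deg n k)) ` P \<beta> \<subseteq> {..2 * N + n}"
    proof clarify
      fix k k' assume "(k, k') \<in> P \<beta>"
      then show "nat (deg n k) \<le> 2 * N + n" using deg(2)[of k] by (auto simp: P_def)
    qed
    ultimately have "card (P \<beta>) \<le> card {..2 * N + n}" by (intro card_inj_on_le) auto
    then show ?thesis using True by simp
  next
    case False
    show ?thesis
    proof (cases "P \<beta> = {}")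
      case True then show ?thesis by simp
    next
      case ne: False
      have s: "0 < deg n k + deg n k'" "deg n k + deg n k' \<le> 4 * int N + 2 * int n" if "(k, k') \<in> P \<beta>" for k k'
        using deg[of k] deg[of k'] that by (auto simp: P_def)
      have inj: "inj_on (\<lambda>(k, k'). nat (deg n k + deg n k')) (P \<beta>)"
      proof (rule inj_onI, clarify)
        fix k k' l l' assume kl: "(k, k') \<in> P \<beta>" "(l, l') \<in> P \<beta>"
          and "nat (deg n k + deg n k') = nat (deg n l + deg n l')"
        then have e: "deg n k + deg n k' = deg n l + deg n l'"
          using s(1)[OF kl(1)] s(1)[OF kl(2)] by (simp add: eq_nat_nat_iff less_imp_le)
        then have "(deg n k - deg n k') * (deg n k + deg n k') = (deg n l - deg n l') * (deg n k + deg n k')"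
          using fac[OF kl(1)] fac[OF kl(2)] by simp
        then have "deg n k - deg n k' = deg n l - deg n l'" using s[OF kl(1)] by simp
        with e have "deg n k = deg n l" "deg n k' = deg n l'" by simp_all
        moreover have "hopf k' = hopf l'" "hopf k = hopf l" using kl by (auto simp: P_def)
        ultimately show "k = l \<and> k' = l'" by (simp add: deg_hopf_inj)
      qed
      have im: "(\<lambda>(k, k'). nat (deg n k + deg n k')) ` P \<beta> \<subseteq> {d. d dvd nat \<bar>m \<beta>\<bar>}"
      proof clarify
        fix k k' assume kk: "(k, k') \<in> P \<beta>"
        have "deg n k + deg n k' dvd m \<beta>" using fac[OF kk] by (metis dvd_triv_right)
        then show "nat (deg n k + deg n k') dvd nat \<bar>m \<beta>\<bar>"
          using s[OF kk] by (simp add: nat_dvd_iff)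
      qed
      \<comment> \<open>The difference of the degrees is at most their sum in absolute value, so the
        product is at most the square of the largest sum; this sets the range over which
        \<open>D\<close> must bound the divisors.\<close>
      have "nat \<bar>m \<beta>\<bar> \<le> (4 * N + 2 * n)\<^sup>2"
      proof -
        obtain k k' where kk: "(k, k') \<in> P \<beta>" using ne by auto
        have "\<bar>m \<beta>\<bar> = \<bar>deg n k - deg n k'\<bar> * (deg n k + deg n k')"
          using fac[OF kk] s(1)[OF kk] by (simp add: abs_mult flip: fac[OF kk])
        also have "\<dots> \<le> (deg n k + deg n k') * (deg n k + deg n k')"
        proof (intro mult_right_mono)
          have "0 < deg n k" "0 < deg n k'" using kk deg(1) by (auto simp: P_def)
          then show "\<bar>deg n k - deg n k'\<bar> \<le> deg n k + deg n k'" "0 \<le> deg n k + deg n k'" by linarith+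
        qed
        also have "\<dots> \<le> (4 * int N + 2 * int n) * (4 * int N + 2 * int n)"
          using s[OF kk] by (intro mult_mono) auto
        also have "\<dots> = int ((4 * N + 2 * n)\<^sup>2)" by (simp add: power2_eq_square)
        finally show ?thesis by linarith
      qed
      then have "card {d. d dvd nat \<bar>m \<beta>\<bar>} \<le> D" using False by (intro D) auto
      moreover have "card (P \<beta>) \<le> card {d. d dvd nat \<bar>m \<beta>\<bar>}"
        using False by (intro card_inj_on_le[OF inj im] finite_divisors_nat) auto
      ultimately show ?thesis by simp
    qed
  qed
  have "{(k, k') \<in> F \<times> F. lam n k - lam n k' = \<tau> \<and> hopf k - hopf k' = B} \<subseteq> (\<Union>\<beta>\<in>{- int N..int N}. P \<beta>)"
    using hopf by (auto simp: P_def)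
  moreover have "finite (P \<beta>)" for \<beta>
    by (rule finite_subset[of _ "F \<times> F"]) (auto simp: P_def finF)
  ultimately have "card {(k, k') \<in> F \<times> F. lam n k - lam n k' = \<tau> \<and> hopf k - hopf k' = B} \<le> card (\<Union>\<beta>\<in>{- int N..int N}. P \<beta>)"
    by (intro card_mono) auto
  also have "\<dots> \<le> (\<Sum>\<beta>\<in>{- int N..int N}. card (P \<beta>))" by (rule card_UN_le) simp
  also have "\<dots> \<le> (\<Sum>\<beta>\<in>{- int N..int N}. D + (if m \<beta> = 0 then 2 * N + n + 1 else 0))"
    by (intro sum_mono bound)
  also have "\<dots> = (2 * N + 1) * D + card {\<beta> \<in> {- int N..int N}. m \<beta> = 0} * (2 * N + n + 1)"
    by (simp add: sum.distrib sum.If_cases Int_def conj_commute nat_add_distrib nat_mult_distrib)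
  also have "\<dots> \<le> (2 * N + 1) * D + 1 * (2 * N + n + 1)"
  proof (intro add_left_mono mult_right_mono)
    have "\<beta> = \<gamma>" if "m \<beta> = 0" "m \<gamma> = 0" for \<beta> \<gamma>
    proof -
      have "B \<noteq> 0" using that nz by (auto simp: m_def)
      moreover have "B * (2 * \<beta> + B) = B * (2 * \<gamma> + B)" using that unfolding m_def by linarith
      ultimately show ?thesis by simp
    qed
    then show "card {\<beta> \<in> {- int N..int N}. m \<beta> = 0} \<le> 1" by (intro card_le_Suc0_iff_eq[THEN iffD2, unfolded One_nat_def[symmetric]])
      (auto intro: finite_subset[of _ "{- int N..int N}"])
  qed simp
  finally show ?thesis by simp
qed


section \<open>The space-time estimate\<close>

abbreviation time_measure :: "real \<Rightarrow> real measure" where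
  "time_measure T \<equiv> restrict_space lborel {-T..T}"

lemma finite_measure_time: "finite_measure (time_measure T)"
  using emeasure_compact_finite[of "{-T..T}"]
  by (intro finite_measureI) (simp add: emeasure_restrict_space space_restrict_space less_top)

lemma continuous_time_integrable:
  fixes f :: "real \<Rightarrow> 'b::{banach, second_countable_topology}"
  assumes "continuous_on UNIV f"
  shows "integrable (time_measure T) f"
proof (cases "T \<ge> 0")
  case True
  have "compact (f ` {-T..T})" using assms by (intro compact_continuous_image) (auto intro: continuous_on_subset)
  then have "bounded (f ` {-T..T})" by (rule compact_imp_bounded)
  then obtain B where "\<forall>x\<in>f ` {-T..T}. norm x \<le> B" unfolding bounded_iff by blast
  then show ?thesis
    using assms by (intro finite_measure.integrable_const_bound[OF finite_measure_time, where B=B] AE_I2 measurable_restrict_space1)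
      (auto simp: space_restrict_space intro: borel_measurable_continuous_onI)
next
  case False
  then have "{-T..T} = {}" by auto
  then show ?thesis by (simp add: integrable_restrict_space)
qed

lemma integral_time_const: "T \<ge> 0 \<Longrightarrow> (LINT t|time_measure T. c) = (2 * T) *\<^sub>R (c :: 'b::{banach, second_countable_topology})"
  by (simp add: measure_restrict_space space_restrict_space)

text \<open>The interval consists of whole periods, so the primitive takes the same value at both
  ends.\<close>

lemma integral_time_cis:
  fixes j :: int and K :: nat
  assumes "j \<noteq> 0"
  shows "(LINT t|time_measure (2 * pi * K). cis (of_int j * t)) = 0"
proof -
  let ?T = "2 * pi * real K"
  let ?F = "\<lambda>t::real. exp (\<i> * of_int j * of_real t) / (\<i> * of_int j)"
  have D: "(?F has_vector_derivative cis (of_int j * t)) (at t within {-?T..?T})" for t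
  proof -
    have "(?F has_vector_derivative (exp (\<i> * of_int j * of_real t) * (\<i> * of_int j)) / (\<i> * of_int j)) (at t within {-?T..?T})"
      by (rule has_vector_derivative_real_field) (use assms in \<open>auto intro!: derivative_eq_intros\<close>)
    then show ?thesis using assms by (simp add: cis_conv_exp mult.assoc)
  qed
  have "has_bochner_integral lborel (\<lambda>t. indicator {-?T..?T} t *\<^sub>R cis (of_int j * t)) (?F ?T - ?F (-?T))"
    by (rule has_bochner_integral_FTC_Icc) (use D in \<open>auto intro!: continuous_intros\<close>)
  moreover have "?F ?T = ?F (-?T)"
  proof -
    have e: "exp (\<i> * of_int j * of_real (s * ?T)) = 1" if "s = 1 \<or> s = -1" for s
    proof -
      have "\<i> * of_int j * of_real (s * ?T) = (2 * of_int (if s = 1 then j * int K else - (j * int K)) * pi) * \<i>"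
        using that by auto
      then show ?thesis by (simp only: exp_integer_2pi[OF Ints_of_int])
    qed
    from e[of 1] e[of "-1"] show ?thesis by simp
  qed
  ultimately show ?thesis
    by (simp add: integral_restrict_space has_bochner_integral_iff)
qed

definition evol :: "nat \<Rightarrow> (nat \<times> nat \<Rightarrow> complex^'m::finite \<Rightarrow> complex) \<Rightarrow> (nat \<times> nat) set \<Rightarrow> real \<Rightarrow> complex^'m \<Rightarrow> complex" where
  "evol n h F t z = (\<Sum>k\<in>F. cis (of_int (lam n k) * t) * h k z)"

text \<open>
  Expanding \<open>\<bar>u\<bar>\<^sup>4\<close> into pairs, integration in time and over the Hopf fibres leaves only the pairs of
  equal differences of \<open>lam\<close> and \<open>hopf\<close>.
\<close>

lemma space_time_L4:
  fixes h :: "nat \<times> nat \<Rightarrow> complex^'m::finite \<Rightarrow> complex" and K :: nat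
  assumes F: "finite F" and h: "\<And>k. k \<in> F \<Longrightarrow> h k \<in> harmk k"
    and W: "\<And>\<tau> B. (\<tau>, B) \<noteq> (0, 0) \<Longrightarrow>
      card {(k, k') \<in> F \<times> F. lam n k - lam n k' = \<tau> \<and> hopf k - hopf k' = B} \<le> W"
    and D: "\<And>k z. k \<in> F \<Longrightarrow> z \<in> sphere 0 1 \<Longrightarrow> (norm (h k z))\<^sup>2 \<le> D * sq_norm (h k)"
  shows "(LINT t|time_measure (2 * pi * K). LINT z|sphere_measure. (norm (evol n h F t z))^4)
      \<le> 4 * pi * K * (1 + real W) * D * (\<Sum>k\<in>F. sq_norm (h k))\<^sup>2"
    and "continuous_on UNIV (\<lambda>t. LINT z|sphere_measure. (norm (evol n h F t z))^4)"
proof -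
  let ?T = "2 * pi * real K"
  define P where "P = F \<times> F"
  have finP: "finite P" using F by (simp add: P_def)
  define tp where "tp p = lam n (fst p) - lam n (snd p)" for p
  define bp where "bp p = hopf (fst p) - hopf (snd p)" for p
  define H where "H p = (\<lambda>z. h (fst p) z * cnj (h (snd p) z))" for p
  define G where "G p p' = (LINT z|sphere_measure. H p z * cnj (H p' z))" for p p'
  define g where "g p = (LINT z|sphere_measure. (norm (h (fst p) z))\<^sup>2 * (norm (h (snd p) z))\<^sup>2)" for p
  have ch: "k \<in> F \<Longrightarrow> cpoly (h k)" for k using harm_cpoly[OF h] .
  have cH: "p \<in> P \<Longrightarrow> cpoly (H p)" for p unfolding H_def P_def by (intro cpoly_mult cpoly_cnj ch) auto
  have LH: "p \<in> P \<Longrightarrow> L2s (H p)" for p by (intro L2s_cpoly cH)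
  \<comment> \<open>The two degrees of the product of four harmonics are balanced exactly when the
    differences of \<open>hopf\<close> agree; otherwise the circle action annihilates the
    integral.\<close>
  have G0: "G p p' = 0" if p: "p \<in> P" "p' \<in> P" and b: "bp p \<noteq> bp p'" for p p'
  proof -
    obtain k1 k2 k3 k4 where e: "p = (k1, k2)" "p' = (k3, k4)" by (cases p, cases p')
    have k: "k1 \<in> F" "k2 \<in> F" "k3 \<in> F" "k4 \<in> F" using p by (auto simp: P_def e)
    have "bh (fst k1 + snd k2 + (snd k3 + fst k4)) (snd k1 + fst k2 + (fst k3 + snd k4))
        (\<lambda>z. h k1 z * cnj (h k2 z) * cnj (h k3 z * cnj (h k4 z)))"
      unfolding complex_cnj_mult complex_cnj_cnj by (intro bh_mult bh_cnj harm_bh h k)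
    moreover have "fst k1 + snd k2 + (snd k3 + fst k4) \<noteq> snd k1 + fst k2 + (fst k3 + snd k4)"
      using b by (auto simp: bp_def e hopf_def)
    ultimately show ?thesis unfolding G_def H_def e fst_conv snd_conv by (rule integral_bh_zero)
  qed
  have sq: "complex_of_real ((norm (evol n h F t z))^4)
      = (\<Sum>p\<in>P. \<Sum>p'\<in>P. cis (of_int (tp p - tp p') * t) * (H p z * cnj (H p' z)))" for t z
  proof -
    have f: "evol n h F t z * cnj (evol n h F t z) = (\<Sum>p\<in>P. cis (of_int (tp p) * t) * H p z)"
    proof -
      have "evol n h F t z * cnj (evol n h F t z)
          = (\<Sum>k\<in>F. \<Sum>k'\<in>F. (cis (of_int (lam n k) * t) * h k z) * cnj (cis (of_int (lam n k') * t) * h k' z))"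
        by (simp add: evol_def sum_product)
      also have "\<dots> = (\<Sum>k\<in>F. \<Sum>k'\<in>F. cis (of_int (lam n k - lam n k') * t) * (h k z * cnj (h k' z)))"
      proof (intro sum.cong refl)
        fix k k'
        have "cis (of_int (lam n k - lam n k') * t) = cis (of_int (lam n k) * t) * cnj (cis (of_int (lam n k') * t))"
          by (simp add: cis_cnj cis_mult left_diff_distrib)
        then show "(cis (of_int (lam n k) * t) * h k z) * cnj (cis (of_int (lam n k') * t) * h k' z)
            = cis (of_int (lam n k - lam n k') * t) * (h k z * cnj (h k' z))"
          by (simp only: complex_cnj_mult mult_ac)
      qed
      finally show ?thesis by (simp add: P_def H_def tp_def sum.cartesian_product case_prod_beta)
    qed
    have "complex_of_real ((norm (evol n h F t z))^4) = complex_of_real ((norm (evol n h F t z))\<^sup>2) * cnj (complex_of_real ((norm (evol n h F t z))\<^sup>2))"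
      by (simp add: power4_eq_xxxx power2_eq_square)
    also have "\<dots> = (\<Sum>p\<in>P. cis (of_int (tp p) * t) * H p z) * cnj (\<Sum>p\<in>P. cis (of_int (tp p) * t) * H p z)"
      by (simp only: complex_norm_square f)
    also have "\<dots> = (\<Sum>p\<in>P. \<Sum>p'\<in>P. (cis (of_int (tp p) * t) * H p z) * cnj (cis (of_int (tp p') * t) * H p' z))"
      by (simp add: sum_product)
    also have "\<dots> = (\<Sum>p\<in>P. \<Sum>p'\<in>P. cis (of_int (tp p - tp p') * t) * (H p z * cnj (H p' z)))"
    proof (intro sum.cong refl)
      fix p p'
      have "cis (of_int (tp p - tp p') * t) = cis (of_int (tp p) * t) * cnj (cis (of_int (tp p') * t))"
        by (simp add: cis_cnj cis_mult left_diff_distrib)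
      then show "(cis (of_int (tp p) * t) * H p z) * cnj (cis (of_int (tp p') * t) * H p' z)
          = cis (of_int (tp p - tp p') * t) * (H p z * cnj (H p' z))"
        by (simp only: complex_cnj_mult mult_ac)
    qed
    finally show ?thesis .
  qed
  let ?J = "\<lambda>t. LINT z|sphere_measure. (norm (evol n h F t z))^4"
  have J: "complex_of_real (?J t) = (\<Sum>p\<in>P. \<Sum>p'\<in>P. cis (of_int (tp p - tp p') * t) * G p p')" for t
  proof -
    have i: "integrable sphere_measure (\<lambda>z. cis (of_int (tp p - tp p') * t) * (H p z * cnj (H p' z)))" if "p \<in> P" "p' \<in> P" for p p'
      by (intro integrable_mult_right L2s_mult_integrable LH that)
    have "complex_of_real (?J t) = (LINT z|sphere_measure. complex_of_real ((norm (evol n h F t z))^4))"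
      by (rule integral_complex_of_real[symmetric])
    also have "\<dots> = (\<Sum>p\<in>P. LINT z|sphere_measure. (\<Sum>p'\<in>P. cis (of_int (tp p - tp p') * t) * (H p z * cnj (H p' z))))"
      unfolding sq by (rule Bochner_Integration.integral_sum) (intro Bochner_Integration.integrable_sum i)
    also have "\<dots> = (\<Sum>p\<in>P. \<Sum>p'\<in>P. LINT z|sphere_measure. cis (of_int (tp p - tp p') * t) * (H p z * cnj (H p' z)))"
      by (intro sum.cong refl Bochner_Integration.integral_sum i)
    finally show ?thesis by (simp add: G_def)
  qed
  have cJ: "continuous_on UNIV (\<lambda>t. \<Sum>p\<in>P. \<Sum>p'\<in>P. cis (of_int (tp p - tp p') * t) * G p p')"
    by (intro continuous_intros)
  have "?J = (\<lambda>t. Re (\<Sum>p\<in>P. \<Sum>p'\<in>P. cis (of_int (tp p - tp p') * t) * G p p'))"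
    by (subst J[symmetric]) simp
  then show contJ: "continuous_on UNIV ?J" using continuous_on_Re[OF cJ] by (simp only:)
  let ?E = "\<lambda>p p'. tp p = tp p' \<and> bp p = bp p'"
  have total: "complex_of_real (LINT t|time_measure ?T. ?J t) = of_real (2 * ?T) * (\<Sum>p\<in>P. \<Sum>p'\<in>P. if ?E p p' then G p p' else 0)"
  proof -
    have i: "integrable (time_measure ?T) (\<lambda>t. cis (of_int (tp p - tp p') * t) * G p p')" for p p'
      by (intro continuous_time_integrable continuous_intros)
    have "complex_of_real (LINT t|time_measure ?T. ?J t) = (LINT t|time_measure ?T. complex_of_real (?J t))"
      by (rule integral_complex_of_real[symmetric])
    also have "\<dots> = (\<Sum>p\<in>P. \<Sum>p'\<in>P. LINT t|time_measure ?T. cis (of_int (tp p - tp p') * t) * G p p')"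
      unfolding J using i by simp
    also have "\<dots> = (\<Sum>p\<in>P. \<Sum>p'\<in>P. of_real (2 * ?T) * (if ?E p p' then G p p' else 0))"
    proof (intro sum.cong refl)
      fix p p' assume p: "p \<in> P" "p' \<in> P"
      show "(LINT t|time_measure ?T. cis (of_int (tp p - tp p') * t) * G p p') = of_real (2 * ?T) * (if ?E p p' then G p p' else 0)"
      proof (cases "tp p = tp p'")
        case True
        then show ?thesis using G0[OF p] integral_time_const[of ?T "G p p'"] by (auto simp: scaleR_conv_of_real)
      next
        case False
        then show ?thesis using integral_time_cis[of "tp p - tp p'" K] by simp
      qed
    qed
    finally show ?thesis by (simp only: sum_distrib_left)
  qed
  have g: "g p = sq_norm (H p)" "g p \<ge> 0" for p
    by (simp_all add: g_def sq_norm_def H_def norm_mult power_mult_distrib)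
  have ReG: "Re (G p p') \<le> (g p + g p') / 2" if p: "p \<in> P" "p' \<in> P" for p p'
  proof -
    have "0 \<le> sq_norm (\<lambda>z. H p z + (-1) * H p' z)" by simp
    also have "\<dots> = sq_norm (H p) + sq_norm (H p') - 2 * Re (G p p')"
      using sq_norm_add[OF LH[OF p(1)] L2s_cmult[OF LH[OF p(2)], of "-1"]]
      unfolding sphere_inner_cmult_right sq_norm_cmult by (simp add: G_def sphere_inner_def)
    finally show ?thesis by (simp add: g)
  qed
  define Q where "Q = (\<Sum>p\<in>P. g p)"
  \<comment> \<open>A diagonal pair has both differences 0 and so is resonant with all diagonal
    pairs and with no other. The resonant sum splits into a diagonal and an off-diagonal
    block.\<close>
  have diag: "?E p (k, k) \<longleftrightarrow> fst p = snd p" for p k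
    using lam_hopf_inj[of n "fst p" "snd p"] by (auto simp: tp_def bp_def)
  let ?D = "{p \<in> P. fst p = snd p}" and ?N = "{p \<in> P. fst p \<noteq> snd p}"
  have cE: "card {p' \<in> ?N. ?E p p'} \<le> W" if p: "p \<in> ?N" for p
  proof -
    have nz: "(tp p, bp p) \<noteq> (0, 0)" using p lam_hopf_inj[of n "fst p" "snd p"] by (auto simp: tp_def bp_def)
    have "{p' \<in> ?N. ?E p p'} \<subseteq> {(k, k') \<in> F \<times> F. lam n k - lam n k' = tp p \<and> hopf k - hopf k' = bp p}"
      by (auto simp: P_def tp_def bp_def)
    then have "card {p' \<in> ?N. ?E p p'} \<le> card {(k, k') \<in> F \<times> F. lam n k - lam n k' = tp p \<and> hopf k - hopf k' = bp p}"
      using finP by (intro card_mono) (auto simp: P_def intro: finite_subset[of _ "F \<times> F"])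
    then show ?thesis using W[OF nz] by linarith
  qed
  have "(\<Sum>p\<in>P. \<Sum>p'\<in>P. if ?E p p' then Re (G p p') else 0)
      = (\<Sum>p\<in>?D. \<Sum>p'\<in>?D. Re (G p p')) + (\<Sum>p\<in>?N. \<Sum>p'\<in>?N. if ?E p p' then Re (G p p') else 0)"
  proof -
    have DE: "?E p p' \<longleftrightarrow> fst p' = snd p'" if "p \<in> ?D" for p p'
      using that diag[of p' "fst p"] by (cases p) auto
    have DE': "?E p p' \<longrightarrow> fst p' \<noteq> snd p'" if "p \<in> ?N" for p p'
      using that diag[of p "fst p'"] by (cases p') auto
    have PDN: "P = ?D \<union> ?N" by auto
    have "(\<Sum>p\<in>P. \<Sum>p'\<in>P. if ?E p p' then Re (G p p') else 0)
        = (\<Sum>p\<in>?D. \<Sum>p'\<in>P. if ?E p p' then Re (G p p') else 0) + (\<Sum>p\<in>?N. \<Sum>p'\<in>P. if ?E p p' then Re (G p p') else 0)"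
      using finP by (subst (1) PDN, subst sum.union_disjoint) auto
    moreover have "(\<Sum>p'\<in>P. if ?E p p' then Re (G p p') else 0) = (\<Sum>p'\<in>?D. Re (G p p'))" if "p \<in> ?D" for p
      using finP DE[OF that] by (simp add: sum.inter_filter)
    moreover have "(\<Sum>p'\<in>P. if ?E p p' then Re (G p p') else 0) = (\<Sum>p'\<in>?N. if ?E p p' then Re (G p p') else 0)" if "p \<in> ?N" for p
      using finP DE'[OF that] by (intro sum.mono_neutral_right) auto
    ultimately show ?thesis by simp
  qed
  \<comment> \<open>The diagonal block is too large for the count \<open>W\<close>, but it equals
    \<open>Q\<close> exactly, since \<open>G (k, k) (k', k')\<close> is the integral of a product of
    squares.\<close>
  also have "(\<Sum>p\<in>?D. \<Sum>p'\<in>?D. Re (G p p')) = Q"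
  proof -
    have D: "?D = (\<lambda>k. (k, k)) ` F" by (auto simp: P_def)
    have "(\<Sum>p\<in>?D. \<Sum>p'\<in>?D. Re (G p p')) = (\<Sum>k\<in>F. \<Sum>k'\<in>F. Re (G (k, k) (k', k')))"
      unfolding D by (simp add: sum.reindex inj_on_def)
    also have "\<dots> = (\<Sum>k\<in>F. \<Sum>k'\<in>F. g (k, k'))"
    proof (intro sum.cong refl)
      fix k k'
      have "G (k, k) (k', k') = (LINT z|sphere_measure. complex_of_real ((norm (h k z))\<^sup>2 * (norm (h k' z))\<^sup>2))"
        unfolding G_def H_def of_real_mult complex_norm_square by (simp add: mult_ac)
      also have "\<dots> = complex_of_real (g (k, k'))" unfolding g_def by (subst integral_complex_of_real) simp
      finally show "Re (G (k, k) (k', k')) = g (k, k')" by simp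
    qed
    finally show ?thesis by (simp add: Q_def P_def sum.cartesian_product)
  qed
  \<comment> \<open>By \<open>ReG\<close> each term is charged in equal parts to its two pairs. As
    resonance is symmetric and a pair has at most \<open>W\<close> partners, each pair is charged at
    most \<open>W\<close> times in all.\<close>
  also have "(\<Sum>p\<in>?N. \<Sum>p'\<in>?N. if ?E p p' then Re (G p p') else 0) \<le> real W * Q"
  proof -
    have "(\<Sum>p\<in>?N. \<Sum>p'\<in>?N. if ?E p p' then Re (G p p') else 0)
        \<le> (\<Sum>p\<in>?N. \<Sum>p'\<in>?N. (if ?E p p' then g p / 2 else 0) + (if ?E p p' then g p' / 2 else 0))"
      using ReG by (intro sum_mono) (auto simp: add_divide_distrib)
    also have "\<dots> = (\<Sum>p\<in>?N. \<Sum>p'\<in>?N. if ?E p p' then g p / 2 else 0) + (\<Sum>p\<in>?N. \<Sum>p'\<in>?N. if ?E p p' then g p' / 2 else 0)"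
      by (simp only: sum.distrib)
    also have "(\<Sum>p\<in>?N. \<Sum>p'\<in>?N. if ?E p p' then g p' / 2 else 0) = (\<Sum>p'\<in>?N. \<Sum>p\<in>?N. if ?E p' p then g p' / 2 else 0)"
      by (subst sum.swap) (intro sum.cong refl if_cong, auto)
    finally have "(\<Sum>p\<in>?N. \<Sum>p'\<in>?N. if ?E p p' then Re (G p p') else 0) \<le> (\<Sum>p\<in>?N. 2 * (\<Sum>p'\<in>?N. if ?E p p' then g p / 2 else 0))"
      by (simp add: sum_distrib_left[symmetric])
    also have "\<dots> \<le> (\<Sum>p\<in>?N. real W * g p)"
    proof (rule sum_mono)
      fix p assume p: "p \<in> ?N"
      have "(\<Sum>p'\<in>?N. if ?E p p' then g p / 2 else 0) = (\<Sum>p'\<in>{p' \<in> ?N. ?E p p'}. g p / 2)"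
        using finP by (intro sum.inter_filter[symmetric]) auto
      also have "\<dots> = real (card {p' \<in> ?N. ?E p p'}) * (g p / 2)" by simp
      also have "\<dots> \<le> real W * (g p / 2)" using cE[OF p] g(2)[of p] by (intro mult_right_mono) auto
      finally show "2 * (\<Sum>p'\<in>?N. if ?E p p' then g p / 2 else 0) \<le> real W * g p" by simp
    qed
    also have "\<dots> = real W * (\<Sum>p\<in>?N. g p)" by (simp only: sum_distrib_left)
    also have "\<dots> \<le> real W * Q" unfolding Q_def using finP g(2) by (intro mult_left_mono sum_mono2) auto
    finally show ?thesis .
  qed
  finally have main: "(\<Sum>p\<in>P. \<Sum>p'\<in>P. if ?E p p' then Re (G p p') else 0) \<le> (1 + real W) * Q"
    by (simp add: distrib_right)
  have Q: "Q \<le> D * (\<Sum>k\<in>F. sq_norm (h k))\<^sup>2"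
  proof -
    have ih: "integrable sphere_measure (\<lambda>z. (norm (h k z))\<^sup>2 * c)" if "k \<in> F" for k and c :: real
      using L2s_cpoly[OF ch[OF that]] by (intro integrable_mult_left) (simp add: L2s_def)
    have "g (k, k') \<le> D * sq_norm (h k') * sq_norm (h k)" if k: "k \<in> F" "k' \<in> F" for k k'
    proof -
      have "g (k, k') \<le> (LINT z|sphere_measure. (norm (h k z))\<^sup>2 * (D * sq_norm (h k')))"
        unfolding g_def fst_conv snd_conv
      proof (rule integral_mono)
        show "integrable sphere_measure (\<lambda>z. (norm (h k z))\<^sup>2 * (norm (h k' z))\<^sup>2)"
          by (intro continuous_on_sphere_integrable continuous_intros cpoly_continuous ch k)
        show "integrable sphere_measure (\<lambda>z. (norm (h k z))\<^sup>2 * (D * sq_norm (h k')))" by (rule ih[OF k(1)])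
        fix z :: "complex^'m" assume "z \<in> space sphere_measure"
        then show "(norm (h k z))\<^sup>2 * (norm (h k' z))\<^sup>2 \<le> (norm (h k z))\<^sup>2 * (D * sq_norm (h k'))"
          by (intro mult_left_mono D k) auto
      qed
      also have "\<dots> = sq_norm (h k) * (D * sq_norm (h k'))"
        unfolding sq_norm_def by (rule integral_mult_left_zero)
      finally show ?thesis by (simp add: mult_ac)
    qed
    then have "Q \<le> (\<Sum>k\<in>F. \<Sum>k'\<in>F. D * sq_norm (h k') * sq_norm (h k))"
      unfolding Q_def P_def by (subst sum.cartesian_product) (auto intro!: sum_mono)
    also have "\<dots> = D * (\<Sum>k\<in>F. sq_norm (h k))\<^sup>2"
      by (simp add: power2_eq_square sum_product sum_distrib_left mult_ac)
    finally show ?thesis .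
  qed
  have "(LINT t|time_measure ?T. ?J t) = 2 * ?T * (\<Sum>p\<in>P. \<Sum>p'\<in>P. if ?E p p' then Re (G p p') else 0)"
    using arg_cong[OF total, of Re] by (simp add: Re_sum if_distrib[of Re] cong: if_cong)
  also have "\<dots> \<le> 2 * ?T * ((1 + real W) * (D * (\<Sum>k\<in>F. sq_norm (h k))\<^sup>2))"
    by (intro mult_left_mono order_trans[OF main] mult_left_mono Q) auto
  also have "\<dots> = 4 * pi * K * (1 + real W) * D * (\<Sum>k\<in>F. sq_norm (h k))\<^sup>2"
    by (simp only: mult.assoc)
  finally show "(LINT t|time_measure ?T. ?J t) \<le> 4 * pi * K * (1 + real W) * D * (\<Sum>k\<in>F. sq_norm (h k))\<^sup>2" .
qed

section \<open>Estimates for finite sums of harmonics\<close>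

text \<open>The two indices are comparable on the cone, so the square of each is at most
  \<open>M\<close> times their product, which the eigenvalue controls.\<close>

lemma cone_region_le:
  assumes M: "M > 1" and k: "k \<in> cone_region M" and mu: "mu n k \<le> L"
  shows "(real (fst k))\<^sup>2 \<le> M * L" "(real (snd k))\<^sup>2 \<le> M * L"
proof -
  obtain a b where e: "k = (a, b)" by (cases k)
  have ab: "real a < M * real b" "real b < M * real a"
    using k M by (auto simp: cone_region_def e field_simps)
  have "mu n k = 1 + 2 * (real a * real b) + real n * (real a + real b)" by (simp add: mu_def eigval_def e)
  moreover have "0 \<le> real n * (real a + real b)" "0 \<le> real a * real b" by simp_all
  ultimately have "real a * real b \<le> L" using mu by linarith
  then have L: "M * (real a * real b) \<le> M * L" using M by simp
  have "real a * real a \<le> real a * (M * real b)" "real b * real b \<le> real b * (M * real a)"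
    using ab by (intro mult_left_mono; simp)+
  then show "(real (fst k))\<^sup>2 \<le> M * L" "(real (snd k))\<^sup>2 \<le> M * L"
    using L by (simp_all add: e power2_eq_square mult_ac)
qed

text \<open>Here \<open>x = sqrt (M * L)\<close> bounds both indices. The number of partners
  contributes \<open>x powr (1 + 2 * \<epsilon>)\<close>, the pointwise bound
  \<open>x ^ (2 * n - 1)\<close>, and the product is \<open>(M * L) powr (n + \<epsilon>)\<close> up
  to a constant.\<close>

lemma cone_L4:
  fixes K :: nat and \<epsilon> :: real
  assumes n: "CARD('m::finite) = n + 1" "n \<ge> 1" and M: "M > 1" and \<epsilon>: "\<epsilon> > 0"
  obtains C where "C > 0"
    "\<And>F (L::real) (h :: nat \<times> nat \<Rightarrow> complex^'m \<Rightarrow> complex). finite F \<Longrightarrow> F \<subseteq> cone_region M \<Longrightarrow> L \<ge> 1 \<Longrightarrow>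
      (\<And>k. k \<in> F \<Longrightarrow> mu n k \<le> L) \<Longrightarrow> (\<And>k. k \<in> F \<Longrightarrow> h k \<in> harmk k) \<Longrightarrow>
      (LINT t|time_measure (2 * pi * K). LINT z|sphere_measure. (norm (evol n h F t z))^4)
        \<le> C * L powr (n + \<epsilon>) * (\<Sum>k\<in>F. sq_norm (h k))\<^sup>2"
proof -
  let ?V = "sphere_vol TYPE('m)"
  have V: "?V > 0" by (rule measure_sphere_pos)
  obtain Cd where Cd: "Cd > 0" "\<And>m :: nat. m > 0 \<Longrightarrow> real (card {d. d dvd m}) \<le> Cd * real m powr \<epsilon>"
    using divisor_bound[OF \<epsilon>] by blast
  define A where "A = 3 * Cd * (4 + 2 * real n) powr (2 * \<epsilon>) + real n + 4"
  have A: "A > 0" unfolding A_def using Cd by (intro add_nonneg_pos add_nonneg_nonneg) auto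
  \<comment> \<open>The added 1 keeps \<open>C\<close> positive for \<open>K = 0\<close>; the power
    of 2 comes from replacing an index plus 1 by \<open>2 * x\<close>.\<close>
  define C where "C = (4 * pi * K + 1) * A * (2 * 2 ^ (2 * n - 1) / ?V) * M powr (n + \<epsilon>)"
  have C: "C > 0" unfolding C_def using A V M by (intro mult_pos_pos) (auto simp: add_nonneg_pos)
  have "(LINT t|time_measure (2 * pi * K). LINT z|sphere_measure. (norm (evol n h F t z))^4)
        \<le> C * L powr (n + \<epsilon>) * (\<Sum>k\<in>F. sq_norm (h k))\<^sup>2"
    if F: "finite F" "F \<subseteq> cone_region M" and L: "L \<ge> 1" "\<And>k. k \<in> F \<Longrightarrow> mu n k \<le> L"
      and h: "\<And>k. k \<in> F \<Longrightarrow> h k \<in> harmk k"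
    for F and L :: real and h :: "nat \<times> nat \<Rightarrow> complex^'m \<Rightarrow> complex"
  proof -
    define x where "x = sqrt (M * L)"
    have M_L: "M * L \<ge> 1" using M L(1) mult_mono[of 1 M 1 L] by simp
    have x1: "x \<ge> 1" using M_L by (simp add: x_def)
    have x2: "x\<^sup>2 = M * L" using M_L by (simp add: x_def)
    define N where "N = nat \<lfloor>x\<rfloor>"
    have Nx: "real N \<le> x" using x1 by (simp add: N_def of_nat_floor)
    have box: "real (fst k) \<le> x" "real (snd k) \<le> x" "fst k \<le> N" "snd k \<le> N" if k: "k \<in> F" for k
    proof -
      have "k \<in> cone_region M" using F k by auto
      from cone_region_le[OF M this L(2)[OF k]] show *: "real (fst k) \<le> x" "real (snd k) \<le> x"
        unfolding x_def by (simp_all add: real_le_rsqrt)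
      then show "fst k \<le> N" "snd k \<le> N" unfolding N_def by (simp_all add: le_nat_floor)
    qed
    define Dv where "Dv = nat \<lfloor>Cd * real ((4 * N + 2 * n)\<^sup>2) powr \<epsilon>\<rfloor>"
    have Dv: "card {d. d dvd m} \<le> Dv" if "0 < m" "m \<le> (4 * N + 2 * n)\<^sup>2" for m
    proof -
      have "real (card {d. d dvd m}) \<le> Cd * real m powr \<epsilon>" by (rule Cd(2)[OF that(1)])
      also have "\<dots> \<le> Cd * real ((4 * N + 2 * n)\<^sup>2) powr \<epsilon>"
        using that \<epsilon> Cd(1) by (intro mult_left_mono powr_mono2) (auto simp only: of_nat_le_iff of_nat_0_le_iff less_imp_le)
      finally show ?thesis unfolding Dv_def by (simp add: le_nat_floor)
    qed
    define W where "W = (2 * N + 1) * Dv + (2 * N + n + 1)"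
    have Dv_le: "real Dv \<le> Cd * ((4 + 2 * real n) powr (2 * \<epsilon>) * x powr (2 * \<epsilon>))"
    proof -
      have "real Dv \<le> Cd * real ((4 * N + 2 * n)\<^sup>2) powr \<epsilon>" unfolding Dv_def using Cd(1) by (simp add: of_nat_floor)
      also have "real ((4 * N + 2 * n)\<^sup>2) \<le> ((4 + 2 * real n) * x)\<^sup>2"
      proof -
        have "2 * real n * 1 \<le> 2 * real n * x" using x1 by (intro mult_left_mono) auto
        then have "4 * real N + 2 * real n \<le> (4 + 2 * real n) * x" using Nx by (simp add: distrib_right)
        then have "(4 * real N + 2 * real n)\<^sup>2 \<le> ((4 + 2 * real n) * x)\<^sup>2" by (intro power_mono) auto
        then show ?thesis by simp
      qed
      then have "Cd * real ((4 * N + 2 * n)\<^sup>2) powr \<epsilon> \<le> Cd * (((4 + 2 * real n) * x)\<^sup>2) powr \<epsilon>"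
        using Cd(1) \<epsilon> by (intro mult_left_mono powr_mono2) auto
      also have "(((4 + 2 * real n) * x)\<^sup>2) powr \<epsilon> = ((4 + 2 * real n) * x) powr (2 * \<epsilon>)"
        using x1 by (simp add: powr_powr[symmetric] powr_numeral)
      also have "\<dots> = (4 + 2 * real n) powr (2 * \<epsilon>) * x powr (2 * \<epsilon>)" by (rule powr_mult)
      finally show ?thesis by simp
    qed
    have W_le: "1 + real W \<le> A * x powr (1 + 2 * \<epsilon>)"
    proof -
      have xx: "x powr (1 + 2 * \<epsilon>) = x * x powr (2 * \<epsilon>)" using x1 by (simp add: powr_add)
      have x2e: "1 \<le> x powr (2 * \<epsilon>)" using x1 \<epsilon> by (simp add: ge_one_powr_ge_zero)
      have "1 + real W = (2 * real N + 1) * real Dv + (2 * real N + real n + 2)" by (simp add: W_def distrib_right)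
      also have "\<dots> \<le> (3 * x) * (Cd * ((4 + 2 * real n) powr (2 * \<epsilon>) * x powr (2 * \<epsilon>))) + (real n + 4) * (x * x powr (2 * \<epsilon>))"
      proof (intro add_mono mult_mono)
        show "2 * real N + 1 \<le> 3 * x" using Nx x1 by linarith
        have "2 * real N + real n + 2 \<le> 2 * x + real n * x + 2 * x"
          using Nx x1 mult_left_mono[of 1 x "real n"] by simp
        also have "\<dots> = (real n + 4) * (x * 1)" by (simp add: algebra_simps)
        also have "\<dots> \<le> (real n + 4) * (x * x powr (2 * \<epsilon>))"
          using x2e x1 by (intro mult_left_mono) auto
        finally show "2 * real N + real n + 2 \<le> (real n + 4) * (x * x powr (2 * \<epsilon>))" .
      qed (use Dv_le x1 in auto)
      also have "\<dots> = A * x powr (1 + 2 * \<epsilon>)" unfolding xx A_def by (simp add: algebra_simps)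
      finally show ?thesis .
    qed
    define D where "D = 2 * (2 * x) ^ (2 * n - 1) / ?V"
    have D: "(norm (h k z))\<^sup>2 \<le> D * sq_norm (h k)" if k: "k \<in> F" and z: "z \<in> sphere 0 1" for k z
    proof -
      have b: "real (fst k) + 1 \<le> 2 * x" "real (snd k) + 1 \<le> 2 * x" "real (fst k) + real (snd k) + 2 \<le> 2 * (2 * x)"
        using box[OF k] x1 by linarith+
      have "real (hdim n (fst k) (snd k)) = (real (fst k) + 1) ^ (n - 1) * (real (snd k) + 1) ^ (n - 1) * (real (fst k) + real (snd k) + 2)"
        unfolding hdim_def by (simp add: algebra_simps)
      also have "\<dots> \<le> (2 * x) ^ (n - 1) * (2 * x) ^ (n - 1) * (2 * (2 * x))"
        using b x1 by (intro mult_mono power_mono) auto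
      also have "\<dots> = 2 * (2 * x) ^ (2 * n - 1)"
      proof -
        obtain j where "n = Suc j" using n(2) by (cases n) auto
        have "(2 * x) ^ j * (2 * x) ^ j * (2 * (2 * x)) = 2 * ((2 * x) ^ (j + j) * (2 * x))"
          by (simp only: power_add mult_ac)
        also have "(2 * x) ^ (j + j) * (2 * x) = (2 * x) ^ Suc (j + j)" by (simp only: power_Suc2)
        also have "Suc (j + j) = 2 * n - 1" using \<open>n = Suc j\<close> by simp
        finally show ?thesis using \<open>n = Suc j\<close> by (simp only: diff_Suc_1)
      qed
      finally have "real (hdim n (fst k) (snd k)) / ?V * sq_norm (h k) \<le> D * sq_norm (h k)"
        unfolding D_def using V by (intro mult_right_mono divide_right_mono sq_norm_nonneg less_imp_le[OF V])
      with harm_pointwise[OF n h[OF k] z] show ?thesis by (rule order_trans)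
    qed
    have "(LINT t|time_measure (2 * pi * K). LINT z|sphere_measure. (norm (evol n h F t z))^4)
        \<le> 4 * pi * K * (1 + real W) * D * (\<Sum>k\<in>F. sq_norm (h k))\<^sup>2"
    proof (rule space_time_L4(1)[OF F(1) h _ D])
      fix \<tau> B :: int assume "(\<tau>, B) \<noteq> (0, 0)"
      then show "card {(k, k') \<in> F \<times> F. lam n k - lam n k' = \<tau> \<and> hopf k - hopf k' = B} \<le> W"
        unfolding W_def using box Dv by (intro card_pairs_le n(2)) auto
    qed
    also have "\<dots> \<le> C * L powr (n + \<epsilon>) * (\<Sum>k\<in>F. sq_norm (h k))\<^sup>2"
    proof (rule mult_right_mono)
      have D0: "D \<ge> 0" using V x1 by (simp add: D_def)
      have "4 * pi * K * (1 + real W) * D \<le> (4 * pi * K + 1) * (A * x powr (1 + 2 * \<epsilon>)) * D"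
        using W_le D0 A by (intro mult_right_mono mult_mono) auto
      also have "\<dots> = (4 * pi * K + 1) * A * (2 * 2 ^ (2 * n - 1) / ?V) * (x powr (1 + 2 * \<epsilon>) * x ^ (2 * n - 1))"
        by (simp add: D_def power_mult_distrib)
      also have "x powr (1 + 2 * \<epsilon>) * x ^ (2 * n - 1) = (x\<^sup>2) powr (n + \<epsilon>)"
      proof -
        have "x ^ (2 * n - 1) = x powr (2 * real n - 1)"
          using x1 n(2) by (simp add: powr_realpow[symmetric] of_nat_diff)
        then have "x powr (1 + 2 * \<epsilon>) * x ^ (2 * n - 1) = x powr (2 * (n + \<epsilon>))"
          by (simp add: powr_add[symmetric] algebra_simps)
        also have "x\<^sup>2 = x powr 2" using x1 by simp
        then have "x powr (2 * (n + \<epsilon>)) = (x\<^sup>2) powr (n + \<epsilon>)" by (simp only: powr_powr)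
        finally show ?thesis .
      qed
      also have "\<dots> = M powr (n + \<epsilon>) * L powr (n + \<epsilon>)" unfolding x2 by (rule powr_mult)
      finally show "4 * pi * K * (1 + real W) * D \<le> C * L powr (n + \<epsilon>)" by (simp add: C_def mult_ac)
    qed auto
    finally show ?thesis .
  qed
  then show ?thesis by (rule that[OF C])
qed

lemma evol_continuous:
  assumes "\<And>k. k \<in> F \<Longrightarrow> h k \<in> harmk k"
  shows "continuous_on (sphere 0 1) (evol n h F t)"
  unfolding evol_def by (intro continuous_intros cpoly_continuous harm_cpoly[OF assms])

lemma sq_norm_evol:
  fixes h :: "nat \<times> nat \<Rightarrow> complex^'m::finite \<Rightarrow> complex"
  assumes n: "CARD('m) \<ge> 2" and F: "finite F" and h: "\<And>k. k \<in> F \<Longrightarrow> h k \<in> harmk k"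
  shows "sq_norm (evol n h F t) = (\<Sum>k\<in>F. sq_norm (h k))"
proof -
  have "sq_norm (evol n h F t) = (\<Sum>k\<in>F. sq_norm (\<lambda>z. cis (of_int (lam n k) * t) * h k z))"
    unfolding evol_def[abs_def] by (intro sq_norm_harm_sum n F harm_cmult h)
  then show ?thesis by (simp add: sq_norm_cmult)
qed

lemma evol_powr_measurable:
  fixes h :: "nat \<times> nat \<Rightarrow> complex^'m::finite \<Rightarrow> complex"
  assumes F: "finite F" and h: "\<And>k. k \<in> F \<Longrightarrow> h k \<in> harmk k"
  shows "(\<lambda>t. LINT z|sphere_measure. norm (evol n h F t z) powr q) \<in> borel_measurable (time_measure T)"
proof (rule sphere.borel_measurable_lebesgue_integral)
  have "(\<lambda>x. cis (of_int (lam n k) * fst x) * h k (snd x)) \<in> borel_measurable (time_measure T \<Otimes>\<^sub>M sphere_measure)" if k: "k \<in> F" for k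
  proof (rule borel_measurable_times)
    have "(\<lambda>t. cis (of_int (lam n k) * t)) \<in> borel_measurable (time_measure T)"
      by (intro measurable_restrict_space1) (simp, intro borel_measurable_continuous_onI continuous_intros)
    then show "(\<lambda>x. cis (of_int (lam n k) * fst x)) \<in> borel_measurable (time_measure T \<Otimes>\<^sub>M sphere_measure)"
      by (rule measurable_compose[OF measurable_fst])
    show "(\<lambda>x. h k (snd x)) \<in> borel_measurable (time_measure T \<Otimes>\<^sub>M sphere_measure)"
      by (rule measurable_compose[OF measurable_snd]) (intro continuous_on_sphere_measurable cpoly_continuous harm_cpoly[OF h[OF k]])
  qed
  then have "(\<lambda>x. evol n h F (fst x) (snd x)) \<in> borel_measurable (time_measure T \<Otimes>\<^sub>M sphere_measure)"
    unfolding evol_def by (intro borel_measurable_sum)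
  then show "(\<lambda>(t, z). norm (evol n h F t z) powr q) \<in> borel_measurable (time_measure T \<Otimes>\<^sub>M sphere_measure)"
    unfolding case_prod_beta by measurable
qed

text \<open>Hoelder in space places the \<open>q\<close>-norm between the conserved square norm and
  the fourth power, with weight \<open>\<kappa> = (q - 2) / 2\<close>. In time the fourth power then
  appears with exponent \<open>\<kappa> * (p / q)\<close>, which admissibility makes equal to
  \<open>1 / (n + 1)\<close>. This independence of \<open>p\<close> gives uniform constants.\<close>

lemma cone_block:
  fixes K :: nat and \<epsilon> :: real
  assumes n: "CARD('m::finite) = n + 1" "n \<ge> 1" and M: "M > 1" and \<epsilon>: "\<epsilon> > 0"
  obtains C where "C \<ge> 1"
    "\<And>F (L::real) (p::real) (q::real) (h :: nat \<times> nat \<Rightarrow> complex^'m \<Rightarrow> complex). finite F \<Longrightarrow> F \<subseteq> cone_region M \<Longrightarrow> L \<ge> 1 \<Longrightarrow>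
      (\<And>k. k \<in> F \<Longrightarrow> mu n k \<le> L) \<Longrightarrow> (\<And>k. k \<in> F \<Longrightarrow> h k \<in> harmk k) \<Longrightarrow>
      p \<ge> 2 \<Longrightarrow> q \<ge> 2 \<Longrightarrow> q \<le> 4 \<Longrightarrow> 2 / p = (real n + 1) * (1 - 2 / q) \<Longrightarrow>
      (\<integral>\<^sup>+ t. ennreal ((LINT z|sphere_measure. norm (evol n h F t z) powr q) powr (p / q)) \<partial>time_measure (2 * pi * K))
        \<le> ennreal ((C * L powr ((real n + \<epsilon>) / ((real n + 1) * p)) * sqrt (\<Sum>k\<in>F. sq_norm (h k))) powr p)"
proof -
  let ?T = "2 * pi * real K"
  have n2: "CARD('m) \<ge> 2" using n by simp
  obtain C0 where C0: "C0 > 0" and L4: "\<And>F (L::real) (h :: nat \<times> nat \<Rightarrow> complex^'m \<Rightarrow> complex). finite F \<Longrightarrow> F \<subseteq> cone_region M \<Longrightarrow> L \<ge> 1 \<Longrightarrow>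
      (\<And>k. k \<in> F \<Longrightarrow> mu n k \<le> L) \<Longrightarrow> (\<And>k. k \<in> F \<Longrightarrow> h k \<in> harmk k) \<Longrightarrow>
      (LINT t|time_measure ?T. LINT z|sphere_measure. (norm (evol n h F t z))^4)
        \<le> C0 * L powr (real n + \<epsilon>) * (\<Sum>k\<in>F. sq_norm (h k))\<^sup>2"
    using cone_L4[OF n M \<epsilon>, of K] by blast
  define \<eta> where "\<eta> = 1 / (real n + 1)"
  have \<eta>: "0 < \<eta>" "\<eta> \<le> 1" by (simp_all add: \<eta>_def)
  define C where "C = max 1 ((2 * ?T) powr (1 - \<eta>) * C0 powr \<eta>)"
  have C1: "C \<ge> 1" by (simp add: C_def)
  have "(\<integral>\<^sup>+ t. ennreal ((LINT z|sphere_measure. norm (evol n h F t z) powr q) powr (p / q)) \<partial>time_measure ?T)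
        \<le> ennreal ((C * L powr ((real n + \<epsilon>) / ((real n + 1) * p)) * sqrt (\<Sum>k\<in>F. sq_norm (h k))) powr p)"
    if F: "finite F" "F \<subseteq> cone_region M" and L: "L \<ge> 1" "\<And>k. k \<in> F \<Longrightarrow> mu n k \<le> L"
      and h: "\<And>k. k \<in> F \<Longrightarrow> h k \<in> harmk k"
      and p: "p \<ge> 2" and q: "q \<ge> 2" "q \<le> 4" and pq: "2 / p = (real n + 1) * (1 - 2 / q)"
    for F and L p q :: real and h :: "nat \<times> nat \<Rightarrow> complex^'m \<Rightarrow> complex"
  proof -
    define S where "S = (\<Sum>k\<in>F. sq_norm (h k))"
    have S0: "S \<ge> 0" by (simp add: S_def sum_nonneg)
    define \<kappa> where "\<kappa> = (q - 2) / 2"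
    have \<kappa>: "0 \<le> \<kappa>" "\<kappa> \<le> 1" using q by (auto simp: \<kappa>_def)
    have \<kappa>\<eta>: "\<kappa> * (p / q) = \<eta>"
    proof -
      have "2 * q = p * ((real n + 1) * (q - 2))" using pq p q by (simp add: field_simps)
      then show ?thesis using p q by (simp add: \<kappa>_def \<eta>_def field_simps)
    qed
    let ?J = "\<lambda>t. LINT z|sphere_measure. (norm (evol n h F t z))^4"
    have J0: "?J t \<ge> 0" for t by (intro Bochner_Integration.integral_nonneg) simp
    have ec: "continuous_on (sphere 0 1) (evol n h F t)" for t by (rule evol_continuous[OF h])
    have pt: "(LINT z|sphere_measure. norm (evol n h F t z) powr q) powr (p / q) \<le> S powr ((1 - \<kappa>) * (p / q)) * ?J t powr \<eta>" for t
    proof -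
      have "norm w powr q = ((norm w)\<^sup>2) powr (1 - \<kappa>) * ((norm w)^4) powr \<kappa>" for w :: complex
      proof (cases "w = 0")
        case False
        then have "(norm w)\<^sup>2 = norm w powr 2" "(norm w)^4 = norm w powr 4" by simp_all
        then have "((norm w)\<^sup>2) powr (1 - \<kappa>) * ((norm w)^4) powr \<kappa> = norm w powr (2 * (1 - \<kappa>) + 4 * \<kappa>)"
          by (simp only: powr_powr powr_add)
        also have "2 * (1 - \<kappa>) + 4 * \<kappa> = q" by (simp add: \<kappa>_def field_simps)
        finally show ?thesis by simp
      qed simp
      then have "(LINT z|sphere_measure. norm (evol n h F t z) powr q)
          = (LINT z|sphere_measure. ((norm (evol n h F t z))\<^sup>2) powr (1 - \<kappa>) * ((norm (evol n h F t z))^4) powr \<kappa>)"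
        by simp
      also have "\<dots> \<le> (LINT z|sphere_measure. (norm (evol n h F t z))\<^sup>2) powr (1 - \<kappa>) * ?J t powr \<kappa>"
        by (intro integral_holder \<kappa> continuous_on_sphere_integrable continuous_intros ec) auto
      also have "(LINT z|sphere_measure. (norm (evol n h F t z))\<^sup>2) = S"
        using sq_norm_evol[OF n2 F(1) h, of n t] by (simp add: sq_norm_def S_def)
      finally have "(LINT z|sphere_measure. norm (evol n h F t z) powr q) powr (p / q) \<le> (S powr (1 - \<kappa>) * ?J t powr \<kappa>) powr (p / q)"
        using p q by (intro powr_mono2 Bochner_Integration.integral_nonneg) auto
      also have "\<dots> = S powr ((1 - \<kappa>) * (p / q)) * ?J t powr \<eta>"
        by (simp only: powr_mult powr_powr \<kappa>\<eta>)
      finally show ?thesis .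
    qed
    \<comment> \<open>Continuity in time is all that is sought here, so crude values of
      \<open>W\<close> and \<open>D\<close> suffice.\<close>
    have contJ: "continuous_on UNIV ?J"
    proof -
      let ?D = "\<Sum>k\<in>F. real (hdim n (fst k) (snd k)) / sphere_vol TYPE('m)"
      show ?thesis
      proof (rule space_time_L4(2)[OF F(1) h, where W="card (F \<times> F)" and D="?D"])
        fix \<tau> B
        show "card {(k, k') \<in> F \<times> F. lam n k - lam n k' = \<tau> \<and> hopf k - hopf k' = B} \<le> card (F \<times> F)"
          using F(1) by (intro card_mono) auto
      next
        fix k and z :: "complex^'m" assume k: "k \<in> F" and z: "z \<in> sphere 0 1"
        have "(norm (h k z))\<^sup>2 \<le> real (hdim n (fst k) (snd k)) / sphere_vol TYPE('m) * sq_norm (h k)"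
          by (rule harm_pointwise[OF n h[OF k] z])
        also have "\<dots> \<le> ?D * sq_norm (h k)"
          using F(1) k by (intro mult_right_mono member_le_sum) auto
        finally show "(norm (h k z))\<^sup>2 \<le> ?D * sq_norm (h k)" .
      qed
    qed
    have cJ: "integrable (time_measure ?T) ?J" by (rule continuous_time_integrable[OF contJ])
    have Tn: "0 \<le> 2 * ?T" by simp
    have L0: "0 < L" using L(1) by simp
    have iJ: "integrable (time_measure ?T) (\<lambda>t. ?J t powr \<eta>)"
      by (intro continuous_time_integrable continuous_on_powr' contJ continuous_on_const) (use J0 \<eta> in auto)
    have "(\<integral>\<^sup>+ t. ennreal ((LINT z|sphere_measure. norm (evol n h F t z) powr q) powr (p / q)) \<partial>time_measure ?T)
        \<le> (\<integral>\<^sup>+ t. ennreal (S powr ((1 - \<kappa>) * (p / q)) * ?J t powr \<eta>) \<partial>time_measure ?T)"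
      by (intro nn_integral_mono ennreal_leI pt)
    also have "\<dots> = ennreal (LINT t|time_measure ?T. S powr ((1 - \<kappa>) * (p / q)) * ?J t powr \<eta>)"
      by (intro nn_integral_eq_integral integrable_mult_right iJ AE_I2) auto
    also have "\<dots> = ennreal (S powr ((1 - \<kappa>) * (p / q)) * (LINT t|time_measure ?T. 1 powr (1 - \<eta>) * ?J t powr \<eta>))"
      by simp
    also have "\<dots> \<le> ennreal (S powr ((1 - \<kappa>) * (p / q)) * ((LINT t|time_measure ?T. 1) powr (1 - \<eta>) * (LINT t|time_measure ?T. ?J t) powr \<eta>))"
      by (intro ennreal_leI mult_left_mono integral_holder finite_measure.integrable_const finite_measure_time cJ)
         (use \<eta> J0 in auto)
    also have "(LINT t|time_measure ?T. 1 :: real) = 2 * ?T"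
      using integral_time_const[of ?T "1::real"] by simp
    also have "ennreal (S powr ((1 - \<kappa>) * (p / q)) * ((2 * ?T) powr (1 - \<eta>) * (LINT t|time_measure ?T. ?J t) powr \<eta>))
        \<le> ennreal (S powr ((1 - \<kappa>) * (p / q)) * ((2 * ?T) powr (1 - \<eta>) * (C0 * L powr (real n + \<epsilon>) * S\<^sup>2) powr \<eta>))"
    proof (intro ennreal_leI mult_left_mono powr_mono2)
      show "(LINT t|time_measure ?T. ?J t) \<le> C0 * L powr (real n + \<epsilon>) * S\<^sup>2"
        unfolding S_def by (rule L4[OF F L h])
    qed (use \<eta> J0 in \<open>auto intro: Bochner_Integration.integral_nonneg\<close>)
    also have "\<dots> \<le> ennreal ((C * L powr ((real n + \<epsilon>) / ((real n + 1) * p)) * sqrt S) powr p)"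
    proof (rule ennreal_leI)
      have e: "(real n + \<epsilon>) / ((real n + 1) * p) * p = (real n + \<epsilon>) * \<eta>" using p by (simp add: \<eta>_def add.commute)
      have S1: "(S\<^sup>2) powr \<eta> = S powr (2 * \<eta>)"
      proof -
        have "S\<^sup>2 = S powr 2" using S0 by simp
        then show ?thesis by (simp only: powr_powr)
      qed
      have S2: "S powr ((1 - \<kappa>) * (p / q)) * S powr (2 * \<eta>) = sqrt S powr p"
      proof -
        have "(1 - \<kappa>) * (p / q) + 2 * \<eta> = p / q + \<kappa> * (p / q)"
          unfolding \<kappa>\<eta>[symmetric] by (simp only: left_diff_distrib)
        also have "\<dots> = p / 2" using q by (simp add: \<kappa>_def field_simps)
        finally have "S powr ((1 - \<kappa>) * (p / q)) * S powr (2 * \<eta>) = S powr (p / 2)" by (simp only: powr_add[symmetric])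
        also have "\<dots> = sqrt S powr p" using S0 by (simp add: powr_half_sqrt[symmetric] powr_powr)
        finally show ?thesis .
      qed
      have "S powr ((1 - \<kappa>) * (p / q)) * ((2 * ?T) powr (1 - \<eta>) * (C0 * L powr (real n + \<epsilon>) * S\<^sup>2) powr \<eta>)
          = ((2 * ?T) powr (1 - \<eta>) * C0 powr \<eta>) * (L powr ((real n + \<epsilon>) * \<eta>) * (S powr ((1 - \<kappa>) * (p / q)) * S powr (2 * \<eta>)))"
        by (simp only: powr_mult powr_powr S1 mult_ac)
      also have "\<dots> \<le> C powr p * (L powr ((real n + \<epsilon>) * \<eta>) * (S powr ((1 - \<kappa>) * (p / q)) * S powr (2 * \<eta>)))"
      proof (rule mult_right_mono)
        have "(2 * ?T) powr (1 - \<eta>) * C0 powr \<eta> \<le> C powr 1" using C1 by (simp add: C_def)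
        also have "\<dots> \<le> C powr p" using C1 p by (intro powr_mono) auto
        finally show "(2 * ?T) powr (1 - \<eta>) * C0 powr \<eta> \<le> C powr p" .
      qed auto
      also have "\<dots> = (C * L powr ((real n + \<epsilon>) / ((real n + 1) * p)) * sqrt S) powr p"
        unfolding S2 by (simp only: powr_mult powr_powr e mult.assoc)
      finally show "S powr ((1 - \<kappa>) * (p / q)) * ((2 * ?T) powr (1 - \<eta>) * (C0 * L powr (real n + \<epsilon>) * S\<^sup>2) powr \<eta>)
          \<le> (C * L powr ((real n + \<epsilon>) / ((real n + 1) * p)) * sqrt S) powr p" .
    qed
    finally show ?thesis by (simp only: S_def)
  qed
  then show ?thesis by (rule that[OF C1])
qed

section \<open>Assembling the blocks of frequencies\<close>

text \<open>The power \<open>p\<close> of the mixed norm of a finite sum. The inner integral is of a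
  continuous function and stays real; only the integral in time is taken in
  \<open>ennreal\<close>.\<close>

definition mixed_powr :: "nat \<Rightarrow> real \<Rightarrow> real \<Rightarrow> real \<Rightarrow> (nat \<times> nat \<Rightarrow> complex^'m::finite \<Rightarrow> complex) \<Rightarrow> (nat \<times> nat) set \<Rightarrow> ennreal" where
  "mixed_powr n T p q h F =
     (\<integral>\<^sup>+ t. ennreal ((LINT z|sphere_measure. norm (evol n h F t z) powr q) powr (p / q)) \<partial>time_measure T)"

lemma evol_powr_integrable:
  fixes h :: "nat \<times> nat \<Rightarrow> complex^'m::finite \<Rightarrow> complex"
  assumes "\<And>k. k \<in> F \<Longrightarrow> h k \<in> harmk k" "q > 0"
  shows "integrable sphere_measure (\<lambda>z. norm (evol n h F t z) powr q)"
  using assms by (intro continuous_on_sphere_integrable continuous_on_powr' continuous_intros evol_continuous) auto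

text \<open>The triangle inequality of the mixed norm, by \<open>nn_integral_powr_sum_le\<close>
  first in space and then in time. The blocks are the fibres of \<open>idx\<close>.\<close>

lemma mixed_powr_triangle:
  fixes h :: "nat \<times> nat \<Rightarrow> complex^'m::finite \<Rightarrow> complex" and idx :: "nat \<times> nat \<Rightarrow> 'i"
  assumes F: "finite F" and h: "\<And>k. k \<in> F \<Longrightarrow> h k \<in> harmk k" and pq: "p \<ge> 1" "q \<ge> 1"
    and a: "\<And>i. i \<in> idx ` F \<Longrightarrow> a i \<ge> 0"
    and le: "\<And>i. i \<in> idx ` F \<Longrightarrow> mixed_powr n T p q h {k \<in> F. idx k = i} \<le> ennreal (a i powr p)"
  shows "mixed_powr n T p q h F \<le> ennreal ((\<Sum>i\<in>idx ` F. a i) powr p)"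
proof -
  define G where "G i = {k \<in> F. idx k = i}" for i
  define X where "X i t = (LINT z|sphere_measure. norm (evol n h (G i) t z) powr q) powr (1 / q)" for i t
  have X0: "X i t \<ge> 0" for i t by (simp add: X_def)
  have hG: "k \<in> G i \<Longrightarrow> h k \<in> harmk k" for i k using h by (auto simp: G_def)
  have finG: "finite (G i)" for i using F by (simp add: G_def)
  have iq: "integrable sphere_measure (\<lambda>z. norm (evol n h (G i) t z) powr q)" for i t
    using hG pq by (intro evol_powr_integrable) auto
  have Xq: "X i t powr q = (LINT z|sphere_measure. norm (evol n h (G i) t z) powr q)" for i t
    using pq by (simp add: X_def powr_powr Bochner_Integration.integral_nonneg)
  have split: "evol n h F t z = (\<Sum>i\<in>idx ` F. evol n h (G i) t z)" for t z
    unfolding evol_def G_def by (rule sum.image_gen[OF F])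
  have pt: "(LINT z|sphere_measure. norm (evol n h F t z) powr q) powr (p / q) \<le> (\<Sum>i\<in>idx ` F. X i t) powr p" for t
  proof -
    have "ennreal (LINT z|sphere_measure. norm (evol n h F t z) powr q) = (\<integral>\<^sup>+ z. ennreal (norm (evol n h F t z) powr q) \<partial>sphere_measure)"
      using h pq by (intro nn_integral_eq_integral[symmetric] evol_powr_integrable) auto
    also have "\<dots> \<le> (\<integral>\<^sup>+ z. ennreal ((\<Sum>i\<in>idx ` F. norm (evol n h (G i) t z)) powr q) \<partial>sphere_measure)"
      unfolding split using pq by (intro nn_integral_mono ennreal_leI powr_mono2 norm_sum) auto
    also have "\<dots> \<le> ennreal ((\<Sum>i\<in>idx ` F. X i t) powr q)"
    proof (rule nn_integral_powr_sum_le[OF pq(2)])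
      fix i
      show "(\<lambda>z. norm (evol n h (G i) t z)) \<in> borel_measurable sphere_measure"
        using hG by (intro continuous_on_sphere_measurable continuous_intros evol_continuous) auto
      show "(\<integral>\<^sup>+ z. ennreal (norm (evol n h (G i) t z) powr q) \<partial>sphere_measure) \<le> ennreal (X i t powr q)"
        unfolding Xq using iq by (subst nn_integral_eq_integral) auto
    qed (use F X0 in auto)
    finally have "(LINT z|sphere_measure. norm (evol n h F t z) powr q) \<le> (\<Sum>i\<in>idx ` F. X i t) powr q"
      by (simp add: ennreal_le_iff)
    then have "(LINT z|sphere_measure. norm (evol n h F t z) powr q) powr (p / q) \<le> ((\<Sum>i\<in>idx ` F. X i t) powr q) powr (p / q)"
      using pq by (intro powr_mono2 Bochner_Integration.integral_nonneg) auto
    also have "\<dots> = (\<Sum>i\<in>idx ` F. X i t) powr p" using pq by (simp add: powr_powr)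
    finally show ?thesis .
  qed
  have "mixed_powr n T p q h F \<le> (\<integral>\<^sup>+ t. ennreal ((\<Sum>i\<in>idx ` F. X i t) powr p) \<partial>time_measure T)"
    unfolding mixed_powr_def by (intro nn_integral_mono ennreal_leI pt)
  also have "\<dots> \<le> ennreal ((\<Sum>i\<in>idx ` F. a i) powr p)"
  proof (rule nn_integral_powr_sum_le[OF pq(1)])
    fix i assume i: "i \<in> idx ` F"
    have "(\<lambda>t. LINT z|sphere_measure. norm (evol n h (G i) t z) powr q) \<in> borel_measurable (time_measure T)"
      by (rule evol_powr_measurable[OF finG hG])
    then show "X i \<in> borel_measurable (time_measure T)" unfolding X_def by measurable
    have "X i t powr p = (LINT z|sphere_measure. norm (evol n h (G i) t z) powr q) powr (p / q)" for t
      by (simp add: X_def powr_powr)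
    then show "(\<integral>\<^sup>+ t. ennreal (X i t powr p) \<partial>time_measure T) \<le> ennreal (a i powr p)"
      using le[OF i] by (simp add: mixed_powr_def G_def)
  qed (use F X0 a in auto)
  finally show ?thesis .
qed

text \<open>The phases do not change the norms of the components, so \<open>sobolev\<close> holds at
  each time with the same right side. Its exponent \<open>(n + 1) * (1 - 2 / q)\<close> is
  \<open>2 / p\<close> by admissibility, and integration in time costs only the length of the
  interval.\<close>

lemma edge_estimate:
  fixes h :: "nat \<times> nat \<Rightarrow> complex^'m::finite \<Rightarrow> complex"
  assumes n: "CARD('m) = n + 1" "n \<ge> 1" and F: "finite F" and h: "\<And>k. k \<in> F \<Longrightarrow> h k \<in> harmk k"
    and T: "T \<ge> 0" and p: "p \<ge> 2" and q: "q \<ge> 2" and pq: "2 / p = (real n + 1) * (1 - 2 / q)"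
  shows "mixed_powr n T p q h F
    \<le> ennreal ((max 1 (2 * T) * (8 * max 1 (4 / sqrt (sphere_vol TYPE('m)))) * sqrt (\<Sum>k\<in>F. mu n k powr (2 / p) * sq_norm (h k))) powr p)"
proof -
  define B where "B = 8 * max 1 (4 / sqrt (sphere_vol TYPE('m)))"
  define A where "A = sqrt (\<Sum>k\<in>F. mu n k powr (2 / p) * sq_norm (h k))"
  have A: "A \<ge> 0" unfolding A_def by (intro real_sqrt_ge_zero sum_nonneg mult_nonneg_nonneg) auto
  have B: "B \<ge> 0" by (simp add: B_def)
  have "(LINT z|sphere_measure. norm (evol n h F t z) powr q) powr (p / q) \<le> (B * A) powr p" for t
  proof -
    have "(LINT z|sphere_measure. norm (\<Sum>k\<in>F. cis (of_int (lam n k) * t) * h k z) powr q)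
        \<le> (8 * max 1 (4 / sqrt (sphere_vol TYPE('m))) * sqrt (\<Sum>k\<in>F. mu n k powr (2 / p) * sq_norm (\<lambda>z. cis (of_int (lam n k) * t) * h k z))) powr q"
    proof (rule sobolev[OF n F _ q])
      show "2 / p = real (n + 1) * (1 - 2 / q)" using pq by (simp add: add.commute)
      show "2 / p \<le> 1" using p by simp
    qed (intro harm_cmult h)
    then have "(LINT z|sphere_measure. norm (evol n h F t z) powr q) \<le> (B * A) powr q"
      by (simp add: evol_def B_def A_def sq_norm_cmult)
    then have "(LINT z|sphere_measure. norm (evol n h F t z) powr q) powr (p / q) \<le> ((B * A) powr q) powr (p / q)"
      using p q by (intro powr_mono2 Bochner_Integration.integral_nonneg) auto
    then show ?thesis using q by (simp add: powr_powr)
  qed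
  then have "mixed_powr n T p q h F \<le> (\<integral>\<^sup>+ t. ennreal ((B * A) powr p) \<partial>time_measure T)"
    unfolding mixed_powr_def by (intro nn_integral_mono ennreal_leI)
  also have "\<dots> = ennreal ((2 * T) * (B * A) powr p)"
    using T by (simp add: emeasure_restrict_space space_restrict_space ennreal_mult[symmetric] mult.commute)
  also have "\<dots> \<le> ennreal ((max 1 (2 * T) * B * A) powr p)"
  proof (rule ennreal_leI)
    have "2 * T \<le> max 1 (2 * T) powr 1" by simp
    also have "\<dots> \<le> max 1 (2 * T) powr p" using p by (intro powr_mono) auto
    finally have "2 * T * (B * A) powr p \<le> max 1 (2 * T) powr p * (B * A) powr p" by (intro mult_right_mono) auto
    then show "2 * T * (B * A) powr p \<le> (max 1 (2 * T) * B * A) powr p" by (simp only: powr_mult mult.assoc)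
  qed
  finally show ?thesis by (simp only: A_def B_def)
qed

text \<open>
  Splitting the cone by \<open>2\<^sup>i \<le> \<mu>\<^bsup>2/p\<^esup> < 2\<^bsup>i+1\<^esup>\<close> rather than dyadically in \<open>\<mu>\<close> keeps the constant
  independent of \<open>p\<close>.
\<close>

lemma cone_estimate:
  fixes K :: nat and s :: real
  assumes n: "CARD('m::finite) = n + 1" "n \<ge> 1" and M: "M > 1" and s: "s > 2 * real n / (real n + 1)"
  obtains C where "C \<ge> 1"
    "\<And>F (p::real) (q::real) (h :: nat \<times> nat \<Rightarrow> complex^'m \<Rightarrow> complex). finite F \<Longrightarrow> F \<subseteq> cone_region M \<Longrightarrow>
      (\<And>k. k \<in> F \<Longrightarrow> h k \<in> harmk k) \<Longrightarrow> p \<ge> 2 \<Longrightarrow> q \<ge> 2 \<Longrightarrow> q \<le> 4 \<Longrightarrow> 2 / p = (real n + 1) * (1 - 2 / q) \<Longrightarrow>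
      mixed_powr n (2 * pi * real K) p q h F \<le> ennreal ((C * sqrt (\<Sum>k\<in>F. mu n k powr (s / p) * sq_norm (h k))) powr p)"
proof -
  let ?T = "2 * pi * real K"
  \<comment> \<open>Half of the gap between \<open>n\<close> and \<open>(n + 1) * s / 2\<close>. A
    block of index \<open>i\<close> then loses \<open>2 powr ((i + 1) * \<delta>)\<close>, its
    weight in the norm is \<open>2 powr (s / 4 * i)\<close>, and the positive difference \<gamma> of
    the rates is the decay available for the sum over the blocks.\<close>
  define \<epsilon> where "\<epsilon> = ((real n + 1) * s / 2 - real n) / 2"
  have \<epsilon>: "\<epsilon> > 0" using s by (simp add: \<epsilon>_def field_simps)
  define \<delta> where "\<delta> = (real n + \<epsilon>) / (2 * (real n + 1))"
  define \<gamma> where "\<gamma> = s / 4 - \<delta>"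
  have "\<gamma> = \<epsilon> / (2 * (real n + 1))" by (simp add: \<gamma>_def \<delta>_def \<epsilon>_def field_simps)
  then have \<gamma>: "\<gamma> > 0" using \<epsilon> by simp
  have "0 \<le> 2 * real n / (real n + 1)" by simp
  with s have s0: "s > 0" by linarith
  obtain C0 where C0: "C0 \<ge> 1" and blk: "\<And>F (L::real) (p::real) (q::real) (h :: nat \<times> nat \<Rightarrow> complex^'m \<Rightarrow> complex).
      finite F \<Longrightarrow> F \<subseteq> cone_region M \<Longrightarrow> L \<ge> 1 \<Longrightarrow>
      (\<And>k. k \<in> F \<Longrightarrow> mu n k \<le> L) \<Longrightarrow> (\<And>k. k \<in> F \<Longrightarrow> h k \<in> harmk k) \<Longrightarrow>
      p \<ge> 2 \<Longrightarrow> q \<ge> 2 \<Longrightarrow> q \<le> 4 \<Longrightarrow> 2 / p = (real n + 1) * (1 - 2 / q) \<Longrightarrow>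
      mixed_powr n ?T p q h F \<le> ennreal ((C0 * L powr ((real n + \<epsilon>) / ((real n + 1) * p)) * sqrt (\<Sum>k\<in>F. sq_norm (h k))) powr p)"
    using cone_block[OF n M \<epsilon>, of K] unfolding mixed_powr_def by blast
  define r where "r = 2 powr (- 2 * \<gamma>)"
  have "2 powr (- 2 * \<gamma>) < 2 powr (0::real)" using \<gamma> by (intro powr_less_mono) auto
  then have r: "0 \<le> r" "r < 1" by (simp_all add: r_def)
  define C where "C = max 1 (C0 * 2 powr \<delta> * sqrt (1 / (1 - r)))"
  have C1: "C \<ge> 1" by (simp add: C_def)
  have main: "mixed_powr n ?T p q h F \<le> ennreal ((C * sqrt (\<Sum>k\<in>F. mu n k powr (s / p) * sq_norm (h k))) powr p)"
    if F: "finite F" "F \<subseteq> cone_region M" and h: "\<And>k. k \<in> F \<Longrightarrow> h k \<in> harmk k"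
      and p: "p \<ge> 2" and q: "q \<ge> 2" "q \<le> 4" and pq: "2 / p = (real n + 1) * (1 - 2 / q)"
    for F and p q :: real and h :: "nat \<times> nat \<Rightarrow> complex^'m \<Rightarrow> complex"
  proof -
    define \<theta> where "\<theta> = 2 / p"
    have \<theta>: "\<theta> > 0" using p by (simp add: \<theta>_def)
    define idx where "idx k = nat \<lfloor>\<theta> * log 2 (mu n k)\<rfloor>" for k
    have mu_powr: "mu n k powr x = 2 powr (x * log 2 (mu n k))" for k x
    proof -
      have "2 powr (x * log 2 (mu n k)) = (2 powr (log 2 (mu n k))) powr x" by (simp only: powr_powr mult.commute)
      also have "2 powr (log 2 (mu n k)) = mu n k" by simp
      finally show ?thesis by (rule sym)
    qed
    have idx: "real (idx k) \<le> \<theta> * log 2 (mu n k)" "\<theta> * log 2 (mu n k) \<le> real (idx k) + 1" for k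
    proof -
      have "\<theta> * log 2 (mu n k) \<ge> 0" using \<theta> mu_ge_1[of n k] by simp
      then have "real (idx k) = of_int \<lfloor>\<theta> * log 2 (mu n k)\<rfloor>" by (simp add: idx_def)
      then show "real (idx k) \<le> \<theta> * log 2 (mu n k)" "\<theta> * log 2 (mu n k) \<le> real (idx k) + 1" by linarith+
    qed
    define S where "S i = (\<Sum>k\<in>{k \<in> F. idx k = i}. sq_norm (h k))" for i
    have S0: "S i \<ge> 0" for i by (simp add: S_def sum_nonneg)
    define a where "a i = C0 * 2 powr ((real i + 1) * \<delta>) * sqrt (S i)" for i
    have a0: "a i \<ge> 0" for i using C0 S0 by (simp add: a_def)
    have "mixed_powr n ?T p q h F \<le> ennreal ((\<Sum>i\<in>idx ` F. a i) powr p)"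
    proof (rule mixed_powr_triangle[OF F(1) h])
      fix i
      have "mixed_powr n ?T p q h {k \<in> F. idx k = i}
          \<le> ennreal ((C0 * (2 powr ((real i + 1) / \<theta>)) powr ((real n + \<epsilon>) / ((real n + 1) * p)) * sqrt (\<Sum>k\<in>{k \<in> F. idx k = i}. sq_norm (h k))) powr p)"
      proof (rule blk)
        show "1 \<le> 2 powr ((real i + 1) / \<theta>)" using \<theta> by (intro ge_one_powr_ge_zero) auto
        fix k assume k: "k \<in> {k \<in> F. idx k = i}"
        then have "log 2 (mu n k) \<le> (real i + 1) / \<theta>" using idx(2)[of k] \<theta> by (simp add: field_simps)
        then have "2 powr (1 * log 2 (mu n k)) \<le> 2 powr ((real i + 1) / \<theta>)" by (intro powr_mono) auto
        then show "mu n k \<le> 2 powr ((real i + 1) / \<theta>)" using mu_powr[of k 1, symmetric] less_imp_le[OF mu_pos] by simp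
      qed (use F h p q pq in auto)
      also have "(2 powr ((real i + 1) / \<theta>)) powr ((real n + \<epsilon>) / ((real n + 1) * p)) = 2 powr ((real i + 1) * \<delta>)"
        using p by (simp add: powr_powr \<theta>_def \<delta>_def)
      finally show "mixed_powr n ?T p q h {k \<in> F. idx k = i} \<le> ennreal (a i powr p)" by (simp only: a_def S_def)
    qed (use p q a0 in auto)
    also have "\<dots> \<le> ennreal ((C * sqrt (\<Sum>k\<in>F. mu n k powr (s / p) * sq_norm (h k))) powr p)"
    proof (intro ennreal_leI powr_mono2)
      let ?I = "idx ` F"
      let ?Z = "\<Sum>k\<in>F. mu n k powr (s / p) * sq_norm (h k)"
      \<comment> \<open>Each bound is split into a decaying factor and the root of the weighted mass
        of the block, to be summed by Cauchy-Schwarz. The factor \<open>2 powr \<delta>\<close>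
        accounts for the upper end \<open>i + 1\<close> of the block.\<close>
      have ai: "a i = C0 * 2 powr \<delta> * (2 powr (- (\<gamma> * i)) * sqrt (2 powr (s / 2 * i) * S i))" for i
      proof -
        have "2 powr ((real i + 1) * \<delta>) = 2 powr \<delta> * (2 powr (- (\<gamma> * i)) * 2 powr (s / 4 * i))"
          unfolding powr_add[symmetric] by (simp add: \<gamma>_def algebra_simps)
        moreover have "2 powr (s / 4 * i) = sqrt (2 powr (s / 2 * i))"
          by (simp add: powr_half_sqrt[symmetric] powr_powr)
        ultimately show ?thesis by (simp only: a_def real_sqrt_mult mult.assoc)
      qed
      have "(\<Sum>i\<in>?I. 2 powr (- (\<gamma> * i)) * sqrt (2 powr (s / 2 * i) * S i))
          \<le> sqrt (\<Sum>i\<in>?I. (2 powr (- (\<gamma> * i)))\<^sup>2) * sqrt (\<Sum>i\<in>?I. (sqrt (2 powr (s / 2 * i) * S i))\<^sup>2)"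
        using L2_set_mult_ineq[of "\<lambda>i. 2 powr (- (\<gamma> * real i))" "\<lambda>i. sqrt (2 powr (s / 2 * real i) * S i)" ?I] S0
        unfolding L2_set_def by simp
      also have "\<dots> \<le> sqrt (1 / (1 - r)) * sqrt ?Z"
      proof (intro mult_mono real_sqrt_le_mono)
        have "(2 powr (- (\<gamma> * real i)))\<^sup>2 = r ^ i" for i
        proof -
          have "(2 powr (- (\<gamma> * real i)))\<^sup>2 = 2 powr (- (\<gamma> * real i) * 2)" unfolding power2_eq_square powr_add[symmetric] by (simp add: mult_ac)
          also have "\<dots> = r powr real i" unfolding r_def powr_powr by (rule arg_cong[where f="\<lambda>x. 2 powr x"]) simp
          also have "\<dots> = r ^ i" by (simp add: r_def powr_realpow)
          finally show ?thesis .
        qed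
        then have "(\<Sum>i\<in>?I. (2 powr (- (\<gamma> * i)))\<^sup>2) = (\<Sum>i\<in>?I. r ^ i)" by simp
        also have "\<dots> \<le> (\<Sum>i. r ^ i)" using r F by (intro sum_le_suminf summable_geometric) auto
        also have "\<dots> = 1 / (1 - r)" using r by (intro suminf_geometric) auto
        finally show "(\<Sum>i\<in>?I. (2 powr (- (\<gamma> * i)))\<^sup>2) \<le> 1 / (1 - r)" .
        have "(\<Sum>i\<in>?I. (sqrt (2 powr (s / 2 * i) * S i))\<^sup>2) = (\<Sum>i\<in>?I. \<Sum>k\<in>{k \<in> F. idx k = i}. 2 powr (s / 2 * real i) * sq_norm (h k))"
        proof (rule sum.cong[OF refl])
          fix i
          have "(sqrt (2 powr (s / 2 * real i) * S i))\<^sup>2 = 2 powr (s / 2 * real i) * S i" using S0[of i] by simp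
          then show "(sqrt (2 powr (s / 2 * real i) * S i))\<^sup>2 = (\<Sum>k\<in>{k \<in> F. idx k = i}. 2 powr (s / 2 * real i) * sq_norm (h k))"
            by (simp only: S_def sum_distrib_left)
        qed
        also have "\<dots> = (\<Sum>i\<in>?I. \<Sum>k\<in>{k \<in> F. idx k = i}. 2 powr (s / 2 * real (idx k)) * sq_norm (h k))"
          by (intro sum.cong refl) auto
        also have "\<dots> = (\<Sum>k\<in>F. 2 powr (s / 2 * real (idx k)) * sq_norm (h k))"
          by (rule sum.image_gen[OF F(1), symmetric])
        also have "\<dots> \<le> ?Z"
        proof (intro sum_mono mult_right_mono sq_norm_nonneg)
          fix k
          have "s / 2 * real (idx k) \<le> s / 2 * (\<theta> * log 2 (mu n k))" using idx(1)[of k] s0 by (intro mult_left_mono) auto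
          then have "2 powr (s / 2 * real (idx k)) \<le> 2 powr (s / p * log 2 (mu n k))"
            by (intro powr_mono) (auto simp: \<theta>_def)
          then show "2 powr (s / 2 * real (idx k)) \<le> mu n k powr (s / p)" by (simp only: mu_powr[symmetric])
        qed
        finally show "(\<Sum>i\<in>?I. (sqrt (2 powr (s / 2 * i) * S i))\<^sup>2) \<le> ?Z" .
      qed (use r in \<open>auto intro: sum_nonneg\<close>)
      finally have "(\<Sum>i\<in>?I. 2 powr (- (\<gamma> * i)) * sqrt (2 powr (s / 2 * i) * S i)) \<le> sqrt (1 / (1 - r)) * sqrt ?Z" .
      then have "C0 * 2 powr \<delta> * (\<Sum>i\<in>?I. 2 powr (- (\<gamma> * i)) * sqrt (2 powr (s / 2 * i) * S i))
          \<le> C0 * 2 powr \<delta> * (sqrt (1 / (1 - r)) * sqrt ?Z)"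
        using C0 by (intro mult_left_mono) auto
      then have "(\<Sum>i\<in>?I. a i) \<le> C0 * 2 powr \<delta> * sqrt (1 / (1 - r)) * sqrt ?Z"
        by (simp only: ai sum_distrib_left mult.assoc)
      also have "\<dots> \<le> C * sqrt ?Z" unfolding C_def by (intro mult_right_mono real_sqrt_ge_zero sum_nonneg) auto
      finally show "(\<Sum>i\<in>?I. a i) \<le> C * sqrt ?Z" .
    qed (use p a0 in \<open>auto intro: sum_nonneg\<close>)
    finally show ?thesis .
  qed
  show ?thesis by (rule that[OF C1]) (rule main)
qed

lemma finite_estimate:
  fixes K :: nat and s :: real
  assumes n: "CARD('m::finite) = n + 1" "n \<ge> 1" and M: "M > 1" and s: "s > 2 * real n / (real n + 1)"
  obtains C where "C \<ge> 1"
    "\<And>F (p::real) (q::real) (h :: nat \<times> nat \<Rightarrow> complex^'m \<Rightarrow> complex). finite F \<Longrightarrow>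
      (\<And>k. k \<in> F \<Longrightarrow> h k \<in> harmk k) \<Longrightarrow> p \<ge> 2 \<Longrightarrow> q \<ge> 2 \<Longrightarrow> q \<le> 4 \<Longrightarrow> 2 / p = (real n + 1) * (1 - 2 / q) \<Longrightarrow>
      mixed_powr n (2 * pi * real K) p q h F \<le> ennreal ((C * sqrt
        ((\<Sum>k\<in>F \<inter> cone_region M. mu n k powr (s / p) * sq_norm (h k)) + (\<Sum>k\<in>F - cone_region M. mu n k powr (2 / p) * sq_norm (h k)))) powr p)"
proof -
  let ?T = "2 * pi * real K"
  obtain C1 where C1: "C1 \<ge> 1" and cone: "\<And>F (p::real) (q::real) (h :: nat \<times> nat \<Rightarrow> complex^'m \<Rightarrow> complex). finite F \<Longrightarrow> F \<subseteq> cone_region M \<Longrightarrow>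
      (\<And>k. k \<in> F \<Longrightarrow> h k \<in> harmk k) \<Longrightarrow> p \<ge> 2 \<Longrightarrow> q \<ge> 2 \<Longrightarrow> q \<le> 4 \<Longrightarrow> 2 / p = (real n + 1) * (1 - 2 / q) \<Longrightarrow>
      mixed_powr n ?T p q h F \<le> ennreal ((C1 * sqrt (\<Sum>k\<in>F. mu n k powr (s / p) * sq_norm (h k))) powr p)"
    using cone_estimate[OF n M s, of K] by blast
  define C2 where "C2 = max 1 (2 * ?T) * (8 * max 1 (4 / sqrt (sphere_vol TYPE('m))))"
  have C2: "C2 \<ge> 0" unfolding C2_def by (intro mult_nonneg_nonneg) auto
  have C: "C1 + C2 \<ge> 1" using C1 C2 by linarith
  have main: "mixed_powr n ?T p q h F \<le> ennreal (((C1 + C2) * sqrt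
        ((\<Sum>k\<in>F \<inter> cone_region M. mu n k powr (s / p) * sq_norm (h k)) + (\<Sum>k\<in>F - cone_region M. mu n k powr (2 / p) * sq_norm (h k)))) powr p)"
    if F: "finite F" and h: "\<And>k. k \<in> F \<Longrightarrow> h k \<in> harmk k"
      and p: "p \<ge> 2" and q: "q \<ge> 2" "q \<le> 4" and pq: "2 / p = (real n + 1) * (1 - 2 / q)"
    for F and p q :: real and h :: "nat \<times> nat \<Rightarrow> complex^'m \<Rightarrow> complex"
  proof -
    define A1 where "A1 = (\<Sum>k\<in>F \<inter> cone_region M. mu n k powr (s / p) * sq_norm (h k))"
    define A2 where "A2 = (\<Sum>k\<in>F - cone_region M. mu n k powr (2 / p) * sq_norm (h k))"
    have A: "A1 \<ge> 0" "A2 \<ge> 0" by (simp_all add: A1_def A2_def sum_nonneg)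
    define a where "a c = (if c then C1 * sqrt A1 else C2 * sqrt A2)" for c
    have a0: "a c \<ge> 0" for c using C1 C2 A by (simp add: a_def)
    have "mixed_powr n ?T p q h F \<le> ennreal ((\<Sum>c\<in>(\<lambda>k. k \<in> cone_region M) ` F. a c) powr p)"
    proof (rule mixed_powr_triangle[OF F h])
      fix c
      show "mixed_powr n ?T p q h {k \<in> F. (k \<in> cone_region M) = c} \<le> ennreal (a c powr p)"
      proof (cases c)
        case True
        then have e: "{k \<in> F. (k \<in> cone_region M) = c} = F \<inter> cone_region M" by auto
        show ?thesis unfolding e a_def A1_def if_P[OF True] using F h p q pq by (intro cone) auto
      next
        case False
        then have e: "{k \<in> F. (k \<in> cone_region M) = c} = F - cone_region M" by auto
        show ?thesis unfolding e a_def A2_def C2_def if_not_P[OF False] using F h p q pq by (intro edge_estimate n) auto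
      qed
    qed (use p q a0 in auto)
    also have "\<dots> \<le> ennreal (((C1 + C2) * sqrt (A1 + A2)) powr p)"
    proof (intro ennreal_leI powr_mono2)
      have "(\<Sum>c\<in>(\<lambda>k. k \<in> cone_region M) ` F. a c) \<le> (\<Sum>c\<in>UNIV. a c)" using a0 by (intro sum_mono2) auto
      also have "\<dots> = C1 * sqrt A1 + C2 * sqrt A2" by (simp add: UNIV_bool a_def)
      also have "\<dots> \<le> C1 * sqrt (A1 + A2) + C2 * sqrt (A1 + A2)" using C1 C2 A by (intro add_mono mult_left_mono) auto
      also have "\<dots> = (C1 + C2) * sqrt (A1 + A2)" by (simp add: distrib_right)
      finally show "(\<Sum>c\<in>(\<lambda>k. k \<in> cone_region M) ` F. a c) \<le> (C1 + C2) * sqrt (A1 + A2)" .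
    qed (use p a0 in \<open>auto intro: sum_nonneg\<close>)
    finally show ?thesis by (simp only: A1_def A2_def)
  qed
  show ?thesis by (rule that[OF C]) (rule main)
qed

section \<open>Passage to the limit\<close>

text \<open>Convergence in mean gives pointwise convergence almost everywhere only along a
  subsequence. So a subsequence is chosen on which the integrals stay at or below \<open>y\<close>,
  and Fatou's lemma is applied to a further one.\<close>

lemma fatou_L2:
  fixes f :: "complex^'m::finite \<Rightarrow> complex" and g :: "nat \<Rightarrow> complex^'m \<Rightarrow> complex"
  assumes f: "L2s f" and g: "\<And>k. L2s (g k)" and lim: "(\<lambda>k. sq_norm (\<lambda>z. f z - g k z)) \<longlonglongrightarrow> 0" and q: "q > 0"
  shows "(\<integral>\<^sup>+ z. ennreal (norm (f z) powr q) \<partial>sphere_measure) \<le> liminf (\<lambda>k. \<integral>\<^sup>+ z. ennreal (norm (g k z) powr q) \<partial>sphere_measure)"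
  unfolding le_Liminf_iff
proof (intro allI impI)
  fix y assume y: "y < (\<integral>\<^sup>+ z. ennreal (norm (f z) powr q) \<partial>sphere_measure)"
  show "\<forall>\<^sub>F k in sequentially. y < (\<integral>\<^sup>+ z. ennreal (norm (g k z) powr q) \<partial>sphere_measure)"
  proof (rule ccontr)
    assume "\<not> ?thesis"
    from not_eventually_sequentiallyD[OF this] obtain r :: "nat \<Rightarrow> nat" where r: "strict_mono r"
      "\<forall>k. \<not> y < (\<integral>\<^sup>+ z. ennreal (norm (g (r k) z) powr q) \<partial>sphere_measure)" by blast
    have "\<exists>r'. strict_mono r' \<and> (AE z in sphere_measure. (\<lambda>k. (norm (f z - g (r (r' k)) z))\<^sup>2) \<longlonglongrightarrow> 0)"
    proof (rule tendsto_L1_AE_subseq)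
      show "integrable sphere_measure (\<lambda>z. (norm (f z - g (r k) z))\<^sup>2)" for k
        using L2s_diff[OF f g] by (simp add: L2s_def)
      show "(\<lambda>k. LINT z|sphere_measure. norm ((norm (f z - g (r k) z))\<^sup>2)) \<longlonglongrightarrow> 0"
        using LIMSEQ_subseq_LIMSEQ[OF lim r(1)] by (simp add: sq_norm_def o_def)
    qed
    then obtain r' where ae: "AE z in sphere_measure. (\<lambda>k. (norm (f z - g (r (r' k)) z))\<^sup>2) \<longlonglongrightarrow> 0" by blast
    have "AE z in sphere_measure. ennreal (norm (f z) powr q) = liminf (\<lambda>k. ennreal (norm (g (r (r' k)) z) powr q))"
      using ae
    proof eventually_elim
      case (elim z)
      have "(\<lambda>k. norm (f z - g (r (r' k)) z)) \<longlonglongrightarrow> 0"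
        using tendsto_real_sqrt[OF elim] by simp
      then have "(\<lambda>k. f z - g (r (r' k)) z) \<longlonglongrightarrow> 0" by (rule tendsto_norm_zero_cancel)
      from tendsto_diff[OF tendsto_const this, of "f z"] have "(\<lambda>k. g (r (r' k)) z) \<longlonglongrightarrow> f z" by simp
      then have "(\<lambda>k. norm (g (r (r' k)) z)) \<longlonglongrightarrow> norm (f z)" by (rule tendsto_norm)
      then have "(\<lambda>k. norm (g (r (r' k)) z) powr q) \<longlonglongrightarrow> norm (f z) powr q"
        using q by (intro tendsto_powr' tendsto_const) auto
      then have "(\<lambda>k. ennreal (norm (g (r (r' k)) z) powr q)) \<longlonglongrightarrow> ennreal (norm (f z) powr q)" by (rule tendsto_ennrealI)
      then show ?case by (rule lim_imp_Liminf[OF trivial_limit_sequentially, symmetric])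
    qed
    then have "(\<integral>\<^sup>+ z. ennreal (norm (f z) powr q) \<partial>sphere_measure)
        = (\<integral>\<^sup>+ z. liminf (\<lambda>k. ennreal (norm (g (r (r' k)) z) powr q)) \<partial>sphere_measure)"
      by (rule nn_integral_cong_AE)
    also have "\<dots> \<le> liminf (\<lambda>k. \<integral>\<^sup>+ z. ennreal (norm (g (r (r' k)) z) powr q) \<partial>sphere_measure)"
    proof (rule nn_integral_liminf)
      fix k
      have "g (r (r' k)) \<in> borel_measurable sphere_measure" by (rule L2s_measurable[OF g])
      then show "(\<lambda>z. ennreal (norm (g (r (r' k)) z) powr q)) \<in> borel_measurable sphere_measure" by measurable
    qed
    also have "\<dots> \<le> y"
    proof -
      have "liminf (\<lambda>k. \<integral>\<^sup>+ z. ennreal (norm (g (r (r' k)) z) powr q) \<partial>sphere_measure) \<le> limsup (\<lambda>k. \<integral>\<^sup>+ z. ennreal (norm (g (r (r' k)) z) powr q) \<partial>sphere_measure)"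
        by (rule Liminf_le_Limsup) simp
      also have "\<dots> \<le> y" using r(2) by (intro Limsup_bounded always_eventually) (auto simp: not_less)
      finally show ?thesis .
    qed
    finally show False using y by simp
  qed
qed

lemma sphere_norm_powr:
  assumes q: "q > 0"
  shows "ennreal_powr (sphere_norm (ereal q) f) p = ennreal_powr (\<integral>\<^sup>+ z. ennreal (norm (f z) powr q) \<partial>sphere_measure) (p / q)"
proof -
  have "ennreal_powr (ennreal_powr x (1 / q)) p = ennreal_powr x (p / q)" for x
    by (cases x) (simp_all add: ennreal_powr_ennreal powr_powr, simp_all add: ennreal_powr_def)
  then show ?thesis by (simp add: sphere_norm_def Lp_norm_def ennreal_powr_ennreal)
qed

text \<open>A bound \<open>w\<close> below the power is carried back by the exponent
  \<open>1 / a\<close> to a bound below \<open>Y\<close>, which may be infinite, and then forward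
  again.\<close>

lemma ennreal_powr_le_liminf:
  assumes a: "a > 0" and Y: "Y \<le> liminf (\<lambda>k. ennreal (y k))" and y: "\<And>k. y k \<ge> 0"
  shows "ennreal_powr Y a \<le> liminf (\<lambda>k. ennreal (y k powr a))"
  unfolding le_Liminf_iff
proof (intro allI impI)
  fix w assume w: "w < ennreal_powr Y a"
  then obtain w' where w': "w = ennreal w'" "w' \<ge> 0" by (cases w) auto
  have "ennreal (w' powr (1 / a)) < Y"
  proof (cases Y)
    case (real Y')
    then have "w' < Y' powr a" using w w' by (simp add: ennreal_powr_ennreal ennreal_less_iff)
    then have "w' powr (1 / a) < (Y' powr a) powr (1 / a)" using a w' by (intro powr_less_mono2) auto
    then show ?thesis using real a by (simp add: powr_powr ennreal_less_iff)
  qed simp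
  then have "\<forall>\<^sub>F k in sequentially. ennreal (w' powr (1 / a)) < ennreal (y k)"
    using Y unfolding le_Liminf_iff by blast
  then show "\<forall>\<^sub>F k in sequentially. w < ennreal (y k powr a)"
  proof eventually_elim
    case (elim k)
    then have "w' powr (1 / a) < y k" by (simp add: ennreal_less_iff)
    then have "(w' powr (1 / a)) powr a < y k powr a" using a by (intro powr_less_mono2) auto
    then show ?case using a w' by (simp add: powr_powr ennreal_less_iff)
  qed
qed

text \<open>Fatou's lemma is applied twice, in space at each fixed time and then in time. The
  measurability in time comes from the finite sums, so the pointwise bound of the norm of
  \<open>v t\<close> is taken before integrating.\<close>

lemma mixed_norm_le:
  fixes v :: "real \<Rightarrow> complex^'m::finite \<Rightarrow> complex" and H :: "nat \<times> nat \<Rightarrow> complex^'m \<Rightarrow> complex"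
  assumes v: "\<And>t. L2s (v t)" and H: "\<And>k. H k \<in> harmk k" and F: "\<And>k::nat. finite (F k)"
    and lim: "\<And>t. (\<lambda>k. sq_norm (\<lambda>z. v t z - evol n H (F k) t z)) \<longlonglongrightarrow> 0"
    and pq: "p > 0" "q > 0" and B: "B \<ge> 0" "\<And>k. mixed_powr n T p q H (F k) \<le> ennreal (B powr p)"
    and I: "I \<in> sets borel" "I \<subseteq> {-T..T}"
  shows "mixed_norm (ereal p) (ereal q) I v \<le> ennreal B"
proof -
  let ?\<Phi> = "\<lambda>k t. ennreal ((LINT z|sphere_measure. norm (evol n H (F k) t z) powr q) powr (p / q))"
  have pt: "ennreal_powr (sphere_norm (ereal q) (v t)) p \<le> liminf (\<lambda>k. ?\<Phi> k t)" for t
  proof -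
    have "(\<integral>\<^sup>+ z. ennreal (norm (v t z) powr q) \<partial>sphere_measure) \<le> liminf (\<lambda>k. \<integral>\<^sup>+ z. ennreal (norm (evol n H (F k) t z) powr q) \<partial>sphere_measure)"
      by (intro fatou_L2 v lim pq L2s_continuous evol_continuous H)
    also have "\<dots> = liminf (\<lambda>k. ennreal (LINT z|sphere_measure. norm (evol n H (F k) t z) powr q))"
      by (intro arg_cong[where f=liminf] ext nn_integral_eq_integral evol_powr_integrable H pq AE_I2) auto
    finally show ?thesis unfolding sphere_norm_powr[OF pq(2)]
      using pq by (intro ennreal_powr_le_liminf Bochner_Integration.integral_nonneg) auto
  qed
  have "(\<integral>\<^sup>+ t. ennreal_powr (sphere_norm (ereal q) (v t)) p \<partial>restrict_space lborel I)
      = (\<integral>\<^sup>+ t. ennreal_powr (sphere_norm (ereal q) (v t)) p * indicator I t \<partial>lborel)"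
    using I by (intro nn_integral_restrict_space) auto
  also have "\<dots> \<le> (\<integral>\<^sup>+ t. liminf (\<lambda>k. ?\<Phi> k t) * indicator {-T..T} t \<partial>lborel)"
    using I by (intro nn_integral_mono mult_mono pt) (auto simp: indicator_def)
  also have "\<dots> = (\<integral>\<^sup>+ t. liminf (\<lambda>k. ?\<Phi> k t) \<partial>time_measure T)"
    by (intro nn_integral_restrict_space[symmetric]) auto
  also have "\<dots> \<le> liminf (\<lambda>k. \<integral>\<^sup>+ t. ?\<Phi> k t \<partial>time_measure T)"
  proof (rule nn_integral_liminf)
    fix k
    have "(\<lambda>t. LINT z|sphere_measure. norm (evol n H (F k) t z) powr q) \<in> borel_measurable (time_measure T)"
      by (intro evol_powr_measurable F H)
    then show "?\<Phi> k \<in> borel_measurable (time_measure T)" by measurable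
  qed
  also have "\<dots> \<le> limsup (\<lambda>k. \<integral>\<^sup>+ t. ?\<Phi> k t \<partial>time_measure T)" by (rule Liminf_le_Limsup) simp
  also have "\<dots> \<le> ennreal (B powr p)" 
    using B(2) by (intro Limsup_bounded always_eventually) (simp add: mixed_powr_def)
  finally have le: "(\<integral>\<^sup>+ t. ennreal_powr (sphere_norm (ereal q) (v t)) p \<partial>restrict_space lborel I) \<le> ennreal (B powr p)" .
  then obtain x where x: "(\<integral>\<^sup>+ t. ennreal_powr (sphere_norm (ereal q) (v t)) p \<partial>restrict_space lborel I) = ennreal x" "0 \<le> x" "x \<le> B powr p"
    by (cases "\<integral>\<^sup>+ t. ennreal_powr (sphere_norm (ereal q) (v t)) p \<partial>restrict_space lborel I") (auto simp: top_unique)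
  then have "x powr (1 / p) \<le> (B powr p) powr (1 / p)" using pq by (intro powr_mono2) auto
  also have "\<dots> = B" using pq B by (simp add: powr_powr)
  finally show ?thesis using x by (simp add: mixed_norm_def Lp_norm_def ennreal_powr_ennreal ennreal_leI)
qed

section \<open>The Strichartz estimate\<close>

lemma ennreal_sum_le_infsum:
  fixes f :: "'i \<Rightarrow> ennreal"
  assumes "finite F" "F \<subseteq> A"
  shows "sum f F \<le> infsum f A"
  using assms by (subst nonneg_infsum_complete) (auto intro!: SUP_upper)

text \<open>Converts the two infinite sums in \<open>ennreal\<close> into one real number that
  bounds all finite partial sums, the form in which \<open>finite_estimate\<close> can use
  them.\<close>

lemma X_norm_bound:
  fixes v0 :: "complex^'m::finite \<Rightarrow> complex" and H :: "nat \<times> nat \<Rightarrow> complex^'m \<Rightarrow> complex"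
  assumes H: "\<And>k. H k \<in> harmk k" "\<And>k. harm_proj (fst k) (snd k) v0 = restrict (H k) (sphere 0 1)"
    and fin: "X_norm n M r s v0 \<noteq> top"
  obtains A where "A \<ge> 0" "X_norm n M r s v0 = ennreal (sqrt A)"
    "\<And>F. finite F \<Longrightarrow> (\<Sum>k\<in>F \<inter> cone_region M. mu n k powr r * sq_norm (H k)) + (\<Sum>k\<in>F - cone_region M. mu n k powr s * sq_norm (H k)) \<le> A"
proof -
  have nrm: "(sphere_norm 2 (harm_proj (fst k) (snd k) v0))\<^sup>2 = ennreal (sq_norm (H k))" for k
  proof -
    have L: "L2s (H k)" by (intro L2s_cpoly harm_cpoly[OF H(1)])
    have "L2s (restrict (H k) (sphere 0 1))" using L by (subst L2s_cong[of _ "H k"]) auto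
    then have "sphere_norm 2 (harm_proj (fst k) (snd k) v0) = ennreal (sqrt (sq_norm (restrict (H k) (sphere 0 1))))"
      unfolding H(2) by (rule sphere_norm_2_L2s)
    also have "sq_norm (restrict (H k) (sphere 0 1)) = sq_norm (H k)" by (rule sq_norm_cong) auto
    finally show ?thesis by (simp add: ennreal_power)
  qed
  define S where "S B e = (\<Sum>\<^sub>\<infinity>k\<in>B. ennreal (mu n k powr e * sq_norm (H k)))" for B e
  have X: "X_norm n M r s v0 = ennreal_powr (S (cone_region M) r + S (- cone_region M) s) (1 / 2)"
    unfolding X_norm_def S_def case_prod_beta nrm mu_def by (simp add: ennreal_mult)
  then have "S (cone_region M) r + S (- cone_region M) s \<noteq> top" using fin by (auto simp: ennreal_powr_def)
  then obtain A where A: "S (cone_region M) r + S (- cone_region M) s = ennreal A" "A \<ge> 0"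
    by (cases "S (cone_region M) r + S (- cone_region M) s") auto
  show thesis
  proof (rule that[OF A(2)])
    show "X_norm n M r s v0 = ennreal (sqrt A)"
      using A by (simp add: X ennreal_powr_ennreal powr_half_sqrt)
    fix F :: "(nat \<times> nat) set" assume F: "finite F"
    have "ennreal ((\<Sum>k\<in>F \<inter> cone_region M. mu n k powr r * sq_norm (H k)) + (\<Sum>k\<in>F - cone_region M. mu n k powr s * sq_norm (H k)))
        = (\<Sum>k\<in>F \<inter> cone_region M. ennreal (mu n k powr r * sq_norm (H k))) + (\<Sum>k\<in>F - cone_region M. ennreal (mu n k powr s * sq_norm (H k)))"
      by (simp add: sum_nonneg sum_ennreal)
    also have "\<dots> \<le> S (cone_region M) r + S (- cone_region M) s"
      unfolding S_def using F by (intro add_mono ennreal_sum_le_infsum) auto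
    finally show "(\<Sum>k\<in>F \<inter> cone_region M. mu n k powr r * sq_norm (H k)) + (\<Sum>k\<in>F - cone_region M. mu n k powr s * sq_norm (H k)) \<le> A"
      using A by simp
  qed
qed

lemma sq_norm_le_expansion:
  fixes f :: "complex^'m::finite \<Rightarrow> complex"
  assumes n: "CARD('m) \<ge> 2" and f: "L2s f" and h: "\<And>k. h k \<in> harmk k"
    and ip: "\<And>k u. u \<in> harmk k \<Longrightarrow> sphere_inner f u = sphere_inner (h k) u"
    and A: "\<And>F. finite F \<Longrightarrow> (\<Sum>k\<in>F. sq_norm (h k)) \<le> A"
  shows "sq_norm f \<le> A"
proof (rule field_le_epsilon)
  fix e :: real assume "e > 0"
  then obtain F0 where F0: "finite F0" "sq_norm (\<lambda>z. f z - (\<Sum>k\<in>F0. h k z)) < e"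
    using harmonic_expansion[OF n f h ip] by blast
  then show "sq_norm f \<le> A + e" using bessel_identity[OF n f h ip F0(1)] A[OF F0(1)] by linarith
qed

text \<open>The components of \<open>v t\<close> are those of \<open>v0\<close> up to phases. The
  squares \<open>{..j} \<times> {..j}\<close> extract a sequence, as Fatou's lemma needs, from the
  net of finite sets; equal norms of components give equal total norms by Bessel and
  completeness.\<close>

lemma cauchy_solution_expansion:
  fixes v0 :: "complex^'m::{finite,linorder} \<Rightarrow> complex"
  assumes v: "cauchy_solution v0 v" and v0: "L2s v0" and n: "CARD('m) = n + 1" "n \<ge> 1"
    and H: "\<And>k. H k \<in> harmk k" "\<And>k g. g \<in> harmk k \<Longrightarrow> sphere_inner v0 g = sphere_inner (H k) g"
  shows "(\<lambda>z. cis (of_int (lam n k) * t) * H k z) \<in> harmk k"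
    and "g \<in> harmk k \<Longrightarrow> sphere_inner (v t) g = sphere_inner (\<lambda>z. cis (of_int (lam n k) * t) * H k z) g"
    and "L2s (v t)"
    and "(\<lambda>j. sq_norm (\<lambda>z. v t z - evol n H ({..j} \<times> {..j}) t z)) \<longlonglongrightarrow> 0"
    and "sq_norm (v t) = sq_norm v0"
proof -
  have n2: "CARD('m) \<ge> 2" using n by simp
  show h: "(\<lambda>z. cis (of_int (lam n k) * t) * H k z) \<in> harmk k" for k by (rule harm_cmult[OF H(1)])
  show ip: "sphere_inner (v t) g = sphere_inner (\<lambda>z. cis (of_int (lam n k) * t) * H k z) g" if "g \<in> harmk k" for k g
    using cauchy_solution_inner[OF v that n(1) v0, of t] H(2)[OF that]
    by (simp add: sphere_inner_cmult_left eigval_lam)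
  show L: "L2s (v t)" using v by (simp add: cauchy_solution_def sphere_L2_iff)
  show "(\<lambda>j. sq_norm (\<lambda>z. v t z - evol n H ({..j} \<times> {..j}) t z)) \<longlonglongrightarrow> 0"
  proof (rule LIMSEQ_I)
    fix e :: real assume "e > 0"
    from harmonic_expansion[OF n2 L h ip this] obtain F0 where F0: "finite F0"
      "\<forall>F. finite F \<longrightarrow> F0 \<subseteq> F \<longrightarrow> sq_norm (\<lambda>z. v t z - (\<Sum>k\<in>F. cis (of_int (lam n k) * t) * H k z)) < e"
      by blast
    obtain N where N: "F0 \<subseteq> {..N} \<times> {..N}"
    proof
      show "F0 \<subseteq> {..Max (insert 0 (fst ` F0) \<union> snd ` F0)} \<times> {..Max (insert 0 (fst ` F0) \<union> snd ` F0)}"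
        using F0(1) by (auto intro!: Max_ge simp: image_iff) (metis fst_conv snd_conv)+
    qed
    have "sq_norm (\<lambda>z. v t z - evol n H ({..j} \<times> {..j}) t z) < e" if "j \<ge> N" for j
    proof -
      have "F0 \<subseteq> {..j} \<times> {..j}" using N that by auto
      then show ?thesis using F0(2) by (simp add: evol_def)
    qed
    then show "\<exists>N. \<forall>j\<ge>N. norm (sq_norm (\<lambda>z. v t z - evol n H ({..j} \<times> {..j}) t z) - 0) < e" by auto
  qed
  show "sq_norm (v t) = sq_norm v0"
  proof (rule antisym)
    have s: "sq_norm (\<lambda>z. cis (of_int (lam n k) * t) * H k z) = sq_norm (H k)" for k by (simp add: sq_norm_cmult)
    show "sq_norm (v t) \<le> sq_norm v0"
    proof (rule sq_norm_le_expansion[OF n2 L h ip])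
      fix F :: "(nat \<times> nat) set" assume "finite F"
      from bessel_identity[OF n2 v0 H this] sq_norm_nonneg[of "\<lambda>z. v0 z - (\<Sum>k\<in>F. H k z)"]
      show "(\<Sum>k\<in>F. sq_norm (\<lambda>z. cis (of_int (lam n k) * t) * H k z)) \<le> sq_norm v0" unfolding s by linarith
    qed
    show "sq_norm v0 \<le> sq_norm (v t)"
    proof (rule sq_norm_le_expansion[OF n2 v0 H])
      fix F :: "(nat \<times> nat) set" assume "finite F"
      from bessel_identity[OF n2 L h ip this] sq_norm_nonneg[of "\<lambda>z. v t z - (\<Sum>k\<in>F. cis (of_int (lam n k) * t) * H k z)"]
      show "(\<Sum>k\<in>F. sq_norm (H k)) \<le> sq_norm (v t)" unfolding s by linarith
    qed
  qed
qed

text \<open>From \<open>p \<ge> 2\<close> follows \<open>q \<le> 2 * (n + 1) / n\<close>, which is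
  at most 4. This is why an estimate of the fourth power is a sufficient endpoint for
  interpolation.\<close>

lemma admissible_exponents:
  fixes p q :: real
  assumes n: "n \<ge> 1" and p: "p \<ge> 2" and pq: "2 / p + real (2 * n + 2) / q = real (2 * n + 2) / 2"
  shows "2 \<le> q" "q \<le> 4" "2 / p = (real n + 1) * (1 - 2 / q)"
proof -
  have p1: "0 < 2 / p" "2 / p \<le> 1" using p by auto
  have e: "2 / p + 2 * (real n + 1) / q = real n + 1" using pq by (simp add: add_divide_distrib)
  then show "2 / p = (real n + 1) * (1 - 2 / q)" by (simp add: field_simps)
  \<comment> \<open>The sign of \<open>q\<close> comes out of the equation itself;
    \<open>q = 0\<close> is excluded too, since division by 0 gives 0.\<close>
  have "2 * (real n + 1) / q > 0" using e p1 n by linarith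
  then have q: "q > 0" by (simp add: zero_less_divide_iff)
  have "2 * (real n + 1) / q < real n + 1" "real n \<le> 2 * (real n + 1) / q" using e p1 by linarith+
  then have q1: "2 * (real n + 1) < (real n + 1) * q" "real n * q \<le> 2 * (real n + 1)" using q by (simp_all add: field_simps)
  have "0 < (q - 2) * (real n + 1)" using q1 by (simp add: algebra_simps)
  then show "2 \<le> q" by (simp add: zero_less_mult_iff)
  have "2 * (real n + 1) \<le> real n * 4" using n by simp
  with q1 have "real n * q \<le> real n * 4" by linarith
  then show "q \<le> 4" using n by simp
qed

theorem theorem1p1:
  fixes n :: nat and M s :: real and I :: "real set"
  assumes "n \<ge> 1"
    and "CARD('m::{finite,linorder}) = n + 1"
    and "M > 1"
    and "is_interval I" and "bounded I"
    and "if n = 1 then s \<ge> s_crit n else s > s_crit n"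
  shows "\<exists>C::real. C > 0 \<and>
    (\<forall>(p::ereal) (q::real) (v0 :: complex ^ 'm::{finite,linorder} \<Rightarrow> complex) v.
       p \<ge> 2 \<longrightarrow>
       2 / p + ereal (real (2 * n + 2) / q) = ereal (real (2 * n + 2) / 2) \<longrightarrow>
       v0 \<in> sphere_L2 \<longrightarrow>
       cauchy_solution v0 v \<longrightarrow>
       mixed_norm p (ereal q) I v
         \<le> ennreal C * X_norm n M (real_of_ereal (ereal s / p)) (real_of_ereal (2 / p)) v0)"
proof -
  note n = assms(2,1)
  have n2: "CARD('m) \<ge> 2" using n by simp
  \<comment> \<open>For \<open>n = 1\<close> the right side is 1, below the value
    \<open>4 / 3\<close> of \<open>s_crit\<close>; for \<open>n > 1\<close> it is
    \<open>s_crit n\<close>.\<close>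
  have s: "s > 2 * real n / (real n + 1)"
  proof (cases "n = 1")
    case False
    have "2 * real n / (real n + 1) = 2 * (1 - 1 / (real n + 1))" by (simp add: field_simps)
    then show ?thesis using assms(6) False by (simp add: s_crit_def)
  qed (use assms(6) in \<open>simp add: s_crit_def\<close>)
  have I_borel: "I \<in> sets borel" by (rule real_interval_borel_measurable[OF assms(4)])
  obtain b where b: "\<And>t. t \<in> I \<Longrightarrow> \<bar>t\<bar> \<le> b" using assms(5) unfolding bounded_iff real_norm_def by blast
  \<comment> \<open>The interval \<open>I\<close> is enclosed in a symmetric one made of whole
    periods \<open>2 * pi\<close>, on which resonances are isolated.\<close>
  obtain K :: nat where K: "b \<le> real K" using real_arch_simple by blast
  have "1 * real K \<le> 2 * pi * real K" using pi_ge_two by (intro mult_right_mono) auto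
  then have "I \<subseteq> {-(2 * pi * real K)..2 * pi * real K}" using b K by (fastforce simp: abs_le_iff)
  note I = I_borel this
  obtain C where C: "C \<ge> 1" and est: "\<And>F (p::real) (q::real) (h :: nat \<times> nat \<Rightarrow> complex^'m::{finite,linorder} \<Rightarrow> complex). finite F \<Longrightarrow>
      (\<And>k. k \<in> F \<Longrightarrow> h k \<in> harmk k) \<Longrightarrow> p \<ge> 2 \<Longrightarrow> q \<ge> 2 \<Longrightarrow> q \<le> 4 \<Longrightarrow> 2 / p = (real n + 1) * (1 - 2 / q) \<Longrightarrow>
      mixed_powr n (2 * pi * real K) p q h F \<le> ennreal ((C * sqrt
        ((\<Sum>k\<in>F \<inter> cone_region M. mu n k powr (s / p) * sq_norm (h k)) + (\<Sum>k\<in>F - cone_region M. mu n k powr (2 / p) * sq_norm (h k)))) powr p)"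
    using finite_estimate[OF n assms(3) s, of K] by blast
  have "mixed_norm p (ereal q) I v \<le> ennreal C * X_norm n M (real_of_ereal (ereal s / p)) (real_of_ereal (2 / p)) v0"
    if p: "p \<ge> 2" and pq: "2 / p + ereal (real (2 * n + 2) / q) = ereal (real (2 * n + 2) / 2)"
      and v0: "v0 \<in> sphere_L2" and v: "cauchy_solution v0 v"
    for p :: ereal and q :: real and v0 :: "complex^'m::{finite,linorder} \<Rightarrow> complex" and v
  proof (cases "X_norm n M (real_of_ereal (ereal s / p)) (real_of_ereal (2 / p)) v0 = top")
    case True
    then show ?thesis using C by (simp add: ennreal_mult_top)
  next
    case False
    have Lv0: "L2s v0" using v0 by (simp add: sphere_L2_iff)
    have "\<exists>h. h \<in> harmk k \<and> harm_proj (fst k) (snd k) v0 = restrict h (sphere 0 1) \<and> (\<forall>g\<in>harmk k. sphere_inner v0 g = sphere_inner h g)" for k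
      by (rule harm_proj_exists[OF n Lv0, of "fst k" "snd k"]) blast
    then obtain H where H: "\<And>k. H k \<in> harmk k" "\<And>k. harm_proj (fst k) (snd k) v0 = restrict (H k) (sphere 0 1)"
      and ip: "\<And>k g. g \<in> harmk k \<Longrightarrow> sphere_inner v0 g = sphere_inner (H k) g"
      by metis
    note ex = cauchy_solution_expansion[OF v Lv0 n H(1) ip]
    obtain A where A: "A \<ge> 0" and X: "X_norm n M (real_of_ereal (ereal s / p)) (real_of_ereal (2 / p)) v0 = ennreal (sqrt A)"
      and AF: "\<And>F. finite F \<Longrightarrow> (\<Sum>k\<in>F \<inter> cone_region M. mu n k powr (real_of_ereal (ereal s / p)) * sq_norm (H k))
        + (\<Sum>k\<in>F - cone_region M. mu n k powr (real_of_ereal (2 / p)) * sq_norm (H k)) \<le> A"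
      using X_norm_bound[OF H False] by blast
    show ?thesis
    proof (cases p)
      case (real p')
      have p': "p' \<ge> 2" using p real by simp
      have pq': "2 / p' + real (2 * n + 2) / q = real (2 * n + 2) / 2"
        using pq p' real by simp
      note adm = admissible_exponents[OF n(2) p' pq']
      have e: "real_of_ereal (ereal s / p) = s / p'" "real_of_ereal (2 / p) = 2 / p'" using real p' by simp_all
      have "mixed_norm (ereal p') (ereal q) I v \<le> ennreal (C * sqrt A)"
      proof (rule mixed_norm_le[where F="\<lambda>j. {..j} \<times> {..j}" and H=H and n=n])
        fix j :: nat
        let ?F = "{..j} \<times> {..j}"
        have "mixed_powr n (2 * pi * real K) p' q H ?F \<le> ennreal ((C * sqrt
            ((\<Sum>k\<in>?F \<inter> cone_region M. mu n k powr (s / p') * sq_norm (H k)) + (\<Sum>k\<in>?F - cone_region M. mu n k powr (2 / p') * sq_norm (H k)))) powr p')"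
          by (intro est adm p' H) auto
        also have "\<dots> \<le> ennreal ((C * sqrt A) powr p')"
          using C p' AF[of ?F] unfolding e
          by (intro ennreal_leI powr_mono2 mult_left_mono real_sqrt_le_mono mult_nonneg_nonneg real_sqrt_ge_zero add_nonneg_nonneg sum_nonneg) auto
        finally show "mixed_powr n (2 * pi * real K) p' q H ?F \<le> ennreal ((C * sqrt A) powr p')" .
      qed (use ex H p' adm C A I in auto)
      then show ?thesis unfolding X using C A real by (simp add: ennreal_mult)
    next
      \<comment> \<open>Here \<open>q = 2\<close> and both weights have exponent 0, so the estimate
        is the conservation of the square norm together with completeness.\<close>
      case PInf
      then have "real (2 * n + 2) / q = real (2 * n + 2) / 2" using pq by simp
      then have q: "q = 2" unfolding divide_cancel_left by simp
      have e: "real_of_ereal (ereal s / p) = 0" "real_of_ereal (2 / p) = 0" using PInf by simp_all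
      have le: "sq_norm v0 \<le> A"
      proof (rule sq_norm_le_expansion[OF n2 Lv0 H(1) ip])
        fix F :: "(nat \<times> nat) set" assume F: "finite F"
        have "(\<Sum>k\<in>F. sq_norm (H k)) = (\<Sum>k\<in>F \<inter> cone_region M. sq_norm (H k)) + (\<Sum>k\<in>F - cone_region M. sq_norm (H k))"
          by (rule sum.Int_Diff[OF F])
        then show "(\<Sum>k\<in>F. sq_norm (H k)) \<le> A" using AF[OF F] unfolding e by (simp add: less_imp_neq[OF mu_pos, symmetric])
      qed
      have "sphere_norm (ereal q) (v t) = ennreal (sqrt (sq_norm v0))" for t
        using sphere_norm_2_L2s[OF ex(3), of t] ex(5)[of t] by (simp add: q)
      then have "mixed_norm p (ereal q) I v = esssup (restrict_space lborel I) (\<lambda>t. ennreal (sqrt (sq_norm v0)))"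
        by (simp add: mixed_norm_def Lp_norm_def PInf)
      also have "\<dots> \<le> ennreal (C * sqrt A)"
      proof (intro esssup_I AE_I2 ennreal_leI)
        have "1 * sqrt (sq_norm v0) \<le> C * sqrt A" using le C by (intro mult_mono) auto
        then show "sqrt (sq_norm v0) \<le> C * sqrt A" by simp
      qed simp
      finally show ?thesis unfolding X using C A by (simp add: ennreal_mult)
    qed (use p in simp)
  qed
  then show ?thesis using C by (intro exI[of _ C]) auto
qed

end
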